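(* Let $m\in\mathbb{N}$ and let $u\in H^1(D)$ satisfy $\int_{\mathbb{S}^1}u\,d\theta=0$ and $\int_{\mathbb{S}^1}e^{u}e^{ik\theta}\,d\theta=0$ for $k=1,\dots,m$. Then $$\log\left(\frac{1}{2\pi}\int_{\mathbb{S}^1}e^{u}\,d\theta\right)\le\frac{1}{4\pi(m+1)}\|\nabla u\|_{L^2(D)}^2 .$$ Moreover, equality holds if and only if $u(z)=\log\frac{1}{|1-\xi z^{m+1}|^2}$ for some $\xi\in\mathbb{C}$ with $|\xi|<1$.
   Context: $\mathbb{N}$ denotes the positive integers. $D$ is the open unit disk in $\mathbb{R}^2$, identified with $\mathbb{C}$ (variable $z$), $\mathbb{S}^1=\partial D$ is the unit circle, and $\theta$ is the usual angle variable. $H^1(D)$ is the Sobolev space of real-valued functions; integrals over $\mathbb{S}^1$ involving $u$ are understood via the boundary trace of $u$. *)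

theory Defs
  imports "HOL-Analysis.Analysis"
begin

text \<open>Infinitely differentiable functions on the whole space: \<^term>\<open>f\<close> is differentiable everywhere
  and, coinductively, all its directional derivatives are again of this kind.\<close>

coinductive smooth :: "('a::euclidean_space \<Rightarrow> real) \<Rightarrow> bool" where
  "\<lbrakk>\<And>x. f differentiable (at x); \<And>v. smooth (\<lambda>x. frechet_derivative f (at x) v)\<rbrakk> \<Longrightarrow> smooth f"

definition test_functions :: "'a::euclidean_space set \<Rightarrow> ('a \<Rightarrow> real) set" where
  "test_functions \<Omega> = {\<phi>. smooth \<phi> \<and> compact (closure {x. \<phi> x \<noteq> 0}) \<and> closure {x. \<phi> x \<noteq> 0} \<subseteq> \<Omega>}"

definition square_integrable :: "'a measure \<Rightarrow> ('a \<Rightarrow> 'b::euclidean_space) \<Rightarrow> bool" where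
  "square_integrable M f \<longleftrightarrow> f \<in> borel_measurable M \<and> integrable M (\<lambda>x. (norm (f x))\<^sup>2)"

definition L2_norm :: "'a measure \<Rightarrow> ('a \<Rightarrow> 'b::euclidean_space) \<Rightarrow> real" where
  "L2_norm M f = sqrt (LINT x|M. (norm (f x))\<^sup>2)"

text \<open>Elements of Sobolev and Lebesgue spaces are represented by functions on the whole type, of which
  only the values almost everywhere on the (open) set \<open>\<Omega>\<close> matter. The gradient is a vector field
  whose component in the coordinate direction \<open>b\<close> is \<open>g x \<bullet> b\<close>.\<close>

definition has_weak_gradient :: "'a::euclidean_space set \<Rightarrow> ('a \<Rightarrow> real) \<Rightarrow> ('a \<Rightarrow> 'a) \<Rightarrow> bool" where
  "has_weak_gradient \<Omega> u g \<longleftrightarrow>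
     square_integrable (lebesgue_on \<Omega>) u \<and> square_integrable (lebesgue_on \<Omega>) g \<and>
     (\<forall>\<phi>\<in>test_functions \<Omega>. \<forall>b\<in>Basis.
        (LINT x|lebesgue_on \<Omega>. u x * frechet_derivative \<phi> (at x) b)
          = - (LINT x|lebesgue_on \<Omega>. (g x \<bullet> b) * \<phi> x))"

definition H1 :: "'a::euclidean_space set \<Rightarrow> ('a \<Rightarrow> real) set" where
  "H1 \<Omega> = {u. \<exists>g. has_weak_gradient \<Omega> u g}"

text \<open>For \<^prop>\<open>u \<in> H1 \<Omega>\<close> the weak gradient is unique up to null sets, so the choice is immaterial.\<close>

definition weak_gradient :: "'a::euclidean_space set \<Rightarrow> ('a \<Rightarrow> real) \<Rightarrow> 'a \<Rightarrow> 'a" where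
  "weak_gradient \<Omega> u = (SOME g. has_weak_gradient \<Omega> u g)"

definition H1_norm :: "'a::euclidean_space set \<Rightarrow> ('a \<Rightarrow> real) \<Rightarrow> real" where
  "H1_norm \<Omega> u = sqrt ((L2_norm (lebesgue_on \<Omega>) u)\<^sup>2 + (L2_norm (lebesgue_on \<Omega>) (weak_gradient \<Omega> u))\<^sup>2)"

abbreviation unit_disc :: "complex set" where
  "unit_disc \<equiv> ball 0 1"

text \<open>The measure \<open>d\<theta>\<close>; a function \<open>f\<close> on the unit circle is integrated as \<open>\<lambda>\<theta>. f (cis \<theta>)\<close>.\<close>

abbreviation angle_measure :: "real measure" where
  "angle_measure \<equiv> lebesgue_on {0..2*pi}"

text \<open>The trace operator is the continuous extension from \<open>H\<^sup>1\<close> to \<open>L\<^sup>2\<close> of the circle of the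
  restriction operator on functions smooth up to the boundary. As usual, the latter are the
  restrictions to the closed disc of smooth functions on the plane.\<close>

definition has_boundary_trace :: "(complex \<Rightarrow> real) \<Rightarrow> (complex \<Rightarrow> real) \<Rightarrow> bool" where
  "has_boundary_trace u f \<longleftrightarrow>
     square_integrable angle_measure (\<lambda>\<theta>. f (cis \<theta>)) \<and>
     (\<exists>\<phi> :: nat \<Rightarrow> complex \<Rightarrow> real.
        (\<forall>n. smooth (\<phi> n)) \<and>
        (\<lambda>n. H1_norm unit_disc (\<lambda>z. \<phi> n z - u z)) \<longlonglongrightarrow> 0 \<and>
        (\<lambda>n. L2_norm angle_measure (\<lambda>\<theta>. \<phi> n (cis \<theta>) - f (cis \<theta>))) \<longlonglongrightarrow> 0)"

text \<open>By the trace theorem, every \<^prop>\<open>u \<in> H1 unit_disc\<close> has a boundary trace, unique up to null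
  sets of the circle.\<close>

definition boundary_trace :: "(complex \<Rightarrow> real) \<Rightarrow> complex \<Rightarrow> real" where
  "boundary_trace u = (SOME f. has_boundary_trace u f)"

end

theory Submission
  imports Defs "HOL-Complex_Analysis.Complex_Analysis"
begin

text \<open>Put \<open>n = m + 1\<close>, let \<open>f\<close> be the boundary trace of \<open>u\<close>
  with Fourier coefficients \<open>c\<^sub>k\<close>, and write \<open>M\<close> for the mean over
  the circle and \<open>E = \<Sum>k\<ge>1. k |c\<^sub>k|\<^sup>2\<close>. By Dirichlet's principle
  \<open>4 \<pi> E\<close> is at most the Dirichlet integral of \<open>u\<close>, with equality
  for harmonic \<open>u\<close> (\<open>energy_identity\<close>). So the claim is \<open>n ln A
  \<le> E\<close> for \<open>A = M (exp f)\<close>, whenever \<open>exp f\<close> has vanishing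
  moments of orders 1 to \<open>n - 1\<close>. For \<open>n = 1\<close> this is the Lebedev-Milin
  inequality.

  Suppose first that \<open>f = 2 Re F\<close> on the circle, with \<open>F\<close> entire and
  \<open>F 0 = 0\<close>. The density \<open>w = exp f\<close> is \<open>A + 2 Re B\<close> on the
  circle for a holomorphic \<open>B\<close> with \<open>B 0 = 0\<close>. Put \<open>\<zeta> = B /
  (A + B)\<close>. Positivity of \<open>w\<close> gives \<open>|\<zeta>| < 1\<close>, and \<open>w
  = A (1 - |\<zeta>|\<^sup>2) / |1 - \<zeta>|\<^sup>2\<close>. Taking logarithms, \<open>K = F +
  Ln (1 - \<zeta>)\<close> satisfies \<open>2 Re K = ln A + ln (1 - |\<zeta>|\<^sup>2)\<close> on
  the circle; the mean over the circle gives \<open>ln A = M (- ln (1 -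
  |\<zeta>|\<^sup>2))\<close>. Now expand the Dirichlet energy of \<open>F = K - Ln (1 -
  \<zeta>)\<close> in powers of \<open>\<zeta>\<close>. The off-diagonal terms of the energy of
  the logarithm cancel against the cross term (\<open>log_energy_expansion\<close>), and what
  remains is the energy of \<open>K\<close> plus \<open>\<Sum>l\<ge>1. D (\<zeta>\<^sup>l) /
  l\<^sup>2\<close>, where \<open>D\<close> is the Dirichlet energy
  (\<open>dirichlet_sum_le_E\<close>). The moment conditions make \<open>\<zeta>\<close> divisible
  by \<open>z\<^sup>n\<close>, so that \<open>\<zeta>\<^sup>l\<close> only has coefficients of
  index at least \<open>n l\<close> and \<open>D (\<zeta>\<^sup>l) \<ge> n l M
  (|\<zeta>|\<^sup>2\<^sup>l)\<close>. Hence \<open>E\<close> is at least \<open>n M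
  (\<Sum>l\<ge>1. |\<zeta>|\<^sup>2\<^sup>l / l) = n M (- ln (1 - |\<zeta>|\<^sup>2)) = n ln
  A\<close>.

  A general \<open>f\<close> is approximated by its partial Fourier sums. These satisfy the moment
  conditions only in the limit, so the bound is proved for sequences of exponents with an error
  from the low coefficients (\<open>energy_limit\<close>). The case \<open>n = 1\<close>, where no
  moments occur, supplies the integrability of \<open>exp f\<close> and the convergence of its
  moments. If equality holds, the coefficients of \<open>\<zeta>\<close> of index above
  \<open>n\<close> also tend to 0, since each of them would improve the bound. So
  \<open>\<zeta>\<close> tends to \<open>\<xi> z\<^sup>n\<close>, and \<open>exp f\<close> is a
  multiple of \<open>1 / |1 - \<xi> z\<^sup>n|\<^sup>2\<close>
  (\<open>equality_imp_extremal\<close>).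

  The link with the disc is elementary analysis. Mollification gives density of the smooth
  functions in \<open>H\<^sup>1\<close>. The divergence theorem on the disc follows from Fubini's
  theorem. Applied to \<open>\<phi>\<^sup>2 z\<close>, it yields the trace inequality, hence the
  existence of traces, and a Poincare inequality; applied to \<open>\<phi>\<close> times the
  gradient of a harmonic polynomial, it yields Dirichlet's principle. The Poincare inequality
  carries the case of equality from the circle into the disc.\<close>

section \<open>Means over the circle and Fourier coefficients\<close>

abbreviation circle_integrable :: "(complex \<Rightarrow> 'b::{banach,second_countable_topology}) \<Rightarrow> bool" where
  "circle_integrable f \<equiv> integrable angle_measure (\<lambda>\<theta>. f (cis \<theta>))"

definition circle_mean :: "(complex \<Rightarrow> 'b::{banach,second_countable_topology}) \<Rightarrow> 'b" where
  "circle_mean f = (1 / (2 * pi)) *\<^sub>R (LINT \<theta>|angle_measure. f (cis \<theta>))"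

lemma continuous_on_comp_cis:
  assumes "continuous_on (sphere 0 1) f"
  shows "continuous_on S (\<lambda>\<theta>. f (cis \<theta>))"
  by (rule continuous_on_compose2[OF assms]) (auto intro!: continuous_intros)

lemma circle_integrable_continuous:
  fixes f :: "complex \<Rightarrow> 'b::euclidean_space"
  assumes "continuous_on (sphere 0 1) f"
  shows "circle_integrable f"
  by (rule continuous_imp_integrable_real[OF continuous_on_comp_cis[OF assms]])

lemma finite_measure_angle: "finite_measure angle_measure"
  by (rule finite_measureI) (simp add: emeasure_restrict_space)

lemma circle_mean_const [simp]: "circle_mean (\<lambda>z. c) = c"
  by (simp add: circle_mean_def measure_restrict_space)

lemma circle_mean_cong: "(\<And>z. norm z = 1 \<Longrightarrow> f z = g z) \<Longrightarrow> circle_mean f = circle_mean g"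
  by (simp add: circle_mean_def)

lemma circle_mean_add: "circle_integrable f \<Longrightarrow> circle_integrable g \<Longrightarrow>
    circle_mean (\<lambda>z. f z + g z) = circle_mean f + circle_mean g"
  by (simp add: circle_mean_def algebra_simps)

lemma circle_mean_diff: "circle_integrable f \<Longrightarrow> circle_integrable g \<Longrightarrow>
    circle_mean (\<lambda>z. f z - g z) = circle_mean f - circle_mean g"
  by (simp add: circle_mean_def algebra_simps)

lemma circle_mean_mult_left:
  fixes f :: "complex \<Rightarrow> 'b::{real_normed_field,banach,second_countable_topology}"
  shows "circle_mean (\<lambda>z. c * f z) = c * circle_mean f"
  by (cases "c = 0") (simp_all add: circle_mean_def)

lemma circle_mean_mult_right:
  fixes f :: "complex \<Rightarrow> 'b::{real_normed_field,banach,second_countable_topology}"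
  shows "circle_mean (\<lambda>z. f z * c) = circle_mean f * c"
  using circle_mean_mult_left[of c f] by (simp add: mult.commute)

lemma circle_mean_sum: "(\<And>i. i \<in> I \<Longrightarrow> circle_integrable (f i)) \<Longrightarrow>
    circle_mean (\<lambda>z. \<Sum>i\<in>I. f i z) = (\<Sum>i\<in>I. circle_mean (f i))"
  by (simp add: circle_mean_def scaleR_sum_right)

lemma circle_mean_of_real: "circle_mean (\<lambda>z. complex_of_real (f z)) = of_real (circle_mean f)"
  by (simp add: circle_mean_def scaleR_conv_of_real)

lemma circle_mean_cnj: "circle_mean (\<lambda>z. cnj (f z)) = cnj (circle_mean f)"
  by (simp add: circle_mean_def scaleR_conv_of_real)

lemma circle_mean_Re: "circle_integrable f \<Longrightarrow> circle_mean (\<lambda>z. Re (f z)) = Re (circle_mean f)"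
  by (simp add: circle_mean_def scaleR_conv_of_real)

lemma circle_mean_mono:
  fixes f g :: "complex \<Rightarrow> real"
  assumes "circle_integrable f" "circle_integrable g" "\<And>z. norm z = 1 \<Longrightarrow> f z \<le> g z"
  shows "circle_mean f \<le> circle_mean g"
  unfolding circle_mean_def real_scaleR_def using assms
  by (intro mult_left_mono integral_mono) auto

lemma circle_mean_nonneg:
  fixes f :: "complex \<Rightarrow> real"
  assumes "\<And>z. norm z = 1 \<Longrightarrow> 0 \<le> f z"
  shows "0 \<le> circle_mean f"
  unfolding circle_mean_def using assms by (auto intro!: mult_nonneg_nonneg integral_nonneg_AE)

lemma circle_mean_norm_le:
  assumes "circle_integrable f"
  shows "norm (circle_mean f) \<le> circle_mean (\<lambda>z. norm (f z))"
  unfolding circle_mean_def using integral_norm_bound[of angle_measure "\<lambda>\<theta>. f (cis \<theta>)"]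
  by (simp add: mult_left_mono divide_right_mono)

lemma circle_mean_norm_le_const:
  fixes f :: "complex \<Rightarrow> 'b::euclidean_space"
  assumes "circle_integrable f" "\<And>z. norm z = 1 \<Longrightarrow> norm (f z) \<le> C"
  shows "norm (circle_mean f) \<le> C"
proof -
  have "norm (circle_mean f) \<le> circle_mean (\<lambda>z. norm (f z))"
    by (rule circle_mean_norm_le[OF assms(1)])
  also have "\<dots> \<le> circle_mean (\<lambda>z. C)"
    using assms by (intro circle_mean_mono) (auto simp: finite_measure.integrable_const[OF finite_measure_angle])
  finally show ?thesis by simp
qed

text \<open>Continuity on the circle supplies the measurability, so that this form of dominated convergence
  only asks for pointwise convergence and a uniform bound.\<close>

lemma circle_mean_dominated:
  fixes f :: "nat \<Rightarrow> complex \<Rightarrow> 'b::euclidean_space"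
  assumes "\<And>N. continuous_on (sphere 0 1) (f N)" "continuous_on (sphere 0 1) g"
    and "\<And>z. norm z = 1 \<Longrightarrow> (\<lambda>N. f N z) \<longlonglongrightarrow> g z"
    and "\<And>N z. norm z = 1 \<Longrightarrow> norm (f N z) \<le> C"
  shows "(\<lambda>N. circle_mean (f N)) \<longlonglongrightarrow> circle_mean g"
  unfolding circle_mean_def
proof (rule tendsto_scaleR[OF tendsto_const])
  show "(\<lambda>N. LINT \<theta>|angle_measure. f N (cis \<theta>)) \<longlonglongrightarrow> (LINT \<theta>|angle_measure. g (cis \<theta>))"
  proof (rule integral_dominated_convergence[where w = "\<lambda>_. C"])
    show "(\<lambda>\<theta>. g (cis \<theta>)) \<in> borel_measurable angle_measure"
      using circle_integrable_continuous[OF assms(2)] by auto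
    show "(\<lambda>\<theta>. f N (cis \<theta>)) \<in> borel_measurable angle_measure" for N
      using circle_integrable_continuous[OF assms(1)] by auto
    show "integrable angle_measure (\<lambda>_. C)"
      by (rule finite_measure.integrable_const[OF finite_measure_angle])
  qed (use assms in auto)
qed

text \<open>Only the coefficients with index \<open>k \<ge> 0\<close> are recorded: for a real function the
  remaining ones are their conjugates.\<close>

definition fourier_coeff :: "(complex \<Rightarrow> complex) \<Rightarrow> nat \<Rightarrow> complex" where
  "fourier_coeff f k = circle_mean (\<lambda>z. f z * cnj z ^ k)"

text \<open>On the unit circle \<open>dz = \<i> z d\<theta>\<close>, so a mean over the circle is a contour
  integral, to which Cauchy's formulas apply.\<close>

lemma circle_mean_eq_contour:
  assumes "(f has_contour_integral I) (circlepath 0 1)" "continuous_on (sphere 0 1) f"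
  shows "circle_mean (\<lambda>z. z * f z) = I / (2 * pi * \<i>)"
proof -
  have 1: "((\<lambda>t. f (0 + complex_of_real 1 * exp (\<i> * complex_of_real t)) * complex_of_real 1 * \<i> * exp (\<i> * complex_of_real t)) has_integral I) {0..2*pi}"
    using assms(1) unfolding circlepath_def
    by (subst (asm) has_contour_integral_part_circlepath_iff) (auto simp: exp_eq_polar ac_simps)
  hence "((\<lambda>t. \<i> * (cis t * f (cis t))) has_integral I) {0..2*pi}"
    by (simp add: cis_conv_exp ac_simps)
  hence 2: "((\<lambda>t. - \<i> * (\<i> * (cis t * f (cis t)))) has_integral (- \<i> * I)) {0..2*pi}"
    by (rule has_integral_mult_right)
  have "circle_integrable (\<lambda>z. z * f z)"
    by (intro circle_integrable_continuous continuous_intros assms)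
  hence "(LINT \<theta>|angle_measure. cis \<theta> * f (cis \<theta>)) = integral {0..2*pi} (\<lambda>t. cis t * f (cis t))"
    by (intro lebesgue_integral_eq_integral) auto
  also have "\<dots> = - \<i> * I" using 2 by (intro integral_unique) (simp add: algebra_simps)
  finally show ?thesis by (simp add: circle_mean_def scaleR_conv_of_real field_simps)
qed

lemma cnj_eq_inverse_circle: "norm z = 1 \<Longrightarrow> cnj z = inverse z"
  by (simp add: inverse_complex_def complex_eq_iff cmod_def real_sqrt_eq_1_iff)

lemma fourier_coeff_holomorphic:
  assumes "q holomorphic_on ball 0 R" "R > 1"
  shows "fourier_coeff q k = (deriv ^^ k) q 0 / fact k"
proof -
  have sub: "cball 0 1 \<subseteq> ball (0::complex) R" using assms by auto
  have c: "continuous_on (cball 0 1) q"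
    using assms(1) sub continuous_on_subset holomorphic_on_imp_continuous_on by blast
  have h: "q holomorphic_on ball 0 1" using assms by (meson holomorphic_on_subset sub ball_subset_cball order_trans)
  have 1: "((\<lambda>u. q u / (u - 0) ^ Suc k) has_contour_integral
      2 * complex_of_real pi * \<i> / fact k * (deriv ^^ k) q 0) (circlepath 0 1)"
    using Cauchy_has_contour_integral_higher_derivative_circlepath[OF c h, of 0 k] by simp
  have "circle_mean (\<lambda>z. z * (q z / (z - 0) ^ Suc k)) = (deriv ^^ k) q 0 / fact k"
    by (subst circle_mean_eq_contour[OF 1])
       (auto intro!: continuous_intros continuous_on_subset[OF c])
  moreover have "fourier_coeff q k = circle_mean (\<lambda>z. z * (q z / (z - 0) ^ Suc k))"
    unfolding fourier_coeff_def
    by (rule circle_mean_cong) (auto simp: cnj_eq_inverse_circle field_simps)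
  ultimately show ?thesis by simp
qed

lemma fourier_coeff_sums:
  assumes "q holomorphic_on ball 0 R" "R > 1" "z \<in> ball 0 R"
  shows "(\<lambda>k. fourier_coeff q k * z ^ k) sums q z"
  using holomorphic_power_series[OF assms(1,3)]
  by (simp add: fourier_coeff_holomorphic[OF assms(1,2)])

lemma circle_mean_holomorphic:
  assumes "q holomorphic_on ball 0 R" "R > 1"
  shows "circle_mean q = q 0"
  using fourier_coeff_holomorphic[OF assms, of 0] by (simp add: fourier_coeff_def)

lemma fourier_coeff_0: "fourier_coeff q 0 = circle_mean q"
  by (simp add: fourier_coeff_def)

lemma fourier_coeff_deriv:
  assumes "q holomorphic_on ball 0 R" "R > 1"
  shows "fourier_coeff (\<lambda>z. z * deriv q z) k = of_nat k * fourier_coeff q k"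
proof (cases k)
  case 0
  have "(\<lambda>z. z * deriv q z) holomorphic_on ball 0 R"
    using assms by (intro holomorphic_intros) auto
  from circle_mean_holomorphic[OF this assms(2)] show ?thesis by (simp add: 0 fourier_coeff_0)
next
  case (Suc j)
  have h: "deriv q holomorphic_on ball 0 R"
    using assms by (intro holomorphic_intros) auto
  have "fourier_coeff (\<lambda>z. z * deriv q z) k = fourier_coeff (deriv q) j"
    unfolding fourier_coeff_def Suc
    by (rule circle_mean_cong) (auto simp: cnj_eq_inverse_circle field_simps)
  also have "\<dots> = (deriv ^^ k) q 0 / fact j"
    by (subst fourier_coeff_holomorphic[OF h assms(2)]) (simp add: Suc funpow_Suc_right del: funpow.simps)
  also have "\<dots> = of_nat k * fourier_coeff q k"
    by (subst fourier_coeff_holomorphic[OF assms]) (simp add: Suc del: of_nat_Suc funpow.simps)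
  finally show ?thesis .
qed

lemma circle_continuous_holomorphic:
  assumes "q holomorphic_on ball 0 R" "R > 1"
  shows "continuous_on (sphere 0 1) q"
  by (rule continuous_on_subset[OF holomorphic_on_imp_continuous_on[OF assms(1)]]) (use assms in auto)

text \<open>The Taylor coefficients of a function that is holomorphic beyond the circle are absolutely
  summable. Hence \<open>q\<close> may be replaced by its partial sums under the mean, with
  \<open>p\<close> fixed.\<close>

lemma parseval_holomorphic:
  assumes p: "p holomorphic_on ball 0 R" and q: "q holomorphic_on ball 0 R" and "R > 1"
  shows "(\<lambda>k. fourier_coeff p k * cnj (fourier_coeff q k)) sums circle_mean (\<lambda>z. p z * cnj (q z))"
proof -
  have cp: "continuous_on (sphere 0 1) p" and cq: "continuous_on (sphere 0 1) q"
    using circle_continuous_holomorphic assms by blast+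
  define S where "S N z = (\<Sum>k<N. fourier_coeff q k * z ^ k)" for N and z :: complex
  have ab: "summable (\<lambda>k. norm (fourier_coeff q k))"
  proof -
    define r where "r = (1 + R) / 2"
    have r: "1 < r" "r < R" using assms by (auto simp: r_def)
    have "summable (\<lambda>k. fourier_coeff q k * (of_real r) ^ k)"
      using fourier_coeff_sums[OF q \<open>R > 1\<close>, of "of_real r"] r by (auto simp: sums_iff)
    from powser_insidea[OF this, of 1] r show ?thesis by simp
  qed
  obtain C where C: "\<And>z. norm z = 1 \<Longrightarrow> norm (p z) \<le> C"
    using compact_imp_bounded[OF compact_continuous_image[OF cp compact_sphere]]
    unfolding bounded_iff by (metis imageI mem_sphere_0)
  have "(\<lambda>N. circle_mean (\<lambda>z. p z * cnj (S N z))) \<longlonglongrightarrow> circle_mean (\<lambda>z. p z * cnj (q z))"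
  proof (rule circle_mean_dominated)
    fix N z assume z: "norm (z::complex) = 1"
    have "norm (S N z) \<le> (\<Sum>k<N. norm (fourier_coeff q k))"
      unfolding S_def by (rule order_trans[OF norm_sum]) (simp add: norm_mult norm_power z)
    also have "\<dots> \<le> (\<Sum>k. norm (fourier_coeff q k))" by (rule sum_le_suminf[OF ab]) auto
    finally show "norm (p z * cnj (S N z)) \<le> C * (\<Sum>k. norm (fourier_coeff q k))"
      unfolding norm_mult complex_mod_cnj using C[OF z]
      by (intro mult_mono) (auto intro: order_trans[OF norm_ge_zero])
  next
    fix z :: complex assume z: "norm z = 1"
    have "(\<lambda>N. S N z) \<longlonglongrightarrow> q z"
      using fourier_coeff_sums[OF q \<open>R > 1\<close>, of z] \<open>R > 1\<close> z by (simp add: sums_def S_def)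
    thus "(\<lambda>N. p z * cnj (S N z)) \<longlonglongrightarrow> p z * cnj (q z)" by (intro tendsto_intros)
  qed (auto simp: S_def intro!: continuous_intros cp cq)
  moreover have "circle_mean (\<lambda>z. p z * cnj (S N z)) = (\<Sum>k<N. fourier_coeff p k * cnj (fourier_coeff q k))" for N
  proof -
    have "circle_mean (\<lambda>z. p z * cnj (S N z)) = circle_mean (\<lambda>z. \<Sum>k<N. cnj (fourier_coeff q k) * (p z * cnj z ^ k))"
      by (simp add: S_def sum_distrib_left algebra_simps)
    also have "\<dots> = (\<Sum>k<N. circle_mean (\<lambda>z. cnj (fourier_coeff q k) * (p z * cnj z ^ k)))"
      by (intro circle_mean_sum circle_integrable_continuous continuous_intros cp)
    finally show ?thesis by (simp add: circle_mean_mult_left circle_mean_mult_right fourier_coeff_def mult.commute)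
  qed
  ultimately show ?thesis by (simp add: sums_def)
qed

section \<open>The Dirichlet form of holomorphic functions\<close>

text \<open>For \<open>p\<close>, \<open>q\<close> holomorphic beyond the closed disc this is
  \<open>1/\<pi>\<close> times the integral of \<open>p'\<close> times the conjugate of
  \<open>q'\<close> over the disc, written as an integral over the boundary; in terms of Taylor
  coefficients it is \<open>\<Sum>k. k p\<^sub>k cnj q\<^sub>k\<close>.\<close>

definition dirichlet_form :: "(complex \<Rightarrow> complex) \<Rightarrow> (complex \<Rightarrow> complex) \<Rightarrow> complex" where
  "dirichlet_form p q = circle_mean (\<lambda>z. z * deriv p z * cnj (q z))"

lemma dirichlet_form_sums:
  assumes p: "p holomorphic_on ball 0 R" and q: "q holomorphic_on ball 0 R" and "R > 1"
  shows "(\<lambda>k. of_nat k * (fourier_coeff p k * cnj (fourier_coeff q k))) sums dirichlet_form p q"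
proof -
  have "(\<lambda>z. z * deriv p z) holomorphic_on ball 0 R" using p by (intro holomorphic_intros) auto
  from parseval_holomorphic[OF this q \<open>R > 1\<close>] show ?thesis
    by (simp add: dirichlet_form_def fourier_coeff_deriv[OF p \<open>R > 1\<close>] mult.assoc)
qed

lemma dirichlet_form_commute:
  assumes p: "p holomorphic_on ball 0 R" and q: "q holomorphic_on ball 0 R" and "R > 1"
  shows "dirichlet_form q p = cnj (dirichlet_form p q)"
proof -
  have "(\<lambda>k. cnj (of_nat k * (fourier_coeff p k * cnj (fourier_coeff q k)))) sums cnj (dirichlet_form p q)"
    using dirichlet_form_sums[OF assms] by (simp only: sums_cnj)
  moreover have "(\<lambda>k. cnj (of_nat k * (fourier_coeff p k * cnj (fourier_coeff q k)))) sums dirichlet_form q p"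
    using dirichlet_form_sums[OF q p \<open>R > 1\<close>] by (simp add: mult.commute)
  ultimately show ?thesis using sums_unique2 by blast
qed

lemma dirichlet_form_self_sums:
  assumes p: "p holomorphic_on ball 0 R" and "R > 1"
  shows "(\<lambda>k. real k * (norm (fourier_coeff p k))\<^sup>2) sums Re (dirichlet_form p p)"
  using sums_Re[OF dirichlet_form_sums[OF p p \<open>R > 1\<close>]]
  by (simp add: complex_norm_square[symmetric] flip: of_real_power)

lemma dirichlet_form_nonneg:
  assumes p: "p holomorphic_on ball 0 R" and "R > 1"
  shows "0 \<le> Re (dirichlet_form p p)"
  by (rule sums_le[OF _ sums_zero dirichlet_form_self_sums[OF assms]]) simp

lemma parseval_norm:
  assumes p: "p holomorphic_on ball 0 R" and "R > 1"
  shows "(\<lambda>k. (norm (fourier_coeff p k))\<^sup>2) sums circle_mean (\<lambda>z. (norm (p z))\<^sup>2)"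
  using parseval_holomorphic[OF p p \<open>R > 1\<close>]
  by (simp add: complex_norm_square[symmetric] circle_mean_of_real sums_of_real_iff flip: of_real_power)

section \<open>The Dirichlet energy of a logarithm\<close>

lemma neg_Ln_series_term: "- ((-1) ^ Suc n / of_nat n * (- y) ^ n) = y ^ n / (of_nat n :: complex)"
proof -
  have "(-1) ^ n * (- y) ^ n = y ^ n" by (simp flip: power_mult_distrib)
  thus ?thesis by simp
qed

lemma divide_of_nat_le_self: "0 \<le> y \<Longrightarrow> y / real n \<le> y"
  by (cases n) (auto simp: divide_le_eq algebra_simps)

lemma circle_mean_sum_continuous:
  fixes f :: "'i \<Rightarrow> complex \<Rightarrow> 'b::euclidean_space"
  assumes "\<And>i. i \<in> I \<Longrightarrow> continuous_on (sphere 0 1) (f i)"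
  shows "circle_mean (\<lambda>z. \<Sum>i\<in>I. f i z) = (\<Sum>i\<in>I. circle_mean (f i))"
  using assms by (intro circle_mean_sum circle_integrable_continuous)

text \<open>This identity is the heart of the inequality. Write \<open>L = Ln (1 - \<zeta>) = - (\<Sum>l.
  \<zeta>\<^sup>l / l)\<close> and expand the Dirichlet energy of \<open>L\<close> into the double
  series with entries \<open>c p l = \<langle>\<zeta>\<^sup>p, \<zeta>\<^sup>l\<rangle> / (p
  l)\<close>. The diagonal is the series on the left. The part below the diagonal is, by a Cauchy
  product of the series of \<open>1 / (1 - \<zeta>)\<close> and of \<open>- ln (1 -
  |\<zeta>|\<^sup>2)\<close> on the circle, the mean of \<open>z L' ln (1 -
  |\<zeta>|\<^sup>2)\<close>, and the part above it is the conjugate of that. So subtracting twice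
  the real part of this mean leaves exactly the diagonal.\<close>

lemma log_energy_expansion:
  assumes hol: "\<zeta> holomorphic_on ball 0 R" and L: "L holomorphic_on ball 0 R" and "R > 1"
    and lt1: "\<And>z. norm z = 1 \<Longrightarrow> norm (\<zeta> z) < 1"
    and expL: "\<And>z. z \<in> ball 0 R \<Longrightarrow> exp (L z) = 1 - \<zeta> z"
    and LnL: "\<And>z. norm z = 1 \<Longrightarrow> L z = Ln (1 - \<zeta> z)"
  defines "lam \<equiv> \<lambda>z. ln (1 - (norm (\<zeta> z))\<^sup>2)"
  shows "(\<lambda>l. Re (dirichlet_form (\<lambda>z. \<zeta> z ^ Suc l) (\<lambda>z. \<zeta> z ^ Suc l)) / (real (Suc l))\<^sup>2) sums
           (Re (dirichlet_form L L) - 2 * Re (circle_mean (\<lambda>z. z * deriv L z * of_real (lam z))))"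
proof -
  define d where "d z = z * deriv \<zeta> z" for z
  have sph: "z \<in> ball 0 R" if "norm z = 1" for z :: complex using that \<open>R > 1\<close> by simp
  have c\<zeta>: "continuous_on (sphere 0 1) \<zeta>" and cL: "continuous_on (sphere 0 1) L"
    using circle_continuous_holomorphic hol L \<open>R > 1\<close> by blast+
  have "d holomorphic_on ball 0 R" unfolding d_def using hol by (intro holomorphic_intros) auto
  hence cd: "continuous_on (sphere 0 1) d" using circle_continuous_holomorphic \<open>R > 1\<close> by blast
  obtain D where D: "\<And>z. norm z = 1 \<Longrightarrow> norm (d z) \<le> D"
    using compact_imp_bounded[OF compact_continuous_image[OF cd compact_sphere]]
    unfolding bounded_iff by (metis imageI mem_sphere_0)
  obtain \<rho> where \<rho>: "\<rho> < 1" "\<And>z. norm z = 1 \<Longrightarrow> norm (\<zeta> z) \<le> \<rho>"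
  proof -
    have "\<exists>x\<in>sphere 0 1. \<forall>y\<in>sphere 0 1. norm (\<zeta> y) \<le> norm (\<zeta> x)"
      by (intro continuous_attains_sup continuous_intros c\<zeta>) auto
    thus ?thesis using that lt1 by (metis mem_sphere_0)
  qed
  have \<rho>0: "0 \<le> \<rho>" by (rule order_trans[OF norm_ge_zero \<rho>(2)[of 1]]) simp
  have D0: "0 \<le> D" by (rule order_trans[OF norm_ge_zero D[of 1]]) simp
  have ne1: "\<zeta> z \<noteq> 1" if "norm z = 1" for z using lt1[OF that] by auto
  have derivL: "z * deriv L z = - d z / (1 - \<zeta> z)" if "norm z = 1" for z
  proof -
    have z: "z \<in> ball 0 R" by (rule sph[OF that])
    have "((\<lambda>z. exp (L z)) has_field_derivative exp (L z) * deriv L z) (at z)"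
      using L z by (auto intro!: derivative_eq_intros holomorphic_derivI[OF L])
    moreover have "((\<lambda>z. exp (L z)) has_field_derivative - deriv \<zeta> z) (at z)"
    proof (rule has_field_derivative_transform_within_open[OF _ open_ball z])
      show "((\<lambda>z. 1 - \<zeta> z) has_field_derivative - deriv \<zeta> z) (at z)"
        using z by (auto intro!: derivative_eq_intros holomorphic_derivI[OF hol])
    qed (use expL in auto)
    ultimately have "exp (L z) * deriv L z = - deriv \<zeta> z" using DERIV_unique by blast
    hence "deriv L z = - deriv \<zeta> z / (1 - \<zeta> z)"
      using expL[OF z] ne1[OF that] by (metis eq_divide_eq mult.commute right_minus_eq)
    thus ?thesis by (simp add: d_def)
  qed
  have Pow: "(\<lambda>z. \<zeta> z ^ l) holomorphic_on ball 0 R" for l using hol by (intro holomorphic_intros)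
  define c where "c p l = dirichlet_form (\<lambda>z. \<zeta> z ^ p) (\<lambda>z. \<zeta> z ^ l) / of_nat (p * l)" for p l
  have c_comm: "c l p = cnj (c p l)" for p l
    unfolding c_def using dirichlet_form_commute[OF Pow Pow \<open>R > 1\<close>, of p l] by (simp add: mult.commute)
  have c_eq: "c (Suc p) l = circle_mean (\<lambda>z. d z * \<zeta> z ^ p * (cnj (\<zeta> z) ^ l / of_nat l))" for p l
  proof -
    have "dirichlet_form (\<lambda>z. \<zeta> z ^ Suc p) (\<lambda>z. \<zeta> z ^ l)
        = circle_mean (\<lambda>z. of_nat (Suc p) * (d z * \<zeta> z ^ p * cnj (\<zeta> z) ^ l))"
      unfolding dirichlet_form_def
    proof (rule circle_mean_cong)
      fix z :: complex assume z: "norm z = 1"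
      have "deriv (\<lambda>z. \<zeta> z ^ Suc p) z = of_nat (Suc p) * \<zeta> z ^ p * deriv \<zeta> z"
        using sph[OF z] by (intro DERIV_imp_deriv)
          (auto intro!: derivative_eq_intros holomorphic_derivI[OF hol] simp del: of_nat_Suc power_Suc)
      thus "z * deriv (\<lambda>z. \<zeta> z ^ Suc p) z * cnj (\<zeta> z ^ l) = of_nat (Suc p) * (d z * \<zeta> z ^ p * cnj (\<zeta> z) ^ l)"
        by (simp add: d_def del: of_nat_Suc)
    qed
    hence "c (Suc p) l = circle_mean (\<lambda>z. d z * \<zeta> z ^ p * cnj (\<zeta> z) ^ l) / of_nat l"
      unfolding c_def of_nat_mult by (simp only: circle_mean_mult_left) (simp del: of_nat_Suc)
    also have "\<dots> = circle_mean (\<lambda>z. d z * \<zeta> z ^ p * cnj (\<zeta> z) ^ l * (1 / of_nat l))"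
      by (subst circle_mean_mult_right) simp
    finally show ?thesis by simp
  qed
  have cont_term: "continuous_on (sphere 0 1) (\<lambda>z. d z * \<zeta> z ^ p * (cnj (\<zeta> z) ^ l / of_nat l))" for p l
    unfolding divide_inverse by (intro continuous_on_mult continuous_on_power continuous_on_cnj continuous_on_const cd c\<zeta>)
  \<comment> \<open>The square partial sums of the double series, and the part of them strictly below the
    diagonal; the entry with \<open>l = 0\<close> vanishes and is kept in \<open>Y\<close> to
    obtain the shape of a Cauchy product.\<close>
  define X where "X N = (\<Sum>p<N. \<Sum>l<N. c (Suc p) (Suc l))" for N
  define Y where "Y N = (\<Sum>p<N. \<Sum>l\<le>p. c (Suc p) l)" for N
  have c0: "c p 0 = 0" for p by (simp add: c_def)
  have XY: "X N = (\<Sum>l<N. c (Suc l) (Suc l)) + Y N + cnj (Y N)" for N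
  proof (induction N)
    case (Suc N)
    have Y1: "(\<Sum>l\<le>N. c (Suc N) l) = (\<Sum>l<N. c (Suc N) (Suc l))"
      by (subst lessThan_Suc_atMost[symmetric], subst sum.lessThan_Suc_shift) (simp add: c0)
    have Y2: "Y (Suc N) = Y N + (\<Sum>l<N. c (Suc N) (Suc l))" by (simp add: Y_def Y1)
    have "X (Suc N) = X N + (\<Sum>l<N. c (Suc N) (Suc l)) + (\<Sum>p<N. c (Suc p) (Suc N)) + c (Suc N) (Suc N)"
      unfolding X_def sum.lessThan_Suc sum.distrib by (simp only: add.assoc)
    moreover have "(\<Sum>p<N. c (Suc p) (Suc N)) = cnj (\<Sum>l<N. c (Suc N) (Suc l))"
      unfolding cnj_sum by (intro sum.cong refl c_comm)
    ultimately show ?case unfolding Y2 Suc.IH sum.lessThan_Suc complex_cnj_add by (simp only: algebra_simps)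
  qed (simp_all add: X_def Y_def)
  have geo: "norm (\<Sum>i<N. x i) \<le> 1 / (1 - \<rho>)" if "\<And>i. norm (x i) \<le> \<rho> ^ i" for x :: "nat \<Rightarrow> complex" and N
  proof -
    have "norm (\<Sum>i<N. x i) \<le> (\<Sum>i<N. \<rho> ^ i)" by (rule sum_norm_le) (use that in auto)
    also have "\<dots> \<le> (\<Sum>i. \<rho> ^ i)" by (rule sum_le_suminf) (use \<rho> \<rho>0 in auto)
    finally show ?thesis using \<rho> \<rho>0 by (simp add: suminf_geometric)
  qed
  \<comment> \<open>Uniform bounds on the circle come from \<open>|\<zeta>| \<le> \<rho> < 1\<close> there.\<close>
  have Xlim: "X \<longlonglongrightarrow> dirichlet_form L L"
  proof -
    have Xeq: "X N = circle_mean (\<lambda>z. d z * (\<Sum>p<N. \<zeta> z ^ p) * (\<Sum>l<N. cnj (\<zeta> z) ^ Suc l / of_nat (Suc l)))" for N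
    proof -
      have "X N = circle_mean (\<lambda>z. \<Sum>p<N. \<Sum>l<N. d z * \<zeta> z ^ p * (cnj (\<zeta> z) ^ Suc l / of_nat (Suc l)))"
        unfolding X_def c_eq
        by (simp only: circle_mean_sum_continuous[OF cont_term] circle_mean_sum_continuous[OF continuous_on_sum[OF cont_term]])
      thus ?thesis by (simp only: mult.assoc sum_product) (simp only: sum_distrib_left)
    qed
    moreover have "(\<lambda>N. circle_mean (\<lambda>z. d z * (\<Sum>p<N. \<zeta> z ^ p) * (\<Sum>l<N. cnj (\<zeta> z) ^ Suc l / of_nat (Suc l))))
        \<longlonglongrightarrow> circle_mean (\<lambda>z. d z * (1 / (1 - \<zeta> z)) * cnj (- L z))"
    proof (rule circle_mean_dominated)
      fix z :: complex and N assume z: "norm z = 1"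
      have "norm (\<zeta> z) ^ i \<le> \<rho> ^ i" for i using \<rho>(2)[OF z] by (intro power_mono) auto
      moreover have "norm (\<zeta> z) ^ Suc i / real (Suc i) \<le> \<rho> ^ i" for i
      proof -
        have "norm (\<zeta> z) ^ Suc i / real (Suc i) \<le> norm (\<zeta> z) ^ Suc i / 1"
          by (intro divide_left_mono) auto
        also have "\<dots> \<le> 1 * norm (\<zeta> z) ^ i" unfolding div_by_1 power_Suc using lt1[OF z] by (intro mult_right_mono) auto
        also have "\<dots> \<le> \<rho> ^ i" using \<rho>(2)[OF z] by (simp add: power_mono)
        finally show ?thesis .
      qed
      ultimately show "norm (d z * (\<Sum>p<N. \<zeta> z ^ p) * (\<Sum>l<N. cnj (\<zeta> z) ^ Suc l / of_nat (Suc l)))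
          \<le> D * (1 / (1 - \<rho>)) * (1 / (1 - \<rho>))" unfolding norm_mult using D[OF z] \<rho> D0
        by (intro mult_mono geo mult_nonneg_nonneg) (auto simp: norm_power norm_divide norm_mult simp del: of_nat_Suc power_Suc)
    next
      fix z :: complex assume z: "norm z = 1"
      have 1: "(\<lambda>p. \<zeta> z ^ p) sums (1 / (1 - \<zeta> z))" by (rule geometric_sums[OF lt1[OF z]])
      have "(\<lambda>n. (-1)^Suc n / of_nat n * (- \<zeta> z)^n) sums ln (1 + (- \<zeta> z))"
        using lt1[OF z] by (intro Ln_series) auto
      hence "(\<lambda>n. - ((-1)^Suc n / of_nat n * (- \<zeta> z)^n)) sums (- L z)"
        unfolding LnL[OF z] by (intro sums_minus) simp
      moreover have "- ((-1)^Suc n / of_nat n * (- \<zeta> z)^n) = \<zeta> z ^ n / of_nat n" for n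
        by (rule neg_Ln_series_term)
      ultimately have "(\<lambda>n. \<zeta> z ^ n / of_nat n) sums (- L z)" by (simp only:)
      hence "(\<lambda>n. \<zeta> z ^ Suc n / of_nat (Suc n)) sums (- L z)" by (subst sums_Suc_iff) simp
      hence "(\<lambda>n. cnj (\<zeta> z ^ Suc n / of_nat (Suc n))) sums cnj (- L z)" by (simp only: sums_cnj)
      hence 2: "(\<lambda>n. cnj (\<zeta> z) ^ Suc n / of_nat (Suc n)) sums cnj (- L z)"
        by (simp del: of_nat_Suc power_Suc)
      show "(\<lambda>N. d z * (\<Sum>p<N. \<zeta> z ^ p) * (\<Sum>l<N. cnj (\<zeta> z) ^ Suc l / of_nat (Suc l)))
         \<longlonglongrightarrow> d z * (1 / (1 - \<zeta> z)) * cnj (- L z)"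
        using 1 2 unfolding sums_def by (intro tendsto_intros) auto
    next
      show "continuous_on (sphere 0 1) (\<lambda>z. d z * (\<Sum>p<N. \<zeta> z ^ p) * (\<Sum>l<N. cnj (\<zeta> z) ^ Suc l / of_nat (Suc l)))" for N
        unfolding divide_inverse by (intro continuous_on_mult continuous_on_sum continuous_on_power
            continuous_on_cnj continuous_on_const cd c\<zeta>)
      show "continuous_on (sphere 0 1) (\<lambda>z. d z * (1 / (1 - \<zeta> z)) * cnj (- L z))"
        using ne1 by (intro continuous_intros cd c\<zeta> cL) force+
    qed
    moreover have "circle_mean (\<lambda>z. d z * (1 / (1 - \<zeta> z)) * cnj (- L z)) = dirichlet_form L L"
      unfolding dirichlet_form_def by (rule circle_mean_cong) (simp add: derivL)
    ultimately show ?thesis by (simp only: Xeq[abs_def])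
  qed
  have sq_le: "norm (\<zeta> z) ^ 2 < 1" if "norm z = 1" for z
    using lt1[OF that] by (simp add: power_less_one_iff)
  \<comment> \<open>On the circle \<open>\<zeta>\<^sup>p cnj \<zeta>\<^sup>l = |\<zeta>|\<^sup>2\<^sup>l
    \<zeta>\<^sup>p\<^sup>-\<^sup>l\<close>, which turns \<open>Y\<close> into the partial sums of
    a Cauchy product.\<close>
  have Ylim: "Y \<longlonglongrightarrow> circle_mean (\<lambda>z. z * deriv L z * of_real (lam z))"
  proof -
    define a where "a z i = complex_of_real ((norm (\<zeta> z))\<^sup>2 ^ i / real i)" for z i
    have Yeq: "Y N = circle_mean (\<lambda>z. d z * (\<Sum>q<N. \<Sum>i\<le>q. a z i * \<zeta> z ^ (q - i)))" for N
    proof -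
      have "Y N = circle_mean (\<lambda>z. \<Sum>p<N. \<Sum>l\<le>p. d z * \<zeta> z ^ p * (cnj (\<zeta> z) ^ l / of_nat l))"
        unfolding Y_def c_eq
        by (simp only: circle_mean_sum_continuous[OF cont_term] circle_mean_sum_continuous[OF continuous_on_sum[OF cont_term]])
      also have "\<dots> = circle_mean (\<lambda>z. d z * (\<Sum>q<N. \<Sum>i\<le>q. a z i * \<zeta> z ^ (q - i)))"
      proof (rule circle_mean_cong)
        fix z
        have "\<zeta> z ^ p * (cnj (\<zeta> z) ^ l / of_nat l) = a z l * \<zeta> z ^ (p - l)" if "l \<le> p" for p l
        proof -
          have "\<zeta> z ^ p = \<zeta> z ^ (p - l) * \<zeta> z ^ l" using that by (simp flip: power_add)
          moreover have "complex_of_real ((norm (\<zeta> z))\<^sup>2 ^ l) = \<zeta> z ^ l * cnj (\<zeta> z) ^ l"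
            unfolding of_real_power[of _ l] complex_norm_square power_mult_distrib ..
          ultimately show ?thesis unfolding a_def of_real_divide by simp
        qed
        thus "(\<Sum>p<N. \<Sum>l\<le>p. d z * \<zeta> z ^ p * (cnj (\<zeta> z) ^ l / of_nat l))
           = d z * (\<Sum>q<N. \<Sum>i\<le>q. a z i * \<zeta> z ^ (q - i))"
          unfolding sum_distrib_left mult.assoc by (intro sum.cong refl) auto
      qed
      finally show ?thesis .
    qed
    have sumS: "summable (\<lambda>q. \<Sum>i\<le>q. \<rho> ^ i * \<rho> ^ (q - i))"
      by (rule summable_Cauchy_product) (use \<rho> \<rho>0 in auto)
    have "(\<lambda>N. circle_mean (\<lambda>z. d z * (\<Sum>q<N. \<Sum>i\<le>q. a z i * \<zeta> z ^ (q - i))))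
        \<longlonglongrightarrow> circle_mean (\<lambda>z. d z * (of_real (- lam z) * (1 / (1 - \<zeta> z))))"
    proof (rule circle_mean_dominated)
      fix z :: complex and N assume z: "norm z = 1"
      have ai: "norm (a z i) \<le> \<rho> ^ i" for i
      proof (cases "i = 0")
        case False
        have "norm (a z i) \<le> (norm (\<zeta> z))\<^sup>2 ^ i / 1"
          unfolding a_def norm_of_real by (simp add: divide_of_nat_le_self)
        also have "\<dots> = norm (\<zeta> z) ^ i * norm (\<zeta> z) ^ i" by (simp add: power2_eq_square power_mult_distrib)
        also have "\<dots> \<le> \<rho> ^ i * 1" using \<rho>(2)[OF z] lt1[OF z] \<rho>0
          by (intro mult_mono power_mono power_le_one) auto
        finally show ?thesis by simp
      qed (use \<rho>0 in \<open>auto simp: a_def\<close>)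
      have "norm (\<Sum>q<N. \<Sum>i\<le>q. a z i * \<zeta> z ^ (q - i)) \<le> (\<Sum>q<N. \<Sum>i\<le>q. \<rho> ^ i * \<rho> ^ (q - i))"
        using \<rho>(2)[OF z] \<rho>0 ai
        by (intro sum_norm_le) (auto simp: norm_mult norm_power intro!: mult_mono power_mono)
      also have "\<dots> \<le> (\<Sum>q. \<Sum>i\<le>q. \<rho> ^ i * \<rho> ^ (q - i))"
        by (rule sum_le_suminf[OF sumS]) (use \<rho>0 in \<open>auto intro!: sum_nonneg\<close>)
      finally show "norm (d z * (\<Sum>q<N. \<Sum>i\<le>q. a z i * \<zeta> z ^ (q - i))) \<le> D * (\<Sum>q. \<Sum>i\<le>q. \<rho> ^ i * \<rho> ^ (q - i))"
        unfolding norm_mult using D[OF z] D0 by (intro mult_mono) auto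
    next
      fix z :: complex assume z: "norm z = 1"
      define x where "x = (norm (\<zeta> z))\<^sup>2"
      have x: "0 \<le> x" "x < 1" using sq_le[OF z] by (auto simp: x_def)
      have "(\<lambda>n. (-1)^Suc n / of_nat n * (- of_real x)^n) sums Ln (1 + (- complex_of_real x))"
        using x by (intro Ln_series) auto
      hence "(\<lambda>n. - ((-1)^Suc n / of_nat n * (- of_real x)^n)) sums (- Ln (1 - complex_of_real x))"
        by (intro sums_minus) simp
      moreover have "- ((-1)^Suc n / of_nat n * (- of_real x)^n) = a z n" for n
        unfolding neg_Ln_series_term by (simp add: a_def x_def)
      moreover have "Ln (1 - complex_of_real x) = of_real (lam z)"
        using x Ln_of_real[of "1 - x"] by (simp add: lam_def x_def)
      ultimately have 1: "a z sums (of_real (- lam z))" by simp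
      have na: "norm (a z n) \<le> x ^ n" for n
        unfolding a_def x_def norm_of_real by (simp add: divide_of_nat_le_self)
      have 2: "summable (\<lambda>n. norm (a z n))"
        by (rule summable_comparison_test'[of "\<lambda>n. x ^ n"]) (use x na in auto)
      have 3: "summable (\<lambda>n. norm (\<zeta> z ^ n))" using lt1[OF z] by (simp add: norm_power)
      have "(\<lambda>q. \<Sum>i\<le>q. a z i * \<zeta> z ^ (q - i)) sums ((\<Sum>n. a z n) * (\<Sum>n. \<zeta> z ^ n))"
        by (rule Cauchy_product_sums[OF 2 3])
      hence "(\<lambda>q. \<Sum>i\<le>q. a z i * \<zeta> z ^ (q - i)) sums (of_real (- lam z) * (1 / (1 - \<zeta> z)))"
        using sums_unique[OF 1] suminf_geometric[OF lt1[OF z]] by simp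
      thus "(\<lambda>N. d z * (\<Sum>q<N. \<Sum>i\<le>q. a z i * \<zeta> z ^ (q - i))) \<longlonglongrightarrow> d z * (of_real (- lam z) * (1 / (1 - \<zeta> z)))"
        unfolding sums_def by (intro tendsto_intros)
    next
      show "continuous_on (sphere 0 1) (\<lambda>z. d z * (\<Sum>q<N. \<Sum>i\<le>q. a z i * \<zeta> z ^ (q - i)))" for N
        unfolding a_def divide_inverse
        by (intro continuous_on_mult continuous_on_sum continuous_on_power cd c\<zeta> continuous_on_of_real
            continuous_on_const continuous_on_norm)
      show "continuous_on (sphere 0 1) (\<lambda>z. d z * (of_real (- lam z) * (1 / (1 - \<zeta> z))))"
        unfolding lam_def using ne1 sq_le by (intro continuous_intros cd c\<zeta>) force+
    qed
    moreover have "circle_mean (\<lambda>z. d z * (of_real (- lam z) * (1 / (1 - \<zeta> z))))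
        = circle_mean (\<lambda>z. z * deriv L z * of_real (lam z))"
      by (rule circle_mean_cong) (simp add: derivL)
    ultimately show ?thesis by (simp only: Yeq[abs_def])
  qed
  have "(\<lambda>N. Re (X N) - 2 * Re (Y N)) \<longlonglongrightarrow> Re (dirichlet_form L L) - 2 * Re (circle_mean (\<lambda>z. z * deriv L z * of_real (lam z)))"
    by (intro tendsto_intros Xlim Ylim)
  moreover have "Re (X N) - 2 * Re (Y N) = (\<Sum>l<N. Re (c (Suc l) (Suc l)))" for N
    by (simp add: XY)
  moreover have "Re (c (Suc l) (Suc l)) = Re (dirichlet_form (\<lambda>z. \<zeta> z ^ Suc l) (\<lambda>z. \<zeta> z ^ Suc l)) / (real (Suc l))\<^sup>2" for l
    unfolding c_def power2_eq_square of_nat_mult[symmetric] by (simp only: Re_divide_of_nat)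
  ultimately show ?thesis by (simp add: sums_def)
qed

section \<open>Trigonometric approximation\<close>

text \<open>By the product formula \<open>2 Re x Re y = Re (x y) + Re (x cnj y)\<close>, since \<open>z cnj
  z = 1\<close> on the circle. This makes real parts of polynomials an algebra on the circle.\<close>

lemma monomial_mult_trigonometric:
  "\<exists>p::complex poly. \<forall>z\<in>sphere 0 1. Re (a * z ^ k) * Re (b * z ^ l) = Re (poly p z)"
proof -
  have eq: "Re x * Re y = (Re (x * y) + Re (x * cnj y)) / 2" for x y by simp
  have half: "Re (poly (monom (c / 2) m + monom (d / 2) n) z) = (Re (c * z ^ m) + Re (d * z ^ n)) / 2" for c d m n z
  proof -
    have "poly (monom (c / 2) m + monom (d / 2) n) z = (c * z ^ m + d * z ^ n) / 2" by (simp add: poly_monom)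
    thus ?thesis by (simp only: Re_divide_numeral plus_complex.sel)
  qed
  have prod: "a * z ^ k * (b * z ^ l) = a * b * z ^ (k + l)" for z by (simp add: power_add)
  have z: "cnj z * z = 1" "z * cnj z = 1" if "norm z = 1" for z
    using that by (simp_all add: complex_norm_square[symmetric] mult.commute[of "cnj z"])
  show ?thesis
  proof (cases "l \<le> k")
    case True
    have 1: "z ^ k * cnj z ^ l = z ^ (k - l)" if "norm z = 1" for z
    proof -
      have "z ^ k = z ^ (k - l) * z ^ l" using True by (simp flip: power_add)
      thus ?thesis using z[OF that] by (simp add: mult.assoc flip: power_mult_distrib)
    qed
    have "Re (a * z ^ k * cnj (b * z ^ l)) = Re (a * cnj b * z ^ (k - l))" if "norm z = 1" for z
    proof -
      have "a * z ^ k * cnj (b * z ^ l) = a * cnj b * (z ^ k * cnj z ^ l)" by simp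
      thus ?thesis using 1[OF that] by (simp only:)
    qed
    hence "\<forall>z\<in>sphere 0 1. Re (a * z ^ k) * Re (b * z ^ l) = Re (poly (monom (a * b / 2) (k + l) + monom (a * cnj b / 2) (k - l)) z)"
      unfolding half unfolding eq prod by simp
    thus ?thesis by blast
  next
    case False
    have 1: "z ^ l * cnj z ^ k = z ^ (l - k)" if "norm z = 1" for z
    proof -
      have "z ^ l = z ^ (l - k) * z ^ k" using False by (simp flip: power_add)
      thus ?thesis using z[OF that] by (simp add: mult.assoc flip: power_mult_distrib)
    qed
    have "Re (a * z ^ k * cnj (b * z ^ l)) = Re (cnj a * b * z ^ (l - k))" if "norm z = 1" for z
    proof -
      have "cnj (a * z ^ k * cnj (b * z ^ l)) = cnj a * b * (z ^ l * cnj z ^ k)" by simp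
      hence "Re (cnj (a * z ^ k * cnj (b * z ^ l))) = Re (cnj a * b * z ^ (l - k))" using 1[OF that] by (simp only:)
      thus ?thesis by (simp only: cnj.sel)
    qed
    hence "\<forall>z\<in>sphere 0 1. Re (a * z ^ k) * Re (b * z ^ l) = Re (poly (monom (a * b / 2) (k + l) + monom (cnj a * b / 2) (l - k)) z)"
      unfolding half unfolding eq prod by simp
    thus ?thesis by blast
  qed
qed

lemma real_polynomial_trigonometric:
  fixes g :: "complex \<Rightarrow> real"
  assumes "real_polynomial_function g"
  shows "\<exists>p::complex poly. \<forall>z\<in>sphere 0 1. g z = Re (poly p z)"
  using assms
proof induction
  case (linear f)
  have "f z = Re (poly [:0, Complex (f 1) (- f \<i>):] z)" for z
  proof -
    have "f z = f (Re z *\<^sub>R 1 + Im z *\<^sub>R \<i>)" by (rule arg_cong[of _ _ f]) (simp add: complex_eq_iff)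
    also have "\<dots> = Re z * f 1 + Im z * f \<i>"
      using linear by (simp only: bounded_linear.linear linear_add linear_scale real_scaleR_def)
    finally show ?thesis by simp
  qed
  thus ?case by blast
next
  case (const c)
  show ?case by (rule exI[of _ "[:of_real c:]"]) simp
next
  case (add f g)
  then obtain p q where "\<forall>z\<in>sphere 0 1. f z = Re (poly p z)" "\<forall>z\<in>sphere 0 1. g z = Re (poly q z)" by blast
  thus ?case by (intro exI[of _ "p + q"]) simp
next
  case (mult f g)
  then obtain p q where pq: "\<forall>z\<in>sphere 0 1. f z = Re (poly p z)" "\<forall>z\<in>sphere 0 1. g z = Re (poly q z)" by blast
  have "\<forall>k l. \<exists>r. \<forall>z\<in>sphere 0 1. Re (coeff p k * z ^ k) * Re (coeff q l * z ^ l) = Re (poly r z)"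
    using monomial_mult_trigonometric by blast
  then obtain r where r: "\<And>k l z. z \<in> sphere 0 1 \<Longrightarrow> Re (coeff p k * z ^ k) * Re (coeff q l * z ^ l) = Re (poly (r k l) z)"
    by metis
  have "f z * g z = Re (poly (\<Sum>k\<le>degree p. \<Sum>l\<le>degree q. r k l) z)" if "z \<in> sphere 0 1" for z
  proof -
    have "f z * g z = (\<Sum>k\<le>degree p. Re (coeff p k * z ^ k)) * (\<Sum>l\<le>degree q. Re (coeff q l * z ^ l))"
      by (simp only: pq[rule_format, OF that] poly_altdef Re_sum)
    thus ?thesis by (simp only: sum_product r[OF that] poly_sum Re_sum)
  qed
  thus ?case by blast
qed

text \<open>The Stone-Weierstrass theorem gives a polynomial in the two real coordinates, and on the circle
  such a polynomial is the real part of a complex one.\<close>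

lemma trigonometric_approximation:
  fixes v :: "complex \<Rightarrow> real"
  assumes "continuous_on (sphere 0 1) v" "e > 0"
  obtains p where "\<And>z. norm z = 1 \<Longrightarrow> \<bar>v z - Re (poly p z)\<bar> < e"
proof -
  obtain g where "real_polynomial_function g" and g: "\<And>z. z \<in> sphere 0 1 \<Longrightarrow> \<bar>v z - g z\<bar> < e"
    using Stone_Weierstrass_real_polynomial_function[OF compact_sphere assms] by blast
  moreover obtain p where "\<forall>z\<in>sphere 0 1. g z = Re (poly p z)"
    using real_polynomial_trigonometric[OF \<open>real_polynomial_function g\<close>] by blast
  ultimately show ?thesis using that[of p] by (metis mem_sphere_0)
qed

lemma circle_mean_real_times_power:
  fixes v :: "complex \<Rightarrow> real"
  shows "circle_mean (\<lambda>z. of_real (v z) * z ^ k) = cnj (fourier_coeff (\<lambda>z. of_real (v z)) k)"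
  unfolding fourier_coeff_def by (subst circle_mean_cnj[symmetric]) simp

lemma circle_mean_zero_continuous:
  fixes v :: "complex \<Rightarrow> real"
  assumes "continuous_on (sphere 0 1) v" "circle_mean v = 0" "\<And>z. norm z = 1 \<Longrightarrow> 0 \<le> v z" "norm z = 1"
  shows "v z = 0"
proof -
  have c: "continuous_on {0..2*pi} (\<lambda>\<theta>. v (cis \<theta>))" by (rule continuous_on_comp_cis[OF assms(1)])
  have "integral {0..2*pi} (\<lambda>\<theta>. v (cis \<theta>)) = (LINT \<theta>|angle_measure. v (cis \<theta>))"
    by (rule lebesgue_integral_eq_integral[symmetric]) (use circle_integrable_continuous[OF assms(1)] in auto)
  also have "\<dots> = 0" using assms(2) by (simp add: circle_mean_def)
  finally have "\<forall>\<theta>\<in>{0..2*pi}. v (cis \<theta>) = 0"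
    using integral_eq_0_iff[OF c] assms(3) by simp
  moreover have "z = cis (Arg2pi z)" using Arg2pi_eq[of z] assms(4) by (simp add: cis_conv_exp)
  ultimately show ?thesis using Arg2pi[of z] by (metis atLeastAtMost_iff less_imp_le)
qed

text \<open>A real function whose coefficients vanish is orthogonal to all real parts of polynomials, hence
  to arbitrarily good uniform approximations of itself.\<close>

lemma fourier_coeff_unique:
  fixes v :: "complex \<Rightarrow> real"
  assumes v: "continuous_on (sphere 0 1) v" and 0: "\<And>k. fourier_coeff (\<lambda>z. of_real (v z)) k = 0" and "norm z = 1"
  shows "v z = 0"
proof -
  have int: "circle_mean (\<lambda>z. v z * Re (poly p z)) = 0" for p
  proof -
    have "circle_mean (\<lambda>z. v z * Re (poly p z)) = circle_mean (\<lambda>z. Re (of_real (v z) * poly p z))"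
      by (rule circle_mean_cong) simp
    also have "\<dots> = Re (circle_mean (\<lambda>z. of_real (v z) * poly p z))"
      by (intro circle_mean_Re circle_integrable_continuous continuous_intros v)
    also have "circle_mean (\<lambda>z. of_real (v z) * poly p z) = circle_mean (\<lambda>z. \<Sum>k\<le>degree p. coeff p k * (of_real (v z) * z ^ k))"
      by (simp add: poly_altdef sum_distrib_left mult_ac)
    also have "\<dots> = (\<Sum>k\<le>degree p. coeff p k * circle_mean (\<lambda>z. of_real (v z) * z ^ k))"
      by (subst circle_mean_sum_continuous) (auto intro!: continuous_intros v simp: circle_mean_mult_left)
    also have "\<dots> = 0" by (simp add: circle_mean_real_times_power 0)
    finally show ?thesis by simp
  qed
  obtain C where C: "\<And>z. norm z = 1 \<Longrightarrow> \<bar>v z\<bar> \<le> C"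
    using compact_imp_bounded[OF compact_continuous_image[OF v compact_sphere]]
    unfolding bounded_iff by (metis imageI mem_sphere_0 real_norm_def)
  have C0: "C \<ge> 0" by (rule order_trans[OF abs_ge_zero C[of 1]]) simp
  have le: "circle_mean (\<lambda>z. (v z)\<^sup>2) \<le> e" if "e > 0" for e
  proof -
    define d where "d = e / (C + 1)"
    have d: "d > 0" using that C0 by (simp add: d_def)
    obtain p where p: "\<And>z. norm z = 1 \<Longrightarrow> \<bar>v z - Re (poly p z)\<bar> < d" using trigonometric_approximation[OF v d] by blast
    have "circle_mean (\<lambda>z. (v z)\<^sup>2) = circle_mean (\<lambda>z. (v z)\<^sup>2) - circle_mean (\<lambda>z. v z * Re (poly p z))" by (simp add: int)
    also have "\<dots> = circle_mean (\<lambda>z. (v z)\<^sup>2 - v z * Re (poly p z))"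
      by (rule circle_mean_diff[symmetric]; intro circle_integrable_continuous continuous_intros v)
    also have "\<dots> \<le> circle_mean (\<lambda>z. e)"
    proof (rule circle_mean_mono)
      fix z :: complex assume z: "norm z = 1"
      have "(v z)\<^sup>2 - v z * Re (poly p z) = v z * (v z - Re (poly p z))" by (simp add: power2_eq_square algebra_simps)
      also have "\<dots> \<le> \<bar>v z\<bar> * \<bar>v z - Re (poly p z)\<bar>" by (metis abs_ge_self abs_mult)
      also have "\<dots> \<le> (C + 1) * d" using C[OF z] p[OF z] C0 by (intro mult_mono) auto
      finally show "(v z)\<^sup>2 - v z * Re (poly p z) \<le> e" using C0 by (simp add: d_def)
    qed (intro circle_integrable_continuous continuous_intros v)+
    finally show ?thesis by simp
  qed
  have "circle_mean (\<lambda>z. (v z)\<^sup>2) \<le> 0" by (rule field_le_epsilon) (use le in auto)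
  moreover have "circle_mean (\<lambda>z. (v z)\<^sup>2) \<ge> 0" by (rule circle_mean_nonneg) simp
  ultimately have "circle_mean (\<lambda>z. (v z)\<^sup>2) = 0" by simp
  from circle_mean_zero_continuous[OF _ this] have "(v z)\<^sup>2 = 0"
    using \<open>norm z = 1\<close> by (auto intro!: continuous_intros v)
  thus ?thesis by simp
qed

section \<open>The density defined by an entire exponent\<close>

text \<open>The setting of the inequality for nice boundary data: \<open>2 Re F\<close> is the harmonic
  function and its exponential \<open>w = |exp F|\<^sup>2\<close> is the density on the circle
  whose mean \<open>A\<close> has to be bounded by the Dirichlet energy of \<open>F\<close>.\<close>

locale entire_exponent =
  fixes F :: "complex \<Rightarrow> complex"
  assumes entire: "F holomorphic_on UNIV" and F0: "F 0 = 0"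
begin

definition w :: "complex \<Rightarrow> real" where "w z = (norm (exp (F z)))\<^sup>2"
definition A :: real where "A = circle_mean w"

lemma w_eq_exp: "w z = exp (2 * Re (F z))"
  by (simp add: w_def exp_double)

lemma w_pos: "w z > 0" by (simp add: w_eq_exp)

lemma F_ball: "F holomorphic_on ball 0 R"
  using entire holomorphic_on_subset by blast

lemma F_cont: "continuous_on S F"
  using entire holomorphic_on_imp_continuous_on continuous_on_subset by blast

lemma w_cont: "continuous_on S w"
  unfolding w_eq_exp[abs_def] by (intro continuous_intros F_cont)

lemma mean_F: "circle_mean F = 0"
  using circle_mean_holomorphic[OF F_ball[of 2]] F0 by simp

text \<open>Jensen's inequality, in the form \<open>exp x \<ge> 1 + x\<close>.\<close>

lemma A_ge_1: "A \<ge> 1"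
proof -
  have "circle_mean (\<lambda>z. 1 + 2 * Re (F z)) = 1 + circle_mean (\<lambda>z. 2 * Re (F z))"
    by (subst circle_mean_add; (intro circle_integrable_continuous continuous_intros F_cont)?) simp
  also have "\<dots> = 1"
    using circle_mean_Re[OF circle_integrable_continuous[OF F_cont]] by (simp add: circle_mean_mult_left mean_F)
  finally have "1 = circle_mean (\<lambda>z. 1 + 2 * Re (F z))" by simp
  also have "\<dots> \<le> A" unfolding A_def w_eq_exp
    by (rule circle_mean_mono; (intro circle_integrable_continuous continuous_intros F_cont)?)
       (simp add: w_eq_exp exp_ge_add_one_self)
  finally show ?thesis .
qed

definition b :: "nat \<Rightarrow> complex" where "b k = fourier_coeff (\<lambda>z. of_real (w z)) k"

lemma b_0: "b 0 = of_real A"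
  by (simp add: b_def fourier_coeff_0 circle_mean_of_real A_def)

text \<open>The density is \<open>g cnj g\<close> for the entire function \<open>g = exp F\<close>, and its
  \<open>k\<close>-th coefficient pairs the Taylor coefficients of \<open>g\<close> with those of
  \<open>z\<^sup>k g\<close>. Only indices at least \<open>k\<close> contribute, and there the
  Cauchy estimate on the circle of radius 4 applies. The rate \<open>2\<^sup>-\<^sup>k\<close>
  makes the power series \<open>B\<close> below converge beyond the closed disc.\<close>

lemma b_bound: obtains C where "\<And>k. norm (b k) \<le> C / 2 ^ k"
proof -
  define g where "g z = exp (F z)" for z
  have g: "g holomorphic_on S" for S unfolding g_def using entire holomorphic_on_subset
    by (intro holomorphic_intros) blast
  have gc: "continuous_on S g" for S using g holomorphic_on_imp_continuous_on by blast
  obtain C where C: "\<And>z. norm z = 4 \<Longrightarrow> norm (g z) \<le> C"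
    using compact_imp_bounded[OF compact_continuous_image[OF gc compact_sphere[of 0 4]]]
    unfolding bounded_iff by (metis imageI mem_sphere_0)
  obtain D where D: "\<And>z. norm z = 1 \<Longrightarrow> norm (g z) \<le> D"
    using compact_imp_bounded[OF compact_continuous_image[OF gc compact_sphere[of 0 1]]]
    unfolding bounded_iff by (metis imageI mem_sphere_0)
  have C0: "0 \<le> C" by (rule order_trans[OF norm_ge_zero C[of 4]]) simp
  have D0: "0 \<le> D" by (rule order_trans[OF norm_ge_zero D[of 1]]) simp
  have a: "norm (fourier_coeff g k) \<le> C / 4 ^ k" for k
  proof -
    have "norm ((deriv ^^ k) g 0) \<le> fact k * C / 4 ^ k"
      by (rule Cauchy_inequality[OF g gc]) (use C in auto)
    thus ?thesis by (simp add: fourier_coeff_holomorphic[OF g, of 2] norm_divide field_simps)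
  qed
  have "norm (b k) \<le> (C * D * 2) / 2 ^ k" for k
  proof -
    define q where "q z = z ^ k * g z" for z
    have q: "q holomorphic_on S" for S unfolding q_def by (intro holomorphic_intros g)
    have bk: "b k = circle_mean (\<lambda>z. g z * cnj (q z))"
      unfolding b_def fourier_coeff_def q_def w_def g_def complex_norm_square
      by (simp add: mult_ac)
    have q1: "fourier_coeff q n = 0" if "n < k" for n
    proof -
      have "fourier_coeff q n = circle_mean (\<lambda>z. z ^ (k - n) * g z)" unfolding fourier_coeff_def q_def
      proof (rule circle_mean_cong)
        fix z :: complex assume "norm z = 1"
        moreover have "z ^ k = z ^ (k - n) * z ^ n" using that by (simp flip: power_add)
        ultimately show "z ^ k * g z * cnj z ^ n = z ^ (k - n) * g z"
          by (auto simp: cnj_eq_inverse_circle field_simps)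
      qed
      also have "\<dots> = 0"
        by (subst circle_mean_holomorphic[where R = 2]) (use that in \<open>auto intro!: holomorphic_intros g\<close>)
      finally show ?thesis .
    qed
    have q2: "norm (fourier_coeff q n) \<le> D" for n
      unfolding fourier_coeff_def
      by (rule circle_mean_norm_le_const)
         (use D in \<open>auto intro!: circle_integrable_continuous continuous_intros gc simp: q_def norm_mult norm_power\<close>)
    have sums: "(\<lambda>n. fourier_coeff g n * cnj (fourier_coeff q n)) sums b k"
      unfolding bk by (rule parseval_holomorphic[OF g q, of 2]) simp
    have bnd: "norm (fourier_coeff g n * cnj (fourier_coeff q n)) \<le> (C * D / 2 ^ k) * (1 / 2) ^ n" for n
    proof (cases "n < k")
      case True thus ?thesis using q1 C0 D0 by simp
    next
      case False
      have "norm (fourier_coeff g n * cnj (fourier_coeff q n)) \<le> C / 4 ^ n * D"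
        unfolding norm_mult complex_mod_cnj using a[of n] q2[of n] C0 by (intro mult_mono) auto
      also have "\<dots> = C * D / (2 ^ n * 2 ^ n)" by (simp add: power_mult_distrib[symmetric])
      also have "\<dots> \<le> C * D / (2 ^ k * 2 ^ n)"
        using False C0 D0 by (intro divide_left_mono mult_right_mono power_increasing mult_nonneg_nonneg mult_pos_pos) auto
      finally show ?thesis by (simp add: power_one_over field_simps)
    qed
    have s1: "summable (\<lambda>n. (C * D / 2 ^ k) * (1 / 2 :: real) ^ n)" by (intro summable_mult summable_geometric) simp
    have "norm (\<Sum>n. fourier_coeff g n * cnj (fourier_coeff q n)) \<le> (\<Sum>n. (C * D / 2 ^ k) * (1 / 2) ^ n)"
      by (rule norm_suminf_le[OF bnd s1])
    also have "\<dots> = C * D * 2 / 2 ^ k" by (subst suminf_mult) (auto simp: suminf_geometric)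
    finally show ?thesis using sums_unique[OF sums] by simp
  qed
  thus ?thesis using that by blast
qed

end

section \<open>Coefficients of products and bounds for the Dirichlet form\<close>

lemma circle_mean_powers: "circle_mean (\<lambda>z. z ^ n * cnj z ^ k) = (if n = k then 1 else 0)"
proof -
  have le: "circle_mean (\<lambda>z. z ^ n * cnj z ^ k) = (if n = k then 1 else 0)" if "k \<le> n" for n k
  proof -
    have "circle_mean (\<lambda>z. z ^ n * cnj z ^ k) = circle_mean (\<lambda>z. z ^ (n - k))"
    proof (rule circle_mean_cong)
      fix z :: complex assume "norm z = 1"
      moreover have "z ^ n = z ^ (n - k) * z ^ k" using that by (simp flip: power_add)
      ultimately show "z ^ n * cnj z ^ k = z ^ (n - k)" by (auto simp: cnj_eq_inverse_circle field_simps)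
    qed
    also have "\<dots> = 0 ^ (n - k)" by (rule circle_mean_holomorphic[where R = 2]) (auto intro!: holomorphic_intros)
    finally show ?thesis using that by (auto simp: power_0_left)
  qed
  show ?thesis
  proof (cases "k \<le> n")
    case False
    have "circle_mean (\<lambda>z. z ^ n * cnj z ^ k) = circle_mean (\<lambda>z. cnj (z ^ k * cnj z ^ n))" by (simp add: mult.commute)
    also have "\<dots> = 0" unfolding circle_mean_cnj using le[of n k] False by simp
    finally show ?thesis using False by auto
  qed (use le in simp)
qed

lemma fourier_coeff_power_series:
  assumes "\<And>z. norm z = 1 \<Longrightarrow> (\<lambda>n. a n * z ^ n) sums q z" "summable (\<lambda>n. norm (a n))"
    and q: "continuous_on (sphere 0 1) q"
  shows "fourier_coeff q k = a k"
proof -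
  have "(\<lambda>N. circle_mean (\<lambda>z. (\<Sum>n<N. a n * z ^ n) * cnj z ^ k)) \<longlonglongrightarrow> circle_mean (\<lambda>z. q z * cnj z ^ k)"
  proof (rule circle_mean_dominated)
    fix z :: complex and N assume z: "norm z = 1"
    have "norm (\<Sum>n<N. a n * z ^ n) \<le> (\<Sum>n<N. norm (a n))"
      by (rule sum_norm_le) (simp add: norm_mult norm_power z)
    also have "\<dots> \<le> (\<Sum>n. norm (a n))" by (rule sum_le_suminf[OF assms(2)]) auto
    finally show "norm ((\<Sum>n<N. a n * z ^ n) * cnj z ^ k) \<le> (\<Sum>n. norm (a n))"
      by (simp add: norm_mult norm_power z)
    show "(\<lambda>N. (\<Sum>n<N. a n * z ^ n) * cnj z ^ k) \<longlonglongrightarrow> q z * cnj z ^ k"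
      using assms(1)[OF z] unfolding sums_def by (intro tendsto_intros)
  qed (intro continuous_intros q)+
  moreover have "circle_mean (\<lambda>z. (\<Sum>n<N. a n * z ^ n) * cnj z ^ k) = (if k < N then a k else 0)" for N
  proof -
    have "circle_mean (\<lambda>z. (\<Sum>n<N. a n * z ^ n) * cnj z ^ k) = circle_mean (\<lambda>z. \<Sum>n<N. a n * (z ^ n * cnj z ^ k))"
      by (simp add: sum_distrib_right mult.assoc)
    also have "\<dots> = (\<Sum>n<N. a n * circle_mean (\<lambda>z. z ^ n * cnj z ^ k))"
      by (subst circle_mean_sum_continuous) (auto intro!: continuous_intros simp: circle_mean_mult_left)
    also have "\<dots> = (\<Sum>n<N. if n = k then a n else 0)" by (intro sum.cong) (auto simp: circle_mean_powers)
    finally show ?thesis by simp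
  qed
  moreover have "(\<lambda>N. if k < N then a k else 0) \<longlonglongrightarrow> a k"
    by (rule tendsto_eventually) (use eventually_gt_at_top[of k] in eventually_elim, auto)
  ultimately show ?thesis unfolding fourier_coeff_def using LIMSEQ_unique by simp
qed

lemma fourier_coeff_mult:
  assumes p: "p holomorphic_on ball 0 R" and q: "q holomorphic_on ball 0 R" and "R > 1"
  shows "fourier_coeff (\<lambda>z. p z * q z) k = (\<Sum>i\<le>k. fourier_coeff p i * fourier_coeff q (k - i))"
proof -
  have pq: "(\<lambda>z. p z * q z) holomorphic_on ball 0 R" using p q by (intro holomorphic_intros)
  have "(deriv ^^ k) (\<lambda>w. p w * q w) 0 = (\<Sum>i = 0..k. of_nat (k choose i) * (deriv ^^ i) p 0 * (deriv ^^ (k - i)) q 0)"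
    by (rule higher_deriv_mult[OF p q]) (use \<open>R > 1\<close> in auto)
  thus ?thesis
    by (simp add: fourier_coeff_holomorphic[OF pq \<open>R > 1\<close>] fourier_coeff_holomorphic[OF p \<open>R > 1\<close>]
        fourier_coeff_holomorphic[OF q \<open>R > 1\<close>] sum_divide_distrib binomial_fact atLeast0AtMost)
qed

lemma norm_fourier_coeff_le:
  assumes "continuous_on (sphere 0 1) q" "\<And>z. norm z = 1 \<Longrightarrow> norm (q z) \<le> C"
  shows "norm (fourier_coeff q k) \<le> C"
  unfolding fourier_coeff_def using assms
  by (intro circle_mean_norm_le_const circle_integrable_continuous continuous_intros)
     (auto simp: norm_mult norm_power)

text \<open>Compare the series \<open>\<Sum>k. k |p\<^sub>k|\<^sup>2\<close> with \<open>N\<close> times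
  \<open>\<Sum>k. |p\<^sub>k|\<^sup>2\<close>: indices below \<open>N\<close> lose at most
  \<open>N |p\<^sub>k|\<^sup>2\<close>, and every index above \<open>N\<close> gains at least
  \<open>|p\<^sub>k|\<^sup>2\<close>. The gain will identify the case of equality.\<close>

lemma dirichlet_form_ge:
  assumes p: "p holomorphic_on ball 0 R" and "R > 1"
  shows "Re (dirichlet_form p p) \<ge> real N * circle_mean (\<lambda>z. (norm (p z))\<^sup>2)
     - real N * (\<Sum>k<N. (norm (fourier_coeff p k))\<^sup>2)
     + (circle_mean (\<lambda>z. (norm (p z))\<^sup>2) - (\<Sum>k\<le>N. (norm (fourier_coeff p k))\<^sup>2))"
proof -
  define x where "x k = (norm (fourier_coeff p k))\<^sup>2" for k
  have x: "x k \<ge> 0" for k by (simp add: x_def)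
  have s: "x sums circle_mean (\<lambda>z. (norm (p z))\<^sup>2)" unfolding x_def[abs_def] by (rule parseval_norm[OF assms])
  have f1: "(\<lambda>k. if k \<in> {..<N} then x k else 0) sums (\<Sum>k<N. x k)" by (rule sums_If_finite_set) simp
  have f2: "(\<lambda>k. if k \<in> {..N} then x k else 0) sums (\<Sum>k\<le>N. x k)" by (rule sums_If_finite_set) simp
  have "real N * circle_mean (\<lambda>z. (norm (p z))\<^sup>2) - real N * (\<Sum>k<N. x k) + (circle_mean (\<lambda>z. (norm (p z))\<^sup>2) - (\<Sum>k\<le>N. x k))
     \<le> Re (dirichlet_form p p)"
  proof (rule sums_le)
    show "(\<lambda>k. real N * x k - real N * (if k \<in> {..<N} then x k else 0) + (x k - (if k \<in> {..N} then x k else 0))) sums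
      (real N * circle_mean (\<lambda>z. (norm (p z))\<^sup>2) - real N * (\<Sum>k<N. x k) + (circle_mean (\<lambda>z. (norm (p z))\<^sup>2) - (\<Sum>k\<le>N. x k)))"
      by (intro sums_add sums_diff sums_mult s f1 f2)
    show "(\<lambda>k. real k * x k) sums Re (dirichlet_form p p)" unfolding x_def by (rule dirichlet_form_self_sums[OF assms])
    fix k
    show "real N * x k - real N * (if k \<in> {..<N} then x k else 0) + (x k - (if k \<in> {..N} then x k else 0)) \<le> real k * x k"
    proof (cases "k \<le> N")
      case False
      hence "(real N + 1) * x k \<le> real k * x k" using x by (intro mult_right_mono) auto
      thus ?thesis using False by (simp add: algebra_simps)
    next
      case True
      thus ?thesis using x[of k] by (cases "k = N") auto
    qed
  qed
  thus ?thesis by (simp add: x_def)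
qed

lemma dirichlet_form_diff_self:
  assumes p: "p holomorphic_on ball 0 R" and q: "q holomorphic_on ball 0 R" and "R > 1"
  shows "Re (dirichlet_form (\<lambda>z. p z - q z) (\<lambda>z. p z - q z)) =
     Re (dirichlet_form p p) + Re (dirichlet_form q q) - 2 * Re (dirichlet_form q p)"
proof -
  have pq: "(\<lambda>z. p z - q z) holomorphic_on ball 0 R" using p q by (intro holomorphic_intros)
  have c: "continuous_on (sphere 0 1) p" "continuous_on (sphere 0 1) q"
     "continuous_on (sphere 0 1) (deriv p)" "continuous_on (sphere 0 1) (deriv q)"
    using p q circle_continuous_holomorphic \<open>R > 1\<close> holomorphic_deriv[OF _ open_ball] by blast+
  have i: "circle_integrable (\<lambda>z. z * deriv f z * cnj (g z))" if "f \<in> {p,q}" "g \<in> {p,q}" for f g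
    using that c by (intro circle_integrable_continuous continuous_intros) auto
  have "dirichlet_form (\<lambda>z. p z - q z) (\<lambda>z. p z - q z)
    = circle_mean (\<lambda>z. z * deriv p z * cnj (p z) - z * deriv p z * cnj (q z) - (z * deriv q z * cnj (p z) - z * deriv q z * cnj (q z)))"
    unfolding dirichlet_form_def
  proof (rule circle_mean_cong)
    fix z :: complex assume z: "norm z = 1"
    have "deriv (\<lambda>z. p z - q z) z = deriv p z - deriv q z"
      using p q z \<open>R > 1\<close> by (intro deriv_diff) (auto simp: holomorphic_on_open field_differentiable_def intro!: holomorphic_on_imp_differentiable_at[of _ "ball 0 R"])
    thus "z * deriv (\<lambda>z. p z - q z) z * cnj (p z - q z) = z * deriv p z * cnj (p z) - z * deriv p z * cnj (q z) - (z * deriv q z * cnj (p z) - z * deriv q z * cnj (q z))"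
      by (simp only: complex_cnj_diff) (simp only: algebra_simps)
  qed
  also have "\<dots> = dirichlet_form p p - dirichlet_form p q - (dirichlet_form q p - dirichlet_form q q)"
    unfolding dirichlet_form_def
    by (simp only: circle_mean_diff i insert_iff simp_thms Bochner_Integration.integrable_diff)
  also have "dirichlet_form p q = cnj (dirichlet_form q p)" by (rule dirichlet_form_commute[OF q p \<open>R > 1\<close>])
  finally show ?thesis by simp
qed

section \<open>The energy as a sum over powers\<close>

context entire_exponent
begin

definition B :: "complex \<Rightarrow> complex" where "B z = (\<Sum>k. (if k = 0 then 0 else b k) * z ^ k)"

lemma b_summable: "r < 2 \<Longrightarrow> 0 \<le> r \<Longrightarrow> summable (\<lambda>k. norm (b k) * r ^ k)"
proof -
  assume r: "r < 2" "0 \<le> r"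
  obtain C where C: "\<And>k. norm (b k) \<le> C / 2 ^ k" using b_bound by blast
  show ?thesis
  proof (rule summable_comparison_test')
    show "summable (\<lambda>k. C * (r / 2) ^ k)" using r by (intro summable_mult summable_geometric) auto
    show "norm (norm (b k) * r ^ k) \<le> C * (r / 2) ^ k" for k
      using mult_right_mono[OF C[of k], of "r ^ k"] r by (simp add: power_divide)
  qed
qed

lemma B_sums: "norm z < 2 \<Longrightarrow> (\<lambda>k. (if k = 0 then 0 else b k) * z ^ k) sums B z"
  unfolding B_def
proof (rule summable_sums)
  assume z: "norm z < 2"
  show "summable (\<lambda>k. (if k = 0 then 0 else b k) * z ^ k)"
    by (rule summable_comparison_test'[OF b_summable[of "norm z"]]) (use z in \<open>auto simp: norm_mult norm_power\<close>)
qed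

lemma B_holo: "B holomorphic_on ball 0 2"
  by (rule power_series_holomorphic[where a = "\<lambda>k. if k = 0 then 0 else b k"]) (use B_sums in auto)

lemma B_cont: "continuous_on (cball 0 1) B"
  by (rule continuous_on_subset[OF holomorphic_on_imp_continuous_on[OF B_holo]]) auto

lemma B_cont_sphere: "continuous_on (sphere 0 1) B"
  by (rule continuous_on_subset[OF B_cont]) auto

lemma B_0: "B 0 = 0"
  unfolding B_def by (rule sums_unique2[OF summable_sums]) (auto simp: powser_sums_zero_iff intro: sums_If_finite_set)

lemma B_coeff: "fourier_coeff B k = (if k = 0 then 0 else b k)"
proof (rule fourier_coeff_power_series)
  show "summable (\<lambda>n. norm (if n = 0 then 0 else b n))"
    by (rule summable_comparison_test'[OF b_summable[of 1]]) auto
qed (use B_sums B_cont_sphere in auto)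

text \<open>Both sides are real with the same Fourier coefficients, namely \<open>A\<close> at index 0 and
  \<open>b k\<close> at \<open>k \<ge> 1\<close>.\<close>

lemma w_eq_B: "w z = A + 2 * Re (B z)" if "norm z = 1"
proof -
  have "w z - A - 2 * Re (B z) = 0"
  proof (rule fourier_coeff_unique[OF _ _ that])
    show "continuous_on (sphere 0 1) (\<lambda>z. w z - A - 2 * Re (B z))" by (intro continuous_intros w_cont B_cont_sphere)
    fix k
    have Bz: "circle_mean (\<lambda>z. B z * z ^ k) = 0"
      by (subst circle_mean_holomorphic[where R = 2]) (auto intro!: holomorphic_intros B_holo simp: B_0)
    have "fourier_coeff (\<lambda>z. of_real (w z - A - 2 * Re (B z))) k
      = circle_mean (\<lambda>z. (of_real (w z) * cnj z ^ k - of_real A * (z ^ 0 * cnj z ^ k)) - (B z * cnj z ^ k + cnj (B z * z ^ k)))"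
      unfolding fourier_coeff_def
    proof (rule circle_mean_cong)
      fix z
      have "complex_of_real (w z - A - 2 * Re (B z)) = of_real (w z) - of_real A - (B z + cnj (B z))"
        by (simp only: complex_add_cnj of_real_diff)
      thus "of_real (w z - A - 2 * Re (B z)) * cnj z ^ k
          = (of_real (w z) * cnj z ^ k - of_real A * (z ^ 0 * cnj z ^ k)) - (B z * cnj z ^ k + cnj (B z * z ^ k))"
        by (simp only: complex_cnj_mult complex_cnj_power power_0 mult_1) (simp only: algebra_simps)
    qed
    also have "\<dots> = (circle_mean (\<lambda>z. of_real (w z) * cnj z ^ k) - circle_mean (\<lambda>z. of_real A * (z ^ 0 * cnj z ^ k)))
       - (circle_mean (\<lambda>z. B z * cnj z ^ k) + circle_mean (\<lambda>z. cnj (B z * z ^ k)))"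
    proof -
      have i: "circle_integrable (\<lambda>z. of_real (w z) * cnj z ^ k)" "circle_integrable (\<lambda>z. of_real A * (z ^ 0 * cnj z ^ k))"
        "circle_integrable (\<lambda>z. B z * cnj z ^ k)" "circle_integrable (\<lambda>z. cnj (B z * z ^ k))"
        by (intro circle_integrable_continuous continuous_intros w_cont B_cont_sphere)+
      show ?thesis
        by (simp only: circle_mean_diff[OF i(1,2)] circle_mean_add[OF i(3,4)]
            circle_mean_diff[OF Bochner_Integration.integrable_diff[OF i(1,2)] Bochner_Integration.integrable_add[OF i(3,4)]])
    qed
    also have "\<dots> = b k - of_real A * (if k = 0 then 1 else 0) - (if k = 0 then 0 else b k)"
      unfolding circle_mean_mult_left circle_mean_powers circle_mean_cnj Bz B_coeff[unfolded fourier_coeff_def] b_def fourier_coeff_def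
      by simp
    also have "\<dots> = 0" by (simp add: b_0)
    finally show "fourier_coeff (\<lambda>z. of_real (w z - A - 2 * Re (B z))) k = 0" .
  qed
  thus ?thesis by simp
qed

definition U :: "complex \<Rightarrow> complex" where "U z = of_real A + B z"

text \<open>On the circle \<open>2 Re U - A = w > 0\<close>; the maximum principle carries the bound into
  the disc.\<close>

lemma Re_U_ge: "norm z \<le> 1 \<Longrightarrow> Re (U z) \<ge> A / 2"
proof -
  assume z: "norm z \<le> 1"
  have "Re (- (of_real A + 2 * B z)) \<le> 0"
  proof (rule maximum_real_frontier[of "\<lambda>z. - (of_real A + 2 * B z)" "cball 0 1"])
    show "(\<lambda>z. - (of_real A + 2 * B z)) holomorphic_on interior (cball 0 1)"
      by (intro holomorphic_intros holomorphic_on_subset[OF B_holo]) auto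
    show "continuous_on (closure (cball 0 1)) (\<lambda>z. - (of_real A + 2 * B z))"
      by (simp, intro continuous_intros B_cont)
    show "Re (- (of_real A + 2 * B z)) \<le> 0" if "z \<in> frontier (cball 0 1)" for z
      using w_eq_B[of z] w_pos[of z] that by (simp add: frontier_cball)
  qed (use z in auto)
  thus ?thesis by (simp add: U_def)
qed

text \<open>All functions below are built from \<open>1 / U\<close> and \<open>Ln U\<close>. By compactness
  they are holomorphic on a disc that is slightly larger than the unit disc.\<close>

lemma rad_ex: "\<exists>R>1. \<forall>z\<in>ball 0 R. z \<in> ball 0 2 \<and> Re (U z) > 0"
proof -
  define S where "S = {z \<in> ball 0 2. Re (U z) > 0}"
  have "open (ball 0 2 \<inter> (\<lambda>z. Re (U z)) -` {0<..})" unfolding U_def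
    by (rule continuous_open_preimage) (auto intro!: continuous_intros holomorphic_on_imp_continuous_on[OF B_holo])
  hence "open S" by (simp add: S_def vimage_def Int_def)
  moreover have "cball 0 1 \<subseteq> S" unfolding S_def using Re_U_ge A_ge_1 by force
  ultimately obtain e where e: "e > 0" "(\<Union>x\<in>cball 0 1. ball x e) \<subseteq> S"
    using compact_subset_open_imp_ball_epsilon_subset[OF compact_cball] by blast
  have "z \<in> S" if "norm z < 1 + e" for z
  proof (cases "norm z \<le> 1")
    case True
    thus ?thesis using \<open>cball 0 1 \<subseteq> S\<close> by auto
  next
    case False
    have "z \<noteq> 0"
    proof
      assume "z = 0"
      thus False using False by simp
    qed
    have "sgn z - z = (1 - norm z) *\<^sub>R sgn z" using \<open>z \<noteq> 0\<close> by (simp add: sgn_div_norm algebra_simps)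
    hence "dist (sgn z) z = \<bar>1 - norm z\<bar>" using \<open>z \<noteq> 0\<close> unfolding dist_norm by (simp add: norm_sgn)
    hence "dist (sgn z) z < e" using that False by simp
    moreover have "sgn z \<in> cball 0 1" using \<open>z \<noteq> 0\<close> by (simp add: norm_sgn)
    ultimately show ?thesis using e(2) by (meson UN_I mem_ball subsetD)
  qed
  thus ?thesis using e(1) unfolding S_def by (intro exI[of _ "1 + e"]) auto
qed

definition rad :: real where "rad = (SOME R. R > 1 \<and> (\<forall>z\<in>ball 0 R. z \<in> ball 0 2 \<and> Re (U z) > 0))"

lemma rad_gt_1: "rad > 1" and rad_le: "z \<in> ball 0 rad \<Longrightarrow> z \<in> ball 0 2" and Re_U_pos: "z \<in> ball 0 rad \<Longrightarrow> Re (U z) > 0"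
  using someI_ex[OF rad_ex] unfolding rad_def[symmetric] by blast+

text \<open>Equivalently \<open>\<zeta> = B / U\<close>: it vanishes at 0 and has modulus less than 1 on the
  circle. If the moments of \<open>w\<close> of orders 1 to \<open>n - 1\<close> vanish, then
  \<open>\<zeta>\<close> vanishes at 0 to order \<open>n\<close>.\<close>

definition \<zeta> :: "complex \<Rightarrow> complex" where "\<zeta> z = 1 - of_real A / U z"
definition E :: real where "E = Re (dirichlet_form F F)"
definition lam :: "complex \<Rightarrow> real" where "lam z = - ln (1 - (norm (\<zeta> z))\<^sup>2)"

lemma A_pos: "A > 0" using A_ge_1 by simp

lemma U_nonzero: "z \<in> ball 0 rad \<Longrightarrow> U z \<noteq> 0"
  using Re_U_pos[of z] by auto

lemma circle_in_rad: "norm z = 1 \<Longrightarrow> z \<in> ball 0 rad"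
  using rad_gt_1 by simp

lemma U_holo: "U holomorphic_on ball 0 rad"
  unfolding U_def using holomorphic_on_subset[OF B_holo] rad_le by (intro holomorphic_intros) blast

lemma \<zeta>_holo: "\<zeta> holomorphic_on ball 0 rad"
  unfolding \<zeta>_def using U_nonzero by (intro holomorphic_intros U_holo) auto

lemma \<zeta>_pow_holo: "(\<lambda>z. \<zeta> z ^ l) holomorphic_on ball 0 rad"
  by (intro holomorphic_intros \<zeta>_holo)

lemma U_0: "U 0 = of_real A" by (simp add: U_def B_0)
lemma \<zeta>_0: "\<zeta> 0 = 0" using A_pos by (simp add: \<zeta>_def U_0)

lemma U_cont: "continuous_on (sphere 0 1) U"
  and \<zeta>_cont: "continuous_on (sphere 0 1) \<zeta>"
  using circle_continuous_holomorphic[OF _ rad_gt_1] U_holo \<zeta>_holo by blast+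

lemma norm_U_ge: "norm z = 1 \<Longrightarrow> norm (U z) \<ge> A / 2"
  using Re_U_ge[of z] complex_Re_le_cmod[of "U z"] by simp

text \<open>The identity \<open>|A + B|\<^sup>2 - |B|\<^sup>2 = A (A + 2 Re B)\<close>, whose right-hand
  side is \<open>A w\<close> on the circle. Since \<open>A / U = 1 - \<zeta>\<close>, it says that
  \<open>w = A (1 - |\<zeta>|\<^sup>2) / |1 - \<zeta>|\<^sup>2\<close>, a Poisson kernel evaluated
  at \<open>\<zeta>\<close>.\<close>

lemma w_eq_\<zeta>:
  assumes z: "norm z = 1"
  shows "w z = (1 - (norm (\<zeta> z))\<^sup>2) * (norm (U z))\<^sup>2 / A"
proof -
  have "(norm (U z))\<^sup>2 - (norm (B z))\<^sup>2 = A * (A + 2 * Re (B z))"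
    unfolding U_def cmod_power2 by (simp add: power2_eq_square algebra_simps)
  moreover have "norm (B z) = norm (\<zeta> z) * norm (U z)"
  proof -
    have "B z = \<zeta> z * U z" using U_nonzero[OF circle_in_rad[OF z]] by (simp add: \<zeta>_def U_def field_simps)
    thus ?thesis by (simp add: norm_mult)
  qed
  ultimately show ?thesis using w_eq_B[OF z] A_pos by (simp add: power_mult_distrib field_simps)
qed

lemma norm_\<zeta>_lt_1:
  assumes z: "norm z = 1"
  shows "norm (\<zeta> z) < 1"
proof -
  have "(1 - (norm (\<zeta> z))\<^sup>2) * ((norm (U z))\<^sup>2 / A) > 0" using w_pos[of z] w_eq_\<zeta>[OF z] by simp
  moreover have "(norm (U z))\<^sup>2 / A \<ge> 0" using A_pos by simp
  ultimately have "1 - (norm (\<zeta> z))\<^sup>2 > 0" unfolding zero_less_mult_iff by linarith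
  hence "(norm (\<zeta> z))\<^sup>2 < 1\<^sup>2" by simp
  thus ?thesis by (rule power_less_imp_less_base) simp
qed

lemma norm_\<zeta>_sq_lt_1: "norm z = 1 \<Longrightarrow> (norm (\<zeta> z))\<^sup>2 < 1"
  using norm_\<zeta>_lt_1[of z] by (simp add: power_less_one_iff)

lemma lam_cont: "continuous_on (sphere 0 1) lam"
  unfolding lam_def[abs_def] using norm_\<zeta>_sq_lt_1 by (intro continuous_intros \<zeta>_cont) force

lemma log_cont: "continuous_on (sphere 0 1) (\<lambda>z. ln (1 - (norm (\<zeta> z))\<^sup>2))"
  using continuous_on_minus[OF lam_cont] by (simp add: lam_def)

lemma lam_eq:
  assumes z: "norm z = 1"
  shows "lam z = - 2 * Re (F z) - ln A + 2 * ln (norm (U z))"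
proof -
  have "U z \<noteq> 0" using U_nonzero[OF circle_in_rad[OF z]] .
  have "2 * Re (F z) = ln (w z)" by (simp add: w_eq_exp)
  also have "\<dots> = ln (1 - (norm (\<zeta> z))\<^sup>2) + 2 * ln (norm (U z)) - ln A"
    unfolding w_eq_\<zeta>[OF z] using norm_\<zeta>_sq_lt_1[OF z] A_pos \<open>U z \<noteq> 0\<close>
    by (simp add: ln_div ln_mult ln_realpow)
  finally show ?thesis by (simp add: lam_def)
qed

text \<open>This is \<open>Ln (1 - \<zeta>)\<close>, defined through \<open>U\<close> because \<open>Re U >
  0\<close> keeps the logarithm on its principal branch.\<close>

definition L :: "complex \<Rightarrow> complex" where "L z = - Ln (U z / of_real A)"

lemma Re_UA: "z \<in> ball 0 rad \<Longrightarrow> Re (U z / of_real A) > 0"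
  using Re_U_pos A_pos by simp

lemma L_holo: "L holomorphic_on ball 0 rad"
proof -
  have "U z / of_real A \<notin> \<real>\<^sub>\<le>\<^sub>0" if "z \<in> ball 0 rad" for z
    using Re_UA[OF that] by (metis complex_nonpos_Reals_iff not_le)
  thus ?thesis unfolding L_def using A_pos by (intro holomorphic_intros U_holo) auto
qed

lemma L_0: "L 0 = 0" using A_pos by (simp add: L_def U_0)

lemma L_cont: "continuous_on (sphere 0 1) L"
  by (rule circle_continuous_holomorphic[OF L_holo rad_gt_1])

lemma exp_L: "z \<in> ball 0 rad \<Longrightarrow> exp (L z) = 1 - \<zeta> z"
  unfolding L_def \<zeta>_def using U_nonzero[of z] A_pos by (simp add: exp_minus)

lemma L_eq_Ln: "z \<in> ball 0 rad \<Longrightarrow> L z = Ln (1 - \<zeta> z)"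
proof -
  assume z: "z \<in> ball 0 rad"
  have "U z / of_real A \<notin> \<real>\<^sub>\<le>\<^sub>0" using Re_UA[OF z] by (auto simp: complex_nonpos_Reals_iff)
  hence "Ln (inverse (U z / of_real A)) = - Ln (U z / of_real A)" by (rule Ln_inverse)
  thus ?thesis by (simp add: L_def \<zeta>_def)
qed

lemma Re_L: "z \<in> ball 0 rad \<Longrightarrow> Re (L z) = ln A - ln (norm (U z))"
  unfolding L_def using U_nonzero[of z] A_pos by (simp add: norm_divide ln_div)

lemma lam_eq_L: "norm z = 1 \<Longrightarrow> 2 * Re (F z + L z) = ln A - lam z"
  using lam_eq[of z] Re_L[OF circle_in_rad, of z] by simp

text \<open>The harmonic function \<open>2 Re (F + L)\<close> vanishes at 0 and equals \<open>ln A -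
  lam\<close> on the circle. So the quantity to be bounded, \<open>ln A\<close>, is a mean of
  \<open>- ln (1 - |\<zeta>|\<^sup>2)\<close>.\<close>

lemma mean_lam: "circle_mean lam = ln A"
proof -
  have "circle_mean (\<lambda>z. F z + L z) = 0"
    by (subst circle_mean_holomorphic[OF _ rad_gt_1])
       (auto intro!: holomorphic_intros F_ball L_holo simp: F0 L_0)
  hence "circle_mean (\<lambda>z. Re (F z + L z)) = 0"
    by (subst circle_mean_Re) (auto intro!: circle_integrable_continuous continuous_intros F_cont L_cont)
  hence "0 = circle_mean (\<lambda>z. 2 * Re (F z + L z))" by (simp only: circle_mean_mult_left)
  also have "\<dots> = circle_mean (\<lambda>z. ln A - lam z)" by (rule circle_mean_cong) (rule lam_eq_L)
  also have "\<dots> = ln A - circle_mean lam"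
    by (subst circle_mean_diff) (auto intro!: circle_integrable_continuous lam_cont)
  finally show ?thesis by simp
qed

text \<open>Put \<open>K = F + L\<close>, so that the energy of \<open>F = K - L\<close> is that of
  \<open>K\<close>, plus that of \<open>L\<close>, minus \<open>2 Re \<langle>L,
  K\<rangle>\<close>. On the circle \<open>2 Re K = ln A + ln (1 - |\<zeta>|\<^sup>2)\<close>,
  which evaluates \<open>\<langle>L, K\<rangle>\<close>, and the expansion of the energy of
  \<open>L\<close> shows that everything but the energy of \<open>K\<close> adds up to the
  diagonal series. Dropping the energy of \<open>K\<close> leaves the bound.\<close>

lemma dirichlet_sum_le_E:
  "(\<Sum>l<N. Re (dirichlet_form (\<lambda>z. \<zeta> z ^ Suc l) (\<lambda>z. \<zeta> z ^ Suc l)) / (real (Suc l))\<^sup>2) \<le> E"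
proof -
  define S where "S = Re (dirichlet_form L L) - 2 * Re (circle_mean (\<lambda>z. z * deriv L z * of_real (ln (1 - (norm (\<zeta> z))\<^sup>2))))"
  have sums: "(\<lambda>l. Re (dirichlet_form (\<lambda>z. \<zeta> z ^ Suc l) (\<lambda>z. \<zeta> z ^ Suc l)) / (real (Suc l))\<^sup>2) sums S"
    unfolding S_def
    by (rule log_energy_expansion[OF \<zeta>_holo L_holo rad_gt_1 norm_\<zeta>_lt_1 exp_L L_eq_Ln[OF circle_in_rad]])
  define K where "K z = F z + L z" for z
  have K_holo: "K holomorphic_on ball 0 rad" unfolding K_def by (intro holomorphic_intros F_ball L_holo)
  have K_cont: "continuous_on (sphere 0 1) K" unfolding K_def by (intro continuous_intros F_cont L_cont)
  have dL_holo: "(\<lambda>z. z * deriv L z) holomorphic_on ball 0 rad" by (intro holomorphic_intros L_holo) auto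
  have dL_cont: "continuous_on (sphere 0 1) (\<lambda>z. z * deriv L z)"
    by (rule circle_continuous_holomorphic[OF dL_holo rad_gt_1])
  \<comment> \<open>Adding the mean of the holomorphic function \<open>z L' K\<close>, which is its value 0 at the
    origin, replaces \<open>cnj K\<close> by \<open>2 Re K\<close>.\<close>
  have "dirichlet_form L K = circle_mean (\<lambda>z. z * deriv L z * cnj (K z)) + circle_mean (\<lambda>z. z * deriv L z * K z)"
  proof -
    have "circle_mean (\<lambda>z. z * deriv L z * K z) = 0"
      by (subst circle_mean_holomorphic[OF _ rad_gt_1]) (auto intro!: holomorphic_on_mult dL_holo K_holo)
    thus ?thesis by (simp add: dirichlet_form_def)
  qed
  also have "\<dots> = circle_mean (\<lambda>z. z * deriv L z * cnj (K z) + z * deriv L z * K z)"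
    by (rule circle_mean_add[symmetric]; intro circle_integrable_continuous continuous_on_mult[OF dL_cont] continuous_on_cnj K_cont)
  also have "\<dots> = circle_mean (\<lambda>z. z * deriv L z * of_real (ln A) + z * deriv L z * of_real (ln (1 - (norm (\<zeta> z))\<^sup>2)))"
  proof (rule circle_mean_cong)
    fix z :: complex assume z: "norm z = 1"
    have "cnj (K z) + K z = of_real (2 * Re (K z))" by (simp add: complex_add_cnj add.commute)
    also have "2 * Re (K z) = ln A + ln (1 - (norm (\<zeta> z))\<^sup>2)" using lam_eq_L[OF z] by (simp only: K_def lam_def)
    finally have "cnj (K z) + K z = of_real (ln A) + of_real (ln (1 - (norm (\<zeta> z))\<^sup>2))" by simp
    thus "z * deriv L z * cnj (K z) + z * deriv L z * K z
       = z * deriv L z * of_real (ln A) + z * deriv L z * of_real (ln (1 - (norm (\<zeta> z))\<^sup>2))"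
      by (metis distrib_left)
  qed
  also have "\<dots> = circle_mean (\<lambda>z. z * deriv L z * of_real (ln A)) + circle_mean (\<lambda>z. z * deriv L z * of_real (ln (1 - (norm (\<zeta> z))\<^sup>2)))"
    by (intro circle_mean_add circle_integrable_continuous continuous_on_mult[OF dL_cont] continuous_on_const
        continuous_on_of_real log_cont)
  also have "circle_mean (\<lambda>z. z * deriv L z * of_real (ln A)) = 0"
    unfolding circle_mean_mult_right using circle_mean_holomorphic[OF dL_holo rad_gt_1] by simp
  finally have LK: "dirichlet_form L K = circle_mean (\<lambda>z. z * deriv L z * of_real (ln (1 - (norm (\<zeta> z))\<^sup>2)))" by simp
  have "E = Re (dirichlet_form (\<lambda>z. K z - L z) (\<lambda>z. K z - L z))" by (simp add: E_def K_def)
  also have "\<dots> = Re (dirichlet_form K K) + S"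
    unfolding dirichlet_form_diff_self[OF K_holo L_holo rad_gt_1] S_def LK by simp
  finally have "S \<le> E" using dirichlet_form_nonneg[OF K_holo rad_gt_1] by simp
  moreover have "(\<Sum>l<N. Re (dirichlet_form (\<lambda>z. \<zeta> z ^ Suc l) (\<lambda>z. \<zeta> z ^ Suc l)) / (real (Suc l))\<^sup>2) \<le> S"
    unfolding sums_unique[OF sums]
    by (rule sum_le_suminf[OF sums_summable[OF sums]])
       (auto intro!: divide_nonneg_nonneg dirichlet_form_nonneg[OF \<zeta>_pow_holo rad_gt_1] simp del: power_Suc of_nat_Suc)
  ultimately show ?thesis by simp
qed

text \<open>The mean of \<open>F\<^sup>2\<close> is \<open>(F 0)\<^sup>2 = 0\<close>, and
  \<open>|F\<^sub>k|\<^sup>2 \<le> k |F\<^sub>k|\<^sup>2\<close> because the coefficient of index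
  0 vanishes.\<close>

lemma mean_F_sq: "circle_mean (\<lambda>z. (2 * Re (F z))\<^sup>2) \<le> 2 * E"
proof -
  have "circle_mean (\<lambda>z. (2 * Re (F z))\<^sup>2) = circle_mean (\<lambda>z. 2 * (norm (F z))\<^sup>2 + 2 * Re (F z * F z))"
    by (rule circle_mean_cong) (unfold cmod_power2, simp add: power2_eq_square)
  also have "\<dots> = circle_mean (\<lambda>z. 2 * (norm (F z))\<^sup>2) + circle_mean (\<lambda>z. 2 * Re (F z * F z))"
    by (intro circle_mean_add circle_integrable_continuous continuous_intros F_cont)
  also have "circle_mean (\<lambda>z. 2 * Re (F z * F z)) = 2 * Re (circle_mean (\<lambda>z. F z * F z))"
    unfolding circle_mean_mult_left by (subst circle_mean_Re) (auto intro!: circle_integrable_continuous continuous_intros F_cont)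
  also have "circle_mean (\<lambda>z. F z * F z) = 0"
    by (subst circle_mean_holomorphic[where R = 2]) (auto intro!: holomorphic_intros F_ball simp: F0)
  also have "circle_mean (\<lambda>z. 2 * (norm (F z))\<^sup>2) = 2 * circle_mean (\<lambda>z. (norm (F z))\<^sup>2)"
    by (rule circle_mean_mult_left)
  also have "circle_mean (\<lambda>z. (norm (F z))\<^sup>2) \<le> E" unfolding E_def
  proof (rule sums_le[OF _ parseval_norm[OF F_ball[of 2]] dirichlet_form_self_sums[OF F_ball[of 2]]])
    show "(norm (fourier_coeff F k))\<^sup>2 \<le> real k * (norm (fourier_coeff F k))\<^sup>2" for k
    proof (cases "k = 0")
      case False
      hence "1 * (norm (fourier_coeff F k))\<^sup>2 \<le> real k * (norm (fourier_coeff F k))\<^sup>2" by (intro mult_right_mono) auto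
      thus ?thesis by simp
    qed (simp add: fourier_coeff_0 mean_F)
  qed auto
  finally show ?thesis by simp
qed

lemma A_sq_le: "A\<^sup>2 \<le> circle_mean (\<lambda>z. (w z)\<^sup>2)"
proof -
  have "0 \<le> circle_mean (\<lambda>z. (w z - A)\<^sup>2)" by (rule circle_mean_nonneg) simp
  also have "\<dots> = circle_mean (\<lambda>z. (w z)\<^sup>2 - (2 * A * w z - A\<^sup>2))"
    by (rule circle_mean_cong) (simp add: power2_eq_square algebra_simps)
  also have "\<dots> = circle_mean (\<lambda>z. (w z)\<^sup>2) - (circle_mean (\<lambda>z. 2 * A * w z) - circle_mean (\<lambda>z. A\<^sup>2))"
    by (subst circle_mean_diff; (intro circle_integrable_continuous continuous_intros w_cont)?)+ (rule refl)
  also have "\<dots> = circle_mean (\<lambda>z. (w z)\<^sup>2) - A\<^sup>2"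
    by (simp add: circle_mean_mult_left A_def[symmetric] power2_eq_square)
  finally show ?thesis by simp
qed

text \<open>On the circle \<open>Re U = (A + w) / 2\<close>, and the mean of \<open>U\<^sup>2\<close> is
  \<open>A\<^sup>2\<close>; this expresses the mean of \<open>|U|\<^sup>2\<close> through
  \<open>w\<close>.\<close>

lemma mean_U_sq: "circle_mean (\<lambda>z. (norm (U z))\<^sup>2) \<le> circle_mean (\<lambda>z. (w z)\<^sup>2)"
proof -
  have "circle_mean (\<lambda>z. (norm (U z))\<^sup>2) = circle_mean (\<lambda>z. A\<^sup>2 / 2 + A * w z + 1 / 2 * (w z)\<^sup>2 - Re (U z * U z))"
  proof (rule circle_mean_cong)
    fix z :: complex assume z: "norm z = 1"
    have wz: "w z = 2 * Re (U z) - A" using w_eq_B[OF z] by (simp add: U_def)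
    show "(norm (U z))\<^sup>2 = A\<^sup>2 / 2 + A * w z + 1 / 2 * (w z)\<^sup>2 - Re (U z * U z)"
      unfolding cmod_power2 wz by (simp add: power2_eq_square field_simps)
  qed
  also have "\<dots> = A\<^sup>2 / 2 + A * A + 1 / 2 * circle_mean (\<lambda>z. (w z)\<^sup>2) - circle_mean (\<lambda>z. Re (U z * U z))"
    by (subst circle_mean_diff circle_mean_add; (intro circle_integrable_continuous continuous_intros w_cont U_cont)?)+
       (simp only: circle_mean_mult_left A_def[symmetric] circle_mean_const)
  also have "circle_mean (\<lambda>z. Re (U z * U z)) = Re (circle_mean (\<lambda>z. U z * U z))"
    by (intro circle_mean_Re circle_integrable_continuous continuous_intros U_cont)
  also have "circle_mean (\<lambda>z. U z * U z) = of_real A * of_real A"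
    by (subst circle_mean_holomorphic[OF _ rad_gt_1]) (auto intro!: holomorphic_intros U_holo simp: U_0)
  finally show ?thesis using A_sq_le by (simp add: power2_eq_square)
qed

text \<open>A bound in terms of the energy and the second moment of \<open>w\<close> alone. It makes the
  tails of the logarithmic series small uniformly along a sequence of exponents. The constants
  come from \<open>(x + y + t)\<^sup>2 \<le> 3 (x\<^sup>2 + y\<^sup>2 + t\<^sup>2)\<close> applied
  to the three terms of \<open>lam\<close>.\<close>

lemma mean_lam_sq: "circle_mean (\<lambda>z. (lam z)\<^sup>2) \<le> 6 * E + 15 * circle_mean (\<lambda>z. (w z)\<^sup>2) + 12"
proof -
  have "circle_mean (\<lambda>z. (lam z)\<^sup>2) \<le> circle_mean (\<lambda>z. 3 * (2 * Re (F z))\<^sup>2 + (3 * A\<^sup>2 + 12 * (1 + (norm (U z))\<^sup>2)))"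
  proof (rule circle_mean_mono)
    fix z :: complex assume z: "norm z = 1"
    have sq: "(x + y + t)\<^sup>2 \<le> 3 * x\<^sup>2 + 3 * y\<^sup>2 + 3 * t\<^sup>2" for x y t :: real
      using sum_squares_ge_zero[of "x - y" "y - t"] zero_le_power2[of "x - t"] by (simp add: power2_eq_square algebra_simps)
    have "(ln A)\<^sup>2 \<le> A\<^sup>2" using A_ge_1 ln_le_minus_one[of A] by (intro power_mono) auto
    moreover have "(ln (norm (U z)))\<^sup>2 \<le> 1 + (norm (U z))\<^sup>2"
    proof (cases "norm (U z) \<ge> 1")
      case True
      hence "norm (U z) > 0" by linarith
      from ln_le_minus_one[OF this] have "ln (norm (U z)) \<le> norm (U z)" by linarith
      hence "(ln (norm (U z)))\<^sup>2 \<le> (norm (U z))\<^sup>2" using True by (intro power_mono) auto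
      thus ?thesis by simp
    next
      case False
      have U2: "norm (U z) \<ge> 1 / 2" using norm_U_ge[OF z] A_ge_1 by simp
      hence U0: "norm (U z) > 0" by linarith
      have "- ln (norm (U z)) = ln (1 / norm (U z))" using U2 by (subst ln_div) auto
      also have "\<dots> \<le> 1 / norm (U z) - 1" using U2 by (intro ln_le_minus_one) (auto intro!: divide_pos_pos)
      also have "1 / norm (U z) \<le> 1 / (1 / 2)" using U2 by (intro divide_left_mono mult_pos_pos U0) auto
      finally have "- ln (norm (U z)) \<le> 1" by simp
      moreover have "ln (norm (U z)) \<le> 0" using False U0 by (intro ln_le_zero_iff[THEN iffD2]) auto
      ultimately have "\<bar>ln (norm (U z))\<bar> \<le> 1" by linarith
      hence "(ln (norm (U z)))\<^sup>2 \<le> 1" by (simp add: abs_square_le_1)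
      thus ?thesis by (simp add: add_increasing2)
    qed
    moreover have "(lam z)\<^sup>2 \<le> 3 * (2 * Re (F z))\<^sup>2 + 3 * (ln A)\<^sup>2 + 3 * (2 * ln (norm (U z)))\<^sup>2"
      using sq[of "- 2 * Re (F z)" "- ln A" "2 * ln (norm (U z))"] unfolding lam_eq[OF z] by simp
    ultimately show "(lam z)\<^sup>2 \<le> 3 * (2 * Re (F z))\<^sup>2 + (3 * A\<^sup>2 + 12 * (1 + (norm (U z))\<^sup>2))"
      by (simp add: power_mult_distrib)
  qed (intro circle_integrable_continuous continuous_intros lam_cont F_cont U_cont)+
  also have "\<dots> = 3 * circle_mean (\<lambda>z. (2 * Re (F z))\<^sup>2) + (3 * A\<^sup>2 + 12 * (1 + circle_mean (\<lambda>z. (norm (U z))\<^sup>2)))"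
    by (subst circle_mean_add circle_mean_mult_left circle_mean_const;
        (intro circle_integrable_continuous continuous_intros F_cont U_cont)?)+ (rule refl)
  finally show ?thesis using mean_F_sq A_sq_le mean_U_sq by simp
qed

end

section \<open>Energy bounds under moment conditions\<close>

text \<open>Replaces \<open>- ln (1 - x)\<close> by a partial sum of its series with an error that is
  controlled even near \<open>x = 1\<close>: where the logarithm exceeds \<open>1 /
  \<epsilon>\<close> it is dominated by \<open>\<epsilon>\<close> times its square, and elsewhere
  \<open>x\<close> stays below a fixed \<open>\<delta> < 1\<close>, so that the series converges
  uniformly.\<close>

lemma log_series_tail:
  fixes \<epsilon> :: real
  assumes "\<epsilon> > 0"
  obtains \<Lambda> where "\<Lambda> \<ge> 1" "\<And>x. 0 \<le> x \<Longrightarrow> x < 1 \<Longrightarrow>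
     - ln (1 - x) \<le> (\<Sum>l<\<Lambda>. x ^ Suc l / real (Suc l)) + \<epsilon> * (1 + (ln (1 - x))\<^sup>2)"
proof -
  define T where "T = 1 / \<epsilon>"
  define \<delta> where "\<delta> = 1 - exp (- T)"
  have T: "T > 0" using assms by (simp add: T_def)
  have \<delta>: "0 \<le> \<delta>" "\<delta> < 1" using T by (auto simp: \<delta>_def)
  have "(\<lambda>\<Lambda>. \<delta> ^ \<Lambda> * T) \<longlonglongrightarrow> 0 * T" using \<delta> by (intro tendsto_intros LIMSEQ_power_zero) auto
  hence "eventually (\<lambda>\<Lambda>. \<delta> ^ \<Lambda> * T < \<epsilon>) sequentially" using assms by (auto dest: order_tendstoD)
  with eventually_ge_at_top[of 1] have "eventually (\<lambda>\<Lambda>. 1 \<le> \<Lambda> \<and> \<delta> ^ \<Lambda> * T < \<epsilon>) sequentially"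
    by eventually_elim auto
  then obtain \<Lambda> where \<Lambda>: "\<Lambda> \<ge> 1" "\<delta> ^ \<Lambda> * T < \<epsilon>" by (auto simp: eventually_sequentially)
  have "- ln (1 - x) \<le> (\<Sum>l<\<Lambda>. x ^ Suc l / real (Suc l)) + \<epsilon> * (1 + (ln (1 - x))\<^sup>2)" if x: "0 \<le> x" "x < 1" for x :: real
  proof -
    define y where "y = - ln (1 - x)"
    have y0: "y \<ge> 0" using x by (simp add: y_def)
    have sums: "(\<lambda>l. x ^ Suc l / real (Suc l)) sums y"
    proof -
      have "(\<lambda>n. x ^ n / real n) sums y"
        using sums_minus[OF ln_series'[of "- x"]] x
        by (simp add: y_def power_minus_mult sums_def field_simps power_minus[of x] power_add flip: power_mult_distrib)
      thus ?thesis by (subst sums_Suc_iff) simp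
    qed
    have pos: "(\<Sum>l<\<Lambda>. x ^ Suc l / real (Suc l)) \<ge> 0" using x by (intro sum_nonneg) auto
    show ?thesis
    proof (cases "y > T")
      case True
      have "y = \<epsilon> * (T * y)" using assms by (simp add: T_def)
      also have "\<dots> \<le> \<epsilon> * (y * y)" using True y0 assms by (intro mult_left_mono mult_right_mono) auto
      also have "\<dots> \<le> \<epsilon> * (1 + (ln (1 - x))\<^sup>2)" using assms by (simp add: y_def power2_eq_square)
      finally show ?thesis using pos by (simp add: y_def)
    next
      case False
      have "x \<le> \<delta>"
      proof -
        have "ln (1 - x) \<ge> - T" using False by (simp add: y_def)
        hence "exp (- T) \<le> 1 - x" using x by (simp add: ln_ge_iff)
        thus ?thesis by (simp add: \<delta>_def)
      qed
      have sm: "summable (\<lambda>l. x ^ Suc l / real (Suc l))" using sums by (simp add: sums_iff)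
      have "y = (\<Sum>l. x ^ Suc (l + \<Lambda>) / real (Suc (l + \<Lambda>))) + (\<Sum>l<\<Lambda>. x ^ Suc l / real (Suc l))"
        using suminf_split_initial_segment[OF sm, of \<Lambda>] sums_unique[OF sums] by simp
      moreover have "(\<Sum>l. x ^ Suc (l + \<Lambda>) / real (Suc (l + \<Lambda>))) \<le> (\<Sum>l. x ^ \<Lambda> * (x ^ Suc l / real (Suc l)))"
      proof (rule suminf_le)
        show "summable (\<lambda>l. x ^ Suc (l + \<Lambda>) / real (Suc (l + \<Lambda>)))"
          using summable_ignore_initial_segment[OF sm, of \<Lambda>] by simp
        show "summable (\<lambda>l. x ^ \<Lambda> * (x ^ Suc l / real (Suc l)))" by (rule summable_mult[OF sm])
        fix l
        have "x ^ Suc (l + \<Lambda>) / real (Suc (l + \<Lambda>)) \<le> x ^ Suc (l + \<Lambda>) / real (Suc l)"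
          using x by (intro divide_left_mono) auto
        also have "\<dots> = x ^ \<Lambda> * (x ^ Suc l / real (Suc l))" by (simp add: power_add)
        finally show "x ^ Suc (l + \<Lambda>) / real (Suc (l + \<Lambda>)) \<le> x ^ \<Lambda> * (x ^ Suc l / real (Suc l))" .
      qed
      moreover have "(\<Sum>l. x ^ \<Lambda> * (x ^ Suc l / real (Suc l))) = x ^ \<Lambda> * y"
        by (subst suminf_mult[OF sm]) (simp add: sums_unique[OF sums])
      moreover have "x ^ \<Lambda> * y \<le> \<delta> ^ \<Lambda> * T" using \<open>x \<le> \<delta>\<close> x False y0 \<delta> by (intro mult_mono power_mono) auto
      moreover have "\<epsilon> \<le> \<epsilon> * (1 + (ln (1 - x))\<^sup>2)" using assms by simp
      ultimately show ?thesis using \<Lambda>(2) unfolding y_def[symmetric] by linarith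
    qed
  qed
  thus ?thesis using that \<Lambda>(1) by blast
qed

context entire_exponent
begin

text \<open>The contribution of the coefficients of \<open>\<zeta>\<^sup>l\<close> of index below \<open>n
  l\<close>. They vanish if \<open>\<zeta>\<close> is divisible by \<open>z\<^sup>n\<close>, which
  holds if the moments of \<open>w\<close> of orders 1 to \<open>n - 1\<close> are zero; for
  approximations they only tend to 0.\<close>

definition low_part :: "nat \<Rightarrow> nat \<Rightarrow> real" where
  "low_part n \<Lambda> = (\<Sum>l<\<Lambda>. real n / real (Suc l) * (\<Sum>k<n * Suc l. (norm (fourier_coeff (\<lambda>z. \<zeta> z ^ Suc l) k))\<^sup>2))"

text \<open>The squared norm of the Taylor coefficients of \<open>\<zeta>\<close> of index above
  \<open>n\<close>: the gain that vanishes in the case of equality.\<close>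

definition high_part :: "nat \<Rightarrow> real" where
  "high_part n = circle_mean (\<lambda>z. (norm (\<zeta> z))\<^sup>2) - (\<Sum>k\<le>n. (norm (fourier_coeff \<zeta> k))\<^sup>2)"

lemma bessel_\<zeta>: "(\<Sum>k\<le>N. (norm (fourier_coeff (\<lambda>z. \<zeta> z ^ l) k))\<^sup>2) \<le> circle_mean (\<lambda>z. (norm (\<zeta> z ^ l))\<^sup>2)"
  using sum_le_suminf[OF sums_summable[OF parseval_norm[OF \<zeta>_pow_holo rad_gt_1]], of "{..N}"]
  by (simp add: sums_unique[OF parseval_norm[OF \<zeta>_pow_holo rad_gt_1], symmetric])

lemma high_part_nonneg: "high_part n \<ge> 0"
  using bessel_\<zeta>[where N = n and l = 1] by (simp add: high_part_def)

text \<open>Every \<open>\<zeta>\<^sup>l\<close> has, up to the low part, only coefficients of index at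
  least \<open>n l\<close>, so that its energy is at least \<open>n l\<close> times the mean of
  \<open>|\<zeta>|\<^sup>2\<^sup>l\<close>. Division by \<open>l\<^sup>2\<close> and summation
  produce \<open>n\<close> times the logarithmic series of \<open>|\<zeta>|\<^sup>2\<close>; the
  gain is kept for \<open>l = 1\<close> only.\<close>

lemma energy_ge:
  assumes "\<Lambda> \<ge> 1"
  shows "E \<ge> real n * (\<Sum>l<\<Lambda>. circle_mean (\<lambda>z. ((norm (\<zeta> z))\<^sup>2) ^ Suc l) / real (Suc l)) - low_part n \<Lambda> + high_part n"
proof -
  define D where "D l = Re (dirichlet_form (\<lambda>z. \<zeta> z ^ Suc l) (\<lambda>z. \<zeta> z ^ Suc l)) / (real (Suc l))\<^sup>2" for l
  define h where "h l = (if l = (0::nat) then high_part n else 0)" for l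
  have "real n * (circle_mean (\<lambda>z. ((norm (\<zeta> z))\<^sup>2) ^ Suc l) / real (Suc l))
     - real n / real (Suc l) * (\<Sum>k<n * Suc l. (norm (fourier_coeff (\<lambda>z. \<zeta> z ^ Suc l) k))\<^sup>2) + h l \<le> D l" for l
  proof -
    define m where "m = circle_mean (\<lambda>z. (norm (\<zeta> z ^ Suc l))\<^sup>2)"
    define s where "s = (\<Sum>k<n * Suc l. (norm (fourier_coeff (\<lambda>z. \<zeta> z ^ Suc l) k))\<^sup>2)"
    define r where "r = m - (\<Sum>k\<le>n * Suc l. (norm (fourier_coeff (\<lambda>z. \<zeta> z ^ Suc l) k))\<^sup>2)"
    have m: "circle_mean (\<lambda>z. ((norm (\<zeta> z))\<^sup>2) ^ Suc l) = m"
      unfolding m_def by (simp only: norm_power power_mult[symmetric] mult.commute)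
    have r: "h l \<le> r / (real (Suc l))\<^sup>2"
    proof (cases "l = 0")
      case False
      have "r \<ge> 0" unfolding r_def m_def using bessel_\<zeta>[where N = "n * Suc l" and l = "Suc l"] by (simp del: mult_Suc_right power_Suc)
      thus ?thesis using False by (simp add: h_def)
    qed (simp add: h_def r_def m_def high_part_def)
    have "real (n * Suc l) * m - real (n * Suc l) * s + r \<le> Re (dirichlet_form (\<lambda>z. \<zeta> z ^ Suc l) (\<lambda>z. \<zeta> z ^ Suc l))"
      unfolding m_def s_def r_def using dirichlet_form_ge[OF \<zeta>_pow_holo[of "Suc l"] rad_gt_1, of "n * Suc l"] by simp
    hence "(real (n * Suc l) * m - real (n * Suc l) * s + r) / (real (Suc l))\<^sup>2 \<le> D l"
      unfolding D_def by (intro divide_right_mono) auto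
    moreover have "(real (n * Suc l) * m - real (n * Suc l) * s + r) / (real (Suc l))\<^sup>2
        = real n * (m / real (Suc l)) - real n / real (Suc l) * s + r / (real (Suc l))\<^sup>2"
      unfolding of_nat_mult by (simp add: field_simps power2_eq_square del: of_nat_Suc)
    ultimately show ?thesis using r unfolding m s_def by linarith
  qed
  hence "(\<Sum>l<\<Lambda>. real n * (circle_mean (\<lambda>z. ((norm (\<zeta> z))\<^sup>2) ^ Suc l) / real (Suc l))
     - real n / real (Suc l) * (\<Sum>k<n * Suc l. (norm (fourier_coeff (\<lambda>z. \<zeta> z ^ Suc l) k))\<^sup>2) + h l) \<le> (\<Sum>l<\<Lambda>. D l)"
    by (intro sum_mono)
  also have "\<dots> \<le> E" unfolding D_def by (rule dirichlet_sum_le_E)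
  also have "(\<Sum>l<\<Lambda>. real n * (circle_mean (\<lambda>z. ((norm (\<zeta> z))\<^sup>2) ^ Suc l) / real (Suc l))
     - real n / real (Suc l) * (\<Sum>k<n * Suc l. (norm (fourier_coeff (\<lambda>z. \<zeta> z ^ Suc l) k))\<^sup>2) + h l)
    = real n * (\<Sum>l<\<Lambda>. circle_mean (\<lambda>z. ((norm (\<zeta> z))\<^sup>2) ^ Suc l) / real (Suc l)) - low_part n \<Lambda> + sum h {..<\<Lambda>}"
    by (simp only: sum.distrib sum_subtractf sum_distrib_left low_part_def)
  also have "sum h {..<\<Lambda>} = high_part n" using assms by (simp add: h_def)
  finally show ?thesis .
qed

text \<open>The mean of the logarithmic series of \<open>|\<zeta>|\<^sup>2\<close> is \<open>ln A\<close>,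
  and its tail is controlled by the second moment of \<open>lam\<close>.\<close>

lemma energy_ge_log:
  assumes "\<epsilon> > 0" and \<Lambda>: "\<Lambda> \<ge> 1" "\<And>x. 0 \<le> x \<Longrightarrow> x < 1 \<Longrightarrow>
     - ln (1 - x) \<le> (\<Sum>l<\<Lambda>. x ^ Suc l / real (Suc l)) + \<epsilon> * (1 + (ln (1 - x))\<^sup>2)"
  shows "E \<ge> real n * (ln A - \<epsilon> * (1 + (6 * E + 15 * circle_mean (\<lambda>z. (w z)\<^sup>2) + 12))) - low_part n \<Lambda> + high_part n"
proof -
  have c: "continuous_on (sphere 0 1) (\<lambda>z. ((norm (\<zeta> z))\<^sup>2) ^ Suc l * (1 / real (Suc l)))" for l
    by (intro continuous_on_mult continuous_on_power continuous_on_norm \<zeta>_cont continuous_on_const)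
  have "ln A = circle_mean lam" by (rule mean_lam[symmetric])
  also have "\<dots> \<le> circle_mean (\<lambda>z. (\<Sum>l<\<Lambda>. ((norm (\<zeta> z))\<^sup>2) ^ Suc l * (1 / real (Suc l))) + \<epsilon> * (1 + (lam z)\<^sup>2))"
  proof (rule circle_mean_mono)
    fix z :: complex assume z: "norm z = 1"
    show "lam z \<le> (\<Sum>l<\<Lambda>. ((norm (\<zeta> z))\<^sup>2) ^ Suc l * (1 / real (Suc l))) + \<epsilon> * (1 + (lam z)\<^sup>2)"
      using \<Lambda>(2)[of "(norm (\<zeta> z))\<^sup>2"] norm_\<zeta>_sq_lt_1[OF z] unfolding lam_def by (simp del: of_nat_Suc power_Suc)
  qed (intro circle_integrable_continuous continuous_on_add continuous_on_sum c continuous_on_mult continuous_on_const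
        continuous_on_power lam_cont)+
  also have "\<dots> = (\<Sum>l<\<Lambda>. circle_mean (\<lambda>z. ((norm (\<zeta> z))\<^sup>2) ^ Suc l) * (1 / real (Suc l))) + \<epsilon> * (1 + circle_mean (\<lambda>z. (lam z)\<^sup>2))"
  proof -
    have "circle_mean (\<lambda>z. (\<Sum>l<\<Lambda>. ((norm (\<zeta> z))\<^sup>2) ^ Suc l * (1 / real (Suc l))) + \<epsilon> * (1 + (lam z)\<^sup>2))
       = circle_mean (\<lambda>z. (\<Sum>l<\<Lambda>. ((norm (\<zeta> z))\<^sup>2) ^ Suc l * (1 / real (Suc l)))) + circle_mean (\<lambda>z. \<epsilon> * (1 + (lam z)\<^sup>2))"
      by (intro circle_mean_add circle_integrable_continuous continuous_on_add continuous_on_sum c continuous_on_mult continuous_on_const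
        continuous_on_power lam_cont)
    also have "circle_mean (\<lambda>z. \<epsilon> * (1 + (lam z)\<^sup>2)) = \<epsilon> * (1 + circle_mean (\<lambda>z. (lam z)\<^sup>2))"
      unfolding circle_mean_mult_left
      by (subst circle_mean_add; (intro circle_integrable_continuous continuous_on_const continuous_on_power lam_cont)?) simp
    also have "circle_mean (\<lambda>z. (\<Sum>l<\<Lambda>. ((norm (\<zeta> z))\<^sup>2) ^ Suc l * (1 / real (Suc l))))
      = (\<Sum>l<\<Lambda>. circle_mean (\<lambda>z. ((norm (\<zeta> z))\<^sup>2) ^ Suc l) * (1 / real (Suc l)))"
      by (simp only: circle_mean_sum_continuous[OF c] circle_mean_mult_right)
    finally show ?thesis .
  qed
  also have "\<dots> \<le> (\<Sum>l<\<Lambda>. circle_mean (\<lambda>z. ((norm (\<zeta> z))\<^sup>2) ^ Suc l) * (1 / real (Suc l)))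
       + \<epsilon> * (1 + (6 * E + 15 * circle_mean (\<lambda>z. (w z)\<^sup>2) + 12))"
    using mean_lam_sq assms(1) by (intro add_left_mono mult_left_mono) auto
  finally have "ln A - \<epsilon> * (1 + (6 * E + 15 * circle_mean (\<lambda>z. (w z)\<^sup>2) + 12))
     \<le> (\<Sum>l<\<Lambda>. circle_mean (\<lambda>z. ((norm (\<zeta> z))\<^sup>2) ^ Suc l) / real (Suc l))" by simp
  hence "real n * (ln A - \<epsilon> * (1 + (6 * E + 15 * circle_mean (\<lambda>z. (w z)\<^sup>2) + 12)))
     \<le> real n * (\<Sum>l<\<Lambda>. circle_mean (\<lambda>z. ((norm (\<zeta> z))\<^sup>2) ^ Suc l) / real (Suc l))"
    by (rule mult_left_mono) simp
  thus ?thesis using energy_ge[OF \<Lambda>(1), of n] by linarith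
qed

lemma \<zeta>_coeff_le: "norm (fourier_coeff (\<lambda>z. \<zeta> z ^ l) k) \<le> 1"
proof (rule norm_fourier_coeff_le)
  show "norm (\<zeta> z ^ l) \<le> 1" if "norm z = 1" for z
    unfolding norm_power using norm_\<zeta>_lt_1[OF that] by (intro power_le_one) auto
qed (intro continuous_intros \<zeta>_cont)

text \<open>Comparing coefficients in \<open>\<zeta> U = B\<close> expresses the coefficient of
  \<open>\<zeta>\<close> recursively through those of \<open>w\<close>, with the factor \<open>A
  \<ge> 1\<close>.\<close>

lemma \<zeta>_coeff_bound:
  assumes "k \<ge> 1"
  shows "norm (fourier_coeff \<zeta> k) \<le> (\<Sum>i\<in>{1..k}. norm (b i))"
proof -
  have Uc: "fourier_coeff U i = (if i = 0 then of_real A else b i)" for i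
  proof -
    have "fourier_coeff U i = circle_mean (\<lambda>z. of_real A * (z ^ 0 * cnj z ^ i) + B z * cnj z ^ i)"
      unfolding fourier_coeff_def U_def by (simp add: algebra_simps)
    also have "\<dots> = circle_mean (\<lambda>z. of_real A * (z ^ 0 * cnj z ^ i)) + circle_mean (\<lambda>z. B z * cnj z ^ i)"
      by (intro circle_mean_add circle_integrable_continuous continuous_intros B_cont_sphere)
    also have "\<dots> = (if i = 0 then of_real A else 0) + fourier_coeff B i"
      unfolding circle_mean_mult_left circle_mean_powers fourier_coeff_def by simp
    finally show ?thesis by (simp add: B_coeff)
  qed
  have Bsub: "B holomorphic_on ball 0 rad" using holomorphic_on_subset[OF B_holo] rad_le by blast
  have "fourier_coeff B k = fourier_coeff (\<lambda>z. \<zeta> z * U z) k"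
    unfolding fourier_coeff_def
  proof (rule circle_mean_cong)
    fix z :: complex assume "norm z = 1"
    hence "\<zeta> z * U z = B z" using U_nonzero[OF circle_in_rad] by (simp add: \<zeta>_def U_def field_simps)
    thus "B z * cnj z ^ k = \<zeta> z * U z * cnj z ^ k" by simp
  qed
  also have "\<dots> = (\<Sum>i\<le>k. fourier_coeff \<zeta> i * fourier_coeff U (k - i))"
    by (rule fourier_coeff_mult[OF \<zeta>_holo U_holo rad_gt_1])
  also have "\<dots> = fourier_coeff \<zeta> k * of_real A + (\<Sum>i<k. fourier_coeff \<zeta> i * b (k - i))"
    by (simp add: lessThan_Suc_atMost[symmetric] Uc)
  finally have eq: "fourier_coeff \<zeta> k * of_real A = b k - (\<Sum>i<k. fourier_coeff \<zeta> i * b (k - i))"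
    using assms by (simp add: B_coeff)
  have \<zeta>0: "fourier_coeff \<zeta> 0 = 0"
    using circle_mean_holomorphic[OF \<zeta>_holo rad_gt_1] by (simp add: fourier_coeff_0 \<zeta>_0)
  have "norm (fourier_coeff \<zeta> k) \<le> norm (fourier_coeff \<zeta> k * of_real A)"
    using A_ge_1 mult_left_mono[of 1 A "norm (fourier_coeff \<zeta> k)"] by (simp add: norm_mult)
  also have "\<dots> \<le> norm (b k) + norm (\<Sum>i<k. fourier_coeff \<zeta> i * b (k - i))"
    unfolding eq by (rule norm_triangle_ineq4)
  also have "norm (\<Sum>i<k. fourier_coeff \<zeta> i * b (k - i)) \<le> (\<Sum>i\<in>{1..<k}. norm (b (k - i)))"
  proof -
    have "(\<Sum>i<k. fourier_coeff \<zeta> i * b (k - i)) = (\<Sum>i\<in>{1..<k}. fourier_coeff \<zeta> i * b (k - i))"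
      by (rule sum.mono_neutral_right) (auto simp: \<zeta>0 not_le)
    also have "norm \<dots> \<le> (\<Sum>i\<in>{1..<k}. 1 * norm (b (k - i)))"
      by (intro sum_norm_le) (use \<zeta>_coeff_le[of 1] in \<open>auto simp: norm_mult intro!: mult_right_mono mult_left_le_one_le\<close>)
    finally show ?thesis by simp
  qed
  also have "(\<Sum>i\<in>{1..<k}. norm (b (k - i))) = (\<Sum>i\<in>{1..<k}. norm (b i))"
    by (rule sum.reindex_bij_witness[where i = "\<lambda>i. k - i" and j = "\<lambda>i. k - i"]) auto
  also have "norm (b k) + (\<Sum>i\<in>{1..<k}. norm (b i)) = (\<Sum>i\<in>{1..k}. norm (b i))"
    using assms by (simp add: sum.atLeastLessThan_Suc flip: atLeastLessThanSuc_atLeastAtMost)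
  finally show ?thesis by simp
qed

end

text \<open>A sequence of exponents whose densities have asymptotically vanishing moments of orders 1 to
  \<open>n - 1\<close>. Partial Fourier sums of a function satisfying the moment conditions form
  such a sequence, although none of them need satisfy the conditions itself.\<close>

locale entire_exponents =
  fixes F :: "nat \<Rightarrow> complex \<Rightarrow> complex" and n :: nat
  assumes F: "\<And>j. entire_exponent (F j)" and n: "n \<ge> 1"
    and moments: "\<And>i. i \<in> {1..<n} \<Longrightarrow> (\<lambda>j. entire_exponent.b (F j) i) \<longlonglongrightarrow> 0"
begin

abbreviation "zt j \<equiv> entire_exponent.\<zeta> (F j)"

lemma coeff_tendsto_0: "k < n \<Longrightarrow> (\<lambda>j. fourier_coeff (zt j) k) \<longlonglongrightarrow> 0"
proof (cases "k = 0")
  case True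
  interpret entire_exponent "F j" for j by (rule F)
  show ?thesis using circle_mean_holomorphic[OF \<zeta>_holo rad_gt_1] by (simp add: True fourier_coeff_0 \<zeta>_0)
next
  case False
  interpret entire_exponent "F j" for j by (rule F)
  assume "k < n"
  have "(\<lambda>j. \<Sum>i\<in>{1..k}. norm (b j i)) \<longlonglongrightarrow> (\<Sum>i\<in>{1..k}. 0)"
    using \<open>k < n\<close> by (intro tendsto_sum tendsto_norm_zero moments) auto
  hence "(\<lambda>j. \<Sum>i\<in>{1..k}. norm (b j i)) \<longlonglongrightarrow> 0" by simp
  thus ?thesis
    by (rule Lim_null_comparison[rotated]) (use False \<zeta>_coeff_bound[of k] in auto)
qed

text \<open>In the product \<open>\<zeta> \<zeta>\<^sup>l\<close> every term that contributes to an index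
  below \<open>n (l + 1)\<close> has its first factor of index below \<open>n\<close> or its
  second one of index below \<open>n l\<close>.\<close>

lemma power_coeff_tendsto_0: "k < n * l \<Longrightarrow> (\<lambda>j. fourier_coeff (\<lambda>z. zt j z ^ l) k) \<longlonglongrightarrow> 0"
proof (induction l arbitrary: k)
  case (Suc l)
  interpret entire_exponent "F j" for j by (rule F)
  have "(\<lambda>j. \<Sum>i\<le>k. fourier_coeff (zt j) i * fourier_coeff (\<lambda>z. zt j z ^ l) (k - i)) \<longlonglongrightarrow> (\<Sum>i\<le>k. 0)"
  proof (intro tendsto_sum)
    fix i assume "i \<in> {..k}"
    show "(\<lambda>j. fourier_coeff (zt j) i * fourier_coeff (\<lambda>z. zt j z ^ l) (k - i)) \<longlonglongrightarrow> 0"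
    proof (cases "i < n")
      case True
      show ?thesis
        by (rule tendsto_0_le[OF coeff_tendsto_0[OF True], where K = 1])
           (use \<zeta>_coeff_le in \<open>auto intro!: always_eventually mult_right_le_one_le simp: norm_mult\<close>)
    next
      case False
      hence "k - i < n * l" using Suc.prems n \<open>i \<in> {..k}\<close> by auto
      show ?thesis
        by (rule tendsto_0_le[OF Suc.IH[OF \<open>k - i < n * l\<close>], where K = 1])
           (use \<zeta>_coeff_le[of _ 1] in \<open>auto intro!: always_eventually mult_left_le_one_le simp: norm_mult\<close>)
    qed
  qed
  moreover have "fourier_coeff (\<lambda>z. zt j z ^ Suc l) k = (\<Sum>i\<le>k. fourier_coeff (zt j) i * fourier_coeff (\<lambda>z. zt j z ^ l) (k - i))" for j
    using fourier_coeff_mult[OF \<zeta>_holo \<zeta>_pow_holo rad_gt_1, of j l k] by simp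
  ultimately show ?case by simp
qed simp

lemma low_part_tendsto_0: "(\<lambda>j. entire_exponent.low_part (F j) n \<Lambda>) \<longlonglongrightarrow> 0"
proof -
  interpret entire_exponent "F j" for j by (rule F)
  have "(\<lambda>j. low_part j n \<Lambda>) \<longlonglongrightarrow> (\<Sum>l<\<Lambda>. real n / real (Suc l) * (\<Sum>k<n * Suc l. (norm (0::complex))\<^sup>2))"
    unfolding low_part_def by (intro tendsto_intros power_coeff_tendsto_0) (auto simp del: mult_Suc_right)
  thus ?thesis by simp
qed

text \<open>The inequality for entire exponents up to an error that tends to 0, with the gain retained.\<close>

theorem energy_limit:
  assumes "\<And>j. entire_exponent.E (F j) \<le> Emax" "\<And>j. circle_mean (\<lambda>z. (entire_exponent.w (F j) z)\<^sup>2) \<le> W" "\<epsilon> > 0"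
  shows "eventually (\<lambda>j. entire_exponent.E (F j) \<ge> real n * ln (entire_exponent.A (F j)) + entire_exponent.high_part (F j) n - \<epsilon>) sequentially"
proof -
  interpret entire_exponent "F j" for j by (rule F)
  define C where "C = real n * (1 + (6 * Emax + 15 * W + 12))"
  have bnd: "6 * E j + 15 * circle_mean (\<lambda>z. (w j z)\<^sup>2) + 12 \<le> 6 * Emax + 15 * W + 12" for j using assms(1,2)[of j] by auto
  have "E 0 \<ge> 0" unfolding E_def by (rule dirichlet_form_nonneg[OF F_ball[of 0 2]]) simp
  moreover have "circle_mean (\<lambda>z. (w 0 z)\<^sup>2) \<ge> 0" by (rule circle_mean_nonneg) simp
  ultimately have "C > 0" using bnd[of 0] n unfolding C_def by (intro mult_pos_pos) auto
  define \<delta> where "\<delta> = \<epsilon> / (2 * C)"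
  have \<delta>: "\<delta> > 0" using \<open>C > 0\<close> assms(3) by (simp add: \<delta>_def)
  obtain \<Lambda> where \<Lambda>: "\<Lambda> \<ge> 1" "\<And>x. 0 \<le> x \<Longrightarrow> x < 1 \<Longrightarrow>
     - ln (1 - x) \<le> (\<Sum>l<\<Lambda>. x ^ Suc l / real (Suc l)) + \<delta> * (1 + (ln (1 - x))\<^sup>2)" using log_series_tail[OF \<delta>] by blast
  have "eventually (\<lambda>j. low_part j n \<Lambda> < \<epsilon> / 2) sequentially"
    using order_tendstoD(2)[OF low_part_tendsto_0, of "\<epsilon> / 2" \<Lambda>] assms(3) by simp
  thus ?thesis
  proof eventually_elim
    case (elim j)
    have "E j \<ge> real n * (ln (A j) - \<delta> * (1 + (6 * E j + 15 * circle_mean (\<lambda>z. (w j z)\<^sup>2) + 12))) - low_part j n \<Lambda> + high_part j n"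
      by (rule energy_ge_log[OF \<delta> \<Lambda>])
    moreover have "real n * (\<delta> * (1 + (6 * E j + 15 * circle_mean (\<lambda>z. (w j z)\<^sup>2) + 12))) \<le> real n * (\<delta> * (1 + (6 * Emax + 15 * W + 12)))"
      using \<delta> bnd[of j] by (intro mult_left_mono) auto
    moreover have "real n * (\<delta> * (1 + (6 * Emax + 15 * W + 12))) = \<epsilon> / 2"
      using \<open>C > 0\<close> unfolding \<delta>_def C_def by (simp add: field_simps)
    ultimately show ?case using elim by (simp add: algebra_simps)
  qed
qed

end

section \<open>Square integrable functions\<close>

lemma square_integrable_inner:
  assumes "square_integrable M f" "square_integrable M g"
  shows "integrable M (\<lambda>x. f x \<bullet> g x)"
proof (rule Bochner_Integration.integrable_bound)
  show "integrable M (\<lambda>x. (norm (f x))\<^sup>2 + (norm (g x))\<^sup>2)"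
    using assms by (auto simp: square_integrable_def)
  show "(\<lambda>x. f x \<bullet> g x) \<in> borel_measurable M" using assms by (auto simp: square_integrable_def)
  have "\<bar>f x \<bullet> g x\<bar> \<le> (norm (f x))\<^sup>2 + (norm (g x))\<^sup>2" for x
  proof -
    have "\<bar>f x \<bullet> g x\<bar> \<le> norm (f x) * norm (g x)" by (rule Cauchy_Schwarz_ineq2)
    moreover have "2 * norm (f x) * norm (g x) \<le> (norm (f x))\<^sup>2 + (norm (g x))\<^sup>2" by (rule sum_squares_bound)
    moreover have "0 \<le> norm (f x) * norm (g x)" by simp
    ultimately show ?thesis by linarith
  qed
  thus "AE x in M. norm (f x \<bullet> g x) \<le> norm ((norm (f x))\<^sup>2 + (norm (g x))\<^sup>2)" by auto
qed

lemma square_integrable_mult: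
  fixes f g :: "'a \<Rightarrow> real"
  assumes "square_integrable M f" "square_integrable M g"
  shows "integrable M (\<lambda>x. f x * g x)"
  using square_integrable_inner[OF assms] by simp

lemma square_integrable_scaleR:
  "square_integrable M f \<Longrightarrow> square_integrable M (\<lambda>x. c *\<^sub>R f x)"
  by (auto simp: square_integrable_def power_mult_distrib)

lemma square_integrable_add:
  assumes "square_integrable M f" "square_integrable M g"
  shows "square_integrable M (\<lambda>x. f x + g x)"
proof -
  have "(\<lambda>x. (norm (f x + g x))\<^sup>2) = (\<lambda>x. (norm (f x))\<^sup>2 + 2 * (f x \<bullet> g x) + (norm (g x))\<^sup>2)"
    by (simp add: power2_norm_eq_inner algebra_simps inner_commute)
  thus ?thesis using assms square_integrable_inner[OF assms] by (auto simp: square_integrable_def)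
qed

lemma square_integrable_diff:
  assumes "square_integrable M f" "square_integrable M g"
  shows "square_integrable M (\<lambda>x. f x - g x)"
  using square_integrable_add[OF assms(1) square_integrable_scaleR[OF assms(2), of "-1"]] by simp

lemma square_integrable_sq_integrable:
  "square_integrable M f \<Longrightarrow> integrable M (\<lambda>x. (norm (f x))\<^sup>2)" by (simp add: square_integrable_def)

lemma L2_norm_nonneg: "0 \<le> L2_norm M f"
  by (simp add: L2_norm_def)

lemma L2_norm_power2: "(L2_norm M f)\<^sup>2 = (LINT x|M. (norm (f x))\<^sup>2)"
  by (simp add: L2_norm_def)

lemma L2_norm_minus_commute: "L2_norm M (\<lambda>x. f x - g x) = L2_norm M (\<lambda>x. g x - f x)"
  by (simp add: L2_norm_def norm_minus_commute)

lemma L2_norm_scaleR: "L2_norm M (\<lambda>x. c *\<^sub>R f x) = \<bar>c\<bar> * L2_norm M f"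
  by (simp add: L2_norm_def power_mult_distrib real_sqrt_mult)

lemma L2_cauchy_schwarz:
  assumes f: "square_integrable M f" and g: "square_integrable M g"
  shows "\<bar>LINT x|M. f x \<bullet> g x\<bar> \<le> L2_norm M f * L2_norm M g"
proof -
  define a where "a = (LINT x|M. (norm (f x))\<^sup>2)"
  define b where "b = (LINT x|M. (norm (g x))\<^sup>2)"
  define x where "x = (LINT x|M. f x \<bullet> g x)"
  have quad: "0 \<le> s\<^sup>2 * a - 2 * s * x + b" for s
  proof -
    have "0 \<le> (LINT x|M. (norm (s *\<^sub>R f x - g x))\<^sup>2)" by simp
    also have "\<dots> = (LINT x|M. s\<^sup>2 * (norm (f x))\<^sup>2 - 2 * s * (f x \<bullet> g x) + (norm (g x))\<^sup>2)"
      by (rule Bochner_Integration.integral_cong)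
        (unfold power2_norm_eq_inner, simp_all add: algebra_simps inner_commute power2_eq_square)
    also have "\<dots> = s\<^sup>2 * a - 2 * s * x + b"
      using f g square_integrable_inner[OF f g] by (simp add: square_integrable_def a_def b_def x_def)
    finally show ?thesis .
  qed
  have "x\<^sup>2 \<le> a * b"
  proof (cases "a = 0")
    case True
    have "x = 0"
    proof (rule ccontr)
      assume "x \<noteq> 0"
      thus False using quad[of "(b + 1) / (2 * x)"] True by (simp add: field_simps)
    qed
    thus ?thesis using True by simp
  next
    case False
    moreover have "a \<ge> 0" unfolding a_def b_def x_def by simp
    ultimately have "a > 0" by simp
    have "0 \<le> a * ((x / a)\<^sup>2 * a - 2 * (x / a) * x + b)" using quad[of "x / a"] \<open>a > 0\<close> by simp
    also have "\<dots> = a * b - x\<^sup>2" using \<open>a > 0\<close> by (simp add: field_simps power2_eq_square)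
    finally show ?thesis by simp
  qed
  hence "sqrt (x\<^sup>2) \<le> sqrt (a * b)" by (rule real_sqrt_le_mono)
  thus ?thesis by (simp add: L2_norm_def a_def b_def x_def real_sqrt_mult)
qed

lemma L2_norm_triangle:
  assumes f: "square_integrable M f" and g: "square_integrable M g"
  shows "L2_norm M (\<lambda>x. f x + g x) \<le> L2_norm M f + L2_norm M g"
proof (rule power2_le_imp_le)
  have "(LINT x|M. (norm (f x + g x))\<^sup>2) = (LINT x|M. (norm (f x))\<^sup>2 + 2 * (f x \<bullet> g x) + (norm (g x))\<^sup>2)"
    by (rule Bochner_Integration.integral_cong) (simp_all add: power2_norm_eq_inner algebra_simps inner_commute)
  also have "\<dots> = (L2_norm M f)\<^sup>2 + 2 * (LINT x|M. f x \<bullet> g x) + (L2_norm M g)\<^sup>2"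
    using f g square_integrable_inner[OF f g] by (simp add: square_integrable_def L2_norm_power2)
  also have "\<dots> \<le> (L2_norm M f)\<^sup>2 + 2 * (L2_norm M f * L2_norm M g) + (L2_norm M g)\<^sup>2"
    using L2_cauchy_schwarz[OF f g] by simp
  finally show "(L2_norm M (\<lambda>x. f x + g x))\<^sup>2 \<le> (L2_norm M f + L2_norm M g)\<^sup>2"
    unfolding L2_norm_power2[of M "\<lambda>x. f x + g x"] power2_sum by simp
qed (simp add: L2_norm_nonneg)

lemma L2_norm_triangle_diff:
  assumes "square_integrable M f" "square_integrable M g" "square_integrable M h"
  shows "L2_norm M (\<lambda>x. f x - h x) \<le> L2_norm M (\<lambda>x. f x - g x) + L2_norm M (\<lambda>x. g x - h x)"
  using L2_norm_triangle[OF square_integrable_diff[OF assms(1,2)] square_integrable_diff[OF assms(2,3)]] by simp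

text \<open>Used to turn uniform approximation into approximation in \<open>L\<^sup>2\<close>.\<close>

lemma L2_norm_le_uniform:
  fixes f :: "'a \<Rightarrow> 'b::euclidean_space"
  assumes M: "finite_measure M" and f: "square_integrable M f" and le: "\<And>x. x \<in> space M \<Longrightarrow> norm (f x) \<le> \<eta>" and "\<eta> \<ge> 0"
  shows "L2_norm M f \<le> \<eta> * sqrt (measure M (space M))"
proof -
  have i: "integrable M (\<lambda>x. \<eta>\<^sup>2)" using finite_measure.integrable_const[OF M] by blast
  have "(LINT x|M. (norm (f x))\<^sup>2) \<le> (LINT x|M. \<eta>\<^sup>2)"
    by (rule integral_mono[OF square_integrable_sq_integrable[OF f] i]) (use le in \<open>intro power_mono, auto\<close>)
  also have "\<dots> = \<eta>\<^sup>2 * measure M (space M)" by simp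
  finally have "L2_norm M f \<le> sqrt (\<eta>\<^sup>2 * measure M (space M))"
    unfolding L2_norm_def by (rule real_sqrt_le_mono)
  thus ?thesis using \<open>\<eta> \<ge> 0\<close> by (simp add: real_sqrt_mult)
qed

lemma square_integrable_circle:
  fixes f :: "complex \<Rightarrow> 'b::euclidean_space"
  assumes "continuous_on (sphere 0 1) f"
  shows "square_integrable angle_measure (\<lambda>\<theta>. f (cis \<theta>))"
proof -
  have "continuous_on (sphere 0 1) (\<lambda>z. (norm (f z))\<^sup>2)" by (intro continuous_intros assms)
  from circle_integrable_continuous[OF this] circle_integrable_continuous[OF assms]
  show ?thesis unfolding square_integrable_def by auto
qed

lemma square_integrable_bounded_mult:
  fixes f :: "'a \<Rightarrow> real" and g :: "'a \<Rightarrow> complex"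
  assumes "integrable M f" "g \<in> borel_measurable M" "\<And>x. norm (g x) \<le> 1"
  shows "integrable M (\<lambda>x. of_real (f x) * g x)"
  by (rule Bochner_Integration.integrable_bound[OF assms(1)])
     (use assms in \<open>auto simp: norm_mult intro!: mult_left_le\<close>)

lemma circle_integrable_times_cnj_power:
  fixes f :: "complex \<Rightarrow> real"
  assumes "circle_integrable f"
  shows "circle_integrable (\<lambda>z. of_real (f z) * cnj z ^ k)"
proof (rule square_integrable_bounded_mult[OF assms])
  show "(\<lambda>\<theta>. cnj (cis \<theta>) ^ k) \<in> borel_measurable angle_measure"
    by (intro borel_measurable_integrable circle_integrable_continuous[of "\<lambda>z. cnj z ^ k"] continuous_intros)
qed (auto simp: norm_power)

lemma square_integrable_integrable:
  fixes f :: "'a \<Rightarrow> 'b::euclidean_space"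
  assumes "finite_measure M" "square_integrable M f"
  shows "integrable M f"
proof (rule Bochner_Integration.integrable_bound)
  show "integrable M (\<lambda>x. 1 + (norm (f x))\<^sup>2)"
    using assms finite_measure.integrable_const[OF assms(1), of "1::real"] by (auto simp: square_integrable_def)
  have "norm (f x) \<le> 1 + (norm (f x))\<^sup>2" for x
    using sum_squares_bound[of "norm (f x)" 1] norm_ge_zero[of "f x"] unfolding power_one mult_1_right by linarith
  thus "AE x in M. norm (f x) \<le> norm (1 + (norm (f x))\<^sup>2)" by (intro AE_I2) (simp add: add_nonneg_nonneg)
qed (use assms in \<open>auto simp: square_integrable_def\<close>)

section \<open>Partial Fourier sums\<close>

lemma fourier_coeff_diff_real:
  assumes "circle_integrable (f :: complex \<Rightarrow> real)" "circle_integrable (g :: complex \<Rightarrow> real)"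
  shows "fourier_coeff (\<lambda>z. of_real (f z - g z)) k = fourier_coeff (\<lambda>z. of_real (f z)) k - fourier_coeff (\<lambda>z. of_real (g z)) k"
  unfolding fourier_coeff_def of_real_diff left_diff_distrib
  by (rule circle_mean_diff; rule circle_integrable_times_cnj_power; rule assms)

lemma norm_fourier_coeff_real_le:
  assumes "circle_integrable (f :: complex \<Rightarrow> real)"
  shows "norm (fourier_coeff (\<lambda>z. of_real (f z)) k) \<le> circle_mean (\<lambda>z. \<bar>f z\<bar>)"
proof -
  have "norm (fourier_coeff (\<lambda>z. of_real (f z)) k) \<le> circle_mean (\<lambda>z. norm (of_real (f z) * cnj z ^ k))"
    unfolding fourier_coeff_def by (intro circle_mean_norm_le circle_integrable_times_cnj_power assms)
  also have "\<dots> = circle_mean (\<lambda>z. \<bar>f z\<bar>)" by (rule circle_mean_cong) (simp add: norm_mult norm_power)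
  finally show ?thesis .
qed

text \<open>The conjugate of a holomorphic function that vanishes at 0 has no coefficients of nonnegative
  index.\<close>

lemma fourier_coeff_2Re:
  assumes "G holomorphic_on ball 0 R" "R > 1" "G 0 = 0"
  shows "fourier_coeff (\<lambda>z. of_real (2 * Re (G z))) k = fourier_coeff G k"
proof -
  have c: "continuous_on (sphere 0 1) G" by (rule circle_continuous_holomorphic[OF assms(1,2)])
  have "fourier_coeff (\<lambda>z. of_real (2 * Re (G z))) k = circle_mean (\<lambda>z. G z * cnj z ^ k + cnj (G z * z ^ k))"
    unfolding fourier_coeff_def by (rule circle_mean_cong) (simp add: complex_add_cnj[symmetric] distrib_right del: of_real_mult)
  also have "\<dots> = fourier_coeff G k + cnj (circle_mean (\<lambda>z. G z * z ^ k))"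
    unfolding fourier_coeff_def circle_mean_cnj[symmetric]
    by (intro circle_mean_add circle_integrable_continuous continuous_intros c)
  also have "circle_mean (\<lambda>z. G z * z ^ k) = 0"
    by (subst circle_mean_holomorphic[OF _ assms(2)]) (auto intro!: holomorphic_intros assms)
  finally show ?thesis by simp
qed

definition partial_sum :: "(complex \<Rightarrow> real) \<Rightarrow> nat \<Rightarrow> complex \<Rightarrow> complex" where
  "partial_sum f N z = (\<Sum>k\<in>{1..N}. fourier_coeff (\<lambda>z. of_real (f z)) k * z ^ k)"

lemma partial_sum_holo: "partial_sum f N holomorphic_on S"
  unfolding partial_sum_def by (intro holomorphic_intros)

lemma partial_sum_0: "partial_sum f N 0 = 0"
  unfolding partial_sum_def by (auto intro!: sum.neutral)

lemma partial_sum_entire: "entire_exponent (partial_sum f N)"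
  by unfold_locales (rule partial_sum_holo partial_sum_0)+

lemma partial_sum_cont: "continuous_on S (partial_sum f N)"
  using partial_sum_holo holomorphic_on_imp_continuous_on by blast

lemma fourier_coeff_partial_sum:
  "fourier_coeff (partial_sum f N) k = (if k \<in> {1..N} then fourier_coeff (\<lambda>z. of_real (f z)) k else 0)"
proof (rule fourier_coeff_power_series[where a = "\<lambda>k. if k \<in> {1..N} then fourier_coeff (\<lambda>z. of_real (f z)) k else 0"])
  show "(\<lambda>n. (if n \<in> {1..N} then fourier_coeff (\<lambda>z. of_real (f z)) n else 0) * z ^ n) sums partial_sum f N z" for z
    using sums_If_finite_set[of "{1..N}" "\<lambda>n. fourier_coeff (\<lambda>z. of_real (f z)) n * z ^ n"]
    by (simp add: partial_sum_def if_distrib[of "\<lambda>x. x * _"] cong: if_cong)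
  show "summable (\<lambda>n. norm (if n \<in> {1..N} then fourier_coeff (\<lambda>z. of_real (f z)) n else 0))"
    by (rule summable_finite[of "{1..N}"]) auto
qed (rule partial_sum_cont)

lemma partial_sum_energy:
  "Re (dirichlet_form (partial_sum f N) (partial_sum f N)) = (\<Sum>k\<in>{1..N}. real k * (norm (fourier_coeff (\<lambda>z. of_real (f z)) k))\<^sup>2)"
proof -
  have "(\<lambda>k. real k * (norm (fourier_coeff (partial_sum f N) k))\<^sup>2) sums (\<Sum>k\<in>{1..N}. real k * (norm (fourier_coeff (partial_sum f N) k))\<^sup>2)"
    by (rule sums_finite) (auto simp: fourier_coeff_partial_sum)
  hence "Re (dirichlet_form (partial_sum f N) (partial_sum f N)) = (\<Sum>k\<in>{1..N}. real k * (norm (fourier_coeff (partial_sum f N) k))\<^sup>2)"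
    using dirichlet_form_self_sums[OF partial_sum_holo, of 2 f N] sums_unique2 by force
  also have "\<dots> = (\<Sum>k\<in>{1..N}. real k * (norm (fourier_coeff (\<lambda>z. of_real (f z)) k))\<^sup>2)"
    by (rule sum.cong) (auto simp: fourier_coeff_partial_sum)
  finally show ?thesis .
qed

lemma circle_mean_real_times_poly:
  fixes f :: "complex \<Rightarrow> real"
  assumes "circle_integrable f"
  shows "circle_mean (\<lambda>z. f z * Re (poly p z)) = Re (\<Sum>k\<le>degree p. coeff p k * cnj (fourier_coeff (\<lambda>z. of_real (f z)) k))"
proof -
  have i: "circle_integrable (\<lambda>z. coeff p k * (of_real (f z) * z ^ k))" for k
    using circle_integrable_times_cnj_power[OF assms, of k, THEN integrable_cnj] by (intro integrable_mult_right) simp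
  have "circle_mean (\<lambda>z. f z * Re (poly p z)) = circle_mean (\<lambda>z. Re (\<Sum>k\<le>degree p. coeff p k * (of_real (f z) * z ^ k)))"
    by (rule circle_mean_cong) (simp add: poly_altdef sum_distrib_left algebra_simps)
  also have "\<dots> = Re (circle_mean (\<lambda>z. \<Sum>k\<le>degree p. coeff p k * (of_real (f z) * z ^ k)))"
    by (rule circle_mean_Re) (intro Bochner_Integration.integrable_sum i)
  also have "circle_mean (\<lambda>z. \<Sum>k\<le>degree p. coeff p k * (of_real (f z) * z ^ k)) = (\<Sum>k\<le>degree p. circle_mean (\<lambda>z. coeff p k * (of_real (f z) * z ^ k)))"
    by (rule circle_mean_sum) (rule i)
  finally show ?thesis by (simp add: circle_mean_mult_left circle_mean_real_times_power)
qed

text \<open>The Lebedev-Milin inequality. It is the case \<open>n = 1\<close> of the energy bound, in which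
  there are no moments to control, applied to a constant sequence.\<close>

lemma (in entire_exponent) ln_A_le_E: "ln A \<le> E"
proof (rule field_le_epsilon)
  fix \<epsilon> :: real assume "\<epsilon> > 0"
  interpret seq: entire_exponents "\<lambda>_. F" 1
    by unfold_locales (auto simp: entire F0)
  have "eventually (\<lambda>j::nat. E \<ge> real 1 * ln A + high_part 1 - \<epsilon>) sequentially"
    by (rule seq.energy_limit[where Emax = E and W = "circle_mean (\<lambda>z. (w z)\<^sup>2)"]) (use \<open>\<epsilon> > 0\<close> in auto)
  hence "E \<ge> ln A + high_part 1 - \<epsilon>" by simp
  thus "ln A \<le> E + \<epsilon>" using high_part_nonneg[of 1] by linarith
qed

lemma (in entire_exponent) A_le_exp_E: "A \<le> exp E"
proof -
  have "A = exp (ln A)" using A_pos by simp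
  also have "\<dots> \<le> exp E" using ln_A_le_E by simp
  finally show ?thesis .
qed

text \<open>Apply the Lebedev-Milin inequality to \<open>2 F\<close>, whose energy is \<open>4 E\<close> and
  whose density is the square of \<open>w\<close>.\<close>

lemma (in entire_exponent) mean_w_sq_le: "circle_mean (\<lambda>z. (w z)\<^sup>2) \<le> exp (4 * E)"
proof -
  interpret D: entire_exponent "\<lambda>z. 2 * F z"
    by unfold_locales (auto intro!: holomorphic_intros entire simp: F0)
  have "D.w z = (w z)\<^sup>2" for z
    unfolding D.w_eq_exp w_eq_exp exp_double[symmetric] by simp
  hence "D.A = circle_mean (\<lambda>z. (w z)\<^sup>2)" unfolding D.A_def by (intro circle_mean_cong) simp
  moreover have "D.E = 4 * E"
  proof -
    have "dirichlet_form (\<lambda>z. 2 * F z) (\<lambda>z. 2 * F z) = circle_mean (\<lambda>z. 4 * (z * deriv F z * cnj (F z)))"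
      unfolding dirichlet_form_def
    proof (rule circle_mean_cong)
      fix z
      have "F field_differentiable at z" using entire by (simp add: holomorphic_on_def)
      hence "deriv (\<lambda>z. 2 * F z) z = 2 * deriv F z" by (rule deriv_cmult)
      thus "z * deriv (\<lambda>z. 2 * F z) z * cnj (2 * F z) = 4 * (z * deriv F z * cnj (F z))" by simp
    qed
    thus ?thesis unfolding D.E_def E_def dirichlet_form_def by (simp add: circle_mean_mult_left)
  qed
  ultimately show ?thesis using D.A_le_exp_E by simp
qed

lemma partial_sum_poly: "partial_sum f N z = poly (\<Sum>k\<in>{1..N}. monom (fourier_coeff (\<lambda>z. of_real (f z)) k) k) z"
  by (simp add: partial_sum_def poly_sum poly_monom)

text \<open>The error \<open>g\<close> of the partial sum is orthogonal to real parts of polynomials of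
  degree at most \<open>N\<close>.\<close>

lemma partial_sum_best_approx:
  fixes f :: "complex \<Rightarrow> real"
  assumes f: "square_integrable angle_measure (\<lambda>\<theta>. f (cis \<theta>))" and mean: "circle_mean f = 0" and "degree p \<le> N"
  shows "circle_mean (\<lambda>z. (f z - 2 * Re (partial_sum f N z))\<^sup>2) \<le> circle_mean (\<lambda>z. (f z - Re (poly p z))\<^sup>2)"
proof -
  define g where "g z = f z - 2 * Re (partial_sum f N z)" for z
  define P where "P = (\<Sum>k\<in>{1..N}. monom (fourier_coeff (\<lambda>z. of_real (f z)) k) k)"
  define Q where "Q = smult 2 P - p"
  have "degree P \<le> N" unfolding P_def
    by (rule degree_sum_le) (auto intro: order_trans[OF degree_monom_le])
  hence "degree Q \<le> N" unfolding Q_def using assms(3) by (intro degree_diff_le) (auto intro: order_trans[OF degree_smult_le])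
  have ci: "circle_integrable (\<lambda>z. 2 * Re (partial_sum f N z))" by (intro circle_integrable_continuous continuous_intros partial_sum_cont)
  have fi: "circle_integrable f" by (rule square_integrable_integrable[OF finite_measure_angle f])
  have gi: "circle_integrable g" unfolding g_def by (intro Bochner_Integration.integrable_diff fi ci)
  have g2: "square_integrable angle_measure (\<lambda>\<theta>. g (cis \<theta>))" unfolding g_def
    by (intro square_integrable_diff f square_integrable_circle continuous_intros partial_sum_cont)
  have q2: "square_integrable angle_measure (\<lambda>\<theta>. Re (poly Q (cis \<theta>)))"
    by (intro square_integrable_circle[of "\<lambda>z. Re (poly Q z)"] continuous_intros)
  have g0: "fourier_coeff (\<lambda>z. of_real (g z)) k = 0" if "k \<le> N" for k
  proof -
    have "fourier_coeff (\<lambda>z. of_real (g z)) k = fourier_coeff (\<lambda>z. of_real (f z)) k - fourier_coeff (\<lambda>z. of_real (2 * Re (partial_sum f N z))) k"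
      unfolding g_def by (rule fourier_coeff_diff_real[OF fi ci])
    also have "fourier_coeff (\<lambda>z. of_real (2 * Re (partial_sum f N z))) k = fourier_coeff (partial_sum f N) k"
      by (rule fourier_coeff_2Re[OF partial_sum_holo, of 2]) (auto simp: partial_sum_0)
    finally have "fourier_coeff (\<lambda>z. of_real (g z)) k = (if k = 0 then fourier_coeff (\<lambda>z. of_real (f z)) 0 else 0)"
      unfolding fourier_coeff_partial_sum using that by auto
    thus ?thesis using mean by (simp add: fourier_coeff_0 circle_mean_of_real)
  qed
  have "circle_mean (\<lambda>z. g z * Re (poly Q z)) = 0"
    unfolding circle_mean_real_times_poly[OF gi] using \<open>degree Q \<le> N\<close> by (simp add: g0)
  hence "circle_mean (\<lambda>z. (g z)\<^sup>2) = circle_mean (\<lambda>z. (g z)\<^sup>2) + circle_mean (\<lambda>z. 2 * (g z * Re (poly Q z)))"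
    by (simp add: circle_mean_mult_left)
  also have "\<dots> = circle_mean (\<lambda>z. (g z)\<^sup>2 + 2 * (g z * Re (poly Q z)))"
    by (intro circle_mean_add[symmetric] integrable_mult_right square_integrable_mult[OF g2 q2])
       (use square_integrable_sq_integrable[OF g2] in simp)
  also have "\<dots> \<le> circle_mean (\<lambda>z. (g z + Re (poly Q z))\<^sup>2)"
  proof (rule circle_mean_mono)
    show "circle_integrable (\<lambda>z. (g z)\<^sup>2 + 2 * (g z * Re (poly Q z)))"
      by (intro Bochner_Integration.integrable_add integrable_mult_right square_integrable_mult[OF g2 q2])
         (use square_integrable_sq_integrable[OF g2] in simp)
    show "circle_integrable (\<lambda>z. (g z + Re (poly Q z))\<^sup>2)"
      using square_integrable_sq_integrable[OF square_integrable_add[OF g2 q2]] by simp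
    show "(g z)\<^sup>2 + 2 * (g z * Re (poly Q z)) \<le> (g z + Re (poly Q z))\<^sup>2" for z
      unfolding power2_sum by simp
  qed
  also have "(\<lambda>z. g z + Re (poly Q z)) = (\<lambda>z. f z - Re (poly p z))"
    by (rule ext) (simp add: g_def Q_def P_def partial_sum_poly)
  finally show ?thesis by (simp add: g_def)
qed

text \<open>Density of the continuous functions is taken as a hypothesis because it is immediate for
  boundary traces, which are limits of smooth functions.\<close>

lemma partial_sums_converge:
  fixes f :: "complex \<Rightarrow> real"
  assumes f: "square_integrable angle_measure (\<lambda>\<theta>. f (cis \<theta>))" and mean: "circle_mean f = 0"
    and dense: "\<And>e. e > 0 \<Longrightarrow> \<exists>\<phi>::complex \<Rightarrow> real. continuous_on (sphere 0 1) \<phi> \<and> circle_mean (\<lambda>z. (f z - \<phi> z)\<^sup>2) < e"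
  shows "(\<lambda>N. circle_mean (\<lambda>z. (f z - 2 * Re (partial_sum f N z))\<^sup>2)) \<longlonglongrightarrow> 0"
proof (rule LIMSEQ_I)
  fix e :: real assume e: "e > 0"
  obtain \<phi> :: "complex \<Rightarrow> real" where \<phi>: "continuous_on (sphere 0 1) \<phi>" "circle_mean (\<lambda>z. (f z - \<phi> z)\<^sup>2) < e / 4"
    using dense[of "e / 4"] e by auto
  define d where "d = sqrt (e / 8)"
  have d: "d > 0" "d\<^sup>2 = e / 8" using e by (auto simp: d_def)
  obtain p where p: "\<And>z. norm z = 1 \<Longrightarrow> \<bar>\<phi> z - Re (poly p z)\<bar> < d"
    using trigonometric_approximation[OF \<phi>(1) d(1)] by blast
  have f\<phi>: "square_integrable angle_measure (\<lambda>\<theta>. f (cis \<theta>) - \<phi> (cis \<theta>))"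
    by (intro square_integrable_diff f square_integrable_circle \<phi>)
  have i1: "circle_integrable (\<lambda>z. (f z - \<phi> z)\<^sup>2)" using square_integrable_sq_integrable[OF f\<phi>] by simp
  have p2: "square_integrable angle_measure (\<lambda>\<theta>. Re (poly p (cis \<theta>)))"
    by (intro square_integrable_circle[of "\<lambda>z. Re (poly p z)"] continuous_intros)
  have i2: "circle_integrable (\<lambda>z. (f z - Re (poly p z))\<^sup>2)"
    using square_integrable_sq_integrable[OF square_integrable_diff[OF f p2]] by simp
  have ic: "circle_integrable (\<lambda>z. e / 4)" using finite_measure.integrable_const[OF finite_measure_angle] by blast
  have "circle_mean (\<lambda>z. (f z - Re (poly p z))\<^sup>2) \<le> circle_mean (\<lambda>z. 2 * (f z - \<phi> z)\<^sup>2 + e / 4)"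
  proof (rule circle_mean_mono[OF i2])
    show "circle_integrable (\<lambda>z. 2 * (f z - \<phi> z)\<^sup>2 + e / 4)"
      by (intro Bochner_Integration.integrable_add integrable_mult_right i1 ic)
    fix z :: complex assume z: "norm z = 1"
    have "\<bar>\<phi> z - Re (poly p z)\<bar>\<^sup>2 \<le> d\<^sup>2" using p[OF z] by (intro power_mono) auto
    moreover have "(f z - Re (poly p z))\<^sup>2 \<le> 2 * (f z - \<phi> z)\<^sup>2 + 2 * (\<phi> z - Re (poly p z))\<^sup>2"
      using sum_squares_bound[of "f z - \<phi> z" "\<phi> z - Re (poly p z)"] by (simp add: power2_eq_square algebra_simps)
    ultimately show "(f z - Re (poly p z))\<^sup>2 \<le> 2 * (f z - \<phi> z)\<^sup>2 + e / 4" using d(2) by simp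
  qed
  also have "\<dots> = 2 * circle_mean (\<lambda>z. (f z - \<phi> z)\<^sup>2) + e / 4"
    by (subst circle_mean_add[OF integrable_mult_right[OF i1] ic]) (simp add: circle_mean_mult_left)
  finally have p_lt: "circle_mean (\<lambda>z. (f z - Re (poly p z))\<^sup>2) < e" using \<phi>(2) e by linarith
  have "norm (circle_mean (\<lambda>z. (f z - 2 * Re (partial_sum f N z))\<^sup>2) - 0) < e" if "N \<ge> degree p" for N
  proof -
    have "circle_mean (\<lambda>z. (f z - 2 * Re (partial_sum f N z))\<^sup>2) \<ge> 0" by (rule circle_mean_nonneg) simp
    moreover have "circle_mean (\<lambda>z. (f z - 2 * Re (partial_sum f N z))\<^sup>2) < e"
      using partial_sum_best_approx[OF f mean that] p_lt by linarith
    ultimately show ?thesis by simp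
  qed
  thus "\<exists>no. \<forall>N\<ge>no. norm (circle_mean (\<lambda>z. (f z - 2 * Re (partial_sum f N z))\<^sup>2) - 0) < e" by blast
qed

section \<open>The inequality on the circle\<close>

text \<open>By convexity of the exponential function.\<close>

lemma abs_exp_diff_le: "\<bar>exp a - exp b\<bar> \<le> \<bar>a - b\<bar> * (exp a + exp b :: real)"
proof -
  have *: "exp a - exp b \<le> (a - b) * exp a" for a b :: real
  proof -
    have "exp a * (1 - (a - b)) \<le> exp a * exp (b - a)" using exp_ge_add_one_self[of "b - a"] by (intro mult_left_mono) (linarith, simp)
    thus ?thesis by (simp add: algebra_simps flip: exp_add)
  qed
  have "exp a - exp b \<le> \<bar>a - b\<bar> * (exp a + exp b)" for a b :: real
  proof -
    have "exp a - exp b \<le> (a - b) * exp a" by (rule *)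
    also have "\<dots> \<le> \<bar>a - b\<bar> * (exp a + exp b)" by (intro mult_mono) auto
    finally show ?thesis .
  qed
  from this[of a b] this[of b a] show ?thesis by (simp add: abs_le_iff abs_minus_commute add.commute)
qed

text \<open>The properties of a boundary trace that the argument on the circle depends on. The bound
  \<open>Emax\<close> will be \<open>1 / (4 \<pi>)\<close> times the Dirichlet integral of the
  function on the disc.\<close>

locale circle_function =
  fixes f :: "complex \<Rightarrow> real" and Emax :: real
  assumes f: "square_integrable angle_measure (\<lambda>\<theta>. f (cis \<theta>))" and mean: "circle_mean f = 0"
    and dense: "\<And>e. e > 0 \<Longrightarrow> \<exists>\<phi>::complex \<Rightarrow> real. continuous_on (sphere 0 1) \<phi> \<and> circle_mean (\<lambda>z. (f z - \<phi> z)\<^sup>2) < e"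
    and energy: "\<And>N. Re (dirichlet_form (partial_sum f N) (partial_sum f N)) \<le> Emax"
begin

sublocale ps: entire_exponent "partial_sum f N" for N by (rule partial_sum_entire)

lemma E_le: "ps.E N \<le> Emax" unfolding ps.E_def by (rule energy)

lemma mean_w_sq_le: "circle_mean (\<lambda>z. (ps.w N z)\<^sup>2) \<le> exp (4 * Emax)"
  using ps.mean_w_sq_le[of N] E_le[of N] by (meson exp_le_cancel_iff mult_left_mono order_trans zero_le_numeral)

lemma sq_integrable_diff: "circle_integrable (\<lambda>z. (f z - 2 * Re (partial_sum f N z))\<^sup>2)"
proof -
  have "square_integrable angle_measure (\<lambda>\<theta>. f (cis \<theta>) - 2 * Re (partial_sum f N (cis \<theta>)))"
    by (intro square_integrable_diff f square_integrable_circle[of "\<lambda>z. 2 * Re (partial_sum f N z)"] continuous_intros partial_sum_cont)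
  from square_integrable_sq_integrable[OF this] show ?thesis by simp
qed

lemma L2_tendsto: "(\<lambda>N. LINT \<theta>|angle_measure. (f (cis \<theta>) - 2 * Re (partial_sum f N (cis \<theta>)))\<^sup>2) \<longlonglongrightarrow> 0"
  using tendsto_mult_left[OF partial_sums_converge[OF f mean dense], of "2 * pi"] by (simp add: circle_mean_def)

lemma f_measurable: "(\<lambda>\<theta>. f (cis \<theta>)) \<in> borel_measurable angle_measure"
  using f by (simp add: square_integrable_def)

lemma w_measurable: "(\<lambda>\<theta>. ps.w N (cis \<theta>)) \<in> borel_measurable angle_measure"
  by (intro borel_measurable_integrable circle_integrable_continuous ps.w_cont)

text \<open>Fatou's lemma along an almost everywhere convergent subsequence of the partial sums, whose
  exponentials are bounded in \<open>L\<^sup>2\<close> by the Lebedev-Milin inequality.\<close>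

lemma exp_square_integrable: "square_integrable angle_measure (\<lambda>\<theta>. exp (f (cis \<theta>)))"
proof -
  obtain r where r: "strict_mono r" "AE \<theta> in angle_measure. (\<lambda>j. (f (cis \<theta>) - 2 * Re (partial_sum f (r j) (cis \<theta>)))\<^sup>2) \<longlonglongrightarrow> 0"
  proof -
    have "\<exists>r. strict_mono r \<and> (AE \<theta> in angle_measure. (\<lambda>j. (f (cis \<theta>) - 2 * Re (partial_sum f (r j) (cis \<theta>)))\<^sup>2) \<longlonglongrightarrow> 0)"
      by (rule tendsto_L1_AE_subseq) (use sq_integrable_diff L2_tendsto in simp_all)
    thus ?thesis using that by blast
  qed
  define u where "u j \<theta> = (ps.w (r j) (cis \<theta>))\<^sup>2" for j \<theta>
  have um: "u j \<in> borel_measurable angle_measure" for j unfolding u_def using w_measurable by measurable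
  have lim: "AE \<theta> in angle_measure. (\<lambda>j. ennreal (u j \<theta>)) \<longlonglongrightarrow> ennreal ((exp (f (cis \<theta>)))\<^sup>2)"
    using r(2)
  proof eventually_elim
    case (elim \<theta>)
    hence "(\<lambda>j. sqrt ((f (cis \<theta>) - 2 * Re (partial_sum f (r j) (cis \<theta>)))\<^sup>2)) \<longlonglongrightarrow> sqrt 0" by (rule tendsto_real_sqrt)
    hence "(\<lambda>j. f (cis \<theta>) - 2 * Re (partial_sum f (r j) (cis \<theta>))) \<longlonglongrightarrow> 0" by (simp add: tendsto_rabs_zero_iff)
    from tendsto_diff[OF tendsto_const[of "f (cis \<theta>)"] this]
    have "(\<lambda>j. 2 * Re (partial_sum f (r j) (cis \<theta>))) \<longlonglongrightarrow> f (cis \<theta>)" by simp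
    thus ?case unfolding u_def ps.w_eq_exp by (intro tendsto_intros)
  qed
  have "(\<integral>\<^sup>+\<theta>. ennreal ((exp (f (cis \<theta>)))\<^sup>2) \<partial>angle_measure) = (\<integral>\<^sup>+\<theta>. liminf (\<lambda>j. ennreal (u j \<theta>)) \<partial>angle_measure)"
    by (rule nn_integral_cong_AE) (use lim in eventually_elim, simp add: lim_imp_Liminf)
  also have "\<dots> \<le> liminf (\<lambda>j. \<integral>\<^sup>+\<theta>. ennreal (u j \<theta>) \<partial>angle_measure)"
    by (rule nn_integral_liminf) (use um in measurable)
  also have "\<dots> \<le> liminf (\<lambda>j. ennreal (2 * pi * exp (4 * Emax)))"
  proof (rule Liminf_mono, rule always_eventually, rule allI)
    fix j
    have "(\<integral>\<^sup>+\<theta>. ennreal (u j \<theta>) \<partial>angle_measure) = ennreal (LINT \<theta>|angle_measure. u j \<theta>)"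
      unfolding u_def by (intro nn_integral_eq_integral circle_integrable_continuous[of "\<lambda>z. (ps.w (r j) z)\<^sup>2"] continuous_intros ps.w_cont) auto
    also have "(LINT \<theta>|angle_measure. u j \<theta>) = 2 * pi * circle_mean (\<lambda>z. (ps.w (r j) z)\<^sup>2)"
      by (simp add: circle_mean_def u_def)
    also have "\<dots> \<le> 2 * pi * exp (4 * Emax)" by (intro mult_left_mono mean_w_sq_le) auto
    finally show "(\<integral>\<^sup>+\<theta>. ennreal (u j \<theta>) \<partial>angle_measure) \<le> ennreal (2 * pi * exp (4 * Emax))" by (simp add: ennreal_leI)
  qed
  also have "\<dots> < \<infinity>" by (simp add: Liminf_const)
  finally have fin: "(\<integral>\<^sup>+\<theta>. ennreal ((exp (f (cis \<theta>)))\<^sup>2) \<partial>angle_measure) < \<infinity>" .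
  have "integrable angle_measure (\<lambda>\<theta>. (exp (f (cis \<theta>)))\<^sup>2)"
    by (rule integrableI_nonneg) (use fin f_measurable in \<open>auto intro!: borel_measurable_power borel_measurable_exp\<close>)
  thus ?thesis using f_measurable by (simp add: square_integrable_def)
qed

lemma exp_integrable: "circle_integrable (\<lambda>z. exp (f z))"
  by (rule square_integrable_integrable[OF finite_measure_angle exp_square_integrable])

text \<open>From \<open>|exp a - exp b| \<le> |a - b| (exp a + exp b)\<close> and the Cauchy-Schwarz
  inequality. Convergence in \<open>L\<^sup>1\<close> carries over all moments of the
  exponentials.\<close>

lemma exp_L1_tendsto: "(\<lambda>N. circle_mean (\<lambda>z. \<bar>ps.w N z - exp (f z)\<bar>)) \<longlonglongrightarrow> 0"
proof -
  define C where "C = sqrt (2 * pi * exp (4 * Emax)) + L2_norm angle_measure (\<lambda>\<theta>. exp (f (cis \<theta>)))"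
  have w2: "square_integrable angle_measure (\<lambda>\<theta>. ps.w N (cis \<theta>))" for N
    by (intro square_integrable_circle ps.w_cont)
  have f2: "square_integrable angle_measure (\<lambda>\<theta>. \<bar>2 * Re (partial_sum f N (cis \<theta>)) - f (cis \<theta>)\<bar>)" for N
  proof -
    have "square_integrable angle_measure (\<lambda>\<theta>. 2 * Re (partial_sum f N (cis \<theta>)) - f (cis \<theta>))"
      by (intro square_integrable_diff f square_integrable_circle[of "\<lambda>z. 2 * Re (partial_sum f N z)"] continuous_intros partial_sum_cont)
    thus ?thesis by (auto simp: square_integrable_def)
  qed
  have le: "(LINT \<theta>|angle_measure. \<bar>ps.w N (cis \<theta>) - exp (f (cis \<theta>))\<bar>)
     \<le> sqrt (LINT \<theta>|angle_measure. (f (cis \<theta>) - 2 * Re (partial_sum f N (cis \<theta>)))\<^sup>2) * C" for N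
  proof -
    have s: "square_integrable angle_measure (\<lambda>\<theta>. ps.w N (cis \<theta>) + exp (f (cis \<theta>)))"
      by (rule square_integrable_add[OF w2 exp_square_integrable])
    have "(LINT \<theta>|angle_measure. \<bar>ps.w N (cis \<theta>) - exp (f (cis \<theta>))\<bar>)
       \<le> (LINT \<theta>|angle_measure. \<bar>2 * Re (partial_sum f N (cis \<theta>)) - f (cis \<theta>)\<bar> * (ps.w N (cis \<theta>) + exp (f (cis \<theta>))))"
    proof (rule integral_mono)
      show "integrable angle_measure (\<lambda>\<theta>. \<bar>ps.w N (cis \<theta>) - exp (f (cis \<theta>))\<bar>)"
        by (intro integrable_abs Bochner_Integration.integrable_diff exp_integrable circle_integrable_continuous ps.w_cont)
    qed (use square_integrable_mult[OF f2 s] abs_exp_diff_le in \<open>auto simp: ps.w_eq_exp\<close>)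
    also have "\<dots> \<le> L2_norm angle_measure (\<lambda>\<theta>. \<bar>2 * Re (partial_sum f N (cis \<theta>)) - f (cis \<theta>)\<bar>)
        * L2_norm angle_measure (\<lambda>\<theta>. ps.w N (cis \<theta>) + exp (f (cis \<theta>)))"
      using order_trans[OF abs_ge_self L2_cauchy_schwarz[OF f2[of N] s]] by (simp only: inner_real_def)
    also have "L2_norm angle_measure (\<lambda>\<theta>. \<bar>2 * Re (partial_sum f N (cis \<theta>)) - f (cis \<theta>)\<bar>)
       = sqrt (LINT \<theta>|angle_measure. (f (cis \<theta>) - 2 * Re (partial_sum f N (cis \<theta>)))\<^sup>2)"
      by (simp add: L2_norm_def power2_commute)
    also have "L2_norm angle_measure (\<lambda>\<theta>. ps.w N (cis \<theta>) + exp (f (cis \<theta>))) \<le> C"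
    proof -
      have "L2_norm angle_measure (\<lambda>\<theta>. ps.w N (cis \<theta>)) \<le> sqrt (2 * pi * exp (4 * Emax))"
        unfolding L2_norm_def using mean_w_sq_le[of N] by (intro real_sqrt_le_mono) (simp add: circle_mean_def field_simps)
      thus ?thesis using L2_norm_triangle[OF w2 exp_square_integrable] unfolding C_def by (meson add_right_mono order_trans)
    qed
    finally show ?thesis by (simp add: mult_left_mono)
  qed
  have "(\<lambda>N. sqrt (LINT \<theta>|angle_measure. (f (cis \<theta>) - 2 * Re (partial_sum f N (cis \<theta>)))\<^sup>2) * C) \<longlonglongrightarrow> sqrt 0 * C"
    by (intro tendsto_intros L2_tendsto)
  hence "(\<lambda>N. LINT \<theta>|angle_measure. \<bar>ps.w N (cis \<theta>) - exp (f (cis \<theta>))\<bar>) \<longlonglongrightarrow> 0"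
    by (intro Lim_null_comparison[OF _ tendsto_eq_rhs]) (use le in auto)
  from tendsto_mult_left[OF this, of "1 / (2 * pi)"] show ?thesis by (simp add: circle_mean_def)
qed

lemma exp_coeff_tendsto: "(\<lambda>N. ps.b N k) \<longlonglongrightarrow> fourier_coeff (\<lambda>z. of_real (exp (f z))) k"
proof -
  have "norm (ps.b N k - fourier_coeff (\<lambda>z. of_real (exp (f z))) k) \<le> circle_mean (\<lambda>z. \<bar>ps.w N z - exp (f z)\<bar>)" for N
  proof -
    have i: "circle_integrable (ps.w N)" by (intro circle_integrable_continuous ps.w_cont)
    show ?thesis unfolding ps.b_def fourier_coeff_diff_real[OF i exp_integrable, symmetric]
      by (rule norm_fourier_coeff_real_le) (intro Bochner_Integration.integrable_diff i exp_integrable)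
  qed
  hence "(\<lambda>N. ps.b N k - fourier_coeff (\<lambda>z. of_real (exp (f z))) k) \<longlonglongrightarrow> 0"
    by (intro Lim_null_comparison[OF _ exp_L1_tendsto]) auto
  thus ?thesis by (simp add: LIM_zero_iff)
qed

lemma A_tendsto: "(\<lambda>N. ps.A N) \<longlonglongrightarrow> circle_mean (\<lambda>z. exp (f z))"
  using exp_coeff_tendsto[of 0]
  by (simp add: ps.b_0 fourier_coeff_0 circle_mean_of_real tendsto_of_real_iff)

lemma mean_exp_ge_1: "circle_mean (\<lambda>z. exp (f z)) \<ge> 1"
  by (rule LIMSEQ_le_const[OF A_tendsto]) (use ps.A_ge_1 in blast)

end

locale circle_function_moments = circle_function +
  fixes n :: nat
  assumes n: "n \<ge> 1" and moments: "\<And>k. k \<in> {1..<n} \<Longrightarrow> fourier_coeff (\<lambda>z. of_real (exp (f z))) k = 0"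
begin

sublocale seq: entire_exponents "partial_sum f" n
proof unfold_locales
  fix i assume "i \<in> {1..<n}"
  thus "(\<lambda>j. ps.b j i) \<longlonglongrightarrow> 0" using exp_coeff_tendsto[of i] moments by simp
qed (use n in \<open>auto intro: partial_sum_holo simp: partial_sum_0\<close>)

text \<open>The partial sums satisfy the hypotheses of the energy bound, and the means of their exponentials
  converge.\<close>

lemma eventually_energy_ge:
  assumes "\<epsilon> > 0"
  shows "eventually (\<lambda>j. Emax \<ge> real n * ln (circle_mean (\<lambda>z. exp (f z))) + ps.high_part j n - \<epsilon>) sequentially"
proof -
  define A where "A = circle_mean (\<lambda>z. exp (f z))"
  have "(\<lambda>j. real n * ln (ps.A j)) \<longlonglongrightarrow> real n * ln A" unfolding A_def
    using mean_exp_ge_1 by (intro tendsto_intros A_tendsto) auto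
  hence "eventually (\<lambda>j. real n * ln (ps.A j) > real n * ln A - \<epsilon> / 2) sequentially"
    using assms by (intro order_tendstoD) auto
  moreover have "eventually (\<lambda>j. ps.E j \<ge> real n * ln (ps.A j) + ps.high_part j n - \<epsilon> / 2) sequentially"
    by (rule seq.energy_limit[OF E_le mean_w_sq_le]) (use assms in simp)
  ultimately show ?thesis
  proof eventually_elim
    case (elim j)
    thus ?case using E_le[of j] unfolding A_def by linarith
  qed
qed

theorem log_mean_exp_le: "real n * ln (circle_mean (\<lambda>z. exp (f z))) \<le> Emax"
proof (rule field_le_epsilon)
  fix \<epsilon> :: real assume "\<epsilon> > 0"
  from eventually_energy_ge[OF this] obtain j where
    "Emax \<ge> real n * ln (circle_mean (\<lambda>z. exp (f z))) + ps.high_part j n - \<epsilon>" by (auto simp: eventually_sequentially)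
  thus "real n * ln (circle_mean (\<lambda>z. exp (f z))) \<le> Emax + \<epsilon>" using ps.high_part_nonneg[of j n] by linarith
qed

text \<open>In the case of equality nothing is left for the gain.\<close>

lemma high_part_tendsto_0:
  assumes "real n * ln (circle_mean (\<lambda>z. exp (f z))) = Emax"
  shows "(\<lambda>j. ps.high_part j n) \<longlonglongrightarrow> 0"
proof (rule LIMSEQ_I)
  fix e :: real assume "e > 0"
  hence "eventually (\<lambda>j. Emax \<ge> real n * ln (circle_mean (\<lambda>z. exp (f z))) + ps.high_part j n - e / 2) sequentially"
    by (intro eventually_energy_ge) simp
  hence "eventually (\<lambda>j. norm (ps.high_part j n - 0) < e) sequentially"
  proof eventually_elim
    case (elim j)
    thus ?case using assms ps.high_part_nonneg[of j n] \<open>e > 0\<close> by simp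
  qed
  thus "\<exists>no. \<forall>j\<ge>no. norm (ps.high_part j n - 0) < e" by (simp add: eventually_sequentially)
qed

end

section \<open>The case of equality on the circle\<close>

lemma circle_mean_z_power: "n \<ge> 1 \<Longrightarrow> circle_mean (\<lambda>z. z ^ n) = 0"
  using circle_mean_powers[of n 0] by simp

lemma power_lt_1_beyond_circle:
  assumes "cmod \<xi> < 1" "n \<ge> 1"
  obtains R where "R > 1" "\<And>z. z \<in> ball 0 R \<Longrightarrow> cmod (\<xi> * z ^ n) < 1"
proof -
  have n: "n > 0" using assms by simp
  show ?thesis
  proof (cases "\<xi> = 0")
    case True thus ?thesis using that[of 2] by simp
  next
    case False
    hence "1 < root n (1 / cmod \<xi>)" using assms n by simp
    moreover have "cmod (\<xi> * z ^ n) < 1" if "z \<in> ball 0 (root n (1 / cmod \<xi>))" for z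
    proof -
      have "cmod z ^ n < root n (1 / cmod \<xi>) ^ n" using that n by (intro power_strict_mono) auto
      also have "\<dots> = 1 / cmod \<xi>" using n by simp
      finally show ?thesis using False by (simp add: norm_mult norm_power field_simps)
    qed
    ultimately show ?thesis using that by blast
  qed
qed

lemma Ln_one_minus_holo:
  assumes "\<And>z. z \<in> S \<Longrightarrow> cmod (\<xi> * z ^ n) < 1"
  shows "(\<lambda>z. - Ln (1 - \<xi> * z ^ n)) holomorphic_on S"
proof -
  have "1 - \<xi> * z ^ n \<notin> \<real>\<^sub>\<le>\<^sub>0" if "z \<in> S" for z
    using assms[OF that] complex_Re_le_cmod[of "\<xi> * z ^ n"] by (auto simp: complex_nonpos_Reals_iff)
  thus ?thesis by (intro holomorphic_intros)
qed

lemma one_minus_nonzero: "cmod w < 1 \<Longrightarrow> 1 - w \<noteq> 0"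
  by auto

lemma log_extremal_eq: "cmod w < 1 \<Longrightarrow> ln (1 / (cmod (1 - w))\<^sup>2) = 2 * Re (- Ln (1 - w))"
  using one_minus_nonzero[of w] by (simp add: ln_div ln_realpow)

text \<open>In the case of equality the coefficients of \<open>\<zeta>\<close> of index different from
  \<open>n\<close> tend to 0 in \<open>l\<^sup>2\<close> along the partial sums: those below
  \<open>n\<close> by the moment conditions, those above since the gain vanishes in the limit. A
  subsequence of these functions converges to \<open>\<xi> z\<^sup>n\<close> almost everywhere,
  and the formula for the density becomes \<open>exp f = A (1 - |\<xi>|\<^sup>2) / |1 - \<xi>
  z\<^sup>n|\<^sup>2\<close>. As \<open>f\<close> and \<open>ln |1 - \<xi> z\<^sup>n|\<close> both
  have mean 0, the constant \<open>A (1 - |\<xi>|\<^sup>2)\<close> is 1.\<close>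

lemma (in circle_function_moments) equality_imp_extremal:
  assumes eq: "real n * ln (circle_mean (\<lambda>z. exp (f z))) = Emax"
  shows "\<exists>\<xi>. cmod \<xi> < 1 \<and> (AE \<theta> in angle_measure. f (cis \<theta>) = ln (1 / (cmod (1 - \<xi> * cis \<theta> ^ n))\<^sup>2))"
proof -
  define A where "A = circle_mean (\<lambda>z. exp (f z))"
  have A1: "A \<ge> 1" unfolding A_def by (rule mean_exp_ge_1)
  define c where "c j = fourier_coeff (ps.\<zeta> j) n" for j
  define v where "v j z = (cmod (ps.\<zeta> j z - c j * z ^ n))\<^sup>2" for j z
  have v_mean: "circle_mean (v j) = ps.high_part j n + (\<Sum>k<n. (norm (fourier_coeff (ps.\<zeta> j) k))\<^sup>2)" for j
  proof -
    note cont = ps.\<zeta>_cont[of j]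
    have "circle_mean (v j) = circle_mean (\<lambda>z. (norm (ps.\<zeta> j z))\<^sup>2 - (2 * Re (cnj (c j) * (ps.\<zeta> j z * cnj z ^ n)) - (cmod (c j))\<^sup>2))"
    proof (rule circle_mean_cong)
      fix z :: complex assume z: "norm z = 1"
      have "(cmod (x - y))\<^sup>2 = (cmod x)\<^sup>2 - (2 * Re (x * cnj y) - (cmod y)\<^sup>2)" for x y
        unfolding cmod_power2 by (simp add: power2_eq_square algebra_simps)
      from this[of "ps.\<zeta> j z" "c j * z ^ n"]
      show "v j z = (norm (ps.\<zeta> j z))\<^sup>2 - (2 * Re (cnj (c j) * (ps.\<zeta> j z * cnj z ^ n)) - (cmod (c j))\<^sup>2)"
        using z by (simp add: v_def norm_mult norm_power mult_ac)
    qed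
    also have "\<dots> = circle_mean (\<lambda>z. (norm (ps.\<zeta> j z))\<^sup>2) - (circle_mean (\<lambda>z. 2 * Re (cnj (c j) * (ps.\<zeta> j z * cnj z ^ n))) - circle_mean (\<lambda>z. (cmod (c j))\<^sup>2))"
      by (subst circle_mean_diff; (intro circle_integrable_continuous continuous_intros cont)?)+ (rule refl)
    also have "circle_mean (\<lambda>z. 2 * Re (cnj (c j) * (ps.\<zeta> j z * cnj z ^ n))) = 2 * Re (cnj (c j) * c j)"
    proof -
      have "circle_mean (\<lambda>z. 2 * Re (cnj (c j) * (ps.\<zeta> j z * cnj z ^ n)))
          = 2 * Re (circle_mean (\<lambda>z. cnj (c j) * (ps.\<zeta> j z * cnj z ^ n)))"
        unfolding circle_mean_mult_left[of 2]
        by (subst circle_mean_Re; (intro circle_integrable_continuous continuous_intros cont)?) (rule refl)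
      also have "circle_mean (\<lambda>z. cnj (c j) * (ps.\<zeta> j z * cnj z ^ n)) = cnj (c j) * c j"
        unfolding circle_mean_mult_left c_def fourier_coeff_def ..
      finally show ?thesis .
    qed
    also have "cnj (c j) * c j = of_real ((cmod (c j))\<^sup>2)" by (simp only: complex_norm_square mult.commute)
    finally show ?thesis unfolding ps.high_part_def c_def lessThan_Suc_atMost[symmetric] by simp
  qed
  have "(\<lambda>j. circle_mean (v j)) \<longlonglongrightarrow> 0 + (\<Sum>k<n. (norm (0::complex))\<^sup>2)"
    unfolding v_mean by (intro tendsto_intros high_part_tendsto_0 eq seq.coeff_tendsto_0) auto
  hence v0: "(\<lambda>j. circle_mean (v j)) \<longlonglongrightarrow> 0" by simp
  have "bounded (range c)" unfolding bounded_iff c_def using ps.\<zeta>_coeff_le[of _ 1] by auto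
  then obtain \<xi> s where s: "strict_mono s" "(c \<circ> s) \<longlonglongrightarrow> \<xi>" using bounded_imp_convergent_subsequence by blast
  have v_int: "circle_integrable (v j)" for j unfolding v_def by (intro circle_integrable_continuous continuous_intros ps.\<zeta>_cont)
  \<comment> \<open>One subsequence has to serve both for \<open>\<zeta>\<close> and for the partial sums of
    \<open>f\<close>, so the two squared errors are added.\<close>
  define g where "g j \<theta> = v j (cis \<theta>) + (f (cis \<theta>) - 2 * Re (partial_sum f j (cis \<theta>)))\<^sup>2" for j \<theta>
  have g_int: "integrable angle_measure (g j)" for j unfolding g_def by (intro Bochner_Integration.integrable_add v_int sq_integrable_diff)
  have "(\<lambda>j. (LINT \<theta>|angle_measure. v j (cis \<theta>)) + (LINT \<theta>|angle_measure. (f (cis \<theta>) - 2 * Re (partial_sum f j (cis \<theta>)))\<^sup>2)) \<longlonglongrightarrow> 0 + 0"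
    using tendsto_mult_left[OF v0, of "2 * pi"] by (intro tendsto_add L2_tendsto) (simp add: circle_mean_def)
  hence "(\<lambda>j. LINT \<theta>|angle_measure. g j \<theta>) \<longlonglongrightarrow> 0"
    unfolding g_def by (subst Bochner_Integration.integral_add[OF v_int sq_integrable_diff]) simp
  hence "(\<lambda>j. LINT \<theta>|angle_measure. g (s j) \<theta>) \<longlonglongrightarrow> 0" using LIMSEQ_subseq_LIMSEQ[OF _ s(1)] by (simp add: o_def)
  moreover have g_nn: "g j \<theta> \<ge> 0" for j \<theta> by (simp add: g_def v_def)
  ultimately have "\<exists>r. strict_mono r \<and> (AE \<theta> in angle_measure. (\<lambda>j. g (s (r j)) \<theta>) \<longlonglongrightarrow> 0)"
    by (intro tendsto_L1_AE_subseq[of angle_measure "\<lambda>j. g (s j)"]) (simp_all add: g_int)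
  then obtain r where r: "strict_mono r" "AE \<theta> in angle_measure. (\<lambda>j. g (s (r j)) \<theta>) \<longlonglongrightarrow> 0" by blast
  define t where "t j = s (r j)" for j
  have t: "strict_mono t" unfolding t_def using s(1) r(1) by (simp add: strict_mono_def)
  have ct: "(\<lambda>j. c (t j)) \<longlonglongrightarrow> \<xi>" using LIMSEQ_subseq_LIMSEQ[OF s(2) r(1)] by (simp add: t_def o_def)
  have At: "(\<lambda>j. ps.A (t j)) \<longlonglongrightarrow> A" using LIMSEQ_subseq_LIMSEQ[OF A_tendsto t] by (simp add: A_def o_def)
  have ae: "AE \<theta> in angle_measure. exp (f (cis \<theta>)) * (cmod (1 - \<xi> * cis \<theta> ^ n))\<^sup>2 = A * (1 - (cmod \<xi>)\<^sup>2)"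
    using r(2)
  proof eventually_elim
    case (elim \<theta>)
    define z where "z = cis \<theta>"
    have z: "norm z = 1" by (simp add: z_def)
    have g0: "(\<lambda>j. g (t j) \<theta>) \<longlonglongrightarrow> 0" using elim by (simp add: t_def)
    have "(\<lambda>j. v (t j) z) \<longlonglongrightarrow> 0" by (rule Lim_null_comparison[OF _ g0]) (simp add: g_def v_def z_def)
    hence "(\<lambda>j. sqrt (v (t j) z)) \<longlonglongrightarrow> sqrt 0" by (rule tendsto_real_sqrt)
    hence "(\<lambda>j. ps.\<zeta> (t j) z - c (t j) * z ^ n) \<longlonglongrightarrow> 0" by (simp add: v_def tendsto_norm_zero_iff)
    from tendsto_add[OF this tendsto_mult_right[OF ct, of "z ^ n"]]
    have \<zeta>lim: "(\<lambda>j. ps.\<zeta> (t j) z) \<longlonglongrightarrow> \<xi> * z ^ n" by simp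
    have "(\<lambda>j. (f z - 2 * Re (partial_sum f (t j) z))\<^sup>2) \<longlonglongrightarrow> 0"
      by (rule Lim_null_comparison[OF _ g0]) (simp add: g_def v_def z_def)
    hence "(\<lambda>j. sqrt ((f z - 2 * Re (partial_sum f (t j) z))\<^sup>2)) \<longlonglongrightarrow> sqrt 0" by (rule tendsto_real_sqrt)
    hence "(\<lambda>j. f z - 2 * Re (partial_sum f (t j) z)) \<longlonglongrightarrow> 0" by (simp add: tendsto_rabs_zero_iff)
    from tendsto_diff[OF tendsto_const[of "f z"] this]
    have "(\<lambda>j. 2 * Re (partial_sum f (t j) z)) \<longlonglongrightarrow> f z" by simp
    hence wlim: "(\<lambda>j. ps.w (t j) z) \<longlonglongrightarrow> exp (f z)" unfolding ps.w_eq_exp by (intro tendsto_intros)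
    have "ps.w j z * (cmod (1 - ps.\<zeta> j z))\<^sup>2 = ps.A j * (1 - (cmod (ps.\<zeta> j z))\<^sup>2)" for j
    proof -
      have U: "ps.U j z \<noteq> 0" by (rule ps.U_nonzero[OF ps.circle_in_rad[OF z]])
      hence c1: "cmod (1 - ps.\<zeta> j z) = ps.A j / cmod (ps.U j z)"
        using ps.A_pos[of j] by (simp add: ps.\<zeta>_def norm_divide)
      show ?thesis unfolding ps.w_eq_\<zeta>[OF z] c1 using U ps.A_pos[of j] by (simp add: power_divide power2_eq_square)
    qed
    moreover have "(\<lambda>j. ps.w (t j) z * (cmod (1 - ps.\<zeta> (t j) z))\<^sup>2) \<longlonglongrightarrow> exp (f z) * (cmod (1 - \<xi> * z ^ n))\<^sup>2"
      by (intro tendsto_intros wlim \<zeta>lim)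
    moreover have "(\<lambda>j. ps.A (t j) * (1 - (cmod (ps.\<zeta> (t j) z))\<^sup>2)) \<longlonglongrightarrow> A * (1 - (cmod (\<xi> * z ^ n))\<^sup>2)"
      by (intro tendsto_intros At \<zeta>lim)
    ultimately have "exp (f z) * (cmod (1 - \<xi> * z ^ n))\<^sup>2 = A * (1 - (cmod (\<xi> * z ^ n))\<^sup>2)" using LIMSEQ_unique by simp
    thus ?case using z by (simp add: z_def[symmetric] norm_mult norm_power)
  qed
  have "cmod \<xi> \<le> 1"
    by (rule LIMSEQ_le_const2[OF tendsto_norm[OF ct]]) (use ps.\<zeta>_coeff_le[of _ 1] in \<open>auto simp: c_def\<close>)
  \<comment> \<open>If \<open>|\<xi>| = 1\<close>, then \<open>\<xi> z\<^sup>n = 1\<close> almost everywhere on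
    the circle, although the mean of \<open>z\<^sup>n\<close> is 0.\<close>
  moreover have "cmod \<xi> \<noteq> 1"
  proof
    assume "cmod \<xi> = 1"
    with ae have "AE \<theta> in angle_measure. \<xi> * cis \<theta> ^ n = 1" by simp
    hence "(LINT \<theta>|angle_measure. \<xi> * cis \<theta> ^ n) = (LINT \<theta>|angle_measure. 1)"
      by (intro integral_cong_AE borel_measurable_integrable circle_integrable_continuous[of "\<lambda>z. \<xi> * z ^ n"]
          circle_integrable_continuous[of "\<lambda>z. 1"] continuous_intros)
    hence "circle_mean (\<lambda>z. \<xi> * z ^ n) = circle_mean (\<lambda>z. 1)" unfolding circle_mean_def by (rule arg_cong)
    thus False unfolding circle_mean_mult_left using circle_mean_z_power[OF n] by simp
  qed
  ultimately have \<xi>: "cmod \<xi> < 1" by simp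
  have lt: "cmod (\<xi> * z ^ n) < 1" if "cmod z = 1" for z using \<xi> that by (simp add: norm_mult norm_power)
  define C where "C = ln (A * (1 - (cmod \<xi>)\<^sup>2))"
  have C: "exp C = A * (1 - (cmod \<xi>)\<^sup>2)" using A1 \<xi> by (simp add: C_def abs_square_less_1)
  have ae2: "AE \<theta> in angle_measure. f (cis \<theta>) = C + 2 * Re (- Ln (1 - \<xi> * cis \<theta> ^ n))"
    using ae
  proof eventually_elim
    case (elim \<theta>)
    have l: "cmod (\<xi> * cis \<theta> ^ n) < 1" by (rule lt) simp
    have nz: "1 - \<xi> * cis \<theta> ^ n \<noteq> 0" by (rule one_minus_nonzero[OF l])
    have "exp (f (cis \<theta>)) = exp C * (1 / (cmod (1 - \<xi> * cis \<theta> ^ n))\<^sup>2)"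
      using elim nz by (simp add: C field_simps)
    also have "1 / (cmod (1 - \<xi> * cis \<theta> ^ n))\<^sup>2 = exp (ln (1 / (cmod (1 - \<xi> * cis \<theta> ^ n))\<^sup>2))"
      using nz by simp
    finally have "exp (f (cis \<theta>)) = exp (C + 2 * Re (- Ln (1 - \<xi> * cis \<theta> ^ n)))"
      unfolding log_extremal_eq[OF l] by (simp only: exp_add)
    thus ?case by simp
  qed
  obtain R where R: "R > 1" "\<And>z. z \<in> ball 0 R \<Longrightarrow> cmod (\<xi> * z ^ n) < 1" using power_lt_1_beyond_circle[OF \<xi> n] by blast
  define G where "G z = - Ln (1 - \<xi> * z ^ n)" for z
  have G: "G holomorphic_on ball 0 R" unfolding G_def by (rule Ln_one_minus_holo[OF R(2)])
  have Gc: "continuous_on (sphere 0 1) G" by (rule circle_continuous_holomorphic[OF G R(1)])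
  have "circle_mean f = circle_mean (\<lambda>z. C + 2 * Re (G z))"
    unfolding circle_mean_def using ae2
    by (intro arg_cong[of _ _ "\<lambda>x. _ *\<^sub>R x"] integral_cong_AE f_measurable borel_measurable_integrable
        circle_integrable_continuous[of "\<lambda>z. C + 2 * Re (G z)"] continuous_intros Gc) (simp add: G_def)
  also have "\<dots> = C + 2 * Re (circle_mean G)"
    by (subst circle_mean_add; (intro circle_integrable_continuous continuous_intros Gc)?)
       (simp add: circle_mean_mult_left circle_mean_Re[OF circle_integrable_continuous[OF Gc]])
  also have "circle_mean G = 0" using circle_mean_holomorphic[OF G R(1)] n by (simp add: G_def zero_power)
  finally have "C = 0" using mean by simp
  have "AE \<theta> in angle_measure. f (cis \<theta>) = ln (1 / (cmod (1 - \<xi> * cis \<theta> ^ n))\<^sup>2)"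
    using ae2
  proof eventually_elim
    case (elim \<theta>)
    have "cmod (\<xi> * cis \<theta> ^ n) < 1" by (rule lt) simp
    from log_extremal_eq[OF this] show ?case using elim \<open>C = 0\<close> by simp
  qed
  with \<xi> show ?thesis by blast
qed

section \<open>The extremal functions on the circle\<close>

lemma strided_sums:
  fixes a :: "nat \<Rightarrow> 'a::real_normed_vector"
  assumes "n \<ge> 1" "a sums s"
  shows "(\<lambda>k. if n dvd k then a (k div n) else 0) sums s"
proof -
  have "strict_mono (\<lambda>l. n * l)" using assms(1) by (simp add: strict_mono_def)
  moreover have "(\<lambda>k. if n dvd k then a (k div n) else 0) (n * l) = a l" for l using assms(1) by simp
  ultimately show ?thesis using assms(2) sums_mono_reindex[of "\<lambda>l. n * l" "\<lambda>k. if n dvd k then a (k div n) else 0" s]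
    by (auto simp: image_iff dvd_def)
qed

text \<open>The logarithmic series of \<open>\<xi> z\<^sup>n\<close>, as a power series in \<open>z\<close>.\<close>

lemma log_extremal_coeff:
  assumes \<xi>: "cmod \<xi> < 1" and n: "n \<ge> 1"
  shows "fourier_coeff (\<lambda>z. - Ln (1 - \<xi> * z ^ n)) k = (if n dvd k then \<xi> ^ (k div n) / of_nat (k div n) else 0)"
    and "\<And>z. cmod z \<le> 1 \<Longrightarrow> (\<lambda>k. (if n dvd k then \<xi> ^ (k div n) / of_nat (k div n) else 0) * z ^ k) sums (- Ln (1 - \<xi> * z ^ n))"
    and "summable (\<lambda>k. real k * cmod (if n dvd k then \<xi> ^ (k div n) / of_nat (k div n) else 0))"
proof -
  have lt: "cmod (\<xi> * z ^ n) < 1" if "cmod z \<le> 1" for z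
  proof -
    have "cmod \<xi> * cmod z ^ n \<le> cmod \<xi> * 1" using that by (intro mult_left_mono power_le_one) auto
    thus ?thesis using \<xi> by (simp add: norm_mult norm_power)
  qed
  show sums: "(\<lambda>k. (if n dvd k then \<xi> ^ (k div n) / of_nat (k div n) else 0) * z ^ k) sums (- Ln (1 - \<xi> * z ^ n))" if z: "cmod z \<le> 1" for z
  proof -
    have "(\<lambda>l. (-1) ^ Suc l / of_nat l * (- (\<xi> * z ^ n)) ^ l) sums Ln (1 + (- (\<xi> * z ^ n)))"
      using lt[OF z] by (intro Ln_series) simp
    hence "(\<lambda>l. - ((-1) ^ Suc l / of_nat l * (- (\<xi> * z ^ n)) ^ l)) sums (- Ln (1 - \<xi> * z ^ n))"
      by (intro sums_minus) simp
    hence "(\<lambda>l. (\<xi> * z ^ n) ^ l / of_nat l) sums (- Ln (1 - \<xi> * z ^ n))" unfolding neg_Ln_series_term .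
    from strided_sums[OF n this]
    have "(\<lambda>k. if n dvd k then (\<xi> * z ^ n) ^ (k div n) / of_nat (k div n) else 0) sums (- Ln (1 - \<xi> * z ^ n))" .
    moreover have "(if n dvd k then (\<xi> * z ^ n) ^ (k div n) / of_nat (k div n) else 0)
       = (if n dvd k then \<xi> ^ (k div n) / of_nat (k div n) else 0) * z ^ k" for k
      by (auto simp: power_mult_distrib power_mult[symmetric])
    ultimately show ?thesis by simp
  qed
  have "summable (\<lambda>l. real n * cmod \<xi> ^ l)" using \<xi> by (intro summable_mult summable_geometric) simp
  hence "(\<lambda>l. real n * cmod \<xi> ^ l) sums (\<Sum>l. real n * cmod \<xi> ^ l)" by (rule summable_sums)
  from strided_sums[OF n this]
  have S: "summable (\<lambda>k. if n dvd k then real n * cmod \<xi> ^ (k div n) else 0)" by (rule sums_summable)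
  show S1: "summable (\<lambda>k. real k * cmod (if n dvd k then \<xi> ^ (k div n) / of_nat (k div n) else 0))"
    by (rule summable_comparison_test'[OF S]) (use n in \<open>auto simp: norm_divide norm_power elim!: dvdE\<close>)
  show "fourier_coeff (\<lambda>z. - Ln (1 - \<xi> * z ^ n)) k = (if n dvd k then \<xi> ^ (k div n) / of_nat (k div n) else 0)"
  proof (rule fourier_coeff_power_series)
    show "summable (\<lambda>k. norm (if n dvd k then \<xi> ^ (k div n) / of_nat (k div n) else 0))"
    proof (rule summable_comparison_test'[OF S1])
      fix k :: nat
      show "norm (norm (if n dvd k then \<xi> ^ (k div n) / of_nat (k div n) else 0)) \<le> real k * norm (if n dvd k then \<xi> ^ (k div n) / of_nat (k div n) else 0)"
        by (cases "k = 0") (auto simp: mult_le_cancel_right1)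
    qed
    obtain R where R: "R > 1" "\<And>z. z \<in> ball 0 R \<Longrightarrow> cmod (\<xi> * z ^ n) < 1" using power_lt_1_beyond_circle[OF \<xi> n] by blast
    show "continuous_on (sphere 0 1) (\<lambda>z. - Ln (1 - \<xi> * z ^ n))"
      by (rule circle_continuous_holomorphic[OF Ln_one_minus_holo[OF R(2)] R(1)])
  qed (rule sums, simp)
qed

text \<open>At index \<open>n l\<close> the term is \<open>n |\<xi>|\<^sup>2\<^sup>l / l\<close>.\<close>

lemma extremal_energy:
  assumes \<xi>: "cmod \<xi> < 1" and n: "n \<ge> 1"
  shows "(\<lambda>k. real k * (cmod (fourier_coeff (\<lambda>z. - Ln (1 - \<xi> * z ^ n)) k))\<^sup>2) sums (real n * ln (1 / (1 - (cmod \<xi>)\<^sup>2)))"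
proof -
  define x where "x = (cmod \<xi>)\<^sup>2"
  have x: "0 \<le> x" "x < 1" using \<xi> by (auto simp: x_def abs_square_less_1)
  have "(\<lambda>l. (-1) ^ Suc l / of_nat l * (- complex_of_real x) ^ l) sums Ln (1 + (- complex_of_real x))"
    using x by (intro Ln_series) simp
  hence "(\<lambda>l. - ((-1) ^ Suc l / of_nat l * (- complex_of_real x) ^ l)) sums (- Ln (1 - complex_of_real x))"
    by (intro sums_minus) simp
  hence "(\<lambda>l. of_real x ^ l / of_nat l) sums (- Ln (1 - complex_of_real x))" unfolding neg_Ln_series_term .
  moreover have "- Ln (1 - complex_of_real x) = of_real (ln (1 / (1 - x)))"
    using x Ln_of_real[of "1 - x"] by (simp add: ln_div)
  ultimately have "(\<lambda>l. complex_of_real (x ^ l / real l)) sums of_real (ln (1 / (1 - x)))" by simp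
  hence "(\<lambda>l. x ^ l / real l) sums ln (1 / (1 - x))" by (simp only: sums_of_real_iff)
  hence "(\<lambda>l. real n * (x ^ l / real l)) sums (real n * ln (1 / (1 - x)))" by (rule sums_mult)
  from strided_sums[OF n this]
  have "(\<lambda>k. if n dvd k then real n * (x ^ (k div n) / real (k div n)) else 0) sums (real n * ln (1 / (1 - x)))" .
  moreover have "(if n dvd k then real n * (x ^ (k div n) / real (k div n)) else 0)
     = real k * (cmod (fourier_coeff (\<lambda>z. - Ln (1 - \<xi> * z ^ n)) k))\<^sup>2" for k
  proof (cases "n dvd k")
    case True
    then obtain l where l: "k = n * l" by (elim dvdE)
    have "x ^ l = (cmod \<xi> ^ l)\<^sup>2" by (simp add: x_def power_mult[symmetric] mult.commute)
    thus ?thesis using n by (simp add: log_extremal_coeff(1)[OF \<xi> n] l norm_divide norm_power power_divide power2_eq_square)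
  qed (simp add: log_extremal_coeff(1)[OF \<xi> n])
  ultimately show ?thesis by (simp add: x_def)
qed

text \<open>The function \<open>(1 - |\<xi>|\<^sup>2) / |1 - \<xi> z\<^sup>n|\<^sup>2\<close> is a Poisson
  kernel: on the circle it is the real part of \<open>(1 + \<xi> z\<^sup>n) / (1 - \<xi>
  z\<^sup>n)\<close>, which is 1 at the origin.\<close>

lemma extremal_mean_exp:
  assumes \<xi>: "cmod \<xi> < 1" and n: "n \<ge> 1"
  shows "circle_mean (\<lambda>z. exp (ln (1 / (cmod (1 - \<xi> * z ^ n))\<^sup>2))) = 1 / (1 - (cmod \<xi>)\<^sup>2)"
proof -
  obtain R where R: "R > 1" "\<And>z. z \<in> ball 0 R \<Longrightarrow> cmod (\<xi> * z ^ n) < 1" using power_lt_1_beyond_circle[OF \<xi> n] by blast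
  define h where "h z = (1 + \<xi> * z ^ n) / (1 - \<xi> * z ^ n)" for z
  have h: "h holomorphic_on ball 0 R" unfolding h_def using one_minus_nonzero[OF R(2)] by (intro holomorphic_intros) auto
  have x: "(cmod \<xi>)\<^sup>2 < 1" using \<xi> by (simp add: abs_square_less_1)
  have "circle_mean (\<lambda>z. exp (ln (1 / (cmod (1 - \<xi> * z ^ n))\<^sup>2))) = circle_mean (\<lambda>z. 1 / (1 - (cmod \<xi>)\<^sup>2) * Re (h z))"
  proof (rule circle_mean_cong)
    fix z :: complex assume z: "cmod z = 1"
    define y where "y = \<xi> * z ^ n"
    have y: "cmod y = cmod \<xi>" using z by (simp add: y_def norm_mult norm_power)
    hence nz: "1 - y \<noteq> 0" using \<xi> by auto
    have "Re ((1 + y) / (1 - y)) = (1 - (cmod y)\<^sup>2) / (cmod (1 - y))\<^sup>2"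
      unfolding Re_divide' cmod_power2 by (simp add: power2_eq_square algebra_simps)
    thus "exp (ln (1 / (cmod (1 - \<xi> * z ^ n))\<^sup>2)) = 1 / (1 - (cmod \<xi>)\<^sup>2) * Re (h z)"
      using x nz unfolding h_def y_def[symmetric] y by simp
  qed
  also have "\<dots> = 1 / (1 - (cmod \<xi>)\<^sup>2) * Re (circle_mean h)"
    unfolding circle_mean_mult_left
    by (subst circle_mean_Re) (auto intro!: circle_integrable_continuous circle_continuous_holomorphic[OF h R(1)])
  also have "circle_mean h = 1" using circle_mean_holomorphic[OF h R(1)] n by (simp add: h_def zero_power)
  finally show ?thesis by simp
qed

section \<open>Smooth functions\<close>

lemma smooth_differentiable: "smooth f \<Longrightarrow> f differentiable (at x)"
  by (erule smooth.cases) auto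

lemma smooth_frechet: "smooth f \<Longrightarrow> smooth (\<lambda>x. frechet_derivative f (at x) v)"
  by (erule smooth.cases) auto

lemma smooth_has_derivative: "smooth f \<Longrightarrow> (f has_derivative frechet_derivative f (at x)) (at x)"
  using smooth_differentiable frechet_derivative_works by blast

lemma smooth_continuous_on: "smooth f \<Longrightarrow> continuous_on S f"
  by (meson smooth_differentiable differentiable_imp_continuous_within continuous_at_imp_continuous_on)

lemma smooth_borel: "smooth f \<Longrightarrow> f \<in> borel_measurable borel"
  by (intro borel_measurable_continuous_onI smooth_continuous_on)

lemma frechet_linear: "smooth f \<Longrightarrow> linear (frechet_derivative f (at x))"
  using smooth_has_derivative has_derivative_linear by blast

lemma frechetI: "(f has_derivative f') (at x) \<Longrightarrow> frechet_derivative f (at x) v = f' v"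
  using frechet_derivative_at by metis

text \<open>Smoothness is defined coinductively, so the smoothness of products is shown by exhibiting a
  class of functions that contains them and is closed under directional derivatives. By Leibniz'
  rule, sums of products of smooth functions form such a class.\<close>

inductive product_sum :: "('a::euclidean_space \<Rightarrow> real) \<Rightarrow> bool" where
  prod: "smooth g \<Longrightarrow> smooth h \<Longrightarrow> product_sum (\<lambda>x. g x * h x)"
| sum: "product_sum f \<Longrightarrow> product_sum g \<Longrightarrow> product_sum (\<lambda>x. f x + g x)"

lemma product_sum_step:
  "product_sum f \<Longrightarrow> (\<forall>x. f differentiable (at x)) \<and> (\<forall>v. product_sum (\<lambda>x. frechet_derivative f (at x) v))"
proof (induction rule: product_sum.induct)
  case (prod g h)
  have d: "((\<lambda>x. g x * h x) has_derivative (\<lambda>v. g x * frechet_derivative h (at x) v + frechet_derivative g (at x) v * h x)) (at x)" for x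
    by (rule has_derivative_mult) (use prod smooth_has_derivative in blast)+
  have "(\<lambda>x. frechet_derivative (\<lambda>x. g x * h x) (at x) v) = (\<lambda>x. g x * frechet_derivative h (at x) v + frechet_derivative g (at x) v * h x)" for v
    by (rule ext) (rule frechetI[OF d])
  moreover have "product_sum (\<lambda>x. g x * frechet_derivative h (at x) v + frechet_derivative g (at x) v * h x)" for v
    by (intro product_sum.intros prod smooth_frechet)
  ultimately show ?case using d unfolding differentiable_def by auto
next
  case (sum f g)
  have d: "((\<lambda>x. f x + g x) has_derivative (\<lambda>v. frechet_derivative f (at x) v + frechet_derivative g (at x) v)) (at x)" for x
    by (rule has_derivative_add) (use sum.IH frechet_derivative_works in blast)+
  have "(\<lambda>x. frechet_derivative (\<lambda>x. f x + g x) (at x) v) = (\<lambda>x. frechet_derivative f (at x) v + frechet_derivative g (at x) v)" for v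
    by (rule ext) (rule frechetI[OF d])
  thus ?case using d sum.IH unfolding differentiable_def by (auto intro!: product_sum.sum)
qed

lemma product_sum_smooth: "product_sum f \<Longrightarrow> smooth f"
proof (coinduction arbitrary: f)
  case smooth
  thus ?case using product_sum_step[of f] by auto
qed

lemma smooth_mult: "smooth f \<Longrightarrow> smooth g \<Longrightarrow> smooth (\<lambda>x. f x * g x)"
  by (rule product_sum_smooth[OF product_sum.prod])

lemma smooth_const: "smooth (\<lambda>x. c)"
proof (coinduction arbitrary: c)
  case smooth
  show ?case by (intro exI[of _ "\<lambda>x. c"]) (auto simp: frechet_derivative_const)
qed

lemma smooth_add:
  assumes "smooth f" "smooth g"
  shows "smooth (\<lambda>x. f x + g x)"
  using product_sum_smooth[OF product_sum.sum[OF product_sum.prod[OF assms(1) smooth_const[of 1]] product_sum.prod[OF assms(2) smooth_const[of 1]]]]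
  by simp

lemma smooth_cmult: "smooth f \<Longrightarrow> smooth (\<lambda>x. c * f x)"
  by (rule smooth_mult[OF smooth_const])

lemma smooth_diff:
  assumes "smooth f" "smooth g"
  shows "smooth (\<lambda>x. f x - g x)"
  using smooth_add[OF assms(1) smooth_cmult[OF assms(2), of "-1"]] by simp

lemma smooth_linear:
  assumes "bounded_linear f"
  shows "smooth f"
proof (rule smooth.intros)
  have d: "(f has_derivative f) (at x)" for x using assms by (rule bounded_linear_imp_has_derivative)
  show "f differentiable (at x)" for x using d unfolding differentiable_def by blast
  have "(\<lambda>x. frechet_derivative f (at x) v) = (\<lambda>x. f v)" for v by (rule ext) (rule frechetI[OF d])
  thus "smooth (\<lambda>x. frechet_derivative f (at x) v)" for v by (simp add: smooth_const)
qed

lemma has_derivative_affine: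
  fixes g :: "'a::euclidean_space \<Rightarrow> real"
  assumes "smooth g"
  shows "((\<lambda>x. g (s *\<^sub>R x + b)) has_derivative (\<lambda>v. s * frechet_derivative g (at (s *\<^sub>R x + b)) v)) (at x)"
proof -
  have "((\<lambda>x. s *\<^sub>R x + b) has_derivative (\<lambda>v. s *\<^sub>R v)) (at x)" by (auto intro!: derivative_eq_intros)
  from has_derivative_compose[OF this smooth_has_derivative[OF assms]]
  show ?thesis using linear_scale[OF frechet_linear[OF assms]] by simp
qed

lemma smooth_affine:
  assumes "smooth g"
  shows "smooth (\<lambda>x. g (s *\<^sub>R x + b))"
proof -
  have "smooth f" if "\<exists>g t. smooth g \<and> f = (\<lambda>x. t * g (s *\<^sub>R x + b))" for f
    using that
  proof (coinduction arbitrary: f)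
    case smooth
    then obtain g t where g: "smooth g" "f = (\<lambda>x. t * g (s *\<^sub>R x + b))" by blast
    have d: "(f has_derivative (\<lambda>v. t * (s * frechet_derivative g (at (s *\<^sub>R x + b)) v))) (at x)" for x
      unfolding g(2) by (rule has_derivative_mult_right[OF has_derivative_affine[OF g(1)]])
    have "(\<lambda>x. frechet_derivative f (at x) v) = (\<lambda>x. (t * s) * frechet_derivative g (at (s *\<^sub>R x + b)) v)" for v
      by (rule ext) (simp add: frechetI[OF d])
    hence "\<exists>g t. smooth g \<and> (\<lambda>x. frechet_derivative f (at x) v) = (\<lambda>x. t * g (s *\<^sub>R x + b))" for v
      using smooth_frechet[OF g(1)] by blast
    moreover have "f differentiable (at x)" for x using d unfolding differentiable_def by blast
    ultimately show ?case by blast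
  qed
  moreover have "\<exists>h t. smooth h \<and> (\<lambda>x. g (s *\<^sub>R x + b)) = (\<lambda>x. t * h (s *\<^sub>R x + b))"
    using assms by (intro exI[of _ g] exI[of _ 1]) auto
  ultimately show ?thesis by blast
qed

section \<open>A smooth bump function\<close>

text \<open>The functions \<open>p (1 / t) exp (- 1 / t)\<close>, extended by 0 to \<open>t \<le> 0\<close>.
  With arbitrary polynomials \<open>p\<close> they are closed under differentiation.\<close>

definition flat_exp :: "real poly \<Rightarrow> real \<Rightarrow> real" where
  "flat_exp p t = (if t > 0 then poly p (1 / t) * exp (- (1 / t)) else 0)"

lemma poly_exp_tendsto_0: "((\<lambda>s::real. poly p s * exp (- s)) \<longlongrightarrow> 0) at_top"
proof -
  have "((\<lambda>s. \<Sum>k\<le>degree p. coeff p k * (s ^ k / exp s)) \<longlongrightarrow> (\<Sum>k\<le>degree p. coeff p k * 0)) at_top"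
    by (intro tendsto_intros tendsto_power_div_exp_0)
  thus ?thesis by (simp add: poly_altdef sum_distrib_right exp_minus divide_inverse mult.assoc)
qed

lemma flat_exp_deriv:
  "(flat_exp p has_real_derivative flat_exp ([:0,0,1:] * (p - pderiv p)) t) (at t)"
proof -
  consider "t > 0" | "t < 0" | "t = 0" by linarith
  thus ?thesis
  proof cases
    case 1
    have "((\<lambda>t. poly p (1 / t) * exp (- (1 / t))) has_real_derivative flat_exp ([:0,0,1:] * (p - pderiv p)) t) (at t)"
    proof -
      have "((\<lambda>t::real. 1 / t) has_real_derivative - (1 / t\<^sup>2)) (at t)"
        using 1 by (auto intro!: derivative_eq_intros simp: power2_eq_square)
      from DERIV_chain2[OF poly_DERIV this]
      have "((\<lambda>t. poly p (1 / t)) has_real_derivative poly (pderiv p) (1 / t) * - (1 / t\<^sup>2)) (at t)" .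
      moreover have "((\<lambda>t. exp (- (1 / t))) has_real_derivative exp (- (1 / t)) * (1 / t\<^sup>2)) (at t)"
        using 1 by (auto intro!: derivative_eq_intros simp: power2_eq_square)
      ultimately show ?thesis using 1
        by (auto intro!: derivative_eq_intros simp: flat_exp_def power2_eq_square algebra_simps)
    qed
    thus ?thesis
      by (rule has_field_derivative_transform_within_open[of _ _ _ "{0<..}"]) (use 1 in \<open>auto simp: flat_exp_def\<close>)
  next
    case 2
    have "((\<lambda>t. 0) has_real_derivative flat_exp ([:0,0,1:] * (p - pderiv p)) t) (at t)"
      using 2 by (simp add: flat_exp_def)
    thus ?thesis
      by (rule has_field_derivative_transform_within_open[of _ _ _ "{..<0}"]) (use 2 in \<open>auto simp: flat_exp_def\<close>)
  next
    \<comment> \<open>At 0 the difference quotient from the right is again a function of this kind, with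
      \<open>p\<close> multiplied by its argument.\<close>
    case 3
    have "((\<lambda>s. poly ([:0,1:] * p) s * exp (- s)) \<longlongrightarrow> 0) at_top" by (rule poly_exp_tendsto_0)
    hence "((\<lambda>h. poly ([:0,1:] * p) (inverse h) * exp (- inverse h)) \<longlongrightarrow> 0) (at_right 0)"
      by (rule filterlim_compose[OF _ filterlim_inverse_at_top_right])
    hence "((\<lambda>h. flat_exp p h / h) \<longlongrightarrow> 0) (at_right 0)"
      by (rule Lim_transform_eventually) (auto simp: flat_exp_def divide_inverse eventually_at_filter)
    moreover have "((\<lambda>h. flat_exp p h / h) \<longlongrightarrow> 0) (at_left 0)"
      by (rule Lim_transform_eventually[OF tendsto_const]) (auto simp: flat_exp_def eventually_at_filter)
    ultimately have "((\<lambda>h. flat_exp p h / h) \<longlongrightarrow> 0) (at 0)" by (simp add: filterlim_at_split)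
    thus ?thesis using 3 by (simp add: DERIV_def flat_exp_def)
  qed
qed

text \<open>Again a class of functions closed under directional derivatives; it contains the bump function.\<close>

inductive flat_sum :: "('a::euclidean_space \<Rightarrow> real) \<Rightarrow> bool" where
  prod: "smooth q \<Longrightarrow> flat_sum (\<lambda>x. q x * flat_exp p (1 - x \<bullet> x))"
| sum: "flat_sum f \<Longrightarrow> flat_sum g \<Longrightarrow> flat_sum (\<lambda>x. f x + g x)"

lemma flat_sum_step:
  "flat_sum f \<Longrightarrow> (\<forall>x. f differentiable (at x)) \<and> (\<forall>v. flat_sum (\<lambda>x. frechet_derivative f (at x) v))"
proof (induction rule: flat_sum.induct)
  case (prod q p)
  define p' where "p' = [:0,0,1:] * (p - pderiv p)"
  have d1: "((\<lambda>x. flat_exp p (1 - x \<bullet> x)) has_derivative (\<lambda>v. flat_exp p' (1 - x \<bullet> x) * (- 2 * (x \<bullet> v)))) (at x)" for x :: 'a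
  proof -
    have "((\<lambda>x::'a. 1 - x \<bullet> x) has_derivative (\<lambda>v. - 2 * (x \<bullet> v))) (at x)"
      by (auto intro!: derivative_eq_intros simp: inner_commute)
    from has_derivative_compose[OF this flat_exp_deriv[THEN has_field_derivative_imp_has_derivative], of p]
    show ?thesis by (simp add: p'_def mult.commute)
  qed
  have d: "((\<lambda>x. q x * flat_exp p (1 - x \<bullet> x)) has_derivative (\<lambda>v. q x * (flat_exp p' (1 - x \<bullet> x) * (- 2 * (x \<bullet> v))) + frechet_derivative q (at x) v * flat_exp p (1 - x \<bullet> x))) (at x)" for x
    by (rule has_derivative_mult[OF smooth_has_derivative[OF prod] d1])
  have "(\<lambda>x. frechet_derivative (\<lambda>x. q x * flat_exp p (1 - x \<bullet> x)) (at x) v)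
      = (\<lambda>x. (- 2 * q x * (x \<bullet> v)) * flat_exp p' (1 - x \<bullet> x) + frechet_derivative q (at x) v * flat_exp p (1 - x \<bullet> x))" for v
    by (rule ext) (simp add: frechetI[OF d])
  moreover have "flat_sum (\<lambda>x. (- 2 * q x * (x \<bullet> v)) * flat_exp p' (1 - x \<bullet> x) + frechet_derivative q (at x) v * flat_exp p (1 - x \<bullet> x))" for v
    by (intro flat_sum.intros smooth_frechet prod smooth_mult smooth_const smooth_linear bounded_linear_inner_left)
  ultimately show ?case using d unfolding differentiable_def by auto
next
  case (sum f g)
  have d: "((\<lambda>x. f x + g x) has_derivative (\<lambda>v. frechet_derivative f (at x) v + frechet_derivative g (at x) v)) (at x)" for x
    by (rule has_derivative_add) (use sum.IH frechet_derivative_works in blast)+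
  have "(\<lambda>x. frechet_derivative (\<lambda>x. f x + g x) (at x) v) = (\<lambda>x. frechet_derivative f (at x) v + frechet_derivative g (at x) v)" for v
    by (rule ext) (rule frechetI[OF d])
  thus ?case using d sum.IH unfolding differentiable_def by (auto intro!: flat_sum.sum)
qed

lemma flat_sum_smooth: "flat_sum f \<Longrightarrow> smooth f"
proof (coinduction arbitrary: f)
  case smooth
  thus ?case using flat_sum_step[of f] by auto
qed

definition bump :: "'a::euclidean_space \<Rightarrow> real" where "bump x = flat_exp 1 (1 - x \<bullet> x)"

lemma smooth_bump: "smooth bump"
  using flat_sum_smooth[OF flat_sum.prod[OF smooth_const[of 1], of 1]] by (simp add: bump_def[abs_def])

lemma bump_nonneg: "bump x \<ge> 0" and bump_pos_iff: "bump x > 0 \<longleftrightarrow> norm x < 1"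
proof -
  have "1 - x \<bullet> x > 0 \<longleftrightarrow> norm x < 1"
    using power_less_one_iff[of "norm x" 2] by (simp add: power2_norm_eq_inner[symmetric])
  thus "bump x \<ge> 0" "bump x > 0 \<longleftrightarrow> norm x < 1" by (auto simp: bump_def flat_exp_def)
qed

lemma bump_eq_0: "norm x \<ge> 1 \<Longrightarrow> bump x = 0"
  using bump_nonneg[of x] bump_pos_iff[of x] by linarith

section \<open>Mollification on the disc\<close>

lemma borel_measurable_lebesgue_on_borel: "f \<in> borel_measurable borel \<Longrightarrow> f \<in> borel_measurable (lebesgue_on S)"
  by (simp add: measurable_completion measurable_restrict_space1)

lemma nn_integral_lborel_affine:
  fixes t :: "'a::euclidean_space"
  assumes [measurable]: "g \<in> borel_measurable borel" and "c \<noteq> 0"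
  shows "(\<integral>\<^sup>+x. g (t + c *\<^sub>R x) \<partial>lborel) = ennreal (1 / \<bar>c\<bar> ^ DIM('a)) * (\<integral>\<^sup>+x. g x \<partial>lborel)"
proof -
  have "(\<integral>\<^sup>+x. g x \<partial>lborel) = (\<integral>\<^sup>+x. ennreal (\<bar>c\<bar> ^ DIM('a)) * g (t + c *\<^sub>R x) \<partial>lborel)"
    by (subst lborel_affine[OF assms(2), of t]) (simp add: nn_integral_density nn_integral_distr)
  also have "\<dots> = ennreal (\<bar>c\<bar> ^ DIM('a)) * (\<integral>\<^sup>+x. g (t + c *\<^sub>R x) \<partial>lborel)"
    by (rule nn_integral_cmult) measurable
  finally show ?thesis using assms(2)
    by (simp add: mult.assoc[symmetric] ennreal_mult'[symmetric])
qed

definition vanishes_outside :: "real \<Rightarrow> ('a::euclidean_space \<Rightarrow> real) \<Rightarrow> bool" where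
  "vanishes_outside R \<kappa> \<longleftrightarrow> (\<forall>x. norm x \<ge> R \<longrightarrow> \<kappa> x = 0)"

lemma vanishes_outside_integrable:
  assumes "vanishes_outside R \<kappa>" "continuous_on UNIV \<kappa>"
  shows "integrable lborel \<kappa>"
proof -
  have "integrable lborel (\<lambda>x. indicator (cball 0 R) x *\<^sub>R \<kappa> x)"
    by (rule borel_integrable_compact) (use assms in \<open>auto intro: continuous_on_subset\<close>)
  moreover have "indicator (cball 0 R) x *\<^sub>R \<kappa> x = \<kappa> x" for x
    using assms(1) by (auto simp: vanishes_outside_def indicator_def)
  ultimately show ?thesis by (simp only:)
qed

text \<open>The radius is enlarged so that a neighbourhood of the point lies in the complement of the
  original ball.\<close>

lemma vanishes_outside_frechet:
  assumes "vanishes_outside R \<kappa>" "smooth \<kappa>"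
  shows "vanishes_outside (R + 1) (\<lambda>x. frechet_derivative \<kappa> (at x) v)"
  unfolding vanishes_outside_def
proof (intro allI impI)
  fix x :: 'a assume x: "norm x \<ge> R + 1"
  have "((\<lambda>x. 0) has_derivative (\<lambda>v. 0)) (at x)" by simp
  hence "(\<kappa> has_derivative (\<lambda>v. 0)) (at x)"
    by (rule has_derivative_transform_within_open[where s = "- cball 0 R"])
       (use x assms(1) in \<open>auto simp: vanishes_outside_def\<close>)
  from frechetI[OF this] show "frechet_derivative \<kappa> (at x) v = 0" .
qed

lemma vanishes_outside_bounded:
  assumes "vanishes_outside R \<kappa>" "continuous_on UNIV \<kappa>"
  obtains K where "K \<ge> 0" "\<And>x. \<bar>\<kappa> x\<bar> \<le> K"
proof -
  have "bounded (\<kappa> ` cball 0 R)"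
    by (intro compact_imp_bounded compact_continuous_image continuous_on_subset[OF assms(2)]) auto
  then obtain K where K: "\<forall>x\<in>cball 0 R. \<bar>\<kappa> x\<bar> \<le> K" by (auto simp: bounded_iff)
  have "\<bar>\<kappa> x\<bar> \<le> max K 0" for x
    using K assms(1) by (cases "norm x \<le> R") (auto simp: vanishes_outside_def intro: max.coboundedI1)
  thus ?thesis using that[of "max K 0"] by simp
qed

lemma frechet_bounded:
  assumes "vanishes_outside R \<kappa>" "smooth (\<kappa> :: 'a::euclidean_space \<Rightarrow> real)"
  obtains K where "K \<ge> 0" "\<And>a h. \<bar>frechet_derivative \<kappa> (at a) h\<bar> \<le> K * norm h"
proof -
  have "\<forall>b. \<exists>K\<ge>0. \<forall>a. \<bar>frechet_derivative \<kappa> (at a) b\<bar> \<le> K"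
    using vanishes_outside_bounded[OF vanishes_outside_frechet[OF assms] smooth_continuous_on[OF smooth_frechet[OF assms(2)]]] by metis
  then obtain K where K: "\<And>b. K b \<ge> 0" "\<And>a b. \<bar>frechet_derivative \<kappa> (at a) b\<bar> \<le> K b" by metis
  have "\<bar>frechet_derivative \<kappa> (at a) h\<bar> \<le> sum K Basis * norm h" for a h
  proof -
    have "frechet_derivative \<kappa> (at a) h = frechet_derivative \<kappa> (at a) (\<Sum>b\<in>Basis. (h \<bullet> b) *\<^sub>R b)"
      by (simp add: euclidean_representation)
    also have "\<dots> = (\<Sum>b\<in>Basis. (h \<bullet> b) * frechet_derivative \<kappa> (at a) b)"
      using frechet_linear[OF assms(2)] by (simp add: linear_sum linear_scale)
    also have "\<bar>\<dots>\<bar> \<le> (\<Sum>b\<in>Basis. \<bar>(h \<bullet> b) * frechet_derivative \<kappa> (at a) b\<bar>)" by (rule sum_abs)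
    also have "\<dots> \<le> (\<Sum>b\<in>Basis. norm h * K b)"
      unfolding abs_mult using K by (intro sum_mono mult_mono Basis_le_norm) auto
    finally show ?thesis by (simp add: sum_distrib_left mult.commute)
  qed
  moreover have "sum K Basis \<ge> 0" by (intro sum_nonneg K)
  ultimately show ?thesis using that by blast
qed

lemma smooth_lipschitz:
  assumes "smooth (\<kappa> :: 'a::euclidean_space \<Rightarrow> real)" "\<And>a h. \<bar>frechet_derivative \<kappa> (at a) h\<bar> \<le> K * norm h"
  shows "\<bar>\<kappa> x - \<kappa> y\<bar> \<le> K * norm (x - y)"
proof -
  have "norm (\<kappa> x - \<kappa> y) \<le> K * norm (x - y)"
  proof (rule differentiable_bound)
    show "(\<kappa> has_derivative frechet_derivative \<kappa> (at a)) (at a within UNIV)" for a using smooth_has_derivative[OF assms(1)] by simp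
    show "onorm (frechet_derivative \<kappa> (at a)) \<le> K" for a by (rule onorm_le) (use assms(2) in auto)
  qed auto
  thus ?thesis by simp
qed

abbreviation disc_measure :: "complex measure" where "disc_measure \<equiv> lebesgue_on unit_disc"

text \<open>The dilation factor \<open>r\<close> is taken slightly below 1 for mollification. This keeps the
  support of \<open>y \<mapsto> \<kappa> (r x - y)\<close> in the disc for every \<open>x\<close>
  of the disc, so that no extension of \<open>G\<close> beyond the disc is called for.\<close>

definition convolve :: "(complex \<Rightarrow> real) \<Rightarrow> (complex \<Rightarrow> real) \<Rightarrow> real \<Rightarrow> complex \<Rightarrow> real" where
  "convolve G \<kappa> r x = (LINT y|disc_measure. G y * \<kappa> (r *\<^sub>R x - y))"

lemma convolve_integrable:
  assumes G: "integrable disc_measure G" and \<kappa>: "continuous_on UNIV \<kappa>" "vanishes_outside R \<kappa>"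
  shows "integrable disc_measure (\<lambda>y. G y * \<kappa> (a - y))"
proof -
  obtain K where K: "K \<ge> 0" "\<And>x. \<bar>\<kappa> x\<bar> \<le> K" using vanishes_outside_bounded[OF \<kappa>(2,1)] by blast
  have m: "(\<lambda>y. \<kappa> (a - y)) \<in> borel_measurable disc_measure"
    by (intro borel_measurable_lebesgue_on_borel borel_measurable_continuous_onI continuous_on_compose2[OF \<kappa>(1)] continuous_intros) auto
  show ?thesis
  proof (rule Bochner_Integration.integrable_bound)
    show "integrable disc_measure (\<lambda>y. K * G y)" using G by simp
    show "AE y in disc_measure. norm (G y * \<kappa> (a - y)) \<le> norm (K * G y)"
    proof (rule AE_I2)
      fix y
      show "norm (G y * \<kappa> (a - y)) \<le> norm (K * G y)"
        using mult_left_mono[OF K(2)[of "a - y"] abs_ge_zero[of "G y"]] K(1) by (simp add: abs_mult mult.commute)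
    qed
  qed (use G m in measurable)
qed

text \<open>Differentiation under the integral sign: the difference quotients of \<open>\<kappa>\<close> are
  bounded by its Lipschitz constant, so dominated convergence applies.\<close>

lemma convolve_has_derivative:
  assumes G: "integrable disc_measure G" and \<kappa>: "smooth \<kappa>" "vanishes_outside R \<kappa>"
  shows "(convolve G \<kappa> r has_derivative (\<lambda>v. convolve G (\<lambda>a. r * frechet_derivative \<kappa> (at a) v) r x)) (at x)"
proof -
  obtain K where K: "K \<ge> 0" "\<And>a h. \<bar>frechet_derivative \<kappa> (at a) h\<bar> \<le> K * norm h" using frechet_bounded[OF \<kappa>(2,1)] by blast
  define D where "D v = convolve G (\<lambda>a. r * frechet_derivative \<kappa> (at a) v) r x" for v
  have Di: "integrable disc_measure (\<lambda>y. G y * (r * frechet_derivative \<kappa> (at (a - y)) v))" for v a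
    using vanishes_outside_frechet[OF \<kappa>(2,1)]
    by (intro convolve_integrable[OF G, of "\<lambda>a. r * frechet_derivative \<kappa> (at a) v" "R + 1"]
        smooth_continuous_on smooth_cmult smooth_frechet \<kappa>) (simp add: vanishes_outside_def)
  have ki: "integrable disc_measure (\<lambda>y. G y * \<kappa> (a - y))" for a
    by (rule convolve_integrable[OF G smooth_continuous_on[OF \<kappa>(1)] \<kappa>(2)])
  have lin: "linear D"
  proof
    fix v w c
    note L = frechet_linear[OF \<kappa>(1)]
    show "D (v + w) = D v + D w" unfolding D_def convolve_def
      by (subst Bochner_Integration.integral_add[OF Di Di, symmetric]) (simp add: linear_add[OF L] algebra_simps)
    show "D (c *\<^sub>R v) = c *\<^sub>R D v" unfolding D_def convolve_def real_scaleR_def integral_mult_right_zero[symmetric]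
      by (simp add: linear_scale[OF L] algebra_simps)
  qed
  have "((\<lambda>h. norm (convolve G \<kappa> r (x + h) - convolve G \<kappa> r x - D h) / norm h) \<longlongrightarrow> 0) (at 0)"
    unfolding tendsto_at_iff_sequentially o_def
  proof (intro allI impI)
    fix h :: "nat \<Rightarrow> complex" assume h0: "\<forall>i. h i \<in> UNIV - {0}" and h: "h \<longlonglongrightarrow> 0"
    define q where "q i y = G y * ((\<kappa> (r *\<^sub>R (x + h i) - y) - \<kappa> (r *\<^sub>R x - y) - r * frechet_derivative \<kappa> (at (r *\<^sub>R x - y)) (h i)) / norm (h i))" for i y
    have qi: "integrable disc_measure (q i)" for i
    proof -
      have "integrable disc_measure (\<lambda>y. (G y * \<kappa> (r *\<^sub>R (x + h i) - y) - G y * \<kappa> (r *\<^sub>R x - y) - G y * (r * frechet_derivative \<kappa> (at (r *\<^sub>R x - y)) (h i))) / norm (h i))"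
        by (intro integrable_divide Bochner_Integration.integrable_diff ki Di)
      thus ?thesis unfolding q_def by (simp add: algebra_simps)
    qed
    have eq: "(convolve G \<kappa> r (x + h i) - convolve G \<kappa> r x - D (h i)) / norm (h i) = (LINT y|disc_measure. q i y)" for i
    proof -
      have "(LINT y|disc_measure. q i y) = (LINT y|disc_measure. (G y * \<kappa> (r *\<^sub>R (x + h i) - y) - G y * \<kappa> (r *\<^sub>R x - y) - G y * (r * frechet_derivative \<kappa> (at (r *\<^sub>R x - y)) (h i))) / norm (h i))"
        unfolding q_def by (simp add: algebra_simps)
      thus ?thesis unfolding D_def convolve_def by (simp add: Bochner_Integration.integral_diff ki Di)
    qed
    have "(\<lambda>i. LINT y|disc_measure. q i y) \<longlonglongrightarrow> (LINT y|disc_measure. 0)"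
    proof (rule integral_dominated_convergence[where w = "\<lambda>y. 2 * K * \<bar>r\<bar> * \<bar>G y\<bar>"])
      show "integrable disc_measure (\<lambda>y. 2 * K * \<bar>r\<bar> * \<bar>G y\<bar>)" using G by simp
      show "AE y in disc_measure. norm (q i y) \<le> 2 * K * \<bar>r\<bar> * \<bar>G y\<bar>" for i
      proof (rule AE_I2)
        fix y
        have n: "norm (h i) > 0" using h0 by simp
        have e: "r *\<^sub>R (x + h i) - y - (r *\<^sub>R x - y) = r *\<^sub>R h i" by (simp add: algebra_simps)
        have "\<bar>\<kappa> (r *\<^sub>R (x + h i) - y) - \<kappa> (r *\<^sub>R x - y)\<bar> \<le> K * norm (r *\<^sub>R h i)"
          using smooth_lipschitz[OF \<kappa>(1) K(2), of "r *\<^sub>R (x + h i) - y" "r *\<^sub>R x - y"] unfolding e .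
        moreover have "\<bar>r * frechet_derivative \<kappa> (at (r *\<^sub>R x - y)) (h i)\<bar> \<le> \<bar>r\<bar> * (K * norm (h i))"
          unfolding abs_mult by (intro mult_left_mono K) auto
        ultimately have "\<bar>\<kappa> (r *\<^sub>R (x + h i) - y) - \<kappa> (r *\<^sub>R x - y) - r * frechet_derivative \<kappa> (at (r *\<^sub>R x - y)) (h i)\<bar> \<le> 2 * K * \<bar>r\<bar> * norm (h i)"
          by (simp add: algebra_simps)
        hence "\<bar>(\<kappa> (r *\<^sub>R (x + h i) - y) - \<kappa> (r *\<^sub>R x - y) - r * frechet_derivative \<kappa> (at (r *\<^sub>R x - y)) (h i)) / norm (h i)\<bar> \<le> 2 * K * \<bar>r\<bar>"
          using n by (simp add: abs_divide divide_le_eq)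
        hence "\<bar>G y\<bar> * \<bar>(\<kappa> (r *\<^sub>R (x + h i) - y) - \<kappa> (r *\<^sub>R x - y) - r * frechet_derivative \<kappa> (at (r *\<^sub>R x - y)) (h i)) / norm (h i)\<bar> \<le> \<bar>G y\<bar> * (2 * K * \<bar>r\<bar>)"
          by (rule mult_left_mono) simp
        thus "norm (q i y) \<le> 2 * K * \<bar>r\<bar> * \<bar>G y\<bar>" unfolding q_def by (simp only: real_norm_def abs_mult mult_ac)
      qed
      show "AE y in disc_measure. (\<lambda>i. q i y) \<longlonglongrightarrow> 0"
      proof (rule AE_I2)
        fix y
        have "((\<lambda>x. \<kappa> (r *\<^sub>R x + (- y))) has_derivative (\<lambda>v. r * frechet_derivative \<kappa> (at (r *\<^sub>R x + (- y))) v)) (at x)"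
          by (rule has_derivative_affine[OF \<kappa>(1)])
        hence "((\<lambda>h. norm (\<kappa> (r *\<^sub>R (x + h) - y) - \<kappa> (r *\<^sub>R x - y) - r * frechet_derivative \<kappa> (at (r *\<^sub>R x - y)) h) / norm h) \<longlongrightarrow> 0) (at 0)"
          by (simp add: has_derivative_at)
        hence "(\<lambda>i. norm (\<kappa> (r *\<^sub>R (x + h i) - y) - \<kappa> (r *\<^sub>R x - y) - r * frechet_derivative \<kappa> (at (r *\<^sub>R x - y)) (h i)) / norm (h i)) \<longlonglongrightarrow> 0"
          using h0 h unfolding tendsto_at_iff_sequentially o_def by blast
        hence "(\<lambda>i. norm ((\<kappa> (r *\<^sub>R (x + h i) - y) - \<kappa> (r *\<^sub>R x - y) - r * frechet_derivative \<kappa> (at (r *\<^sub>R x - y)) (h i)) / norm (h i))) \<longlonglongrightarrow> 0"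
          by (simp add: abs_divide)
        hence "(\<lambda>i. (\<kappa> (r *\<^sub>R (x + h i) - y) - \<kappa> (r *\<^sub>R x - y) - r * frechet_derivative \<kappa> (at (r *\<^sub>R x - y)) (h i)) / norm (h i)) \<longlonglongrightarrow> 0"
          by (rule tendsto_norm_zero_cancel)
        from tendsto_mult_left[OF this, of "G y"] show "(\<lambda>i. q i y) \<longlonglongrightarrow> 0" by (simp add: q_def)
      qed
    qed (use qi in auto)
    hence "(\<lambda>i. norm ((convolve G \<kappa> r (x + h i) - convolve G \<kappa> r x - D (h i)) / norm (h i))) \<longlonglongrightarrow> 0"
      unfolding eq by (intro tendsto_norm_zero) simp
    thus "(\<lambda>i. norm (convolve G \<kappa> r (x + h i) - convolve G \<kappa> r x - D (h i)) / norm (h i)) \<longlonglongrightarrow> 0"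
      by (simp add: abs_divide)
  qed
  thus ?thesis unfolding has_derivative_at D_def[symmetric] using lin by (simp add: linear_conv_bounded_linear)
qed

text \<open>The derivative of a convolution is the convolution with a derivative, so the convolutions with
  all smooth kernels of bounded support form a class that is closed under directional derivatives.\<close>

lemma smooth_convolve:
  assumes G: "integrable disc_measure G" and \<kappa>: "smooth \<kappa>" "vanishes_outside R \<kappa>"
  shows "smooth (convolve G \<kappa> r)"
proof -
  have "smooth f" if "\<exists>\<kappa> R. smooth \<kappa> \<and> vanishes_outside R \<kappa> \<and> f = convolve G \<kappa> r" for f
    using that
  proof (coinduction arbitrary: f)
    case smooth
    then obtain \<kappa> R where \<kappa>: "smooth \<kappa>" "vanishes_outside R \<kappa>" and f: "f = convolve G \<kappa> r" by blast
    note d = convolve_has_derivative[OF G \<kappa>, of r, folded f]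
    have "(\<lambda>x. frechet_derivative f (at x) v) = convolve G (\<lambda>a. r * frechet_derivative \<kappa> (at a) v) r" for v
      by (rule ext) (rule frechetI[OF d])
    moreover have "smooth (\<lambda>a. r * frechet_derivative \<kappa> (at a) v)" "vanishes_outside (R + 1) (\<lambda>a. r * frechet_derivative \<kappa> (at a) v)" for v
      using smooth_cmult[OF smooth_frechet[OF \<kappa>(1)]] vanishes_outside_frechet[OF \<kappa>(2,1)] by (auto simp: vanishes_outside_def)
    ultimately have "\<exists>\<kappa> R. smooth \<kappa> \<and> vanishes_outside R \<kappa> \<and> (\<lambda>x. frechet_derivative f (at x) v) = convolve G \<kappa> r" for v
      by blast
    moreover have "f differentiable (at x)" for x using d unfolding differentiable_def by blast
    ultimately show ?case by blast
  qed
  thus ?thesis using \<kappa> by blast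
qed

lemma finite_measure_disc: "finite_measure disc_measure"
  by (rule finite_measure_lebesgue_on) (simp add: lmeasurable_ball)

lemma disc_integral_eq_lborel:
  assumes "f \<in> borel_measurable borel" "\<And>x. x \<notin> unit_disc \<Longrightarrow> f x = 0"
  shows "(LINT x|disc_measure. f x) = (LINT x|lborel. (f x :: real))"
proof -
  have "(LINT x|disc_measure. f x) = (LINT x|lebesgue. indicator unit_disc x *\<^sub>R f x)"
    by (rule integral_restrict_space) simp
  also have "(\<lambda>x. indicator unit_disc x *\<^sub>R f x) = f"
    using assms(2) by (intro ext) (auto simp: indicator_def)
  also have "(LINT x|lebesgue. f x) = (LINT x|lborel. f x)"
    by (rule integral_completion) (use assms(1) in simp)
  finally show ?thesis .
qed

lemma disc_nn_integral_le: "(\<integral>\<^sup>+x. f x \<partial>disc_measure) \<le> (\<integral>\<^sup>+x. f x \<partial>lborel)"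
proof -
  have "(\<integral>\<^sup>+x. f x \<partial>disc_measure) = (\<integral>\<^sup>+x. f x * indicator unit_disc x \<partial>lebesgue)"
    by (rule nn_integral_restrict_space) simp
  also have "\<dots> \<le> (\<integral>\<^sup>+x. f x \<partial>lebesgue)" by (rule nn_integral_mono) (auto simp: indicator_def)
  finally show ?thesis by (simp add: nn_integral_completion)
qed

lemma square_integrable_disc_continuous:
  fixes f :: "complex \<Rightarrow> 'b::euclidean_space"
  assumes "continuous_on (cball 0 1) f"
  shows "square_integrable disc_measure f"
proof -
  have *: "integrable disc_measure g" if "continuous_on (cball 0 1) g" for g :: "complex \<Rightarrow> 'c::euclidean_space"
  proof -
    have "integrable lborel (\<lambda>x. indicator (cball 0 1) x *\<^sub>R g x)"
      by (rule borel_integrable_compact) (use that in auto)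
    hence "integrable lebesgue (\<lambda>x. indicator (cball 0 1) x *\<^sub>R g x)"
      by (subst integrable_completion) auto
    hence "g absolutely_integrable_on cball 0 1" by (simp add: set_integrable_def)
    hence "g absolutely_integrable_on unit_disc" by (rule set_integrable_subset) auto
    thus ?thesis by (simp add: set_integrable_def integrable_restrict_space)
  qed
  have "continuous_on (cball 0 1) (\<lambda>x. (norm (f x))\<^sup>2)" by (intro continuous_intros assms)
  from *[OF this] *[OF assms] show ?thesis by (auto simp: square_integrable_def)
qed

lemma smooth_square_integrable: "smooth f \<Longrightarrow> square_integrable disc_measure f"
  by (intro square_integrable_disc_continuous smooth_continuous_on)

definition bump_mass :: real where "bump_mass = (LINT x|lborel. bump (x::complex))"

lemma bump_integrable: "integrable lborel (bump :: complex \<Rightarrow> real)"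
  by (rule vanishes_outside_integrable[of 1]) (auto simp: vanishes_outside_def bump_eq_0 smooth_continuous_on smooth_bump)

lemma bump_mass_pos: "bump_mass > 0"
proof -
  have "bump_mass \<ge> 0" unfolding bump_mass_def by (rule integral_nonneg_AE) (simp add: bump_nonneg)
  moreover have "bump_mass \<noteq> 0"
  proof
    assume "bump_mass = 0"
    hence "AE x::complex in lborel. bump x = 0"
      using integral_nonneg_eq_0_iff_AE[OF bump_integrable] by (simp add: bump_mass_def bump_nonneg)
    hence "AE x::complex in lebesgue. bump x = 0" by (rule AE_completion)
    hence "(0::complex) \<in> {x. bump x = 0}"
      by (intro mem_closed_if_AE_lebesgue continuous_closed_preimage_constant[of UNIV bump 0, simplified] smooth_continuous_on smooth_bump)
         auto
    thus False using bump_pos_iff[of "0::complex"] by simp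
  qed
  ultimately show ?thesis by simp
qed

text \<open>The normalisation to integral 1; the factor \<open>e\<^sup>2\<close> is the Jacobian of the
  dilation of the plane.\<close>

definition mollifier :: "real \<Rightarrow> complex \<Rightarrow> real" where
  "mollifier e x = 1 / (e\<^sup>2 * bump_mass) * bump ((1 / e) *\<^sub>R x)"

lemma smooth_mollifier: "smooth (mollifier e)"
  unfolding mollifier_def[abs_def] using smooth_cmult[OF smooth_affine[OF smooth_bump, of "1 / e" 0], of "1 / (e\<^sup>2 * bump_mass)"] by simp

lemma mollifier_nonneg: "mollifier e x \<ge> 0"
  unfolding mollifier_def by (intro mult_nonneg_nonneg bump_nonneg) (use bump_mass_pos in simp)

lemma mollifier_eq_0: "e > 0 \<Longrightarrow> norm x \<ge> e \<Longrightarrow> mollifier e x = 0"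
  unfolding mollifier_def by (simp add: bump_eq_0)

lemma mollifier_vanishes: "e > 0 \<Longrightarrow> vanishes_outside e (mollifier e)"
  by (auto simp: vanishes_outside_def mollifier_eq_0)

lemma mollifier_borel [measurable]: "mollifier e \<in> borel_measurable borel"
  by (rule smooth_borel[OF smooth_mollifier])

lemma mollifier_affine_borel: "(\<lambda>x. ennreal (mollifier e (t + c *\<^sub>R x))) \<in> borel_measurable lborel"
  by measurable

lemma nn_integral_mollifier:
  assumes "e > 0" "c \<noteq> 0"
  shows "(\<integral>\<^sup>+x. ennreal (mollifier e (t + c *\<^sub>R x)) \<partial>lborel) = ennreal (1 / c\<^sup>2)"
proof -
  note smooth_borel[OF smooth_bump, measurable]
  have "(\<integral>\<^sup>+x. ennreal (mollifier e (t + c *\<^sub>R x)) \<partial>lborel)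
     = (\<integral>\<^sup>+x. ennreal (1 / (e\<^sup>2 * bump_mass)) * ennreal (bump ((1 / e) *\<^sub>R t + (c / e) *\<^sub>R x)) \<partial>lborel)"
    unfolding mollifier_def
    by (intro nn_integral_cong, subst ennreal_mult[symmetric])
       (use bump_mass_pos in \<open>auto simp: bump_nonneg scaleR_add_right\<close>)
  also have "\<dots> = ennreal (1 / (e\<^sup>2 * bump_mass)) * (\<integral>\<^sup>+x. ennreal (bump ((1 / e) *\<^sub>R t + (c / e) *\<^sub>R x)) \<partial>lborel)"
    by (rule nn_integral_cmult) measurable
  also have "(\<integral>\<^sup>+x. ennreal (bump ((1 / e) *\<^sub>R t + (c / e) *\<^sub>R x)) \<partial>lborel) = ennreal (1 / \<bar>c / e\<bar> ^ DIM(complex)) * (\<integral>\<^sup>+x. ennreal (bump (x::complex)) \<partial>lborel)"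
    using assms by (intro nn_integral_lborel_affine) auto
  also have "(\<integral>\<^sup>+x. ennreal (bump (x::complex)) \<partial>lborel) = ennreal bump_mass"
    unfolding bump_mass_def by (intro nn_integral_eq_integral bump_integrable AE_I2 bump_nonneg)
  also have "ennreal (1 / (e\<^sup>2 * bump_mass)) * (ennreal (1 / \<bar>c / e\<bar> ^ DIM(complex)) * ennreal bump_mass) = ennreal (1 / c\<^sup>2)"
    using assms bump_mass_pos by (simp add: ennreal_mult'[symmetric] power_divide)
  finally show ?thesis .
qed

lemma integral_mollifier:
  assumes "e > 0" "norm a + e \<le> 1"
  shows "(LINT y|disc_measure. mollifier e (a - y)) = 1"
proof -
  have "(LINT y|disc_measure. mollifier e (a - y)) = (LINT y|lborel. mollifier e (a - y))"
  proof (rule disc_integral_eq_lborel)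
    fix y assume "y \<notin> unit_disc"
    hence "norm (a - y) \<ge> e" using norm_triangle_ineq2[of y a] assms(2) by (simp add: norm_minus_commute)
    thus "mollifier e (a - y) = 0" by (rule mollifier_eq_0[OF assms(1)])
  qed measurable
  also have "\<dots> = enn2real (\<integral>\<^sup>+y. ennreal (mollifier e (a - y)) \<partial>lborel)"
    by (rule integral_eq_nn_integral) (auto simp: mollifier_nonneg)
  also have "(\<integral>\<^sup>+y. ennreal (mollifier e (a - y)) \<partial>lborel) = 1"
    using nn_integral_mollifier[OF assms(1), of "-1" a] by simp
  finally show ?thesis by simp
qed

text \<open>The kernel has radius \<open>e\<close>, and the dilation by \<open>1 - 2 e\<close> leaves room
  for it.\<close>

definition mollify :: "(complex \<Rightarrow> real) \<Rightarrow> real \<Rightarrow> complex \<Rightarrow> real" where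
  "mollify G e = convolve G (mollifier e) (1 - 2 * e)"

lemma smooth_mollify: "integrable disc_measure G \<Longrightarrow> e > 0 \<Longrightarrow> smooth (mollify G e)"
  unfolding mollify_def by (rule smooth_convolve[OF _ smooth_mollifier mollifier_vanishes])

lemma mollify_integrable:
  "integrable disc_measure G \<Longrightarrow> e > 0 \<Longrightarrow> integrable disc_measure (\<lambda>y. G y * mollifier e (a - y))"
  by (rule convolve_integrable[OF _ smooth_continuous_on[OF smooth_mollifier] mollifier_vanishes])

lemma mollify_inside:
  assumes "0 < e" "e < 1/4" "x \<in> unit_disc"
  shows "norm ((1 - 2 * e) *\<^sub>R x) + e < 1"
proof -
  have "norm ((1 - 2 * e) *\<^sub>R x) \<le> (1 - 2 * e) * 1" using assms unfolding norm_scaleR by (intro mult_mono) auto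
  thus ?thesis using assms(1) unfolding mult_1_right by linarith
qed

text \<open>Jensen's inequality for the probability density given by the kernel, in the form that a variance
  is nonnegative.\<close>

lemma mollify_sq_le:
  assumes G: "square_integrable disc_measure G" and e: "0 < e" "e < 1/4" and x: "x \<in> unit_disc"
  shows "(mollify G e x)\<^sup>2 \<le> (LINT y|disc_measure. (G y)\<^sup>2 * mollifier e ((1 - 2 * e) *\<^sub>R x - y))"
proof -
  define m where "m = mollify G e x"
  define p where "p y = mollifier e ((1 - 2 * e) *\<^sub>R x - y)" for y
  have G1: "integrable disc_measure G" by (rule square_integrable_integrable[OF finite_measure_disc G])
  have G2: "integrable disc_measure (\<lambda>y. (G y)\<^sup>2)" using G by (simp add: square_integrable_def)
  have c1: "integrable disc_measure (\<lambda>y. 1 :: real)" using finite_measure.integrable_const[OF finite_measure_disc] by blast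
  have i1: "integrable disc_measure (\<lambda>y. G y * p y)" and i2: "integrable disc_measure (\<lambda>y. (G y)\<^sup>2 * p y)"
    unfolding p_def by (intro mollify_integrable G1 G2 e)+
  have i0: "integrable disc_measure p" unfolding p_def using mollify_integrable[OF c1 e(1)] by simp
  have p1: "(LINT y|disc_measure. p y) = 1" unfolding p_def using mollify_inside[OF e x] by (intro integral_mollifier e) simp
  have "0 \<le> (LINT y|disc_measure. (G y - m)\<^sup>2 * p y)"
    by (intro integral_nonneg_AE AE_I2 mult_nonneg_nonneg) (auto simp: p_def mollifier_nonneg)
  also have "\<dots> = (LINT y|disc_measure. (G y)\<^sup>2 * p y - 2 * m * (G y * p y) + m\<^sup>2 * p y)"
    by (intro Bochner_Integration.integral_cong refl) (simp add: power2_eq_square algebra_simps)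
  also have "\<dots> = (LINT y|disc_measure. (G y)\<^sup>2 * p y) - 2 * m * (LINT y|disc_measure. G y * p y) + m\<^sup>2 * (LINT y|disc_measure. p y)"
    using i0 i1 i2 by simp
  also have "(LINT y|disc_measure. G y * p y) = m" by (simp add: m_def mollify_def convolve_def p_def)
  finally show ?thesis unfolding p1 m_def[symmetric] p_def[symmetric] by (simp add: power2_eq_square)
qed

text \<open>Integrate the preceding bound over \<open>x\<close> and exchange the integrals. The dilation
  contributes the factor \<open>1 / (1 - 2 e)\<^sup>2 \<le> 4\<close>.\<close>

lemma mollify_L2_bound:
  assumes G: "square_integrable disc_measure G" and e: "0 < e" "e < 1/4"
  shows "L2_norm disc_measure (mollify G e) \<le> 2 * L2_norm disc_measure G"
proof -
  define r where "r = 1 - 2 * e"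
  have r: "1/2 < r" using e by (simp add: r_def)
  have G1: "integrable disc_measure G" by (rule square_integrable_integrable[OF finite_measure_disc G])
  have G2: "integrable disc_measure (\<lambda>y. (G y)\<^sup>2)" using G by (simp add: square_integrable_def)
  have Gm: "G \<in> borel_measurable disc_measure" using G by (simp add: square_integrable_def)
  have mi: "square_integrable disc_measure (mollify G e)" by (rule smooth_square_integrable[OF smooth_mollify[OF G1 e(1)]])
  interpret D: finite_measure disc_measure by (rule finite_measure_disc)
  interpret P: pair_sigma_finite disc_measure disc_measure ..
  have id_m [measurable]: "(\<lambda>x. x) \<in> disc_measure \<rightarrow>\<^sub>M borel" by (rule borel_measurable_lebesgue_on_borel) simp
  have [measurable]: "G \<in> borel_measurable disc_measure" by (rule Gm)
  have fstm: "fst \<in> disc_measure \<Otimes>\<^sub>M disc_measure \<rightarrow>\<^sub>M borel"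
    using measurable_compose[OF measurable_fst id_m, of disc_measure] by (simp add: comp_def)
  have sndm: "snd \<in> disc_measure \<Otimes>\<^sub>M disc_measure \<rightarrow>\<^sub>M borel"
    using measurable_compose[OF measurable_snd id_m, of disc_measure] by (simp add: comp_def)
  have Gsnd: "(\<lambda>q. G (snd q)) \<in> borel_measurable (disc_measure \<Otimes>\<^sub>M disc_measure)"
    by (rule measurable_compose[OF measurable_snd Gm])
  have jm: "(\<lambda>q. ennreal ((G (snd q))\<^sup>2 * mollifier e (r *\<^sub>R fst q - snd q))) \<in> borel_measurable (disc_measure \<Otimes>\<^sub>M disc_measure)"
    using fstm sndm Gsnd by measurable
  have "(\<integral>\<^sup>+x. ennreal ((mollify G e x)\<^sup>2) \<partial>disc_measure)
     \<le> (\<integral>\<^sup>+x. \<integral>\<^sup>+y. ennreal ((G y)\<^sup>2 * mollifier e (r *\<^sub>R x - y)) \<partial>disc_measure \<partial>disc_measure)"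
  proof (rule nn_integral_mono)
    fix x assume "x \<in> space disc_measure"
    hence x: "x \<in> unit_disc" by simp
    have "ennreal ((mollify G e x)\<^sup>2) \<le> ennreal (LINT y|disc_measure. (G y)\<^sup>2 * mollifier e (r *\<^sub>R x - y))"
      unfolding r_def by (intro ennreal_leI mollify_sq_le G e x)
    also have "\<dots> = (\<integral>\<^sup>+y. ennreal ((G y)\<^sup>2 * mollifier e (r *\<^sub>R x - y)) \<partial>disc_measure)"
      by (intro nn_integral_eq_integral[symmetric] mollify_integrable G2 e AE_I2 mult_nonneg_nonneg mollifier_nonneg) auto
    finally show "ennreal ((mollify G e x)\<^sup>2) \<le> (\<integral>\<^sup>+y. ennreal ((G y)\<^sup>2 * mollifier e (r *\<^sub>R x - y)) \<partial>disc_measure)" .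
  qed
  also have "\<dots> = (\<integral>\<^sup>+y. \<integral>\<^sup>+x. ennreal ((G y)\<^sup>2 * mollifier e (r *\<^sub>R x - y)) \<partial>disc_measure \<partial>disc_measure)"
    using P.Fubini'[of "\<lambda>x y. ennreal ((G y)\<^sup>2 * mollifier e (r *\<^sub>R x - y))"] jm by (simp add: case_prod_beta')
  also have "\<dots> \<le> (\<integral>\<^sup>+y. 4 * ennreal ((G y)\<^sup>2) \<partial>disc_measure)"
  proof (rule nn_integral_mono)
    fix y
    have "(\<integral>\<^sup>+x. ennreal ((G y)\<^sup>2 * mollifier e (r *\<^sub>R x - y)) \<partial>disc_measure) \<le> (\<integral>\<^sup>+x. ennreal ((G y)\<^sup>2 * mollifier e (r *\<^sub>R x - y)) \<partial>lborel)"
      by (rule disc_nn_integral_le)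
    also have "\<dots> = (\<integral>\<^sup>+x. ennreal ((G y)\<^sup>2) * ennreal (mollifier e (- y + r *\<^sub>R x)) \<partial>lborel)"
      by (intro nn_integral_cong) (simp add: ennreal_mult')
    also have "\<dots> = ennreal ((G y)\<^sup>2) * (\<integral>\<^sup>+x. ennreal (mollifier e (- y + r *\<^sub>R x)) \<partial>lborel)"
      by (rule nn_integral_cmult) (rule mollifier_affine_borel)
    also have "\<dots> = ennreal ((G y)\<^sup>2) * ennreal (1 / r\<^sup>2)"
      using r by (subst nn_integral_mollifier) (auto simp: e)
    also have "\<dots> \<le> ennreal ((G y)\<^sup>2) * 4"
    proof (rule mult_left_mono)
      have "1 / r\<^sup>2 = (1 / r)\<^sup>2" by (simp add: power_one_over)
      also have "\<dots> \<le> 2\<^sup>2" using r by (intro power_mono) (auto simp: field_simps)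
      finally have "ennreal (1 / r\<^sup>2) \<le> ennreal 4" by (intro ennreal_leI) simp
      thus "ennreal (1 / r\<^sup>2) \<le> 4" by simp
    qed simp
    finally show "(\<integral>\<^sup>+x. ennreal ((G y)\<^sup>2 * mollifier e (r *\<^sub>R x - y)) \<partial>disc_measure) \<le> 4 * ennreal ((G y)\<^sup>2)" by (simp add: mult.commute)
  qed
  also have "\<dots> = 4 * ennreal (LINT y|disc_measure. (G y)\<^sup>2)"
    by (subst nn_integral_cmult) (auto simp: nn_integral_eq_integral[OF G2])
  also have "\<dots> = ennreal (4 * (LINT y|disc_measure. (G y)\<^sup>2))" by (simp add: ennreal_mult')
  finally have "(\<integral>\<^sup>+x. ennreal ((mollify G e x)\<^sup>2) \<partial>disc_measure) \<le> ennreal (4 * (LINT y|disc_measure. (G y)\<^sup>2))" .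
  moreover have "(\<integral>\<^sup>+x. ennreal ((mollify G e x)\<^sup>2) \<partial>disc_measure) = ennreal (LINT x|disc_measure. (mollify G e x)\<^sup>2)"
    by (rule nn_integral_eq_integral) (use mi in \<open>auto simp: square_integrable_def\<close>)
  ultimately have "(LINT x|disc_measure. (mollify G e x)\<^sup>2) \<le> 4 * (LINT y|disc_measure. (G y)\<^sup>2)"
    by (simp add: ennreal_le_iff)
  hence "sqrt (LINT x|disc_measure. (mollify G e x)\<^sup>2) \<le> sqrt (4 * (LINT y|disc_measure. (G y)\<^sup>2))" by (rule real_sqrt_le_mono)
  thus ?thesis by (simp add: L2_norm_def real_sqrt_mult)
qed

text \<open>Truncate \<open>G\<close> at height \<open>B\<close>, then truncate continuous functions that
  converge to \<open>G\<close> almost everywhere; both approximations converge in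
  \<open>L\<^sup>2\<close> by dominated convergence.\<close>

lemma L2_continuous_dense:
  assumes G: "square_integrable disc_measure (G :: complex \<Rightarrow> real)" and e: "e > 0"
  obtains c where "continuous_on UNIV c" "L2_norm disc_measure (\<lambda>x. G x - c x) < e"
proof -
  have Gm: "G \<in> borel_measurable disc_measure" using G by (simp add: square_integrable_def)
  define cl where "cl B t = max (- real B) (min (real B) t)" for B :: nat and t :: real
  have cl_cont: "continuous_on UNIV (cl B)" for B unfolding cl_def by (intro continuous_intros)
  have cl_m: "cl B \<in> borel_measurable borel" for B by (rule borel_measurable_continuous_onI[OF cl_cont])
  have clG: "(\<lambda>x. cl B (G x)) \<in> borel_measurable disc_measure" for B by (rule measurable_compose[OF Gm cl_m])
  have sq_const: "square_integrable disc_measure (\<lambda>x. C)" for C :: real by (rule square_integrable_disc_continuous) simp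
  have "(\<lambda>B. LINT x|disc_measure. (G x - cl B (G x))\<^sup>2) \<longlonglongrightarrow> (LINT x|disc_measure. 0)"
  proof (rule integral_dominated_convergence[where w = "\<lambda>x. (G x)\<^sup>2"])
    show "integrable disc_measure (\<lambda>x. (G x)\<^sup>2)" using G by (simp add: square_integrable_def)
    show "AE x in disc_measure. norm ((G x - cl B (G x))\<^sup>2) \<le> (G x)\<^sup>2" for B
    proof (rule AE_I2)
      fix x
      have "\<bar>G x - cl B (G x)\<bar> \<le> \<bar>G x\<bar>" by (auto simp: cl_def max_def min_def)
      from power_mono[OF this abs_ge_zero, of 2] show "norm ((G x - cl B (G x))\<^sup>2) \<le> (G x)\<^sup>2" by simp
    qed
    show "AE x in disc_measure. (\<lambda>B. (G x - cl B (G x))\<^sup>2) \<longlonglongrightarrow> 0"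
    proof (rule AE_I2, rule tendsto_eventually)
      fix x
      obtain B0 :: nat where B0: "\<bar>G x\<bar> \<le> real B0" using real_arch_simple by blast
      show "eventually (\<lambda>B. (G x - cl B (G x))\<^sup>2 = 0) sequentially"
        using eventually_ge_at_top[of B0]
      proof eventually_elim
        case (elim B)
        hence "\<bar>G x\<bar> \<le> real B" using B0 by linarith
        thus ?case by (auto simp: cl_def max_def min_def)
      qed
    qed
  qed (use Gm clG in measurable)
  hence "(\<lambda>B. sqrt (LINT x|disc_measure. (G x - cl B (G x))\<^sup>2)) \<longlonglongrightarrow> sqrt 0" by (intro tendsto_real_sqrt) simp
  hence "eventually (\<lambda>B. sqrt (LINT x|disc_measure. (G x - cl B (G x))\<^sup>2) < e / 2) sequentially"
    using e by (intro order_tendstoD) auto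
  then obtain B where "sqrt (LINT x|disc_measure. (G x - cl B (G x))\<^sup>2) < e / 2" by (auto simp: eventually_sequentially)
  hence B: "L2_norm disc_measure (\<lambda>x. G x - cl B (G x)) < e / 2" by (simp add: L2_norm_def)
  have "G measurable_on unit_disc" using Gm measurable_on_iff_borel_measurable[of unit_disc G] by simp
  then obtain N g where N: "negligible N" and g: "\<And>n. continuous_on UNIV (g n)"
     and lim: "\<And>x. x \<notin> N \<Longrightarrow> (\<lambda>n. g n x) \<longlonglongrightarrow> (if x \<in> unit_disc then G x else 0)"
    unfolding measurable_on_def by blast
  have cg: "continuous_on UNIV (\<lambda>x. cl B (g n x))" for n by (rule continuous_on_compose2[OF cl_cont g]) auto
  have cgm: "(\<lambda>x. cl B (g n x)) \<in> borel_measurable disc_measure" for n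
    by (intro borel_measurable_lebesgue_on_borel borel_measurable_continuous_onI cg)
  have "(\<lambda>n. LINT x|disc_measure. (cl B (G x) - cl B (g n x))\<^sup>2) \<longlonglongrightarrow> (LINT x|disc_measure. 0)"
  proof (rule integral_dominated_convergence[where w = "\<lambda>x. (2 * real B)\<^sup>2"])
    show "integrable disc_measure (\<lambda>x. (2 * real B)\<^sup>2)" using finite_measure.integrable_const[OF finite_measure_disc] by blast
    show "AE x in disc_measure. norm ((cl B (G x) - cl B (g n x))\<^sup>2) \<le> (2 * real B)\<^sup>2" for n
    proof (rule AE_I2)
      fix x
      have "\<bar>cl B (G x) - cl B (g n x)\<bar> \<le> 2 * real B" by (auto simp: cl_def max_def min_def)
      from power_mono[OF this abs_ge_zero, of 2] show "norm ((cl B (G x) - cl B (g n x))\<^sup>2) \<le> (2 * real B)\<^sup>2" by simp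
    qed
    have "AE x in lebesgue. x \<notin> N" using N by (simp add: negligible_iff_null_sets AE_not_in)
    hence "AE x in disc_measure. x \<notin> N" by (subst AE_restrict_space_iff) auto
    with AE_space show "AE x in disc_measure. (\<lambda>n. (cl B (G x) - cl B (g n x))\<^sup>2) \<longlonglongrightarrow> 0"
    proof eventually_elim
      case (elim x)
      have "(\<lambda>n. g n x) \<longlonglongrightarrow> G x" using lim[OF elim(2)] elim(1) by simp
      hence "(\<lambda>n. cl B (g n x)) \<longlonglongrightarrow> cl B (G x)" unfolding cl_def by (intro tendsto_intros)
      from tendsto_power[OF tendsto_diff[OF tendsto_const[of "cl B (G x)"] this], of 2] show ?case by simp
    qed
  qed (use cgm clG in measurable)
  hence "(\<lambda>n. sqrt (LINT x|disc_measure. (cl B (G x) - cl B (g n x))\<^sup>2)) \<longlonglongrightarrow> sqrt 0" by (intro tendsto_real_sqrt) simp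
  hence "eventually (\<lambda>n. sqrt (LINT x|disc_measure. (cl B (G x) - cl B (g n x))\<^sup>2) < e / 2) sequentially"
    using e by (intro order_tendstoD) auto
  then obtain n where "sqrt (LINT x|disc_measure. (cl B (G x) - cl B (g n x))\<^sup>2) < e / 2" by (auto simp: eventually_sequentially)
  hence n: "L2_norm disc_measure (\<lambda>x. cl B (G x) - cl B (g n x)) < e / 2" by (simp add: L2_norm_def)
  have s1: "square_integrable disc_measure (\<lambda>x. cl B (G x))"
    unfolding square_integrable_def
  proof
    show "integrable disc_measure (\<lambda>x. (norm (cl B (G x)))\<^sup>2)"
    proof (rule Bochner_Integration.integrable_bound)
      show "integrable disc_measure (\<lambda>x. (real B)\<^sup>2)" using finite_measure.integrable_const[OF finite_measure_disc] by blast
      show "AE x in disc_measure. norm ((norm (cl B (G x)))\<^sup>2) \<le> norm ((real B)\<^sup>2)"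
      proof (rule AE_I2)
        fix x
        have "\<bar>cl B (G x)\<bar> \<le> real B" by (auto simp: cl_def max_def min_def)
        from power_mono[OF this abs_ge_zero, of 2] show "norm ((norm (cl B (G x)))\<^sup>2) \<le> norm ((real B)\<^sup>2)" by simp
      qed
    qed (use clG in measurable)
  qed (rule clG)
  have s2: "square_integrable disc_measure (\<lambda>x. cl B (g n x))"
    by (rule square_integrable_disc_continuous) (rule continuous_on_subset[OF cg], simp)
  have "L2_norm disc_measure (\<lambda>x. G x - cl B (g n x)) < e"
    using L2_norm_triangle_diff[OF G s1 s2] B n by linarith
  thus ?thesis using that[OF cg] by blast
qed

lemma mollify_diff:
  assumes "integrable disc_measure G" "integrable disc_measure H" "e > 0"
  shows "mollify (\<lambda>x. G x - H x) e x = mollify G e x - mollify H e x"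
  unfolding mollify_def convolve_def left_diff_distrib
  by (rule Bochner_Integration.integral_diff; rule mollify_integrable; rule assms)

definition eps :: "nat \<Rightarrow> real" where "eps n = 1 / (real n + 5)"

lemma eps: "0 < eps n" "eps n < 1/4" "eps \<longlonglongrightarrow> 0"
proof -
  show "0 < eps n" "eps n < 1/4" by (auto simp: eps_def field_simps)
  show "eps \<longlonglongrightarrow> 0" unfolding eps_def[abs_def]
    using LIMSEQ_ignore_initial_segment[OF lim_1_over_n[where ?'a = real], of 5] by simp
qed

lemma mollify_continuous_approx:
  assumes c: "continuous_on UNIV c" and "\<eta> > 0"
  shows "eventually (\<lambda>n. \<forall>x\<in>unit_disc. \<bar>mollify c (eps n) x - c x\<bar> \<le> \<eta>) sequentially"
proof -
  have "uniformly_continuous_on (cball 0 1) c"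
    by (intro compact_uniformly_continuous continuous_on_subset[OF c]) auto
  then obtain d where d: "d > 0" "\<And>x y. x \<in> cball 0 1 \<Longrightarrow> y \<in> cball 0 1 \<Longrightarrow> dist y x < d \<Longrightarrow> dist (c y) (c x) < \<eta>"
    unfolding uniformly_continuous_on_def using \<open>\<eta> > 0\<close> by metis
  have c1: "integrable disc_measure c"
    by (intro square_integrable_integrable[OF finite_measure_disc] square_integrable_disc_continuous continuous_on_subset[OF c]) simp
  have one: "integrable disc_measure (\<lambda>y. 1 :: real)" using finite_measure.integrable_const[OF finite_measure_disc] by blast
  have "eventually (\<lambda>n. eps n < d / 3) sequentially" using eps(3) d by (intro order_tendstoD) auto
  thus ?thesis
  proof eventually_elim
    case (elim n)
    show ?case
    proof
      fix x :: complex assume x: "x \<in> unit_disc"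
      define p where "p y = mollifier (eps n) ((1 - 2 * eps n) *\<^sub>R x - y)" for y
      have p1: "(LINT y|disc_measure. p y) = 1" unfolding p_def
        by (rule integral_mollifier[OF eps(1) less_imp_le[OF mollify_inside[OF eps(1,2) x]]])
      have pi: "integrable disc_measure p" unfolding p_def using mollify_integrable[OF one eps(1)] by simp
      have cpi: "integrable disc_measure (\<lambda>y. c y * p y)" unfolding p_def by (rule mollify_integrable[OF c1 eps(1)])
      have "mollify c (eps n) x - c x = (LINT y|disc_measure. c y * p y) - c x * (LINT y|disc_measure. p y)"
        unfolding p1 by (simp add: mollify_def convolve_def p_def)
      also have "\<dots> = (LINT y|disc_measure. c y * p y - c x * p y)" using cpi pi by simp
      also have "\<bar>\<dots>\<bar> \<le> (LINT y|disc_measure. \<eta> * p y)"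
      proof (rule order_trans[OF integral_abs_bound integral_mono])
        show "integrable disc_measure (\<lambda>y. \<bar>c y * p y - c x * p y\<bar>)" using cpi pi by simp
        show "integrable disc_measure (\<lambda>y. \<eta> * p y)" using pi by simp
        fix y assume "y \<in> space disc_measure"
        hence y: "y \<in> unit_disc" by simp
        show "\<bar>c y * p y - c x * p y\<bar> \<le> \<eta> * p y"
        proof (cases "p y = 0")
          case False
          hence "norm ((1 - 2 * eps n) *\<^sub>R x - y) < eps n" using mollifier_eq_0[OF eps(1)] unfolding p_def by (meson not_le)
          moreover have "norm (y - x) \<le> norm ((1 - 2 * eps n) *\<^sub>R x - y) + norm ((2 * eps n) *\<^sub>R x)"
            using norm_triangle_ineq4[of "- ((1 - 2 * eps n) *\<^sub>R x - y)" "(2 * eps n) *\<^sub>R x"]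
            by (simp add: algebra_simps norm_minus_commute)
          moreover have "norm ((2 * eps n) *\<^sub>R x) \<le> 2 * eps n * 1"
            using x eps(1)[of n] unfolding norm_scaleR by (intro mult_mono) auto
          ultimately have "dist y x < d" using elim unfolding dist_norm mult_1_right by linarith
          hence "\<bar>c y - c x\<bar> < \<eta>" using d(2)[of x y] x y by (simp add: dist_real_def)
          hence "\<bar>c y - c x\<bar> * p y \<le> \<eta> * p y" by (intro mult_right_mono) (auto simp: p_def mollifier_nonneg)
          moreover have "\<bar>c y * p y - c x * p y\<bar> = \<bar>c y - c x\<bar> * p y"
            by (simp add: left_diff_distrib[symmetric] abs_mult p_def mollifier_nonneg)
          ultimately show ?thesis by simp
        qed simp
      qed
      also have "\<dots> = \<eta>" by (simp add: p1)
      finally show "\<bar>mollify c (eps n) x - c x\<bar> \<le> \<eta>" .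
    qed
  qed
qed

text \<open>For a continuous function the convergence is uniform; the uniform bound of mollification on
  \<open>L\<^sup>2\<close> extends it to all square integrable functions.\<close>

lemma mollify_tendsto:
  assumes G: "square_integrable disc_measure G"
  shows "(\<lambda>n. L2_norm disc_measure (\<lambda>x. mollify G (eps n) x - G x)) \<longlonglongrightarrow> 0"
proof (rule LIMSEQ_I)
  fix e :: real assume e: "e > 0"
  obtain c where c: "continuous_on UNIV c" "L2_norm disc_measure (\<lambda>x. G x - c x) < e / 6"
    using L2_continuous_dense[OF G, of "e / 6"] e by auto
  define mD where "mD = sqrt (measure disc_measure (space disc_measure))"
  have mD: "mD \<ge> 0" by (simp add: mD_def)
  define \<eta> where "\<eta> = e / (2 * (mD + 1))"
  have \<eta>: "\<eta> > 0" "\<eta> * mD < e / 2" using e mD by (auto simp: \<eta>_def field_simps)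
  have c2: "square_integrable disc_measure c" by (intro square_integrable_disc_continuous continuous_on_subset[OF c(1)]) simp
  have G1: "integrable disc_measure G" and c1: "integrable disc_measure c"
    by (rule square_integrable_integrable[OF finite_measure_disc], rule G c2)+
  have mG: "square_integrable disc_measure (mollify G (eps n))" and mc: "square_integrable disc_measure (mollify c (eps n))" for n
    by (intro smooth_square_integrable smooth_mollify G1 c1 eps)+
  have "eventually (\<lambda>n. norm (L2_norm disc_measure (\<lambda>x. mollify G (eps n) x - G x) - 0) < e) sequentially"
    using mollify_continuous_approx[OF c(1) \<eta>(1)]
  proof eventually_elim
    case (elim n)
    have "L2_norm disc_measure (\<lambda>x. mollify G (eps n) x - G x)
        \<le> L2_norm disc_measure (\<lambda>x. mollify G (eps n) x - mollify c (eps n) x) + L2_norm disc_measure (\<lambda>x. mollify c (eps n) x - G x)"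
      by (rule L2_norm_triangle_diff[OF mG mc G])
    also have "L2_norm disc_measure (\<lambda>x. mollify c (eps n) x - G x) \<le> L2_norm disc_measure (\<lambda>x. mollify c (eps n) x - c x) + L2_norm disc_measure (\<lambda>x. c x - G x)"
      by (rule L2_norm_triangle_diff[OF mc c2 G])
    also have "L2_norm disc_measure (\<lambda>x. mollify c (eps n) x - c x) \<le> \<eta> * mD" unfolding mD_def
      by (rule L2_norm_le_uniform[OF finite_measure_disc square_integrable_diff[OF mc c2]]) (use elim \<eta> in auto)
    also have "L2_norm disc_measure (\<lambda>x. mollify G (eps n) x - mollify c (eps n) x) \<le> 2 * L2_norm disc_measure (\<lambda>x. G x - c x)"
      unfolding mollify_diff[OF G1 c1 eps(1), symmetric] by (rule mollify_L2_bound[OF square_integrable_diff[OF G c2] eps(1,2)])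
    also have "L2_norm disc_measure (\<lambda>x. c x - G x) = L2_norm disc_measure (\<lambda>x. G x - c x)" by (rule L2_norm_minus_commute)
    finally have "L2_norm disc_measure (\<lambda>x. mollify G (eps n) x - G x) < e" using c(2) \<eta>(2) by linarith
    thus ?case by (simp add: L2_norm_nonneg)
  qed
  thus "\<exists>no. \<forall>n\<ge>no. norm (L2_norm disc_measure (\<lambda>x. mollify G (eps n) x - G x) - 0) < e" by (simp add: eventually_sequentially)
qed

section \<open>Weak gradients\<close>

lemma L2_norm_eq_0_AE:
  assumes "square_integrable M f" "L2_norm M f = 0"
  shows "AE x in M. f x = 0"
proof -
  have "(LINT x|M. (norm (f x))\<^sup>2) = 0" using assms(2) by (simp add: L2_norm_def)
  hence "AE x in M. (norm (f x))\<^sup>2 = 0"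
    using integral_nonneg_eq_0_iff_AE[OF square_integrable_sq_integrable[OF assms(1)]] by simp
  thus ?thesis by simp
qed

lemma mollifier_test_function:
  assumes "0 < e" "norm a + e < 1"
  shows "(\<lambda>y. mollifier e (a - y)) \<in> test_functions unit_disc"
proof -
  have "closure {y. mollifier e (a - y) \<noteq> 0} \<subseteq> cball a e"
  proof (rule closure_minimal)
    show "{y. mollifier e (a - y) \<noteq> 0} \<subseteq> cball a e"
      using mollifier_eq_0[OF assms(1)] by (auto simp: dist_norm) (meson linorder_linear)
  qed simp
  moreover have "cball a e \<subseteq> unit_disc"
  proof
    fix y assume "y \<in> cball a e"
    thus "y \<in> unit_disc" using norm_triangle_sub[of y a] assms(2) by (simp add: dist_norm norm_minus_commute)
  qed
  moreover have "compact (closure {y. mollifier e (a - y) \<noteq> 0})"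
    using calculation(1) by (meson bounded_cball bounded_subset closed_closure compact_eq_bounded_closed)
  moreover have "smooth (\<lambda>y. mollifier e (a - y))"
    using smooth_affine[OF smooth_mollifier, of e "-1" a] by simp
  ultimately show ?thesis by (auto simp: test_functions_def)
qed

text \<open>The translated mollifiers are test functions, so all mollifications of \<open>G\<close> vanish.\<close>

lemma fundamental_lemma_of_variations:
  assumes G: "square_integrable disc_measure G"
    and 0: "\<And>\<phi>. \<phi> \<in> test_functions unit_disc \<Longrightarrow> (LINT x|disc_measure. G x * \<phi> x) = 0"
  shows "AE x in disc_measure. G x = 0"
proof -
  have m0: "mollify G (eps n) x = 0" if "x \<in> unit_disc" for n x
    unfolding mollify_def convolve_def by (rule 0[OF mollifier_test_function[OF eps(1) mollify_inside[OF eps(1,2) that]]])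
  have "L2_norm disc_measure (\<lambda>x. mollify G (eps n) x - G x) = L2_norm disc_measure G" for n
    unfolding L2_norm_def by (intro arg_cong[of _ _ sqrt] Bochner_Integration.integral_cong) (auto simp: m0)
  hence "(\<lambda>n::nat. L2_norm disc_measure G) \<longlonglongrightarrow> 0" using mollify_tendsto[OF G] by simp
  hence "L2_norm disc_measure G = 0" by (simp add: LIMSEQ_const_iff)
  thus ?thesis by (rule L2_norm_eq_0_AE[OF G])
qed

lemma square_integrable_inner_const:
  fixes g :: "'a \<Rightarrow> 'b::euclidean_space"
  assumes "square_integrable M g"
  shows "square_integrable M (\<lambda>x. g x \<bullet> b)"
proof -
  have m: "g \<in> borel_measurable M" using assms by (simp add: square_integrable_def)
  have "integrable M (\<lambda>x. (norm (g x \<bullet> b))\<^sup>2)"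
  proof (rule Bochner_Integration.integrable_bound)
    show "integrable M (\<lambda>x. (norm b)\<^sup>2 * (norm (g x))\<^sup>2)" using assms by (simp add: square_integrable_def)
    show "AE x in M. norm ((norm (g x \<bullet> b))\<^sup>2) \<le> norm ((norm b)\<^sup>2 * (norm (g x))\<^sup>2)"
    proof (rule AE_I2)
      fix x
      have "\<bar>g x \<bullet> b\<bar>\<^sup>2 \<le> (norm (g x) * norm b)\<^sup>2" by (intro power_mono Cauchy_Schwarz_ineq2) auto
      thus "norm ((norm (g x \<bullet> b))\<^sup>2) \<le> norm ((norm b)\<^sup>2 * (norm (g x))\<^sup>2)" by (simp add: power_mult_distrib mult.commute)
    qed
  qed (use m in measurable)
  thus ?thesis using m by (simp add: square_integrable_def)
qed

lemma test_function_square_integrable: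
  "\<phi> \<in> test_functions unit_disc \<Longrightarrow> square_integrable disc_measure \<phi>"
  "\<phi> \<in> test_functions unit_disc \<Longrightarrow> square_integrable disc_measure (\<lambda>x. frechet_derivative \<phi> (at x) b)"
  by (auto simp: test_functions_def intro!: smooth_square_integrable smooth_frechet)

abbreviation weak_grad :: "(complex \<Rightarrow> real) \<Rightarrow> (complex \<Rightarrow> complex) \<Rightarrow> bool" where
  "weak_grad u g \<equiv> has_weak_gradient unit_disc u g"

lemma weak_gradD:
  assumes "weak_grad u g"
  shows "square_integrable disc_measure u" "square_integrable disc_measure g"
    "\<And>\<phi> b. \<phi> \<in> test_functions unit_disc \<Longrightarrow> b \<in> Basis \<Longrightarrow>
       (LINT x|disc_measure. u x * frechet_derivative \<phi> (at x) b) = - (LINT x|disc_measure. (g x \<bullet> b) * \<phi> x)"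
  using assms by (auto simp: has_weak_gradient_def)

lemma weak_grad_diff:
  assumes u: "weak_grad u g" and v: "weak_grad v h"
  shows "weak_grad (\<lambda>x. u x - v x) (\<lambda>x. g x - h x)"
  unfolding has_weak_gradient_def
proof (intro conjI ballI)
  show "square_integrable disc_measure (\<lambda>x. u x - v x)" "square_integrable disc_measure (\<lambda>x. g x - h x)"
    by (intro square_integrable_diff weak_gradD[OF u] weak_gradD[OF v])+
  fix \<phi> and b :: complex assume \<phi>: "\<phi> \<in> test_functions unit_disc" and b: "b \<in> Basis"
  note t = test_function_square_integrable[OF \<phi>]
  have i: "integrable disc_measure (\<lambda>x. u x * frechet_derivative \<phi> (at x) b)" "integrable disc_measure (\<lambda>x. v x * frechet_derivative \<phi> (at x) b)"
    "integrable disc_measure (\<lambda>x. (g x \<bullet> b) * \<phi> x)" "integrable disc_measure (\<lambda>x. (h x \<bullet> b) * \<phi> x)"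
    by (intro square_integrable_mult t weak_gradD(1)[OF u] weak_gradD(1)[OF v] square_integrable_inner_const
        weak_gradD(2)[OF u] weak_gradD(2)[OF v])+
  show "(LINT x|disc_measure. (u x - v x) * frechet_derivative \<phi> (at x) b) = - (LINT x|disc_measure. (g x - h x) \<bullet> b * \<phi> x)"
    unfolding left_diff_distrib inner_diff_left Bochner_Integration.integral_diff[OF i(1,2)] Bochner_Integration.integral_diff[OF i(3,4)]
      weak_gradD(3)[OF u \<phi> b] weak_gradD(3)[OF v \<phi> b] by simp
qed

text \<open>This is what makes the choice in the definition of the weak gradient immaterial.\<close>

lemma weak_grad_unique:
  assumes g: "weak_grad u g" and h: "weak_grad u h"
  shows "AE x in disc_measure. g x = h x"
proof -
  have *: "AE x in disc_measure. (g x - h x) \<bullet> b = 0" if b: "b \<in> Basis" for b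
  proof (rule fundamental_lemma_of_variations)
    show "square_integrable disc_measure (\<lambda>x. (g x - h x) \<bullet> b)"
      by (intro square_integrable_inner_const square_integrable_diff weak_gradD[OF g] weak_gradD[OF h])
    fix \<phi> assume \<phi>: "\<phi> \<in> test_functions unit_disc"
    have "weak_grad (\<lambda>x. 0) (\<lambda>x. g x - h x)" using weak_grad_diff[OF g h] by simp
    from weak_gradD(3)[OF this \<phi> b] show "(LINT x|disc_measure. (g x - h x) \<bullet> b * \<phi> x) = 0" by simp
  qed
  have "AE x in disc_measure. \<forall>b\<in>Basis. (g x - h x) \<bullet> b = 0" by (rule AE_finite_allI[OF finite_Basis *])
  thus ?thesis
  proof eventually_elim
    case (elim x)
    hence "g x - h x = 0" unfolding euclidean_all_zero_iff .
    thus ?case by simp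
  qed
qed

lemma weak_gradient_has: "weak_grad u g \<Longrightarrow> weak_grad u (weak_gradient unit_disc u)"
  using someI[of "\<lambda>g. weak_grad u g" g] by (simp add: weak_gradient_def)

lemma L2_norm_cong_AE:
  assumes "AE x in M. f x = g x" "f \<in> borel_measurable M" "g \<in> borel_measurable M"
  shows "L2_norm M f = L2_norm M g"
  unfolding L2_norm_def using assms by (intro arg_cong[of _ _ sqrt] integral_cong_AE) auto

lemma L2_norm_weak_gradient:
  assumes "weak_grad u g"
  shows "L2_norm disc_measure (weak_gradient unit_disc u) = L2_norm disc_measure g"
  using weak_grad_unique[OF weak_gradient_has[OF assms] assms] weak_gradD(2)[OF weak_gradient_has[OF assms]] weak_gradD(2)[OF assms]
  by (intro L2_norm_cong_AE) (auto simp: square_integrable_def)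

lemma H1_norm_tendsto_0_iff:
  assumes "\<And>n. weak_grad (u n) (g n)"
  shows "(\<lambda>n. H1_norm unit_disc (u n)) \<longlonglongrightarrow> 0 \<longleftrightarrow>
     (\<lambda>n. L2_norm disc_measure (u n)) \<longlonglongrightarrow> 0 \<and> (\<lambda>n. L2_norm disc_measure (g n)) \<longlonglongrightarrow> 0"
proof
  assume *: "(\<lambda>n. H1_norm unit_disc (u n)) \<longlonglongrightarrow> 0"
  have H: "H1_norm unit_disc (u n) = sqrt ((L2_norm disc_measure (u n))\<^sup>2 + (L2_norm disc_measure (g n))\<^sup>2)" for n
    unfolding H1_norm_def L2_norm_weak_gradient[OF assms] ..
  have "norm (L2_norm disc_measure (u n)) \<le> H1_norm unit_disc (u n)" "norm (L2_norm disc_measure (g n)) \<le> H1_norm unit_disc (u n)" for n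
    unfolding H by (auto simp: L2_norm_nonneg intro!: real_le_rsqrt)
  thus "(\<lambda>n. L2_norm disc_measure (u n)) \<longlonglongrightarrow> 0 \<and> (\<lambda>n. L2_norm disc_measure (g n)) \<longlonglongrightarrow> 0"
    by (intro conjI Lim_null_comparison[OF _ *] always_eventually allI)
next
  assume *: "(\<lambda>n. L2_norm disc_measure (u n)) \<longlonglongrightarrow> 0 \<and> (\<lambda>n. L2_norm disc_measure (g n)) \<longlonglongrightarrow> 0"
  have "(\<lambda>n. sqrt ((L2_norm disc_measure (u n))\<^sup>2 + (L2_norm disc_measure (g n))\<^sup>2)) \<longlonglongrightarrow> sqrt (0\<^sup>2 + 0\<^sup>2)"
    using * by (intro tendsto_intros) auto
  thus "(\<lambda>n. H1_norm unit_disc (u n)) \<longlonglongrightarrow> 0"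
    unfolding H1_norm_def L2_norm_weak_gradient[OF assms] by simp
qed

definition grad :: "(complex \<Rightarrow> real) \<Rightarrow> complex \<Rightarrow> complex" where
  "grad f x = (\<Sum>b\<in>Basis. frechet_derivative f (at x) b *\<^sub>R b)"

lemma grad_inner: "b \<in> Basis \<Longrightarrow> grad f x \<bullet> b = frechet_derivative f (at x) b"
  by (simp add: grad_def inner_sum_left inner_Basis if_distrib sum.delta cong: if_cong)

lemma grad_inner_frechet: "smooth f \<Longrightarrow> frechet_derivative f (at x) v = grad f x \<bullet> v"
proof -
  assume f: "smooth f"
  have "frechet_derivative f (at x) v = frechet_derivative f (at x) (\<Sum>b\<in>Basis. (v \<bullet> b) *\<^sub>R b)" by (simp add: euclidean_representation)
  also have "\<dots> = (\<Sum>b\<in>Basis. (v \<bullet> b) * frechet_derivative f (at x) b)"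
    using frechet_linear[OF f] by (simp add: linear_sum linear_scale)
  also have "\<dots> = grad f x \<bullet> v" by (simp add: grad_def inner_sum_left inner_commute[of v] mult.commute)
  finally show ?thesis .
qed

lemma continuous_on_grad: "smooth f \<Longrightarrow> continuous_on S (grad f)"
  unfolding grad_def[abs_def] by (intro continuous_intros smooth_continuous_on smooth_frechet)

lemma test_function_inside:
  assumes "\<phi> \<in> test_functions unit_disc"
  obtains d where "d > 0" "d < 1" "vanishes_outside (1 - d) \<phi>"
proof (cases "closure {x. \<phi> x \<noteq> 0} = {}")
  case True
  hence "\<phi> x = 0" for x using closure_subset[of "{x. \<phi> x \<noteq> 0}"] by blast
  thus ?thesis using that[of "1/2"] by (simp add: vanishes_outside_def)
next
  case False
  define K where "K = closure {x. \<phi> x \<noteq> 0}"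
  have K: "compact K" "K \<subseteq> unit_disc" "K \<noteq> {}" using assms False by (auto simp: test_functions_def K_def)
  obtain x where x: "x \<in> K" "\<And>y. y \<in> K \<Longrightarrow> norm y \<le> norm x"
    using continuous_attains_sup[OF K(1,3) continuous_on_norm_id] by blast
  define d where "d = (1 - norm x) / 2"
  have nx: "norm x < 1" using subsetD[OF K(2) x(1)] by simp
  have dx: "norm x < 1 - d" using nx by (simp add: d_def field_simps)
  have "\<phi> y = 0" if "norm y \<ge> 1 - d" for y
  proof (rule ccontr)
    assume "\<phi> y \<noteq> 0"
    hence "y \<in> K" unfolding K_def by (intro subsetD[OF closure_subset]) simp
    from x(2)[OF this] show False using that dx by (meson leD order_less_le_trans)
  qed
  moreover have "d > 0" using nx by (simp add: d_def)
  moreover have "d < 1"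
  proof -
    have "- 1 < norm x" by (rule less_le_trans[OF _ norm_ge_zero]) simp
    thus ?thesis by (simp add: d_def field_simps)
  qed
  ultimately show ?thesis using that[of d] by (simp add: vanishes_outside_def)
qed

text \<open>Small translations keep the support of \<open>h\<close> in the disc, so the integral of the
  translated function is constant; its derivative with respect to the translation is the integral
  of the derivative. Translation is written as a convolution with the constant 1, whose derivative
  is known.\<close>

lemma integral_derivative_vanishing:
  assumes h: "smooth h" "vanishes_outside (1 - d) h" and d: "d > 0" "d < 1"
  shows "(LINT y|disc_measure. frechet_derivative h (at y) v) = 0"
proof -
  define \<kappa> where "\<kappa> a = h (- a)" for a :: complex
  have \<kappa>: "smooth \<kappa>" unfolding \<kappa>_def using smooth_affine[OF h(1), of "-1" 0] by simp
  have \<kappa>v: "vanishes_outside (1 - d) \<kappa>" using h(2) by (simp add: \<kappa>_def vanishes_outside_def)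
  have one: "integrable disc_measure (\<lambda>y. 1 :: real)" using finite_measure.integrable_const[OF finite_measure_disc] by blast
  have const: "convolve (\<lambda>_. 1) \<kappa> 1 x = (LINT y|lborel. h y)" if x: "x \<in> ball 0 d" for x
  proof -
    have "convolve (\<lambda>_. 1) \<kappa> 1 x = (LINT y|disc_measure. h (- x + y))" by (simp add: convolve_def \<kappa>_def algebra_simps)
    also have "\<dots> = (LINT y|lborel. h (- x + y))"
    proof (rule disc_integral_eq_lborel)
      show "(\<lambda>y. h (- x + y)) \<in> borel_measurable borel" using smooth_borel[OF h(1)] by measurable
      fix y assume "y \<notin> unit_disc"
      hence "norm (- x + y) \<ge> 1 - d" using x norm_triangle_ineq2[of y x] by simp
      thus "h (- x + y) = 0" using h(2) by (auto simp: vanishes_outside_def)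
    qed
    also have "\<dots> = (LINT y|distr lborel borel ((+) (- x)). h y)"
      using smooth_borel[OF h(1)] by (subst integral_distr) auto
    finally show ?thesis by (simp add: lborel_distr_plus)
  qed
  have "((\<lambda>x. LINT y|lborel. h y) has_derivative (\<lambda>v. 0)) (at 0)" by simp
  hence "(convolve (\<lambda>_. 1) \<kappa> 1 has_derivative (\<lambda>v. 0)) (at 0)"
    by (rule has_derivative_transform_within_open[where s = "ball 0 d"]) (use d const in auto)
  from has_derivative_unique[OF convolve_has_derivative[OF one \<kappa> \<kappa>v, of 1 0] this]
  have 1: "convolve (\<lambda>_. 1) (\<lambda>a. 1 * frechet_derivative \<kappa> (at a) v) 1 0 = 0" by metis
  have "frechet_derivative \<kappa> (at a) v = - frechet_derivative h (at (- a)) v" for a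
    using frechetI[OF has_derivative_affine[OF h(1), of "-1" 0 a]] by (simp add: \<kappa>_def[abs_def])
  thus ?thesis using 1 by (simp add: convolve_def)
qed

lemma smooth_weak_grad:
  assumes f: "smooth f"
  shows "weak_grad f (grad f)"
  unfolding has_weak_gradient_def
proof (intro conjI ballI)
  show "square_integrable disc_measure f" by (rule smooth_square_integrable[OF f])
  show "square_integrable disc_measure (grad f)" by (rule square_integrable_disc_continuous[OF continuous_on_grad[OF f]])
  fix \<phi> and b :: complex assume \<phi>: "\<phi> \<in> test_functions unit_disc" and b: "b \<in> Basis"
  have s\<phi>: "smooth \<phi>" using \<phi> by (simp add: test_functions_def)
  obtain d where d: "d > 0" "d < 1" "vanishes_outside (1 - d) \<phi>" using test_function_inside[OF \<phi>] by blast
  have der: "frechet_derivative (\<lambda>x. f x * \<phi> x) (at x) b = f x * frechet_derivative \<phi> (at x) b + frechet_derivative f (at x) b * \<phi> x" for x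
    by (rule frechetI[OF has_derivative_mult[OF smooth_has_derivative[OF f] smooth_has_derivative[OF s\<phi>]]])
  have "(LINT x|disc_measure. frechet_derivative (\<lambda>x. f x * \<phi> x) (at x) b) = 0"
    by (rule integral_derivative_vanishing[OF smooth_mult[OF f s\<phi>] _ d(1,2)]) (use d(3) in \<open>auto simp: vanishes_outside_def\<close>)
  hence "(LINT x|disc_measure. f x * frechet_derivative \<phi> (at x) b) + (LINT x|disc_measure. frechet_derivative f (at x) b * \<phi> x) = 0"
    unfolding der
    by (subst (asm) Bochner_Integration.integral_add) (auto intro!: square_integrable_mult smooth_square_integrable smooth_frechet f s\<phi>)
  thus "(LINT x|disc_measure. f x * frechet_derivative \<phi> (at x) b) = - (LINT x|disc_measure. grad f x \<bullet> b * \<phi> x)"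
    by (simp add: grad_inner[OF b])
qed

text \<open>Mollification commutes with weak differentiation, up to the factor produced by the dilation,
  because the kernel is a test function of its second argument.\<close>

lemma mollify_frechet:
  assumes u: "weak_grad u g" and e: "0 < e" "e < 1/4" and x: "x \<in> unit_disc" and b: "b \<in> Basis"
  shows "frechet_derivative (mollify u e) (at x) b = (1 - 2 * e) * mollify (\<lambda>x. g x \<bullet> b) e x"
proof -
  define r where "r = 1 - 2 * e"
  define \<phi> where "\<phi> y = mollifier e (r *\<^sub>R x - y)" for y
  have u1: "integrable disc_measure u" by (rule square_integrable_integrable[OF finite_measure_disc weak_gradD(1)[OF u]])
  have \<phi>: "\<phi> \<in> test_functions unit_disc" unfolding \<phi>_def r_def by (rule mollifier_test_function[OF e(1) mollify_inside[OF e x]])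
  have d\<phi>: "frechet_derivative \<phi> (at y) b = - frechet_derivative (mollifier e) (at (r *\<^sub>R x - y)) b" for y
    using frechetI[OF has_derivative_affine[OF smooth_mollifier[of e], of "-1" "r *\<^sub>R x" y]] by (simp add: \<phi>_def[abs_def])
  have "frechet_derivative (mollify u e) (at x) b = convolve u (\<lambda>a. r * frechet_derivative (mollifier e) (at a) b) r x"
    unfolding mollify_def r_def by (rule frechetI[OF convolve_has_derivative[OF u1 smooth_mollifier mollifier_vanishes[OF e(1)]]])
  also have "\<dots> = (LINT y|disc_measure. - r * (u y * frechet_derivative \<phi> (at y) b))"
    unfolding convolve_def d\<phi> by (intro Bochner_Integration.integral_cong refl) simp
  also have "\<dots> = - r * (LINT y|disc_measure. u y * frechet_derivative \<phi> (at y) b)" by (rule integral_mult_right_zero)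
  also have "\<dots> = r * (LINT y|disc_measure. (g y \<bullet> b) * \<phi> y)" by (simp add: weak_gradD(3)[OF u \<phi> b])
  finally show ?thesis by (simp add: mollify_def convolve_def \<phi>_def r_def)
qed

lemma L2_norm_sq_Basis:
  fixes f :: "'a \<Rightarrow> 'b::euclidean_space"
  assumes "square_integrable M f"
  shows "(L2_norm M f)\<^sup>2 = (\<Sum>b\<in>Basis. (L2_norm M (\<lambda>x. f x \<bullet> b))\<^sup>2)"
proof -
  have "(norm v)\<^sup>2 = (\<Sum>b\<in>Basis. (norm (v \<bullet> b))\<^sup>2)" for v :: 'b
    unfolding power2_norm_eq_inner[of v] euclidean_inner[of v v] by (simp add: power2_eq_square)
  thus ?thesis unfolding L2_norm_power2
    using square_integrable_inner_const[OF assms] by (subst Bochner_Integration.integral_sum[symmetric]) (auto simp: square_integrable_def)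
qed

text \<open>The mollifications converge in \<open>L\<^sup>2\<close>, and their derivatives are the
  mollifications of the weak derivatives up to a factor that tends to 1.\<close>

lemma smooth_dense_H1:
  assumes u: "weak_grad u g"
  shows "(\<lambda>n. H1_norm unit_disc (\<lambda>x. mollify u (eps n) x - u x)) \<longlonglongrightarrow> 0"
proof -
  have u1: "integrable disc_measure u" by (rule square_integrable_integrable[OF finite_measure_disc weak_gradD(1)[OF u]])
  have sm: "smooth (mollify u (eps n))" for n by (rule smooth_mollify[OF u1 eps(1)])
  have wg: "weak_grad (\<lambda>x. mollify u (eps n) x - u x) (\<lambda>x. grad (mollify u (eps n)) x - g x)" for n
    by (rule weak_grad_diff[OF smooth_weak_grad[OF sm] u])
  have "(\<lambda>n. L2_norm disc_measure (\<lambda>x. (grad (mollify u (eps n)) x - g x) \<bullet> b)) \<longlonglongrightarrow> 0" if b: "b \<in> Basis" for b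
  proof -
    define G where "G x = g x \<bullet> b" for x
    have G: "square_integrable disc_measure G" unfolding G_def by (rule square_integrable_inner_const[OF weak_gradD(2)[OF u]])
    have G1: "integrable disc_measure G" by (rule square_integrable_integrable[OF finite_measure_disc G])
    have mG: "square_integrable disc_measure (mollify G (eps n))" for n by (intro smooth_square_integrable smooth_mollify G1 eps)
    have "L2_norm disc_measure (\<lambda>x. (grad (mollify u (eps n)) x - g x) \<bullet> b)
       \<le> L2_norm disc_measure (\<lambda>x. mollify G (eps n) x - G x) + 2 * eps n * (2 * L2_norm disc_measure G)" for n
    proof -
      have "L2_norm disc_measure (\<lambda>x. (grad (mollify u (eps n)) x - g x) \<bullet> b)
         = L2_norm disc_measure (\<lambda>x. (mollify G (eps n) x - G x) + (- 2 * eps n) *\<^sub>R mollify G (eps n) x)"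
        unfolding L2_norm_def
      proof (intro arg_cong[of _ _ sqrt] Bochner_Integration.integral_cong refl)
        fix x assume "x \<in> space disc_measure"
        hence "(grad (mollify u (eps n)) x - g x) \<bullet> b = (1 - 2 * eps n) * mollify G (eps n) x - G x"
          using mollify_frechet[OF u eps(1,2) _ b] by (simp add: inner_diff_left grad_inner[OF b] G_def[abs_def])
        also have "\<dots> = mollify G (eps n) x - G x + (- 2 * eps n) *\<^sub>R mollify G (eps n) x" by (simp add: algebra_simps)
        finally show "(norm ((grad (mollify u (eps n)) x - g x) \<bullet> b))\<^sup>2 = (norm (mollify G (eps n) x - G x + (- 2 * eps n) *\<^sub>R mollify G (eps n) x))\<^sup>2"
          by (simp only:)
      qed
      also have "\<dots> \<le> L2_norm disc_measure (\<lambda>x. mollify G (eps n) x - G x) + L2_norm disc_measure (\<lambda>x. (- 2 * eps n) *\<^sub>R mollify G (eps n) x)"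
        by (intro L2_norm_triangle square_integrable_diff square_integrable_scaleR mG G)
      also have "L2_norm disc_measure (\<lambda>x. (- 2 * eps n) *\<^sub>R mollify G (eps n) x) = 2 * eps n * L2_norm disc_measure (mollify G (eps n))"
        unfolding L2_norm_scaleR using eps(1)[of n] by simp
      also have "\<dots> \<le> 2 * eps n * (2 * L2_norm disc_measure G)"
        using eps(1)[of n] by (intro mult_left_mono mollify_L2_bound G eps) auto
      finally show ?thesis by simp
    qed
    note le = this
    have "(\<lambda>n. L2_norm disc_measure (\<lambda>x. mollify G (eps n) x - G x) + 2 * eps n * (2 * L2_norm disc_measure G)) \<longlonglongrightarrow> 0 + 2 * 0 * (2 * L2_norm disc_measure G)"
      by (intro tendsto_intros mollify_tendsto G eps)
    hence lim: "(\<lambda>n. L2_norm disc_measure (\<lambda>x. mollify G (eps n) x - G x) + 2 * eps n * (2 * L2_norm disc_measure G)) \<longlonglongrightarrow> 0" by simp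
    show ?thesis
    proof (rule Lim_null_comparison[OF always_eventually lim], rule allI)
      show "norm (L2_norm disc_measure (\<lambda>x. (grad (mollify u (eps n)) x - g x) \<bullet> b))
          \<le> L2_norm disc_measure (\<lambda>x. mollify G (eps n) x - G x) + 2 * eps n * (2 * L2_norm disc_measure G)" for n
        unfolding real_norm_def abs_of_nonneg[OF L2_norm_nonneg] by (rule le)
    qed
  qed
  hence "(\<lambda>n. sqrt (\<Sum>b\<in>Basis. (L2_norm disc_measure (\<lambda>x. (grad (mollify u (eps n)) x - g x) \<bullet> b))\<^sup>2)) \<longlonglongrightarrow> sqrt (\<Sum>b\<in>(Basis::complex set). 0\<^sup>2)"
    by (intro tendsto_intros)
  hence "(\<lambda>n. sqrt ((L2_norm disc_measure (\<lambda>x. grad (mollify u (eps n)) x - g x))\<^sup>2)) \<longlonglongrightarrow> 0"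
    unfolding L2_norm_sq_Basis[OF weak_gradD(2)[OF wg]] by simp
  hence "(\<lambda>n. L2_norm disc_measure (\<lambda>x. grad (mollify u (eps n)) x - g x)) \<longlonglongrightarrow> 0"
    by (simp add: L2_norm_nonneg)
  thus ?thesis
    unfolding H1_norm_tendsto_0_iff[OF wg] using mollify_tendsto[OF weak_gradD(1)[OF u]] by simp
qed

section \<open>The divergence theorem on the disc\<close>

text \<open>Planar Lebesgue measure is a product measure in the two coordinates, in either order; the two
  orders serve the two components of the divergence theorem.\<close>

lemma lborel_complex_distr:
  assumes "(e1, e2) = (1, \<i>) \<or> (e1, e2) = (\<i>, 1)"
  shows "(lborel :: complex measure) = distr (lborel \<Otimes>\<^sub>M lborel) borel (\<lambda>q. fst q *\<^sub>R e1 + snd q *\<^sub>R e2)"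
proof (rule lborel_eqI)
  let ?T = "\<lambda>q::real \<times> real. fst q *\<^sub>R e1 + snd q *\<^sub>R e2"
  fix l u :: complex assume lu: "\<And>b. b \<in> Basis \<Longrightarrow> l \<bullet> b \<le> u \<bullet> b"
  have T: "?T \<in> lborel \<Otimes>\<^sub>M lborel \<rightarrow>\<^sub>M borel"
    by (simp add: lborel_prod) (intro borel_measurable_continuous_onI continuous_intros)
  have "?T -` box l u = {l \<bullet> e1<..<u \<bullet> e1} \<times> {l \<bullet> e2<..<u \<bullet> e2}"
    using assms by (auto simp: box_def Basis_complex_def inner_complex_def)
  hence "emeasure (distr (lborel \<Otimes>\<^sub>M lborel) borel ?T) (box l u) = emeasure (lborel \<Otimes>\<^sub>M lborel) ({l \<bullet> e1<..<u \<bullet> e1} \<times> {l \<bullet> e2<..<u \<bullet> e2})"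
    by (subst emeasure_distr[OF T]) (auto simp: space_pair_measure)
  also have "\<dots> = emeasure lborel {l \<bullet> e1<..<u \<bullet> e1} * emeasure lborel {l \<bullet> e2<..<u \<bullet> e2}"
    by (rule lborel.emeasure_pair_measure_Times) auto
  also have "\<dots> = ennreal ((u - l) \<bullet> e1) * ennreal ((u - l) \<bullet> e2)"
    using lu[of e1] lu[of e2] assms by (auto simp: Basis_complex_def inner_diff_left)
  also have "\<dots> = ennreal (((u - l) \<bullet> e1) * ((u - l) \<bullet> e2))"
    using lu[of e1] assms by (subst ennreal_mult') (auto simp: Basis_complex_def inner_diff_left)
  also have "((u - l) \<bullet> e1) * ((u - l) \<bullet> e2) = (\<Prod>b\<in>Basis. (u - l) \<bullet> b)"
    using assms by (auto simp: Basis_complex_def mult.commute)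
  finally show "emeasure (distr (lborel \<Otimes>\<^sub>M lborel) borel ?T) (box l u) = ennreal (\<Prod>b\<in>Basis. (u - l) \<bullet> b)" .
qed simp

lemma disc_integral_cball:
  fixes g :: "complex \<Rightarrow> real"
  assumes "continuous_on UNIV g"
  shows "(LINT z|disc_measure. g z) = (LINT z|lborel. indicator (cball 0 1) z *\<^sub>R g z)"
proof -
  have gm: "g \<in> borel_measurable borel" by (rule borel_measurable_continuous_onI[OF assms])
  have "(LINT z|disc_measure. g z) = (LINT z|lebesgue. indicator unit_disc z *\<^sub>R g z)"
    by (rule integral_restrict_space) simp
  also have "\<dots> = (LINT z|lebesgue. indicator (cball 0 1) z *\<^sub>R g z)"
  proof (rule integral_cong_AE)
    have "AE z in lebesgue. z \<notin> sphere (0::complex) 1"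
      by (rule AE_not_in) (use negligible_sphere[of "0::complex" 1] negligible_iff_null_sets in blast)
    thus "AE z in lebesgue. indicator unit_disc z *\<^sub>R g z = indicator (cball 0 1) z *\<^sub>R g z"
      by eventually_elim (auto simp: indicator_def)
  qed (intro measurable_completion borel_measurable_scaleR borel_measurable_indicator; use gm in simp)+
  also have "\<dots> = (LINT z|lborel. indicator (cball 0 1) z *\<^sub>R g z)"
    by (rule integral_completion) (intro borel_measurable_scaleR borel_measurable_indicator; use gm in simp)
  finally show ?thesis .
qed

text \<open>Fubini's theorem, and the fundamental theorem of calculus on each chord of the disc parallel to
  \<open>e1\<close>.\<close>

lemma green_sections:
  fixes f :: "complex \<Rightarrow> real"
  assumes f: "smooth f" and e: "(e1, e2) = (1, \<i>) \<or> (e1, e2) = (\<i>, 1)"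
  defines "P \<equiv> \<lambda>x y. x *\<^sub>R e1 + y *\<^sub>R e2"
  shows "(LINT z|disc_measure. frechet_derivative f (at z) e1)
     = integral {-1..1} (\<lambda>y. f (P (sqrt (1 - y\<^sup>2)) y) - f (P (- sqrt (1 - y\<^sup>2)) y))"
proof -
  define g where "g z = frechet_derivative f (at z) e1" for z
  have gc: "continuous_on S g" for S unfolding g_def by (intro smooth_continuous_on smooth_frechet f)
  define k where "k z = indicator (cball 0 1) z *\<^sub>R g z" for z :: complex
  have ki: "integrable lborel k" unfolding k_def by (rule borel_integrable_compact) (auto intro: gc)
  define T where "T = (\<lambda>q::real \<times> real. P (fst q) (snd q))"
  have Tm: "T \<in> lborel \<Otimes>\<^sub>M lborel \<rightarrow>\<^sub>M borel" unfolding T_def P_def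
    by (simp add: lborel_prod) (intro borel_measurable_continuous_onI continuous_intros)
  have Pc: "continuous_on UNIV (\<lambda>x. P x y)" for y unfolding P_def by (intro continuous_intros)
  have distr: "(lborel :: complex measure) = distr (lborel \<Otimes>\<^sub>M lborel) borel T"
    unfolding T_def P_def by (rule lborel_complex_distr[OF e])
  have normP: "P x y \<in> cball 0 1 \<longleftrightarrow> x\<^sup>2 + y\<^sup>2 \<le> 1" for x y
    using e unfolding P_def by (auto simp: cmod_def add.commute)
  have km: "k \<in> borel_measurable borel" using ki by auto
  have "integrable (distr (lborel \<Otimes>\<^sub>M lborel) borel T) k" using ki distr by metis
  hence kTi: "integrable (lborel \<Otimes>\<^sub>M lborel) (\<lambda>q. k (T q))" by (subst (asm) integrable_distr_eq[OF Tm km])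
  have "(LINT z|disc_measure. g z) = (LINT z|lborel. k z)" unfolding k_def by (rule disc_integral_cball[OF gc])
  also have "\<dots> = (LINT z|(distr (lborel \<Otimes>\<^sub>M lborel) borel T). k z)" using distr by metis
  also have "\<dots> = (LINT q|(lborel \<Otimes>\<^sub>M lborel). k (T q))" by (rule integral_distr[OF Tm km])
  also have "\<dots> = (LINT y|lborel. LINT x|lborel. k (P x y))"
    using lborel_pair.integral_snd[of "\<lambda>x y. k (P x y)"] kTi by (simp add: T_def case_prod_beta')
  also have "(\<lambda>y. LINT x|lborel. k (P x y)) = (\<lambda>y. indicator {-1..1} y *\<^sub>R (f (P (sqrt (1 - y\<^sup>2)) y) - f (P (- sqrt (1 - y\<^sup>2)) y)))"
  proof (rule ext)
    fix y :: real
    show "(LINT x|lborel. k (P x y)) = indicator {-1..1} y *\<^sub>R (f (P (sqrt (1 - y\<^sup>2)) y) - f (P (- sqrt (1 - y\<^sup>2)) y))"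
    proof (cases "y \<in> {-1..1}")
      case True
      hence y: "y\<^sup>2 \<le> 1" by (simp add: abs_square_le_1 abs_le_iff)
      define s where "s = sqrt (1 - y\<^sup>2)"
      have s: "s \<ge> 0" "s\<^sup>2 = 1 - y\<^sup>2" using y by (auto simp: s_def)
      have "x\<^sup>2 + y\<^sup>2 \<le> 1 \<longleftrightarrow> x \<in> {-s..s}" for x
      proof -
        have "x\<^sup>2 + y\<^sup>2 \<le> 1 \<longleftrightarrow> x\<^sup>2 \<le> s\<^sup>2" using s(2) by linarith
        also have "\<dots> \<longleftrightarrow> \<bar>x\<bar> \<le> s" using abs_le_square_iff[of x s] s(1) by simp
        finally show ?thesis by (auto simp: abs_le_iff)
      qed
      hence "k (P x y) = indicator {-s..s} x *\<^sub>R g (P x y)" for x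
        unfolding k_def indicator_def using normP[of x y] by simp
      hence "(LINT x|lborel. k (P x y)) = (LINT x|lborel. indicator {-s..s} x *\<^sub>R g (P x y))" by simp
      also have "\<dots> = f (P s y) - f (P (-s) y)"
      proof (rule integral_FTC_atLeastAtMost)
        show "- s \<le> s" using s by simp
        fix x
        show "((\<lambda>x. f (P x y)) has_vector_derivative g (P x y)) (at x within {- s..s})"
        proof -
          have 1: "((\<lambda>x. P x y) has_derivative (\<lambda>h. h *\<^sub>R e1)) (at x within {-s..s})"
            unfolding P_def by (auto intro!: derivative_eq_intros)
          have "((\<lambda>x. f (P x y)) has_derivative (\<lambda>h. frechet_derivative f (at (P x y)) (h *\<^sub>R e1))) (at x within {-s..s})"
            by (rule has_derivative_compose[OF 1 smooth_has_derivative[OF f]])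
          thus ?thesis unfolding has_vector_derivative_def g_def by (simp add: linear_scale[OF frechet_linear[OF f]])
        qed
      next
        show "continuous_on {- s..s} (\<lambda>x. g (P x y))"
          by (rule continuous_on_compose2[OF gc[of UNIV] continuous_on_subset[OF Pc]]) auto
      qed
      finally show ?thesis using True by (simp add: s_def)
    next
      case False
      hence "y\<^sup>2 > 1" using abs_square_le_1[of y] by (auto simp: abs_le_iff not_le)
      hence "\<not> (x\<^sup>2 + y\<^sup>2 \<le> 1)" for x using zero_le_power2[of x] by linarith
      hence "k (P x y) = 0" for x unfolding k_def indicator_def using normP[of x y] by simp
      thus ?thesis using False by simp
    qed
  qed
  also have "(LINT y|lborel. indicator {-1..1} y *\<^sub>R (f (P (sqrt (1 - y\<^sup>2)) y) - f (P (- sqrt (1 - y\<^sup>2)) y)))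
     = integral {-1..1} (\<lambda>y. f (P (sqrt (1 - y\<^sup>2)) y) - f (P (- sqrt (1 - y\<^sup>2)) y))"
  proof -
    have c: "continuous_on {-1..1} (\<lambda>y. f (P (sqrt (1 - y\<^sup>2)) y) - f (P (- sqrt (1 - y\<^sup>2)) y))"
      unfolding P_def by (intro continuous_intros continuous_on_compose2[OF smooth_continuous_on[OF f, of UNIV]]) auto
    have "set_integrable lborel {-1..1} (\<lambda>y. f (P (sqrt (1 - y\<^sup>2)) y) - f (P (- sqrt (1 - y\<^sup>2)) y))"
      unfolding set_integrable_def by (rule borel_integrable_compact[OF _ c]) simp
    from set_borel_integral_eq_integral(2)[OF this] show ?thesis by (simp add: set_lebesgue_integral_def)
  qed
  finally show ?thesis by (simp add: g_def)
qed

text \<open>Substitute \<open>y = sin t\<close>. On \<open>[-\<pi>/2, \<pi>/2]\<close> the cosine is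
  nonnegative and the point is the right end of its chord, on \<open>[\<pi>/2, 3\<pi>/2]\<close>
  it is nonpositive and the point is the left end.\<close>

lemma green_param:
  fixes f :: "complex \<Rightarrow> real"
  assumes f: "smooth f" and e: "(e1, e2) = (1, \<i>) \<or> (e1, e2) = (\<i>, 1)"
  defines "P \<equiv> \<lambda>x y. x *\<^sub>R e1 + y *\<^sub>R e2"
  shows "(LINT z|disc_measure. frechet_derivative f (at z) e1)
     = integral {-pi/2..3*pi/2} (\<lambda>t. cos t * f (P (cos t) (sin t)))"
proof -
  define h1 where "h1 y = f (P (sqrt (1 - y\<^sup>2)) y)" for y
  define h2 where "h2 y = f (P (- sqrt (1 - y\<^sup>2)) y)" for y
  have c1: "continuous_on {-1..1} h1" and c2: "continuous_on {-1..1} h2"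
    unfolding P_def h1_def h2_def by (intro continuous_intros continuous_on_compose2[OF smooth_continuous_on[OF f, of UNIV]]; auto)+
  have "((\<lambda>t. cos t *\<^sub>R h1 (sin t)) has_integral (integral {sin (-pi/2)..sin (pi/2)} h1 - integral {sin (pi/2)..sin (-pi/2)} h1)) {-pi/2..pi/2}"
    by (rule has_integral_substitution_general[where s = "{}" and c = "-1" and d = 1])
       (auto intro!: continuous_intros c1 derivative_eq_intros)
  hence i1: "((\<lambda>t. cos t *\<^sub>R h1 (sin t)) has_integral integral {-1..1} h1) {-pi/2..pi/2}" by simp
  have s3: "sin (3*pi/2) = -1"
  proof -
    have "3*pi/2 = 3/2*pi" by simp
    thus ?thesis by (simp only: sin_3over2_pi)
  qed
  have "((\<lambda>t. cos t *\<^sub>R h2 (sin t)) has_integral (integral {sin (pi/2)..sin (3*pi/2)} h2 - integral {sin (3*pi/2)..sin (pi/2)} h2)) {pi/2..3*pi/2}"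
    by (rule has_integral_substitution_general[where s = "{}" and c = "-1" and d = 1])
       (auto intro!: continuous_intros c2 derivative_eq_intros)
  hence i2: "((\<lambda>t. cos t *\<^sub>R h2 (sin t)) has_integral (- integral {-1..1} h2)) {pi/2..3*pi/2}" unfolding s3 by simp
  have sq: "sqrt (1 - (sin t)\<^sup>2) = \<bar>cos t\<bar>" for t by (metis cos_squared_eq real_sqrt_abs)
  have "((\<lambda>t. cos t * f (P (cos t) (sin t))) has_integral integral {-1..1} h1) {-pi/2..pi/2}"
  proof (rule has_integral_eq[OF _ i1])
    fix t assume "t \<in> {-pi/2..pi/2}"
    hence "cos t \<ge> 0" by (intro cos_ge_zero) auto
    thus "cos t *\<^sub>R h1 (sin t) = cos t * f (P (cos t) (sin t))" by (simp add: h1_def sq)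
  qed
  moreover have "((\<lambda>t. cos t * f (P (cos t) (sin t))) has_integral (- integral {-1..1} h2)) {pi/2..3*pi/2}"
  proof (rule has_integral_eq[OF _ i2])
    fix t assume "t \<in> {pi/2..3*pi/2}"
    hence "cos (t - pi) \<ge> 0" by (intro cos_ge_zero) auto
    hence "cos t \<le> 0" by (simp add: cos_diff)
    thus "cos t *\<^sub>R h2 (sin t) = cos t * f (P (cos t) (sin t))" by (simp add: h2_def sq)
  qed
  ultimately have "((\<lambda>t. cos t * f (P (cos t) (sin t))) has_integral (integral {-1..1} h1 + - integral {-1..1} h2)) {-pi/2..3*pi/2}"
    by (rule has_integral_combine[rotated 2]) auto
  moreover have "integral {-1..1} h1 + - integral {-1..1} h2 = integral {-1..1} (\<lambda>y. h1 y - h2 y)"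
    by (subst integral_diff) (auto intro!: integrable_continuous_real c1 c2)
  ultimately show ?thesis
    unfolding green_sections[OF f e] by (simp add: integral_unique P_def h1_def h2_def)
qed

lemma periodic_integral:
  fixes g :: "real \<Rightarrow> real"
  assumes c: "continuous_on UNIV g" and p: "\<And>t. g (t + 2 * pi) = g t" and a: "-2*pi \<le> a" "a \<le> 0"
  shows "integral {a..a + 2 * pi} g = integral {0..2*pi} g"
proof -
  have i: "g integrable_on {x..y}" for x y by (intro integrable_continuous_real continuous_on_subset[OF c]) auto
  have "integral {a..a + 2 * pi} g = integral {a..0} g + integral {0..a + 2 * pi} g"
    by (rule Henstock_Kurzweil_Integration.integral_combine[symmetric]) (use a i in auto)
  also have "integral {a..0} g = integral {a..0} (g \<circ> (+) (2 * pi))" by (simp add: o_def add.commute p)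
  also have "\<dots> = integral {a + 2 * pi..0 + 2 * pi} g" by (rule integral_shift_Icc_real)
  also have "\<dots> + integral {0..a + 2 * pi} g = integral {0..2*pi} g"
    using Henstock_Kurzweil_Integration.integral_combine[of 0 "a + 2 * pi" "2 * pi" g] a i by simp
  finally show ?thesis .
qed

lemma circle_integral_eq:
  assumes "continuous_on (sphere 0 1) (g :: complex \<Rightarrow> real)"
  shows "(LINT \<theta>|angle_measure. g (cis \<theta>)) = integral {0..2*pi} (\<lambda>\<theta>. g (cis \<theta>))"
  by (rule lebesgue_integral_eq_integral) (use circle_integrable_continuous[OF assms] in auto)

lemma green_x:
  assumes f: "smooth f"
  shows "(LINT z|disc_measure. frechet_derivative f (at z) 1) = (LINT \<theta>|angle_measure. f (cis \<theta>) * cos \<theta>)"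
proof -
  have fc: "continuous_on S f" for S by (rule smooth_continuous_on[OF f])
  define g where "g z = f z * Re z" for z
  have gc: "continuous_on S g" for S unfolding g_def by (intro continuous_intros fc)
  have P: "cos t *\<^sub>R 1 + sin t *\<^sub>R \<i> = cis t" for t by (simp add: complex_eq_iff)
  have "(LINT z|disc_measure. frechet_derivative f (at z) 1) = integral {-pi/2..3*pi/2} (\<lambda>t. g (cis t))"
    unfolding green_param[OF f disjI1[OF refl]] P
    by (intro integral_cong) (simp add: g_def mult.commute)
  also have "\<dots> = integral {0..2*pi} (\<lambda>t. g (cis t))"
    using periodic_integral[of "\<lambda>t. g (cis t)" "-pi/2"] continuous_on_comp_cis[OF gc]
    by (simp flip: cis_mult)
  finally show ?thesis using circle_integral_eq[OF gc] by (simp add: g_def)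
qed

lemma green_y:
  assumes f: "smooth f"
  shows "(LINT z|disc_measure. frechet_derivative f (at z) \<i>) = (LINT \<theta>|angle_measure. f (cis \<theta>) * sin \<theta>)"
proof -
  have fc: "continuous_on S f" for S by (rule smooth_continuous_on[OF f])
  define g where "g z = f z * Im z" for z
  have gc: "continuous_on S g" for S unfolding g_def by (intro continuous_intros fc)
  have P: "cos t *\<^sub>R \<i> + sin t *\<^sub>R 1 = cis (pi/2 - t)" for t by (simp add: complex_eq_iff cos_diff sin_diff)
  have "(LINT z|disc_measure. frechet_derivative f (at z) \<i>) = integral {-pi/2..3*pi/2} (\<lambda>t. g (cis (pi/2 - t)))"
    unfolding green_param[OF f disjI2[OF refl]] P
    by (intro integral_cong) (simp add: g_def sin_diff mult.commute)
  \<comment> \<open>With the coordinates exchanged the circle is run through clockwise; reflection and translation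
    of the parameter bring the integral back to the standard form.\<close>
  also have "\<dots> = integral {- (pi/2).. -(- (3*pi/2))} (\<lambda>t. (\<lambda>x. g (cis (pi/2 + x))) (- t))" by simp
  also have "\<dots> = integral {- (3*pi/2)..pi/2} (\<lambda>x. g (cis (pi/2 + x)))"
    using Henstock_Kurzweil_Integration.integral_reflect_real[where b = "pi/2" and a = "- (3*pi/2)" and f = "\<lambda>x. g (cis (pi/2 + x))"] by (simp only:)
  also have "\<dots> = integral {- (3*pi/2)..pi/2} ((\<lambda>t. g (cis t)) \<circ> (+) (pi/2))" by (simp add: o_def)
  also have "\<dots> = integral {- (3*pi/2) + pi/2..pi/2 + pi/2} (\<lambda>t. g (cis t))" by (rule integral_shift_Icc_real)
  also have "\<dots> = integral {- pi..- pi + 2 * pi} (\<lambda>t. g (cis t))" by simp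
  also have "\<dots> = integral {0..2*pi} (\<lambda>t. g (cis t))"
    using periodic_integral[of "\<lambda>t. g (cis t)" "-pi"] continuous_on_comp_cis[OF gc]
    by (simp flip: cis_mult)
  finally show ?thesis using circle_integral_eq[OF gc] by (simp add: g_def)
qed

lemma smooth_Re: "smooth Re" and smooth_Im: "smooth Im"
  by (intro smooth_linear bounded_linear_Re bounded_linear_Im)+

lemma frechet_Re: "frechet_derivative Re (at x) v = Re v" and frechet_Im: "frechet_derivative Im (at x) v = Im v"
  by (rule frechetI, rule bounded_linear_imp_has_derivative, rule bounded_linear_Re bounded_linear_Im)+

lemma frechet_mult:
  assumes "smooth f" "smooth g"
  shows "frechet_derivative (\<lambda>x. f x * g x) (at x) v = f x * frechet_derivative g (at x) v + frechet_derivative f (at x) v * g x"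
  by (rule frechetI[OF has_derivative_mult[OF smooth_has_derivative smooth_has_derivative]]) (use assms in auto)

lemma divergence_disc:
  assumes "smooth f" "smooth g"
  shows "(LINT z|disc_measure. frechet_derivative f (at z) 1 + frechet_derivative g (at z) \<i>) = (LINT \<theta>|angle_measure. f (cis \<theta>) * cos \<theta> + g (cis \<theta>) * sin \<theta>)"
proof -
  have i: "integrable disc_measure (\<lambda>z. frechet_derivative h (at z) v)" if "smooth h" for h v
    using square_integrable_integrable[OF finite_measure_disc smooth_square_integrable[OF smooth_frechet[OF that]]] .
  have j: "integrable angle_measure (\<lambda>\<theta>. f (cis \<theta>) * Re (cis \<theta>))" "integrable angle_measure (\<lambda>\<theta>. g (cis \<theta>) * Im (cis \<theta>))"
    by (rule circle_integrable_continuous[of "\<lambda>z. f z * Re z"] circle_integrable_continuous[of "\<lambda>z. g z * Im z"],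
        intro continuous_on_mult smooth_continuous_on[OF assms(1)] smooth_continuous_on[OF assms(2)] continuous_on_Re continuous_on_Im continuous_on_id)+
  show ?thesis
    using i[OF assms(1)] i[OF assms(2)] j by (simp add: green_x[OF assms(1)] green_y[OF assms(2)])
qed

section \<open>Trace and Poincare inequalities\<close>

text \<open>The divergence theorem for the vector field \<open>\<phi>\<^sup>2 z\<close>, whose normal
  component on the circle is \<open>\<phi>\<^sup>2\<close>. With the Cauchy-Schwarz inequality it
  bounds the boundary norm by the norms on the disc, and also the norm on the disc by the boundary
  norm and the gradient.\<close>

lemma circle_energy_identity:
  assumes \<phi>: "smooth \<phi>"
  shows "(LINT \<theta>|angle_measure. (\<phi> (cis \<theta>))\<^sup>2) = 2 * (LINT z|disc_measure. (\<phi> z)\<^sup>2) + 2 * (LINT z|disc_measure. \<phi> z * (grad \<phi> z \<bullet> z))"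
proof -
  have s2: "smooth (\<lambda>z. \<phi> z * \<phi> z)" by (rule smooth_mult[OF \<phi> \<phi>])
  have eq: "frechet_derivative (\<lambda>z. \<phi> z * \<phi> z * Re z) (at z) 1 + frechet_derivative (\<lambda>z. \<phi> z * \<phi> z * Im z) (at z) \<i>
     = 2 * (\<phi> z)\<^sup>2 + 2 * (\<phi> z * (grad \<phi> z \<bullet> z))" for z
  proof -
    have "grad \<phi> z \<bullet> z = Re z * frechet_derivative \<phi> (at z) 1 + Im z * frechet_derivative \<phi> (at z) \<i>"
      unfolding grad_inner_frechet[OF \<phi>] by (simp add: inner_complex_def)
    thus ?thesis
      unfolding frechet_mult[OF s2 smooth_Re] frechet_mult[OF s2 smooth_Im] frechet_mult[OF \<phi> \<phi>] frechet_Re frechet_Im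
      by (simp add: power2_eq_square algebra_simps)
  qed
  have "(LINT \<theta>|angle_measure. (\<phi> (cis \<theta>))\<^sup>2) = (LINT \<theta>|angle_measure. \<phi> (cis \<theta>) * \<phi> (cis \<theta>) * Re (cis \<theta>) * cos \<theta> + \<phi> (cis \<theta>) * \<phi> (cis \<theta>) * Im (cis \<theta>) * sin \<theta>)"
  proof (intro Bochner_Integration.integral_cong refl)
    fix \<theta>
    have eq': "\<phi> (cis \<theta>) * \<phi> (cis \<theta>) * Re (cis \<theta>) * cos \<theta> + \<phi> (cis \<theta>) * \<phi> (cis \<theta>) * Im (cis \<theta>) * sin \<theta>
       = (\<phi> (cis \<theta>))\<^sup>2 * ((cos \<theta>)\<^sup>2 + (sin \<theta>)\<^sup>2)" by (simp only: cis.sel power2_eq_square) (simp only: algebra_simps)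
    show "(\<phi> (cis \<theta>))\<^sup>2 = \<phi> (cis \<theta>) * \<phi> (cis \<theta>) * Re (cis \<theta>) * cos \<theta> + \<phi> (cis \<theta>) * \<phi> (cis \<theta>) * Im (cis \<theta>) * sin \<theta>"
      by (simp only: eq' sin_cos_squared_add2 mult_1_right)
  qed
  also have "\<dots> = (LINT z|disc_measure. 2 * (\<phi> z)\<^sup>2 + 2 * (\<phi> z * (grad \<phi> z \<bullet> z)))"
    unfolding eq[symmetric]
    by (rule divergence_disc[symmetric]; intro smooth_mult s2 smooth_Re smooth_Im)
  also have "\<dots> = (LINT z|disc_measure. 2 * (\<phi> z)\<^sup>2) + (LINT z|disc_measure. 2 * (\<phi> z * (grad \<phi> z \<bullet> z)))"
  proof (rule Bochner_Integration.integral_add)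
    show "integrable disc_measure (\<lambda>z. 2 * (\<phi> z)\<^sup>2)" using smooth_square_integrable[OF \<phi>] by (simp add: square_integrable_def)
    have "continuous_on (cball 0 1) (\<lambda>z. grad \<phi> z \<bullet> z)" by (intro continuous_intros continuous_on_grad \<phi>)
    from square_integrable_mult[OF smooth_square_integrable[OF \<phi>] square_integrable_disc_continuous[OF this]]
    show "integrable disc_measure (\<lambda>z. 2 * (\<phi> z * (grad \<phi> z \<bullet> z)))" by simp
  qed
  finally show ?thesis by simp
qed

lemma cross_term_bound:
  assumes \<phi>: "smooth \<phi>"
  shows "\<bar>2 * (LINT z|disc_measure. \<phi> z * (grad \<phi> z \<bullet> z))\<bar> \<le> (LINT z|disc_measure. (\<phi> z)\<^sup>2) + (L2_norm disc_measure (grad \<phi>))\<^sup>2"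
proof -
  have g: "square_integrable disc_measure (grad \<phi>)" by (rule square_integrable_disc_continuous[OF continuous_on_grad[OF \<phi>]])
  have "\<bar>LINT z|disc_measure. 2 * (\<phi> z * (grad \<phi> z \<bullet> z))\<bar> \<le> (LINT z|disc_measure. (\<phi> z)\<^sup>2 + (norm (grad \<phi> z))\<^sup>2)"
  proof (rule order_trans[OF integral_abs_bound integral_mono])
    have "continuous_on (cball 0 1) (\<lambda>z. grad \<phi> z \<bullet> z)" by (intro continuous_intros continuous_on_grad \<phi>)
    from square_integrable_mult[OF smooth_square_integrable[OF \<phi>] square_integrable_disc_continuous[OF this]]
    show "integrable disc_measure (\<lambda>z. \<bar>2 * (\<phi> z * (grad \<phi> z \<bullet> z))\<bar>)" by simp
    show "integrable disc_measure (\<lambda>z. (\<phi> z)\<^sup>2 + (norm (grad \<phi> z))\<^sup>2)"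
      using smooth_square_integrable[OF \<phi>] g by (auto simp: square_integrable_def)
    fix z assume "z \<in> space disc_measure"
    hence z: "norm z \<le> 1" by simp
    have "\<bar>grad \<phi> z \<bullet> z\<bar> \<le> norm (grad \<phi> z) * norm z" by (rule Cauchy_Schwarz_ineq2)
    also have "\<dots> \<le> norm (grad \<phi> z) * 1" using z by (intro mult_left_mono) auto
    finally have "\<bar>\<phi> z\<bar> * \<bar>grad \<phi> z \<bullet> z\<bar> \<le> \<bar>\<phi> z\<bar> * norm (grad \<phi> z)" by (intro mult_left_mono) auto
    moreover have "2 * \<bar>\<phi> z\<bar> * norm (grad \<phi> z) \<le> \<bar>\<phi> z\<bar>\<^sup>2 + (norm (grad \<phi> z))\<^sup>2" by (rule sum_squares_bound)
    ultimately show "\<bar>2 * (\<phi> z * (grad \<phi> z \<bullet> z))\<bar> \<le> (\<phi> z)\<^sup>2 + (norm (grad \<phi> z))\<^sup>2" by (simp add: abs_mult)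
  qed
  also have "\<dots> = (LINT z|disc_measure. (\<phi> z)\<^sup>2) + (L2_norm disc_measure (grad \<phi>))\<^sup>2"
    unfolding L2_norm_power2 using smooth_square_integrable[OF \<phi>] g by (simp add: square_integrable_def)
  finally show ?thesis by simp
qed

abbreviation circle_norm :: "(complex \<Rightarrow> real) \<Rightarrow> real" where
  "circle_norm f \<equiv> L2_norm angle_measure (\<lambda>\<theta>. f (cis \<theta>))"

lemma trace_inequality:
  assumes "smooth \<phi>"
  shows "(circle_norm \<phi>)\<^sup>2 \<le> 3 * (L2_norm disc_measure \<phi>)\<^sup>2 + (L2_norm disc_measure (grad \<phi>))\<^sup>2"
  using circle_energy_identity[OF assms] cross_term_bound[OF assms] by (simp add: L2_norm_power2)

lemma poincare_inequality:
  assumes "smooth \<phi>"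
  shows "(L2_norm disc_measure \<phi>)\<^sup>2 \<le> (circle_norm \<phi>)\<^sup>2 + (L2_norm disc_measure (grad \<phi>))\<^sup>2"
  using circle_energy_identity[OF assms] cross_term_bound[OF assms] by (simp add: L2_norm_power2)

lemma smooth_poly: "smooth (\<lambda>z. Re (poly q z)) \<and> smooth (\<lambda>z. Im (poly q z))"
proof (induction q)
  case (pCons a q)
  have "smooth (\<lambda>z. Re a + (Re z * Re (poly q z) - Im z * Im (poly q z)))" "smooth (\<lambda>z. Im a + (Re z * Im (poly q z) + Im z * Re (poly q z)))"
    by (intro smooth_add smooth_diff smooth_mult smooth_const smooth_Re smooth_Im conjunct1[OF pCons.IH] conjunct2[OF pCons.IH])+
  thus ?case by simp
qed (simp add: smooth_const)

lemma frechet_poly: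
  "frechet_derivative (\<lambda>z. Re (poly q z)) (at z) v = Re (poly (pderiv q) z * v)"
  "frechet_derivative (\<lambda>z. Im (poly q z)) (at z) v = Im (poly (pderiv q) z * v)"
proof -
  have d: "((\<lambda>z. poly q z) has_derivative (\<lambda>v. poly (pderiv q) z * v)) (at z)"
    using poly_DERIV[of q z] by (simp add: has_field_derivative_def)
  show "frechet_derivative (\<lambda>z. Re (poly q z)) (at z) v = Re (poly (pderiv q) z * v)"
    by (rule frechetI[OF has_derivative_Re[OF d]])
  show "frechet_derivative (\<lambda>z. Im (poly q z)) (at z) v = Im (poly (pderiv q) z * v)"
    by (rule frechetI[OF has_derivative_Im[OF d]])
qed

text \<open>The divergence theorem for the product of \<open>\<phi>\<close> with the vector field \<open>2
  cnj q\<close>. The latter is the gradient of a harmonic function, namely of twice the real part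
  of a primitive of \<open>q\<close>, and so has divergence 0.\<close>

lemma green_poly:
  assumes \<phi>: "smooth \<phi>"
  shows "(LINT z|disc_measure. grad \<phi> z \<bullet> (2 * cnj (poly q z))) = (LINT \<theta>|angle_measure. \<phi> (cis \<theta>) * (2 * Re (cis \<theta> * poly q (cis \<theta>))))"
proof -
  note sR = smooth_cmult[OF conjunct1[OF smooth_poly[of q]], of 2]
  note sI = smooth_cmult[OF conjunct2[OF smooth_poly[of q]], of "-2"]
  have dR: "frechet_derivative (\<lambda>z. 2 * Re (poly q z)) (at z) v = 2 * Re (poly (pderiv q) z * v)" for z v
    using frechet_mult[OF smooth_const conjunct1[OF smooth_poly], of 2 q z v] by (simp add: frechet_poly frechet_derivative_const)
  have dI: "frechet_derivative (\<lambda>z. - 2 * Im (poly q z)) (at z) v = - 2 * Im (poly (pderiv q) z * v)" for z v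
    using frechet_mult[OF smooth_const conjunct2[OF smooth_poly], of "-2" q z v] by (simp add: frechet_poly frechet_derivative_const)
  have "grad \<phi> z \<bullet> (2 * cnj (poly q z)) = frechet_derivative (\<lambda>z. \<phi> z * (2 * Re (poly q z))) (at z) 1 + frechet_derivative (\<lambda>z. \<phi> z * (- 2 * Im (poly q z))) (at z) \<i>" for z
    unfolding frechet_mult[OF \<phi> sR] frechet_mult[OF \<phi> sI] dR dI grad_inner_frechet[OF \<phi>]
    by (simp add: inner_complex_def algebra_simps)
  hence "(LINT z|disc_measure. grad \<phi> z \<bullet> (2 * cnj (poly q z))) = (LINT \<theta>|angle_measure. \<phi> (cis \<theta>) * (2 * Re (poly q (cis \<theta>))) * cos \<theta> + \<phi> (cis \<theta>) * (- 2 * Im (poly q (cis \<theta>))) * sin \<theta>)"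
    using divergence_disc[OF smooth_mult[OF \<phi> sR] smooth_mult[OF \<phi> sI]] by simp
  also have "\<dots> = (LINT \<theta>|angle_measure. \<phi> (cis \<theta>) * (2 * Re (cis \<theta> * poly q (cis \<theta>))))"
    by (intro Bochner_Integration.integral_cong refl) (simp add: algebra_simps)
  finally show ?thesis .
qed

section \<open>Existence of the boundary trace\<close>

text \<open>The proof of the Riesz-Fischer theorem. The limit is exhibited as the pointwise limit of a
  subsequence, rather than by its existence alone: on the circle the limit has to be obtained as a
  function of the point \<open>cis \<theta>\<close>, and with this form it is one if all the
  \<open>v n\<close> are.\<close>

lemma L2_complete:
  fixes v :: "nat \<Rightarrow> 'a \<Rightarrow> real"
  assumes M: "finite_measure M" and v: "\<And>n. square_integrable M (v n)" and a: "a \<longlonglongrightarrow> 0"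
    and cauchy: "\<And>m n. L2_norm M (\<lambda>x. v m x - v n x) \<le> a m + a n"
  obtains r where "square_integrable M (\<lambda>x. lim (\<lambda>k. v (r k) x))"
     "(\<lambda>n. L2_norm M (\<lambda>x. v n x - lim (\<lambda>k. v (r k) x))) \<longlonglongrightarrow> 0"
proof -
  interpret finite_measure M by (rule M)
  have a0: "a n \<ge> 0" for n using order_trans[OF L2_norm_nonneg cauchy[of n n]] by simp
  have vm: "v n \<in> borel_measurable M" for n using v[of n] by (simp add: square_integrable_def)
  have "\<forall>k. eventually (\<lambda>n. a n < (1/2) ^ k) sequentially" using order_tendstoD(2)[OF a] by simp
  hence "\<forall>k. \<exists>N. \<forall>n\<ge>N. a n < (1/2) ^ k" by (simp add: eventually_sequentially)
  then obtain r where r: "\<And>k n. n \<ge> r k \<Longrightarrow> a n < (1/2) ^ k" by metis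
  have ar: "a (r k) < (1/2) ^ k" for k by (rule r) simp
  define d where "d k x = \<bar>v (r (Suc k)) x - v (r k) x\<bar>" for k x
  define C where "C = sqrt (measure M (space M))"
  have one: "square_integrable M (\<lambda>x. 1 :: real)" by (simp add: square_integrable_def)
  have d2: "square_integrable M (d k)" for k
    using square_integrable_diff[OF v[of "r (Suc k)"] v[of "r k"]] unfolding d_def[abs_def] by (auto simp: square_integrable_def)
  have di: "integrable M (d k)" for k by (rule square_integrable_integrable[OF M d2])
  have dle: "(LINT x|M. d k x) \<le> 2 * C * (1/2) ^ k" for k
  proof -
    have "(LINT x|M. d k x) = (LINT x|M. d k x \<bullet> 1)" by simp
    also have "\<dots> \<le> L2_norm M (d k) * L2_norm M (\<lambda>x. 1 :: real)" by (rule order_trans[OF abs_ge_self L2_cauchy_schwarz[OF d2 one]])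
    also have "L2_norm M (\<lambda>x. 1 :: real) = C" by (simp add: L2_norm_def C_def)
    also have "L2_norm M (d k) = L2_norm M (\<lambda>x. v (r (Suc k)) x - v (r k) x)" by (simp add: L2_norm_def d_def)
    also have "\<dots> \<le> 2 * (1/2) ^ k"
    proof -
      have "(1/2::real) ^ Suc k \<le> (1/2) ^ k" by simp
      thus ?thesis using cauchy[of "r (Suc k)" "r k"] ar[of k] ar[of "Suc k"] by linarith
    qed
    finally show ?thesis by (simp add: C_def mult_right_mono mult_ac)
  qed
  have "(\<integral>\<^sup>+x. (\<Sum>k. ennreal (d k x)) \<partial>M) = (\<Sum>k. \<integral>\<^sup>+x. ennreal (d k x) \<partial>M)"
    by (rule nn_integral_suminf) (use di in auto)
  also have "\<dots> = (\<Sum>k. ennreal (LINT x|M. d k x))"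
    by (intro suminf_cong nn_integral_eq_integral di) (auto simp: d_def)
  also have "\<dots> \<le> (\<Sum>k. ennreal (2 * C * (1/2) ^ k))"
    by (intro suminf_le ennreal_leI dle) auto
  also have "\<dots> = ennreal (\<Sum>k. 2 * C * (1/2) ^ k)"
    by (intro suminf_ennreal2 summable_mult summable_geometric) (auto simp: C_def)
  also have "\<dots> < \<infinity>" by simp
  finally have "(\<integral>\<^sup>+x. (\<Sum>k. ennreal (d k x)) \<partial>M) \<noteq> \<infinity>" by simp
  hence "AE x in M. (\<Sum>k. ennreal (d k x)) \<noteq> \<infinity>" by (intro nn_integral_noteq_infinite) (use di in auto)
  hence conv: "AE x in M. (\<lambda>k. v (r k) x) \<longlonglongrightarrow> lim (\<lambda>k. v (r k) x)"
  proof eventually_elim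
    case (elim x)
    hence "summable (\<lambda>k. d k x)" by (intro summable_suminf_not_top) (auto simp: d_def)
    hence "summable (\<lambda>k. v (r (Suc k)) x - v (r k) x)" unfolding d_def by (rule summable_rabs_cancel)
    then obtain l where "(\<lambda>n. \<Sum>k<n. v (r (Suc k)) x - v (r k) x) \<longlonglongrightarrow> l" by (auto simp: summable_def sums_def)
    hence "(\<lambda>n. v (r n) x - v (r 0) x) \<longlonglongrightarrow> l" by (simp only: sum_lessThan_telescope[of "\<lambda>k. v (r k) x"])
    hence "(\<lambda>n. v (r n) x - v (r 0) x + v (r 0) x) \<longlonglongrightarrow> l + v (r 0) x" by (intro tendsto_intros)
    hence "convergent (\<lambda>n. v (r n) x)" by (auto simp: convergent_def)
    thus ?case by (simp add: convergent_LIMSEQ_iff)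
  qed
  define w where "w x = lim (\<lambda>k. v (r k) x)" for x
  have wm: "w \<in> borel_measurable M" unfolding w_def[abs_def] by (rule borel_measurable_lim_metric) (rule vm)
  have bound: "(\<integral>\<^sup>+x. ennreal ((v n x - w x)\<^sup>2) \<partial>M) \<le> ennreal ((a n)\<^sup>2)" for n
  proof -
    have "(\<integral>\<^sup>+x. ennreal ((v n x - w x)\<^sup>2) \<partial>M) = (\<integral>\<^sup>+x. liminf (\<lambda>k. ennreal ((v n x - v (r k) x)\<^sup>2)) \<partial>M)"
    proof (rule nn_integral_cong_AE)
      show "AE x in M. ennreal ((v n x - w x)\<^sup>2) = liminf (\<lambda>k. ennreal ((v n x - v (r k) x)\<^sup>2))"
        using conv
      proof eventually_elim
        case (elim x)
        have "(\<lambda>k. ennreal ((v n x - v (r k) x)\<^sup>2)) \<longlonglongrightarrow> ennreal ((v n x - w x)\<^sup>2)"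
          using elim unfolding w_def by (intro tendsto_intros)
        from lim_imp_Liminf[OF _ this] show ?case by simp
      qed
    qed
    also have "\<dots> \<le> liminf (\<lambda>k. \<integral>\<^sup>+x. ennreal ((v n x - v (r k) x)\<^sup>2) \<partial>M)"
      by (rule nn_integral_liminf) (use vm in measurable)
    also have "\<dots> \<le> liminf (\<lambda>k. ennreal ((a n + (1/2) ^ k)\<^sup>2))"
    proof (rule Liminf_mono, rule always_eventually, rule allI)
      fix k
      have i: "integrable M (\<lambda>x. (v n x - v (r k) x)\<^sup>2)" using square_integrable_sq_integrable[OF square_integrable_diff[OF v v]] by simp
      have "(LINT x|M. (v n x - v (r k) x)\<^sup>2) = (L2_norm M (\<lambda>x. v n x - v (r k) x))\<^sup>2" by (simp add: L2_norm_power2)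
      also have "\<dots> \<le> (a n + (1/2) ^ k)\<^sup>2"
        using cauchy[of n "r k"] ar[of k] by (intro power_mono L2_norm_nonneg) auto
      finally show "(\<integral>\<^sup>+x. ennreal ((v n x - v (r k) x)\<^sup>2) \<partial>M) \<le> ennreal ((a n + (1/2) ^ k)\<^sup>2)"
        by (subst nn_integral_eq_integral[OF i]) (auto intro: ennreal_leI)
    qed
    also have "\<dots> = ennreal ((a n)\<^sup>2)"
    proof -
      have "(\<lambda>k. ennreal ((a n + (1/2) ^ k)\<^sup>2)) \<longlonglongrightarrow> ennreal ((a n + 0)\<^sup>2)"
        by (intro tendsto_intros LIMSEQ_power_zero) auto
      from lim_imp_Liminf[OF _ this] show ?thesis by simp
    qed
    finally show ?thesis .
  qed
  have i: "integrable M (\<lambda>x. (v n x - w x)\<^sup>2)" for n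
    by (rule integrableI_nonneg) (use bound[of n] vm wm in \<open>auto simp: order_le_less_trans\<close>)
  have sq: "square_integrable M (\<lambda>x. v n x - w x)" for n using i[of n] vm wm by (simp add: square_integrable_def)
  have "square_integrable M (\<lambda>x. v 0 x - (v 0 x - w x))" by (rule square_integrable_diff[OF v sq])
  hence "square_integrable M w" by simp
  moreover have "L2_norm M (\<lambda>x. v n x - w x) \<le> a n" for n
  proof -
    have "ennreal (LINT x|M. (v n x - w x)\<^sup>2) \<le> ennreal ((a n)\<^sup>2)"
      using bound[of n] by (subst (asm) nn_integral_eq_integral[OF i]) auto
    hence "(LINT x|M. (norm (v n x - w x))\<^sup>2) \<le> (a n)\<^sup>2" by (simp add: ennreal_le_iff)
    hence "L2_norm M (\<lambda>x. v n x - w x) \<le> sqrt ((a n)\<^sup>2)" unfolding L2_norm_def by (rule real_sqrt_le_mono)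
    thus ?thesis using a0 by simp
  qed
  hence "(\<lambda>n. L2_norm M (\<lambda>x. v n x - w x)) \<longlonglongrightarrow> 0"
    by (intro Lim_null_comparison[OF _ a] always_eventually allI) (simp add: L2_norm_nonneg)
  ultimately show ?thesis using that[of r] unfolding w_def[abs_def] by blast
qed

lemma grad_diff: "smooth f \<Longrightarrow> smooth g \<Longrightarrow> grad (\<lambda>x. f x - g x) z = grad f z - grad g z"
proof -
  assume f: "smooth f" and g: "smooth g"
  have "frechet_derivative (\<lambda>x. f x - g x) (at z) b = frechet_derivative f (at z) b - frechet_derivative g (at z) b" for b
    by (rule frechetI[OF has_derivative_diff[OF smooth_has_derivative[OF f] smooth_has_derivative[OF g]]])
  thus ?thesis by (simp add: grad_def sum_subtractf scaleR_diff_left)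
qed

lemma grad_square_integrable: "smooth f \<Longrightarrow> square_integrable disc_measure (grad f)"
  by (rule square_integrable_disc_continuous[OF continuous_on_grad])

lemma circle_square_integrable: "smooth f \<Longrightarrow> square_integrable angle_measure (\<lambda>\<theta>. f (cis \<theta>))"
  by (rule square_integrable_circle[OF smooth_continuous_on])

text \<open>The mollifications converge in \<open>H\<^sup>1\<close>. By the trace inequality their
  restrictions to the circle form a Cauchy sequence.\<close>

lemma trace_exists:
  assumes u: "weak_grad u g"
  shows "\<exists>f. has_boundary_trace u f"
proof -
  define \<phi> where "\<phi> n = mollify u (eps n)" for n
  have u1: "integrable disc_measure u" by (rule square_integrable_integrable[OF finite_measure_disc weak_gradD(1)[OF u]])
  have s: "smooth (\<phi> n)" for n unfolding \<phi>_def by (rule smooth_mollify[OF u1 eps(1)])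
  have H: "(\<lambda>n. H1_norm unit_disc (\<lambda>x. \<phi> n x - u x)) \<longlonglongrightarrow> 0" unfolding \<phi>_def by (rule smooth_dense_H1[OF u])
  have wg: "weak_grad (\<lambda>x. \<phi> n x - u x) (\<lambda>x. grad (\<phi> n) x - g x)" for n by (rule weak_grad_diff[OF smooth_weak_grad[OF s] u])
  have lim: "(\<lambda>n. L2_norm disc_measure (\<lambda>x. \<phi> n x - u x)) \<longlonglongrightarrow> 0" "(\<lambda>n. L2_norm disc_measure (\<lambda>x. grad (\<phi> n) x - g x)) \<longlonglongrightarrow> 0"
    using H unfolding H1_norm_tendsto_0_iff[OF wg] by auto
  define a where "a n = 2 * (L2_norm disc_measure (\<lambda>x. \<phi> n x - u x) + L2_norm disc_measure (\<lambda>x. grad (\<phi> n) x - g x))" for n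
  have "a \<longlonglongrightarrow> 2 * (0 + 0)" unfolding a_def[abs_def] by (intro tendsto_intros lim)
  hence a: "a \<longlonglongrightarrow> 0" by simp
  have cauchy: "L2_norm angle_measure (\<lambda>\<theta>. \<phi> m (cis \<theta>) - \<phi> n (cis \<theta>)) \<le> a m + a n" for m n
  proof -
    define x where "x = L2_norm disc_measure (\<lambda>x. \<phi> m x - \<phi> n x)"
    define y where "y = L2_norm disc_measure (\<lambda>x. grad (\<phi> m) x - grad (\<phi> n) x)"
    have "x \<le> L2_norm disc_measure (\<lambda>x. \<phi> m x - u x) + L2_norm disc_measure (\<lambda>x. u x - \<phi> n x)"
      unfolding x_def by (rule L2_norm_triangle_diff[OF smooth_square_integrable[OF s] weak_gradD(1)[OF u] smooth_square_integrable[OF s]])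
    hence x: "x \<le> L2_norm disc_measure (\<lambda>x. \<phi> m x - u x) + L2_norm disc_measure (\<lambda>x. \<phi> n x - u x)"
      by (simp add: L2_norm_minus_commute[of _ u])
    have "y \<le> L2_norm disc_measure (\<lambda>x. grad (\<phi> m) x - g x) + L2_norm disc_measure (\<lambda>x. g x - grad (\<phi> n) x)"
      unfolding y_def by (rule L2_norm_triangle_diff[OF grad_square_integrable[OF s] weak_gradD(2)[OF u] grad_square_integrable[OF s]])
    hence y: "y \<le> L2_norm disc_measure (\<lambda>x. grad (\<phi> m) x - g x) + L2_norm disc_measure (\<lambda>x. grad (\<phi> n) x - g x)"
      by (simp add: L2_norm_minus_commute[of _ g])
    have xy: "x \<ge> 0" "y \<ge> 0" by (auto simp: x_def y_def L2_norm_nonneg)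
    have "(circle_norm (\<lambda>z. \<phi> m z - \<phi> n z))\<^sup>2 \<le> 3 * x\<^sup>2 + y\<^sup>2"
    proof -
      have gd: "grad (\<lambda>x. \<phi> m x - \<phi> n x) = (\<lambda>z. grad (\<phi> m) z - grad (\<phi> n) z)" by (rule ext) (rule grad_diff[OF s s])
      show ?thesis using trace_inequality[OF smooth_diff[OF s s], of m n] unfolding x_def y_def gd .
    qed
    \<comment> \<open>This is \<open>3 x\<^sup>2 + y\<^sup>2 \<le> (2 (x + y))\<^sup>2\<close>.\<close>
    also have "3 * x\<^sup>2 + y\<^sup>2 \<le> (3 * x\<^sup>2 + y\<^sup>2) + (x\<^sup>2 + 8 * (x * y) + 3 * y\<^sup>2)"
      using mult_nonneg_nonneg[OF xy] zero_le_power2[of x] zero_le_power2[of y] by linarith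
    also have "\<dots> = (2 * (x + y))\<^sup>2" by (simp add: power2_eq_square algebra_simps)
    finally have "circle_norm (\<lambda>z. \<phi> m z - \<phi> n z) \<le> 2 * (x + y)"
      by (rule power2_le_imp_le) (simp add: xy)
    thus ?thesis using x y unfolding a_def distrib_left by linarith
  qed
  obtain r where r: "square_integrable angle_measure (\<lambda>\<theta>. lim (\<lambda>k. \<phi> (r k) (cis \<theta>)))"
     "(\<lambda>n. L2_norm angle_measure (\<lambda>\<theta>. \<phi> n (cis \<theta>) - lim (\<lambda>k. \<phi> (r k) (cis \<theta>)))) \<longlonglongrightarrow> 0"
    by (rule L2_complete[OF finite_measure_angle circle_square_integrable[OF s] a cauchy])
  have "has_boundary_trace u (\<lambda>z. lim (\<lambda>k. \<phi> (r k) z))"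
    unfolding has_boundary_trace_def using r s H by blast
  thus ?thesis by blast
qed

section \<open>Sobolev functions and their traces\<close>

lemma L2_norm_tendsto:
  fixes w :: "'a \<Rightarrow> 'b::euclidean_space"
  assumes "\<And>n. square_integrable M (v n)" "square_integrable M w" "(\<lambda>n. L2_norm M (\<lambda>x. v n x - w x)) \<longlonglongrightarrow> 0"
  shows "(\<lambda>n. L2_norm M (v n)) \<longlonglongrightarrow> L2_norm M w"
proof -
  have le: "L2_norm M a \<le> L2_norm M (\<lambda>x. a x - b x) + L2_norm M b"
    if "square_integrable M a" "square_integrable M b" for a b :: "'a \<Rightarrow> 'b"
    using L2_norm_triangle[OF square_integrable_diff[OF that] that(2)] by simp
  have "norm (L2_norm M (v n) - L2_norm M w) \<le> L2_norm M (\<lambda>x. v n x - w x)" for n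
    unfolding real_norm_def abs_le_iff minus_diff_eq
    using le[OF assms(1)[of n] assms(2)] le[OF assms(2) assms(1)[of n]] L2_norm_minus_commute[of M w "v n"] by linarith
  hence "(\<lambda>n. L2_norm M (v n) - L2_norm M w) \<longlonglongrightarrow> 0" by (intro Lim_null_comparison[OF _ assms(3)] always_eventually allI)
  thus ?thesis by (rule LIM_zero_cancel)
qed

lemma L2_inner_tendsto:
  assumes "\<And>n. square_integrable M (v n)" "square_integrable M w" "square_integrable M h" "(\<lambda>n. L2_norm M (\<lambda>x. v n x - w x)) \<longlonglongrightarrow> 0"
  shows "(\<lambda>n. LINT x|M. v n x \<bullet> h x) \<longlonglongrightarrow> (LINT x|M. w x \<bullet> h x)"
proof -
  have le: "norm ((LINT x|M. v n x \<bullet> h x) - (LINT x|M. w x \<bullet> h x)) \<le> L2_norm M (\<lambda>x. v n x - w x) * L2_norm M h" for n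
  proof -
    have "(LINT x|M. v n x \<bullet> h x) - (LINT x|M. w x \<bullet> h x) = (LINT x|M. (v n x - w x) \<bullet> h x)"
      by (subst Bochner_Integration.integral_diff[symmetric]) (auto intro: square_integrable_inner assms simp: inner_diff_left)
    thus ?thesis using L2_cauchy_schwarz[OF square_integrable_diff[OF assms(1,2)] assms(3), of n] by simp
  qed
  have lim: "(\<lambda>n. L2_norm M (\<lambda>x. v n x - w x) * L2_norm M h) \<longlonglongrightarrow> 0" by (rule tendsto_mult_left_zero[OF assms(4)])
  have "(\<lambda>n. (LINT x|M. v n x \<bullet> h x) - (LINT x|M. w x \<bullet> h x)) \<longlonglongrightarrow> 0" by (rule Lim_null_comparison[OF always_eventually[OF allI[OF le]] lim])
  thus ?thesis by (rule LIM_zero_cancel)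
qed

lemma inner_2cnj: "2 * Re (a * v) = (2 * cnj a) \<bullet> (v::complex)"
  by (simp add: inner_complex_def algebra_simps)

lemma grad_2Re_poly: "grad (\<lambda>z. 2 * Re (poly q z)) z = 2 * cnj (poly (pderiv q) z)"
proof (rule euclidean_eqI)
  fix b :: complex assume b: "b \<in> Basis"
  have "frechet_derivative (\<lambda>z. 2 * Re (poly q z)) (at z) b = 2 * Re (poly (pderiv q) z * b)"
    using frechet_mult[OF smooth_const conjunct1[OF smooth_poly], of 2 q z b] by (simp add: frechet_poly frechet_derivative_const)
  thus "(grad (\<lambda>z. 2 * Re (poly q z)) z) \<bullet> b = (2 * cnj (poly (pderiv q) z)) \<bullet> b"
    unfolding grad_inner[OF b] inner_2cnj .
qed

text \<open>A function \<open>u\<close> of \<open>H\<^sup>1\<close> with weak gradient \<open>g\<close> and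
  boundary trace \<open>f\<close>, together with smooth functions \<open>\<phi> n\<close> that
  witness the trace. Identities and inequalities for smooth functions pass to the limit.\<close>

locale sobolev_trace =
  fixes u :: "complex \<Rightarrow> real" and g :: "complex \<Rightarrow> complex" and f :: "complex \<Rightarrow> real" and \<phi> :: "nat \<Rightarrow> complex \<Rightarrow> real"
  assumes u: "weak_grad u g" and f: "square_integrable angle_measure (\<lambda>\<theta>. f (cis \<theta>))"
    and s: "\<And>n. smooth (\<phi> n)"
    and H: "(\<lambda>n. H1_norm unit_disc (\<lambda>x. \<phi> n x - u x)) \<longlonglongrightarrow> 0"
    and T: "(\<lambda>n. L2_norm angle_measure (\<lambda>\<theta>. \<phi> n (cis \<theta>) - f (cis \<theta>))) \<longlonglongrightarrow> 0"
begin

lemma lim_u: "(\<lambda>n. L2_norm disc_measure (\<lambda>x. \<phi> n x - u x)) \<longlonglongrightarrow> 0"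
  and lim_g: "(\<lambda>n. L2_norm disc_measure (\<lambda>x. grad (\<phi> n) x - g x)) \<longlonglongrightarrow> 0"
  using H unfolding H1_norm_tendsto_0_iff[OF weak_grad_diff[OF smooth_weak_grad[OF s] u]] by auto

lemma green_trace:
  "(LINT z|disc_measure. g z \<bullet> (2 * cnj (poly q z))) = (LINT \<theta>|angle_measure. f (cis \<theta>) * (2 * Re (cis \<theta> * poly q (cis \<theta>))))"
proof -
  have q1: "square_integrable disc_measure (\<lambda>z. 2 * cnj (poly q z))"
    by (intro square_integrable_disc_continuous continuous_intros)
  have q2: "square_integrable angle_measure (\<lambda>\<theta>. 2 * Re (cis \<theta> * poly q (cis \<theta>)))"
    by (intro square_integrable_circle[of "\<lambda>z. 2 * Re (z * poly q z)"] continuous_intros)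
  have "(\<lambda>n. LINT z|disc_measure. grad (\<phi> n) z \<bullet> (2 * cnj (poly q z))) \<longlonglongrightarrow> (LINT z|disc_measure. g z \<bullet> (2 * cnj (poly q z)))"
    by (rule L2_inner_tendsto[OF grad_square_integrable[OF s] weak_gradD(2)[OF u] q1 lim_g])
  moreover have "(\<lambda>n. LINT \<theta>|angle_measure. \<phi> n (cis \<theta>) \<bullet> (2 * Re (cis \<theta> * poly q (cis \<theta>)))) \<longlonglongrightarrow> (LINT \<theta>|angle_measure. f (cis \<theta>) \<bullet> (2 * Re (cis \<theta> * poly q (cis \<theta>))))"
    by (rule L2_inner_tendsto[OF circle_square_integrable[OF s] f q2 T])
  ultimately show ?thesis
    unfolding green_poly[OF s] inner_real_def by (rule LIMSEQ_unique)
qed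

lemma minus_smooth:
  assumes \<psi>: "smooth \<psi>"
  shows "sobolev_trace (\<lambda>x. u x - \<psi> x) (\<lambda>x. g x - grad \<psi> x) (\<lambda>x. f x - \<psi> x) (\<lambda>n x. \<phi> n x - \<psi> x)"
proof
  show "weak_grad (\<lambda>x. u x - \<psi> x) (\<lambda>x. g x - grad \<psi> x)" by (rule weak_grad_diff[OF u smooth_weak_grad[OF \<psi>]])
  show "square_integrable angle_measure (\<lambda>\<theta>. f (cis \<theta>) - \<psi> (cis \<theta>))" by (rule square_integrable_diff[OF f circle_square_integrable[OF \<psi>]])
  show "smooth (\<lambda>x. \<phi> n x - \<psi> x)" for n by (rule smooth_diff[OF s \<psi>])
qed (use H T in simp_all)

lemma trace_inequality_H1: "(circle_norm f)\<^sup>2 \<le> 3 * (L2_norm disc_measure u)\<^sup>2 + (L2_norm disc_measure g)\<^sup>2"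
  and poincare_inequality_H1: "(L2_norm disc_measure u)\<^sup>2 \<le> (circle_norm f)\<^sup>2 + (L2_norm disc_measure g)\<^sup>2"
proof -
  have l1: "(\<lambda>n. L2_norm disc_measure (\<phi> n)) \<longlonglongrightarrow> L2_norm disc_measure u"
    by (rule L2_norm_tendsto[OF smooth_square_integrable[OF s] weak_gradD(1)[OF u] lim_u])
  have l2: "(\<lambda>n. L2_norm disc_measure (grad (\<phi> n))) \<longlonglongrightarrow> L2_norm disc_measure g"
    by (rule L2_norm_tendsto[OF grad_square_integrable[OF s] weak_gradD(2)[OF u] lim_g])
  have l3: "(\<lambda>n. circle_norm (\<phi> n)) \<longlonglongrightarrow> circle_norm f"
    by (rule L2_norm_tendsto[OF circle_square_integrable[OF s] f T])
  show "(circle_norm f)\<^sup>2 \<le> 3 * (L2_norm disc_measure u)\<^sup>2 + (L2_norm disc_measure g)\<^sup>2"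
    by (rule LIMSEQ_le[OF tendsto_power[OF l3] tendsto_add[OF tendsto_mult_left[OF tendsto_power[OF l1]] tendsto_power[OF l2]]])
       (use trace_inequality[OF s] in blast)
  show "(L2_norm disc_measure u)\<^sup>2 \<le> (circle_norm f)\<^sup>2 + (L2_norm disc_measure g)\<^sup>2"
    by (rule LIMSEQ_le[OF tendsto_power[OF l1] tendsto_add[OF tendsto_power[OF l3] tendsto_power[OF l2]]])
       (use poincare_inequality[OF s] in blast)
qed

lemma trace_dense:
  assumes "e > 0"
  shows "\<exists>\<psi>::complex \<Rightarrow> real. continuous_on (sphere 0 1) \<psi> \<and> circle_mean (\<lambda>z. (f z - \<psi> z)\<^sup>2) < e"
proof -
  have L: "(\<lambda>n. (circle_norm (\<lambda>z. \<phi> n z - f z))\<^sup>2) \<longlonglongrightarrow> 0\<^sup>2" by (rule tendsto_power[OF T])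
  have "eventually (\<lambda>n. (circle_norm (\<lambda>z. \<phi> n z - f z))\<^sup>2 < 2 * pi * e) sequentially"
    by (rule order_tendstoD(2)[OF L]) (use assms in simp)
  then obtain n where "(circle_norm (\<lambda>z. \<phi> n z - f z))\<^sup>2 < 2 * pi * e" by (auto simp: eventually_sequentially)
  hence "circle_mean (\<lambda>z. (f z - \<phi> n z)\<^sup>2) < e"
    unfolding L2_norm_power2 circle_mean_def by (simp add: field_simps power2_commute)
  thus ?thesis using smooth_continuous_on[OF s] by blast
qed

text \<open>The harmonic extension of the \<open>N\<close>-th partial Fourier sum of the trace.\<close>

definition P :: "nat \<Rightarrow> complex \<Rightarrow> real" where "P N z = 2 * Re (partial_sum f N z)"
definition p :: "nat \<Rightarrow> complex poly" where "p N = (\<Sum>k\<in>{1..N}. monom (fourier_coeff (\<lambda>z. of_real (f z)) k) k)"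
definition energy :: "nat \<Rightarrow> real" where "energy N = Re (dirichlet_form (partial_sum f N) (partial_sum f N))"

lemma P_eq: "P N = (\<lambda>z. 2 * Re (poly (p N) z))"
  by (rule ext) (simp add: P_def p_def partial_sum_poly)

lemma P_smooth: "smooth (P N)"
  unfolding P_eq by (rule smooth_cmult[OF conjunct1[OF smooth_poly]])

lemma coeff_p: "coeff (p N) k = (if k \<in> {1..N} then fourier_coeff (\<lambda>z. of_real (f z)) k else 0)"
  unfolding p_def coeff_sum by (simp add: sum.delta)

text \<open>On the circle \<open>2 Re (z p'(z))\<close> is the radial derivative of \<open>P N\<close>.
  Pairing it with \<open>h\<close> involves only the first \<open>N\<close> coefficients of
  \<open>h\<close>.\<close>

lemma mean_times_radial:
  fixes h :: "complex \<Rightarrow> real"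
  assumes h: "circle_integrable h" and hc: "\<And>k. k \<in> {1..N} \<Longrightarrow> fourier_coeff (\<lambda>z. of_real (h z)) k = fourier_coeff (\<lambda>z. of_real (f z)) k"
  shows "(LINT \<theta>|angle_measure. h (cis \<theta>) * (2 * Re (cis \<theta> * poly (pderiv (p N)) (cis \<theta>)))) = 4 * pi * energy N"
proof -
  define Q where "Q = smult 2 (pCons 0 (pderiv (p N)))"
  have Qc: "coeff Q k = 2 * of_nat k * coeff (p N) k" for k
    by (cases k) (simp_all add: Q_def coeff_pderiv)
  have "(\<Sum>k\<le>degree Q. coeff Q k * cnj (fourier_coeff (\<lambda>z. of_real (h z)) k)) = (\<Sum>k\<in>{1..N}. of_real (2 * (real k * (norm (fourier_coeff (\<lambda>z. of_real (f z)) k))\<^sup>2)))"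
  proof (rule sum.mono_neutral_cong)
    show "coeff Q i * cnj (fourier_coeff (\<lambda>z. of_real (h z)) i) = 0" if "i \<in> {..degree Q} - {1..N}" for i
      using that by (auto simp: Qc coeff_p)
    show "of_real (2 * (real i * (norm (fourier_coeff (\<lambda>z. of_real (f z)) i))\<^sup>2)) = (0::complex)" if "i \<in> {1..N} - {..degree Q}" for i
    proof -
      have "coeff Q i = 0" using that by (intro coeff_eq_0) auto
      thus ?thesis using that by (simp add: Qc coeff_p)
    qed
    show "coeff Q i * cnj (fourier_coeff (\<lambda>z. of_real (h z)) i) = of_real (2 * (real i * (norm (fourier_coeff (\<lambda>z. of_real (f z)) i))\<^sup>2))"
      if "i \<in> {..degree Q} \<inter> {1..N}" for i
    proof -
      have "of_real ((norm (fourier_coeff (\<lambda>z. of_real (f z)) i))\<^sup>2) = fourier_coeff (\<lambda>z. of_real (f z)) i * cnj (fourier_coeff (\<lambda>z. of_real (f z)) i)"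
        by (rule complex_norm_square)
      thus ?thesis using that by (simp add: Qc coeff_p hc del: of_real_power)
    qed
  qed auto
  hence "circle_mean (\<lambda>z. h z * Re (poly Q z)) = (\<Sum>k\<in>{1..N}. 2 * (real k * (norm (fourier_coeff (\<lambda>z. of_real (f z)) k))\<^sup>2))"
    unfolding circle_mean_real_times_poly[OF h] by (simp only: Re_sum Re_complex_of_real)
  also have "\<dots> = 2 * energy N" by (simp add: energy_def partial_sum_energy sum_distrib_left)
  finally have "(LINT \<theta>|angle_measure. h (cis \<theta>) * Re (poly Q (cis \<theta>))) = 4 * pi * energy N"
    by (simp add: circle_mean_def field_simps)
  moreover have "Re (poly Q z) = 2 * Re (z * poly (pderiv (p N)) z)" for z by (simp add: Q_def)
  ultimately show ?thesis by (simp only:)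
qed

lemma f_integrable: "circle_integrable f"
  by (rule square_integrable_integrable[OF finite_measure_angle f])

text \<open>Dirichlet's principle: by Green's identity for the harmonic function \<open>P N\<close>, the
  vector field \<open>g - grad (P N)\<close> is orthogonal to \<open>grad (P N)\<close>, whose
  squared norm is \<open>4 \<pi>\<close> times the energy.\<close>

lemma energy_identity: "(L2_norm disc_measure g)\<^sup>2 - 4 * pi * energy N = (L2_norm disc_measure (\<lambda>x. g x - grad (P N) x))\<^sup>2"
proof -
  have gP: "grad (P N) z = 2 * cnj (poly (pderiv (p N)) z)" for z unfolding P_eq by (rule grad_2Re_poly)
  have Psq: "square_integrable disc_measure (grad (P N))" by (rule grad_square_integrable[OF P_smooth])
  have gsq: "square_integrable disc_measure g" by (rule weak_gradD(2)[OF u])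
  have 1: "(LINT z|disc_measure. g z \<bullet> grad (P N) z) = 4 * pi * energy N"
    unfolding gP green_trace by (rule mean_times_radial[OF f_integrable refl])
  have 2: "(LINT z|disc_measure. grad (P N) z \<bullet> grad (P N) z) = 4 * pi * energy N"
  proof -
    have "(LINT z|disc_measure. grad (P N) z \<bullet> grad (P N) z) = (LINT z|disc_measure. grad (P N) z \<bullet> (2 * cnj (poly (pderiv (p N)) z)))"
      by (simp only: gP)
    also have "\<dots> = (LINT \<theta>|angle_measure. P N (cis \<theta>) * (2 * Re (cis \<theta> * poly (pderiv (p N)) (cis \<theta>))))"
      by (rule green_poly[OF P_smooth])
    also have "\<dots> = 4 * pi * energy N"
    proof (rule mean_times_radial)
      show "circle_integrable (P N)" by (rule circle_integrable_continuous[OF smooth_continuous_on[OF P_smooth]])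
      fix k assume k: "k \<in> {1..N}"
      have "fourier_coeff (\<lambda>z. of_real (P N z)) k = fourier_coeff (partial_sum f N) k" unfolding P_def
        by (rule fourier_coeff_2Re[OF partial_sum_holo, of 2]) (auto simp: partial_sum_0)
      thus "fourier_coeff (\<lambda>z. of_real (P N z)) k = fourier_coeff (\<lambda>z. of_real (f z)) k"
        using k by (simp add: fourier_coeff_partial_sum)
    qed
    finally show ?thesis .
  qed
  have "(L2_norm disc_measure (\<lambda>x. g x - grad (P N) x))\<^sup>2 = (LINT z|disc_measure. (norm (g z))\<^sup>2 - 2 * (g z \<bullet> grad (P N) z) + grad (P N) z \<bullet> grad (P N) z)"
    unfolding L2_norm_power2 by (intro Bochner_Integration.integral_cong refl) (simp add: power2_norm_eq_inner algebra_simps inner_commute)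
  also have "\<dots> = (L2_norm disc_measure g)\<^sup>2 - 2 * (LINT z|disc_measure. g z \<bullet> grad (P N) z) + (LINT z|disc_measure. grad (P N) z \<bullet> grad (P N) z)"
    using square_integrable_inner[OF gsq Psq] square_integrable_inner[OF Psq Psq] square_integrable_sq_integrable[OF gsq]
    by (simp add: L2_norm_power2)
  finally show ?thesis unfolding 1 2 by simp
qed

lemma energy_le: "energy N \<le> (L2_norm disc_measure g)\<^sup>2 / (4 * pi)"
proof -
  have "0 \<le> (L2_norm disc_measure g)\<^sup>2 - 4 * pi * energy N" unfolding energy_identity by simp
  thus ?thesis by (simp add: field_simps)
qed

lemma circle_function:
  assumes "circle_mean f = 0"
  shows "circle_function f ((L2_norm disc_measure g)\<^sup>2 / (4 * pi))"
  by unfold_locales (use f assms trace_dense energy_le in \<open>auto simp: energy_def\<close>)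

end

lemma has_boundary_trace_sobolev:
  assumes u: "weak_grad u g" and "has_boundary_trace u f"
  obtains \<phi> where "sobolev_trace u g f \<phi>"
  using assms unfolding has_boundary_trace_def sobolev_trace_def by blast

lemma weak_grad_limit:
  assumes un: "\<And>n. weak_grad (un n) (gn n)" and u: "square_integrable disc_measure u" and g: "square_integrable disc_measure g"
    and lu: "(\<lambda>n. L2_norm disc_measure (\<lambda>x. un n x - u x)) \<longlonglongrightarrow> 0" and lg: "(\<lambda>n. L2_norm disc_measure (\<lambda>x. gn n x - g x)) \<longlonglongrightarrow> 0"
  shows "weak_grad u g"
  unfolding has_weak_gradient_def
proof (intro conjI ballI u g)
  fix \<phi> and b :: complex assume \<phi>: "\<phi> \<in> test_functions unit_disc" and b: "b \<in> Basis"
  note t = test_function_square_integrable[OF \<phi>]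
  have \<phi>b: "square_integrable disc_measure (\<lambda>x. \<phi> x *\<^sub>R b)"
    using \<phi> by (intro square_integrable_disc_continuous continuous_intros smooth_continuous_on) (simp add: test_functions_def)
  have 1: "(\<lambda>n. LINT x|disc_measure. un n x \<bullet> frechet_derivative \<phi> (at x) b) \<longlonglongrightarrow> (LINT x|disc_measure. u x \<bullet> frechet_derivative \<phi> (at x) b)"
    by (rule L2_inner_tendsto[OF weak_gradD(1)[OF un] u t(2) lu])
  have 2: "(\<lambda>n. LINT x|disc_measure. gn n x \<bullet> (\<phi> x *\<^sub>R b)) \<longlonglongrightarrow> (LINT x|disc_measure. g x \<bullet> (\<phi> x *\<^sub>R b))"
    by (rule L2_inner_tendsto[OF weak_gradD(2)[OF un] g \<phi>b lg])
  have eq: "(LINT x|disc_measure. un n x \<bullet> frechet_derivative \<phi> (at x) b) = - (LINT x|disc_measure. gn n x \<bullet> (\<phi> x *\<^sub>R b))" for n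
    using weak_gradD(3)[OF un \<phi> b, of n] by (simp add: mult.commute)
  have "(LINT x|disc_measure. u x \<bullet> frechet_derivative \<phi> (at x) b) = - (LINT x|disc_measure. g x \<bullet> (\<phi> x *\<^sub>R b))"
    by (rule LIMSEQ_unique[OF 1[unfolded eq] tendsto_minus[OF 2]])
  thus "(LINT x|disc_measure. u x * frechet_derivative \<phi> (at x) b) = - (LINT x|disc_measure. g x \<bullet> b * \<phi> x)"
    by (simp add: mult.commute)
qed

section \<open>The extremal functions on the disc\<close>

definition extremal :: "complex \<Rightarrow> nat \<Rightarrow> complex \<Rightarrow> real" where
  "extremal \<xi> n z = ln (1 / (cmod (1 - \<xi> * z ^ n))\<^sup>2)"

definition extremal_coeff :: "complex \<Rightarrow> nat \<Rightarrow> nat \<Rightarrow> complex" where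
  "extremal_coeff \<xi> n k = (if n dvd k then \<xi> ^ (k div n) / of_nat (k div n) else 0)"

definition extremal_poly :: "complex \<Rightarrow> nat \<Rightarrow> nat \<Rightarrow> complex poly" where
  "extremal_poly \<xi> n N = (\<Sum>k\<in>{1..N}. monom (extremal_coeff \<xi> n k) k)"

lemma L2_limit_unique_AE:
  fixes v :: "nat \<Rightarrow> 'a \<Rightarrow> real"
  assumes v: "\<And>n. square_integrable M (v n)" and a: "square_integrable M a" and b: "square_integrable M b"
    and va: "(\<lambda>n. L2_norm M (\<lambda>x. v n x - a x)) \<longlonglongrightarrow> 0" and vb: "(\<lambda>n. L2_norm M (\<lambda>x. v n x - b x)) \<longlonglongrightarrow> 0"
  shows "AE x in M. a x = b x"
proof -
  have "L2_norm M (\<lambda>x. a x - b x) \<le> L2_norm M (\<lambda>x. v n x - a x) + L2_norm M (\<lambda>x. v n x - b x)" for n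
    using L2_norm_triangle_diff[OF a v b, of n] by (simp only: L2_norm_minus_commute[of M a "v n"])
  hence "L2_norm M (\<lambda>x. a x - b x) \<le> 0"
    using LIMSEQ_le_const[OF tendsto_add[OF va vb]] by simp
  hence "L2_norm M (\<lambda>x. a x - b x) = 0" using L2_norm_nonneg[of M "\<lambda>x. a x - b x"] by linarith
  from L2_norm_eq_0_AE[OF square_integrable_diff[OF a b] this] show ?thesis by simp
qed

context
  fixes \<xi> :: complex and n :: nat
  assumes \<xi>: "cmod \<xi> < 1" and n: "n \<ge> 1"
begin

lemma extremal_lt_1: "cmod z \<le> 1 \<Longrightarrow> cmod (\<xi> * z ^ n) < 1"
proof -
  assume "cmod z \<le> 1"
  hence "cmod \<xi> * cmod z ^ n \<le> cmod \<xi> * 1" by (intro mult_left_mono power_le_one) auto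
  thus ?thesis using \<xi> by (simp add: norm_mult norm_power)
qed

lemma extremal_eq: "cmod z \<le> 1 \<Longrightarrow> extremal \<xi> n z = 2 * Re (- Ln (1 - \<xi> * z ^ n))"
  unfolding extremal_def by (rule log_extremal_eq[OF extremal_lt_1])

lemma extremal_coeff_summable: "summable (\<lambda>k. real k * cmod (extremal_coeff \<xi> n k))"
  unfolding extremal_coeff_def by (rule log_extremal_coeff(3)[OF \<xi> n])

lemma extremal_coeff_0: "extremal_coeff \<xi> n 0 = 0"
  by (simp add: extremal_coeff_def)

text \<open>Bounds the remainder of the Taylor series of the extremal function after degree
  \<open>N\<close>, and that of its derivative, uniformly on the closed disc.\<close>

definition extremal_tail :: "nat \<Rightarrow> real" where "extremal_tail N = (\<Sum>k. real (k + Suc N) * cmod (extremal_coeff \<xi> n (k + Suc N)))"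

lemma extremal_tail_tendsto_0: "extremal_tail \<longlonglongrightarrow> 0"
proof -
  have "(\<lambda>N. \<Sum>k. real (k + N) * cmod (extremal_coeff \<xi> n (k + N))) \<longlonglongrightarrow> 0"
    by (rule suminf_exist_split2[OF extremal_coeff_summable])
  from LIMSEQ_Suc[OF this] show ?thesis unfolding extremal_tail_def[abs_def] .
qed

lemma series_tail:
  fixes c :: "nat \<Rightarrow> complex"
  assumes c: "\<And>k. norm (c k) \<le> real k * cmod (extremal_coeff \<xi> n k)"
  shows "summable c" "norm ((\<Sum>k. c k) - (\<Sum>k\<le>N. c k)) \<le> extremal_tail N"
proof -
  have s: "summable (\<lambda>k. norm (c k))" by (rule summable_comparison_test'[OF extremal_coeff_summable]) (use c in simp)
  show "summable c" by (rule summable_norm_cancel[OF s])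
  have "(\<Sum>k. c k) - (\<Sum>k\<le>N. c k) = (\<Sum>k. c (k + Suc N))"
    using suminf_split_initial_segment[OF \<open>summable c\<close>, of "Suc N"] by (simp add: lessThan_Suc_atMost)
  also have "norm \<dots> \<le> extremal_tail N" unfolding extremal_tail_def
    by (rule norm_suminf_le[OF c summable_ignore_initial_segment[OF extremal_coeff_summable]])
  finally show "norm ((\<Sum>k. c k) - (\<Sum>k\<le>N. c k)) \<le> extremal_tail N" .
qed

lemma extremal_tail_nonneg: "extremal_tail N \<ge> 0"
  unfolding extremal_tail_def by (rule suminf_nonneg[OF summable_ignore_initial_segment[OF extremal_coeff_summable]]) simp

lemma poly_extremal: "poly (extremal_poly \<xi> n N) z = (\<Sum>k\<le>N. extremal_coeff \<xi> n k * z ^ k)"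
proof -
  have "(\<Sum>k\<le>N. extremal_coeff \<xi> n k * z ^ k) = (\<Sum>k\<in>{1..N}. extremal_coeff \<xi> n k * z ^ k)"
    by (rule sum.mono_neutral_right) (auto simp: extremal_coeff_0 not_le)
  thus ?thesis by (simp add: extremal_poly_def poly_sum poly_monom)
qed

lemma poly_pderiv_extremal: "poly (pderiv (extremal_poly \<xi> n N)) z = (\<Sum>k\<le>N. of_nat k * extremal_coeff \<xi> n k * z ^ (k - 1))"
proof -
  have "(\<Sum>k\<le>N. of_nat k * extremal_coeff \<xi> n k * z ^ (k - 1)) = (\<Sum>k\<in>{1..N}. of_nat k * extremal_coeff \<xi> n k * z ^ (k - 1))"
    by (rule sum.mono_neutral_right) (auto simp: extremal_coeff_0 not_le)
  thus ?thesis by (simp add: extremal_poly_def poly_sum higher_pderiv_sum[of 1, simplified] pderiv_monom mult.assoc poly_monom)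
qed

text \<open>The Taylor polynomials of the extremal function; they coincide with the harmonic functions
  \<open>P N\<close> of its trace.\<close>

definition extremal_sum :: "nat \<Rightarrow> complex \<Rightarrow> real" where "extremal_sum N z = 2 * Re (poly (extremal_poly \<xi> n N) z)"

lemma extremal_sum_smooth: "smooth (extremal_sum N)"
  unfolding extremal_sum_def[abs_def] by (rule smooth_cmult[OF conjunct1[OF smooth_poly]])

lemma extremal_sum_approx: "cmod z \<le> 1 \<Longrightarrow> \<bar>extremal_sum N z - extremal \<xi> n z\<bar> \<le> 2 * extremal_tail N"
proof -
  assume z: "cmod z \<le> 1"
  define c where "c k = extremal_coeff \<xi> n k * z ^ k" for k
  have sums: "c sums (- Ln (1 - \<xi> * z ^ n))" unfolding c_def[abs_def] extremal_coeff_def by (rule log_extremal_coeff(2)[OF \<xi> n z])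
  have cb: "norm (c k) \<le> real k * cmod (extremal_coeff \<xi> n k)" for k
  proof (cases "k = 0")
    case False
    have "norm (c k) \<le> cmod (extremal_coeff \<xi> n k) * 1" unfolding c_def norm_mult norm_power
      using z by (intro mult_left_mono power_le_one) auto
    also have "\<dots> \<le> real k * cmod (extremal_coeff \<xi> n k)" using False by (simp add: mult_le_cancel_right1)
    finally show ?thesis .
  qed (simp add: c_def extremal_coeff_0)
  have "extremal_sum N z - extremal \<xi> n z = 2 * Re ((\<Sum>k\<le>N. c k) - (\<Sum>k. c k))"
    unfolding extremal_sum_def extremal_eq[OF z] poly_extremal c_def[symmetric] sums_unique[OF sums] by simp
  moreover have "\<bar>Re ((\<Sum>k\<le>N. c k) - (\<Sum>k. c k))\<bar> \<le> extremal_tail N"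
    using series_tail(2)[OF cb, of N] abs_Re_le_cmod[of "(\<Sum>k\<le>N. c k) - (\<Sum>k. c k)"] by (simp only: norm_minus_commute)
  ultimately show ?thesis by (simp add: abs_mult)
qed

text \<open>The gradient of \<open>2 Re h\<close> for holomorphic \<open>h\<close> is \<open>2 cnj
  h'\<close>; here \<open>h\<close> is the logarithmic series.\<close>

definition extremal_grad :: "complex \<Rightarrow> complex" where
  "extremal_grad z = 2 * cnj (\<Sum>k. of_nat k * extremal_coeff \<xi> n k * z ^ (k - 1))"

lemma grad_extremal_sum_approx: "cmod z \<le> 1 \<Longrightarrow> norm (grad (extremal_sum N) z - extremal_grad z) \<le> 2 * extremal_tail N"
proof -
  assume z: "cmod z \<le> 1"
  define c where "c k = of_nat k * extremal_coeff \<xi> n k * z ^ (k - 1)" for k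
  have cb: "norm (c k) \<le> real k * cmod (extremal_coeff \<xi> n k)" for k
    unfolding c_def norm_mult norm_power using z power_le_one[of "cmod z" "k - 1"] by (auto intro!: mult_left_le)
  have "grad (extremal_sum N) z = 2 * cnj (\<Sum>k\<le>N. c k)"
    unfolding extremal_sum_def[abs_def] grad_2Re_poly poly_pderiv_extremal c_def ..
  hence "grad (extremal_sum N) z - extremal_grad z = 2 * cnj ((\<Sum>k\<le>N. c k) - (\<Sum>k. c k))" by (simp add: extremal_grad_def c_def algebra_simps)
  hence "norm (grad (extremal_sum N) z - extremal_grad z) = 2 * norm ((\<Sum>k\<le>N. c k) - (\<Sum>k. c k))" by (simp only: norm_mult complex_mod_cnj norm_numeral)
  thus ?thesis using series_tail(2)[OF cb, of N] by (simp add: norm_minus_commute)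
qed

lemma extremal_cont: "continuous_on (cball 0 1) (extremal \<xi> n)"
proof -
  have "1 - \<xi> * z ^ n \<noteq> 0" if "z \<in> cball 0 1" for z using extremal_lt_1[of z] that by auto
  thus ?thesis unfolding extremal_def[abs_def] by (intro continuous_intros) auto
qed

text \<open>As a uniform limit of the gradients of the Taylor polynomials.\<close>

lemma extremal_grad_cont: "continuous_on (cball 0 1) extremal_grad"
proof (rule uniform_limit_theorem[OF _ _ trivial_limit_sequentially])
  show "eventually (\<lambda>N. continuous_on (cball 0 1) (grad (extremal_sum N))) sequentially" by (simp add: continuous_on_grad[OF extremal_sum_smooth])
  show "uniform_limit (cball 0 1) (\<lambda>N. grad (extremal_sum N)) extremal_grad sequentially"
    unfolding uniform_limit_iff
  proof (intro allI impI)
    fix e :: real assume e: "e > 0"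
    have "(\<lambda>N. 2 * extremal_tail N) \<longlonglongrightarrow> 2 * 0" by (intro tendsto_intros extremal_tail_tendsto_0)
    hence "eventually (\<lambda>N. 2 * extremal_tail N < e) sequentially" using e by (intro order_tendstoD) auto
    thus "eventually (\<lambda>N. \<forall>z\<in>cball 0 1. dist (grad (extremal_sum N) z) (extremal_grad z) < e) sequentially"
    proof eventually_elim
      case (elim N)
      show ?case
      proof
        fix z :: complex assume "z \<in> cball 0 1"
        hence "norm (grad (extremal_sum N) z - extremal_grad z) \<le> 2 * extremal_tail N" by (intro grad_extremal_sum_approx) simp
        thus "dist (grad (extremal_sum N) z) (extremal_grad z) < e" using elim unfolding dist_norm by linarith
      qed
    qed
  qed
qed

lemma uniform_tail_L2:
  fixes v :: "nat \<Rightarrow> 'a \<Rightarrow> 'b::euclidean_space"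
  assumes M: "finite_measure M" and v: "\<And>N. square_integrable M (v N)" and le: "\<And>N x. x \<in> space M \<Longrightarrow> norm (v N x) \<le> 2 * extremal_tail N"
  shows "(\<lambda>N. L2_norm M (v N)) \<longlonglongrightarrow> 0"
proof -
  have "norm (L2_norm M (v N)) \<le> 2 * extremal_tail N * sqrt (measure M (space M))" for N
    unfolding real_norm_def abs_of_nonneg[OF L2_norm_nonneg]
    by (rule L2_norm_le_uniform[OF M v le]) (use extremal_tail_nonneg in auto)
  moreover have "(\<lambda>N. 2 * extremal_tail N * sqrt (measure M (space M))) \<longlonglongrightarrow> 2 * 0 * sqrt (measure M (space M))"
    by (intro tendsto_intros extremal_tail_tendsto_0)
  hence lim: "(\<lambda>N. 2 * extremal_tail N * sqrt (measure M (space M))) \<longlonglongrightarrow> 0" by simp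
  ultimately show ?thesis by (intro Lim_null_comparison[OF always_eventually[OF allI] lim])
qed

lemma extremal_sq: "square_integrable disc_measure (extremal \<xi> n)" "square_integrable disc_measure extremal_grad"
  by (intro square_integrable_disc_continuous extremal_cont extremal_grad_cont)+

lemma extremal_sq_circle: "square_integrable angle_measure (\<lambda>\<theta>. extremal \<xi> n (cis \<theta>))"
  by (rule square_integrable_circle[OF continuous_on_subset[OF extremal_cont]]) auto

lemma extremal_sum_L2: "(\<lambda>N. L2_norm disc_measure (\<lambda>x. extremal_sum N x - extremal \<xi> n x)) \<longlonglongrightarrow> 0"
  by (rule uniform_tail_L2[OF finite_measure_disc square_integrable_diff[OF smooth_square_integrable[OF extremal_sum_smooth] extremal_sq(1)]])
     (use extremal_sum_approx in simp)

lemma extremal_sum_grad_L2: "(\<lambda>N. L2_norm disc_measure (\<lambda>x. grad (extremal_sum N) x - extremal_grad x)) \<longlonglongrightarrow> 0"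
  by (rule uniform_tail_L2[OF finite_measure_disc square_integrable_diff[OF grad_square_integrable[OF extremal_sum_smooth] extremal_sq(2)]])
     (use grad_extremal_sum_approx in simp)

lemma extremal_sum_circle_L2: "(\<lambda>N. L2_norm angle_measure (\<lambda>\<theta>. extremal_sum N (cis \<theta>) - extremal \<xi> n (cis \<theta>))) \<longlonglongrightarrow> 0"
  by (rule uniform_tail_L2[OF finite_measure_angle square_integrable_diff[OF circle_square_integrable[OF extremal_sum_smooth] extremal_sq_circle]])
     (use extremal_sum_approx in simp)

lemma extremal_fourier:
  assumes k: "k \<ge> 1"
  shows "fourier_coeff (\<lambda>z. of_real (extremal \<xi> n z)) k = extremal_coeff \<xi> n k"
proof -
  obtain R where R: "R > 1" "\<And>z. z \<in> ball 0 R \<Longrightarrow> cmod (\<xi> * z ^ n) < 1" using power_lt_1_beyond_circle[OF \<xi> n] by blast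
  have "fourier_coeff (\<lambda>z. of_real (extremal \<xi> n z)) k = fourier_coeff (\<lambda>z. of_real (2 * Re (- Ln (1 - \<xi> * z ^ n)))) k"
    unfolding fourier_coeff_def by (rule circle_mean_cong) (simp only: extremal_eq)
  also have "\<dots> = fourier_coeff (\<lambda>z. - Ln (1 - \<xi> * z ^ n)) k"
    by (rule fourier_coeff_2Re[OF Ln_one_minus_holo[OF R(2)] R(1)]) (use n in \<open>auto simp: zero_power\<close>)
  finally show ?thesis unfolding extremal_coeff_def log_extremal_coeff(1)[OF \<xi> n] .
qed

lemma fourier_coeff_AE_extremal:
  assumes f: "(\<lambda>\<theta>. f (cis \<theta>)) \<in> borel_measurable angle_measure" and ae: "AE \<theta> in angle_measure. f (cis \<theta>) = extremal \<xi> n (cis \<theta>)" and k: "k \<ge> 1"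
  shows "fourier_coeff (\<lambda>z. of_real (f z)) k = extremal_coeff \<xi> n k"
proof -
  have m: "(\<lambda>\<theta>. cnj (cis \<theta>) ^ k) \<in> borel_measurable angle_measure"
    by (intro borel_measurable_integrable circle_integrable_continuous[of "\<lambda>z. cnj z ^ k"] continuous_intros)
  have "(LINT \<theta>|angle_measure. of_real (f (cis \<theta>)) * cnj (cis \<theta>) ^ k) = (LINT \<theta>|angle_measure. of_real (extremal \<xi> n (cis \<theta>)) * cnj (cis \<theta>) ^ k)"
  proof (rule integral_cong_AE)
    show "AE \<theta> in angle_measure. of_real (f (cis \<theta>)) * cnj (cis \<theta>) ^ k = of_real (extremal \<xi> n (cis \<theta>)) * cnj (cis \<theta>) ^ k"
      using ae by eventually_elim simp
  qed (use f m extremal_sq_circle in \<open>auto simp: square_integrable_def intro!: borel_measurable_times\<close>)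
  hence "fourier_coeff (\<lambda>z. of_real (f z)) k = fourier_coeff (\<lambda>z. of_real (extremal \<xi> n z)) k"
    by (simp add: fourier_coeff_def circle_mean_def)
  thus ?thesis by (simp add: extremal_fourier[OF k])
qed

lemma mean_exp_AE_extremal:
  assumes f: "(\<lambda>\<theta>. f (cis \<theta>)) \<in> borel_measurable angle_measure" and ae: "AE \<theta> in angle_measure. f (cis \<theta>) = extremal \<xi> n (cis \<theta>)"
  shows "circle_mean (\<lambda>z. exp (f z)) = 1 / (1 - (cmod \<xi>)\<^sup>2)"
proof -
  have "(LINT \<theta>|angle_measure. exp (f (cis \<theta>))) = (LINT \<theta>|angle_measure. exp (extremal \<xi> n (cis \<theta>)))"
    by (rule integral_cong_AE) (use f ae extremal_sq_circle in \<open>auto simp: square_integrable_def\<close>)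
  hence "circle_mean (\<lambda>z. exp (f z)) = circle_mean (\<lambda>z. exp (extremal \<xi> n z))" by (simp add: circle_mean_def)
  thus ?thesis unfolding extremal_def by (simp only: extremal_mean_exp[OF \<xi> n])
qed

context
  fixes u :: "complex \<Rightarrow> real" and g :: "complex \<Rightarrow> complex" and f :: "complex \<Rightarrow> real" and \<phi>
  assumes st: "sobolev_trace u g f \<phi>" and ae: "AE \<theta> in angle_measure. f (cis \<theta>) = extremal \<xi> n (cis \<theta>)"
begin

interpretation sobolev_trace u g f \<phi> by (rule st)

lemma P_eq_extremal_sum: "P N = extremal_sum N"
proof -
  have "fourier_coeff (\<lambda>z. of_real (f z)) k = extremal_coeff \<xi> n k" if "k \<in> {1..N}" for k
    using that f ae by (intro fourier_coeff_AE_extremal) (auto simp: square_integrable_def)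
  hence "p N = extremal_poly \<xi> n N" unfolding p_def extremal_poly_def by (intro sum.cong) auto
  thus ?thesis unfolding P_eq extremal_sum_def[abs_def] by simp
qed

lemma energy_tendsto: "energy \<longlonglongrightarrow> real n * ln (1 / (1 - (cmod \<xi>)\<^sup>2))"
proof -
  have "(\<lambda>k. real k * (cmod (extremal_coeff \<xi> n k))\<^sup>2) sums (real n * ln (1 / (1 - (cmod \<xi>)\<^sup>2)))"
    using extremal_energy[OF \<xi> n] unfolding log_extremal_coeff(1)[OF \<xi> n] extremal_coeff_def .
  hence "(\<lambda>N. \<Sum>k\<le>N. real k * (cmod (extremal_coeff \<xi> n k))\<^sup>2) \<longlonglongrightarrow> real n * ln (1 / (1 - (cmod \<xi>)\<^sup>2))" by (simp add: sums_def_le)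
  moreover have "(\<Sum>k\<le>N. real k * (cmod (extremal_coeff \<xi> n k))\<^sup>2) = energy N" for N
  proof -
    have "(\<Sum>k\<le>N. real k * (cmod (extremal_coeff \<xi> n k))\<^sup>2) = (\<Sum>k\<in>{1..N}. real k * (cmod (extremal_coeff \<xi> n k))\<^sup>2)"
      by (rule sum.mono_neutral_right) (auto simp: not_le)
    also have "\<dots> = energy N" unfolding energy_def partial_sum_energy
      by (intro sum.cong refl) (use f ae in \<open>auto simp: fourier_coeff_AE_extremal square_integrable_def\<close>)
    finally show ?thesis .
  qed
  ultimately show ?thesis by (simp only:)
qed

text \<open>If the Dirichlet integral of \<open>u\<close> is the limit of the energies of its trace, then
  the Taylor polynomials of the extremal function converge to \<open>u\<close> in the norm of the
  gradient, by Dirichlet's principle; they do so on the circle as well, hence in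
  \<open>L\<^sup>2\<close> of the disc by the Poincare inequality.\<close>

lemma extremal_trace_imp_extremal:
  assumes "(L2_norm disc_measure g)\<^sup>2 = 4 * pi * (real n * ln (1 / (1 - (cmod \<xi>)\<^sup>2)))"
  shows "AE z in disc_measure. u z = extremal \<xi> n z"
proof (rule L2_limit_unique_AE[OF smooth_square_integrable[OF extremal_sum_smooth] weak_gradD(1)[OF u] extremal_sq(1) _ extremal_sum_L2])
  have "(\<lambda>N. (L2_norm disc_measure g)\<^sup>2 - 4 * pi * energy N) \<longlonglongrightarrow> (L2_norm disc_measure g)\<^sup>2 - 4 * pi * (real n * ln (1 / (1 - (cmod \<xi>)\<^sup>2)))"
    by (intro tendsto_intros energy_tendsto)
  hence 1: "(\<lambda>N. (L2_norm disc_measure (\<lambda>x. g x - grad (extremal_sum N) x))\<^sup>2) \<longlonglongrightarrow> 0"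
    unfolding energy_identity P_eq_extremal_sum unfolding assms by (simp only: diff_self)
  have ce: "circle_norm (\<lambda>z. f z - extremal_sum N z) = circle_norm (\<lambda>z. extremal_sum N z - extremal \<xi> n z)" for N
  proof -
    have "circle_norm (\<lambda>z. f z - extremal_sum N z) = circle_norm (\<lambda>z. extremal \<xi> n z - extremal_sum N z)"
      by (rule L2_norm_cong_AE) (use ae f extremal_sq_circle circle_square_integrable[OF extremal_sum_smooth[of N]] in \<open>auto simp: square_integrable_def\<close>)
    thus ?thesis by (simp only: L2_norm_minus_commute)
  qed
  have 2: "(\<lambda>N. (circle_norm (\<lambda>z. f z - extremal_sum N z))\<^sup>2) \<longlonglongrightarrow> 0\<^sup>2" unfolding ce by (intro tendsto_power extremal_sum_circle_L2)
  have le: "(L2_norm disc_measure (\<lambda>x. u x - extremal_sum N x))\<^sup>2 \<le> (circle_norm (\<lambda>z. f z - extremal_sum N z))\<^sup>2 + (L2_norm disc_measure (\<lambda>x. g x - grad (extremal_sum N) x))\<^sup>2" for N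
    by (rule sobolev_trace.poincare_inequality_H1[OF minus_smooth[OF extremal_sum_smooth]])
  have lim: "(\<lambda>N. (circle_norm (\<lambda>z. f z - extremal_sum N z))\<^sup>2 + (L2_norm disc_measure (\<lambda>x. g x - grad (extremal_sum N) x))\<^sup>2) \<longlonglongrightarrow> 0"
    using tendsto_add[OF 2 1] by simp
  have "(\<lambda>N. (L2_norm disc_measure (\<lambda>x. u x - extremal_sum N x))\<^sup>2) \<longlonglongrightarrow> 0"
    by (rule Lim_null_comparison[OF always_eventually lim]) (use le in simp)
  hence "(\<lambda>N. sqrt ((L2_norm disc_measure (\<lambda>x. u x - extremal_sum N x))\<^sup>2)) \<longlonglongrightarrow> sqrt 0" by (rule tendsto_real_sqrt)
  hence "(\<lambda>N. L2_norm disc_measure (\<lambda>x. u x - extremal_sum N x)) \<longlonglongrightarrow> 0" by (simp add: L2_norm_nonneg)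
  thus "(\<lambda>N. L2_norm disc_measure (\<lambda>x. extremal_sum N x - u x)) \<longlonglongrightarrow> 0" by (simp only: L2_norm_minus_commute[of _ u])
qed

end

text \<open>The Taylor polynomials converge to the extremal function uniformly with their gradients. So
  their gradients converge to the weak gradient of \<open>u\<close>, the trace inequality
  identifies the trace, and Dirichlet's principle evaluates the Dirichlet integral as the limit of
  the energies.\<close>

lemma extremal_imp_trace:
  assumes st: "sobolev_trace u g f \<phi>" and ae: "AE z in disc_measure. u z = extremal \<xi> n z"
  shows "AE \<theta> in angle_measure. f (cis \<theta>) = extremal \<xi> n (cis \<theta>)"
    and "(L2_norm disc_measure g)\<^sup>2 = 4 * pi * (real n * ln (1 / (1 - (cmod \<xi>)\<^sup>2)))"
proof -
  interpret sobolev_trace u g f \<phi> by (rule st)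
  have um: "u \<in> borel_measurable disc_measure" and em: "extremal \<xi> n \<in> borel_measurable disc_measure"
    using weak_gradD(1)[OF u] extremal_sq(1) by (auto simp: square_integrable_def)
  have Qm: "extremal_sum N \<in> borel_measurable disc_measure" for N
    using smooth_square_integrable[OF extremal_sum_smooth] by (auto simp: square_integrable_def)
  have uQ: "L2_norm disc_measure (\<lambda>x. extremal_sum N x - u x) = L2_norm disc_measure (\<lambda>x. extremal_sum N x - extremal \<xi> n x)" for N
    by (rule L2_norm_cong_AE) (use ae um em Qm in auto)
  have lu: "(\<lambda>N. L2_norm disc_measure (\<lambda>x. extremal_sum N x - u x)) \<longlonglongrightarrow> 0" unfolding uQ by (rule extremal_sum_L2)
  have "weak_grad u extremal_grad"
    by (rule weak_grad_limit[OF smooth_weak_grad[OF extremal_sum_smooth] weak_gradD(1)[OF u] extremal_sq(2) lu extremal_sum_grad_L2])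
  hence gae: "AE x in disc_measure. g x = extremal_grad x" by (rule weak_grad_unique[OF u])
  have gm: "g \<in> borel_measurable disc_measure" "extremal_grad \<in> borel_measurable disc_measure"
    using weak_gradD(2)[OF u] extremal_sq(2) by (auto simp: square_integrable_def)
  have gQm: "grad (extremal_sum N) \<in> borel_measurable disc_measure" for N
    using grad_square_integrable[OF extremal_sum_smooth] by (auto simp: square_integrable_def)
  have gQ: "L2_norm disc_measure (\<lambda>x. grad (extremal_sum N) x - g x) = L2_norm disc_measure (\<lambda>x. grad (extremal_sum N) x - extremal_grad x)" for N
    by (rule L2_norm_cong_AE) (use gae gm gQm in auto)
  have lg: "(\<lambda>N. L2_norm disc_measure (\<lambda>x. grad (extremal_sum N) x - g x)) \<longlonglongrightarrow> 0" unfolding gQ by (rule extremal_sum_grad_L2)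
  have le: "(circle_norm (\<lambda>z. f z - extremal_sum N z))\<^sup>2 \<le> 3 * (L2_norm disc_measure (\<lambda>x. extremal_sum N x - u x))\<^sup>2 + (L2_norm disc_measure (\<lambda>x. grad (extremal_sum N) x - g x))\<^sup>2" for N
    using sobolev_trace.trace_inequality_H1[OF minus_smooth[OF extremal_sum_smooth[of N]]] by (simp only: L2_norm_minus_commute[of _ u] L2_norm_minus_commute[of _ g])
  have "(\<lambda>N. 3 * (L2_norm disc_measure (\<lambda>x. extremal_sum N x - u x))\<^sup>2 + (L2_norm disc_measure (\<lambda>x. grad (extremal_sum N) x - g x))\<^sup>2) \<longlonglongrightarrow> 3 * 0\<^sup>2 + 0\<^sup>2"
    by (intro tendsto_intros lu lg)
  hence lim: "(\<lambda>N. 3 * (L2_norm disc_measure (\<lambda>x. extremal_sum N x - u x))\<^sup>2 + (L2_norm disc_measure (\<lambda>x. grad (extremal_sum N) x - g x))\<^sup>2) \<longlonglongrightarrow> 0" by simp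
  have "(\<lambda>N. (circle_norm (\<lambda>z. f z - extremal_sum N z))\<^sup>2) \<longlonglongrightarrow> 0"
    by (rule Lim_null_comparison[OF always_eventually lim]) (use le in simp)
  hence "(\<lambda>N. sqrt ((circle_norm (\<lambda>z. f z - extremal_sum N z))\<^sup>2)) \<longlonglongrightarrow> sqrt 0" by (rule tendsto_real_sqrt)
  hence "(\<lambda>N. circle_norm (\<lambda>z. f z - extremal_sum N z)) \<longlonglongrightarrow> 0" by (simp add: L2_norm_nonneg)
  hence lf: "(\<lambda>N. L2_norm angle_measure (\<lambda>\<theta>. extremal_sum N (cis \<theta>) - f (cis \<theta>))) \<longlonglongrightarrow> 0" by (simp only: L2_norm_minus_commute)
  show tr: "AE \<theta> in angle_measure. f (cis \<theta>) = extremal \<xi> n (cis \<theta>)"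
    by (rule L2_limit_unique_AE[OF circle_square_integrable[OF extremal_sum_smooth] f extremal_sq_circle lf extremal_sum_circle_L2])
  have "(\<lambda>N. (L2_norm disc_measure (\<lambda>x. grad (extremal_sum N) x - g x))\<^sup>2) \<longlonglongrightarrow> 0\<^sup>2" by (rule tendsto_power[OF lg])
  moreover have "(L2_norm disc_measure (\<lambda>x. grad (extremal_sum N) x - g x))\<^sup>2 = (L2_norm disc_measure g)\<^sup>2 - 4 * pi * energy N" for N
    unfolding energy_identity P_eq_extremal_sum[OF st tr] by (simp only: L2_norm_minus_commute)
  ultimately have "(\<lambda>N. (L2_norm disc_measure g)\<^sup>2 - 4 * pi * energy N) \<longlonglongrightarrow> 0" by simp
  moreover have "(\<lambda>N. (L2_norm disc_measure g)\<^sup>2 - 4 * pi * energy N) \<longlonglongrightarrow> (L2_norm disc_measure g)\<^sup>2 - 4 * pi * (real n * ln (1 / (1 - (cmod \<xi>)\<^sup>2)))"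
    by (intro tendsto_intros energy_tendsto[OF st tr])
  ultimately have "0 = (L2_norm disc_measure g)\<^sup>2 - 4 * pi * (real n * ln (1 / (1 - (cmod \<xi>)\<^sup>2)))" by (rule LIMSEQ_unique)
  thus "(L2_norm disc_measure g)\<^sup>2 = 4 * pi * (real n * ln (1 / (1 - (cmod \<xi>)\<^sup>2)))" by simp
qed

end

section \<open>The sharp inequality\<close>

theorem theorem6p1:
  fixes m :: nat and u :: "complex \<Rightarrow> real"
  assumes "m \<ge> 1"
    and "u \<in> H1 unit_disc"
    and "(LINT \<theta>|angle_measure. boundary_trace u (cis \<theta>)) = 0"
    and "\<And>k. k \<in> {1..m} \<Longrightarrow>
           (LINT \<theta>|angle_measure. complex_of_real (exp (boundary_trace u (cis \<theta>))) * cis (real k * \<theta>)) = 0"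
  shows "integrable angle_measure (\<lambda>\<theta>. exp (boundary_trace u (cis \<theta>)))
    \<and> ln (1 / (2 * pi) * (LINT \<theta>|angle_measure. exp (boundary_trace u (cis \<theta>))))
        \<le> 1 / (4 * pi * real (m + 1)) * (L2_norm (lebesgue_on unit_disc) (weak_gradient unit_disc u))\<^sup>2
    \<and> (ln (1 / (2 * pi) * (LINT \<theta>|angle_measure. exp (boundary_trace u (cis \<theta>))))
         = 1 / (4 * pi * real (m + 1)) * (L2_norm (lebesgue_on unit_disc) (weak_gradient unit_disc u))\<^sup>2
       \<longleftrightarrow> (\<exists>\<xi>::complex. cmod \<xi> < 1 \<and>
             (AE z in lebesgue_on unit_disc. u z = ln (1 / (cmod (1 - \<xi> * z ^ (m + 1)))\<^sup>2))))"
proof -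
  define f where "f = boundary_trace u"
  define g where "g = weak_gradient unit_disc u"
  define n where "n = m + 1"
  define G where "G = (L2_norm disc_measure g)\<^sup>2"
  define A where "A = circle_mean (\<lambda>z. exp (f z))"
  have n: "n \<ge> 1" by (simp add: n_def)
  obtain g0 where g0: "weak_grad u g0" using assms(2) by (auto simp: H1_def)
  have wg: "weak_grad u g" unfolding g_def by (rule weak_gradient_has[OF g0])
  obtain f0 where "has_boundary_trace u f0" using trace_exists[OF g0] by blast
  hence tr: "has_boundary_trace u f" unfolding f_def boundary_trace_def by (rule someI[of "has_boundary_trace u"])
  obtain \<phi> where st: "sobolev_trace u g f \<phi>" using has_boundary_trace_sobolev[OF wg tr] by blast
  interpret sobolev_trace u g f \<phi> by (rule st)
  have mean: "circle_mean f = 0" using assms(3) by (simp add: circle_mean_def f_def)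
  interpret cf: circle_function f "G / (4 * pi)" unfolding G_def by (rule circle_function[OF mean])
  interpret cf: circle_function_moments f "G / (4 * pi)" n
  proof unfold_locales
    show "1 \<le> n" by (rule n)
    fix k assume "k \<in> {1..<n}"
    hence "k \<in> {1..m}" by (auto simp: n_def)
    from assms(4)[OF this] have "circle_mean (\<lambda>z. of_real (exp (f z)) * z ^ k) = 0"
      by (simp add: circle_mean_def f_def Complex.DeMoivre)
    thus "fourier_coeff (\<lambda>z. of_real (exp (f z))) k = 0" unfolding circle_mean_real_times_power by simp
  qed
  have Aeq: "1 / (2 * pi) * (LINT \<theta>|angle_measure. exp (boundary_trace u (cis \<theta>))) = A"
    by (simp add: A_def f_def circle_mean_def)
  have Geq: "1 / (4 * pi * real (m + 1)) * (L2_norm (lebesgue_on unit_disc) (weak_gradient unit_disc u))\<^sup>2 = G / (4 * pi) / real n"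
    by (simp add: G_def g_def n_def)
  have rn: "real n > 0" using n by simp
  have int: "integrable angle_measure (\<lambda>\<theta>. exp (boundary_trace u (cis \<theta>)))" using cf.exp_integrable by (simp add: f_def)
  have main: "real n * ln A \<le> G / (4 * pi)" unfolding A_def by (rule cf.log_mean_exp_le)
  have ineq: "ln A \<le> G / (4 * pi) / real n" using main rn by (simp add: field_simps)
  have eq_iff: "ln A = G / (4 * pi) / real n \<longleftrightarrow> real n * ln A = G / (4 * pi)" using rn by (auto simp: field_simps)
  have fm: "(\<lambda>\<theta>. f (cis \<theta>)) \<in> borel_measurable angle_measure" by (rule cf.f_measurable)
  have equality: "real n * ln A = G / (4 * pi) \<longleftrightarrow> (\<exists>\<xi>. cmod \<xi> < 1 \<and> (AE z in disc_measure. u z = extremal \<xi> n z))"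
  proof
    assume eq: "real n * ln A = G / (4 * pi)"
    from cf.equality_imp_extremal[OF eq[unfolded A_def]] obtain \<xi> where \<xi>: "cmod \<xi> < 1"
      and ae: "AE \<theta> in angle_measure. f (cis \<theta>) = extremal \<xi> n (cis \<theta>)" unfolding extremal_def by blast
    have "A = 1 / (1 - (cmod \<xi>)\<^sup>2)" unfolding A_def by (rule mean_exp_AE_extremal[OF \<xi> n fm ae])
    hence "G = 4 * pi * (real n * ln (1 / (1 - (cmod \<xi>)\<^sup>2)))" using eq by (simp add: field_simps)
    from extremal_trace_imp_extremal[OF \<xi> n st ae this[unfolded G_def]] \<xi>
    show "\<exists>\<xi>. cmod \<xi> < 1 \<and> (AE z in disc_measure. u z = extremal \<xi> n z)" by blast
  next
    assume "\<exists>\<xi>. cmod \<xi> < 1 \<and> (AE z in disc_measure. u z = extremal \<xi> n z)"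
    then obtain \<xi> where \<xi>: "cmod \<xi> < 1" and ae: "AE z in disc_measure. u z = extremal \<xi> n z" by blast
    note tr = extremal_imp_trace[OF \<xi> n st ae]
    have "A = 1 / (1 - (cmod \<xi>)\<^sup>2)" unfolding A_def by (rule mean_exp_AE_extremal[OF \<xi> n fm tr(1)])
    thus "real n * ln A = G / (4 * pi)" unfolding G_def tr(2) by simp
  qed
  show ?thesis
    unfolding Aeq Geq eq_iff equality using int ineq unfolding extremal_def n_def by blast
qed

end
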